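(* The following decision problem is $\Sigma_2^p$-complete (under polynomial-time many-one reductions): given a formula $F$, decide whether $F$ is provable in $\mathbf{CL5}$.
   Context: $\Sigma_2^p$ is the second existential level of the polynomial hierarchy ($\mathrm{NP}^{\mathrm{NP}}$). Formulas: built from (non-logical) atoms, taken from a countably infinite set, using $\neg$, $\wedge$, $\vee$, where $\neg$ may be applied only to atoms (no logical constants). For a compound formula $F$, $\neg F$ abbreviates the De Morgan dual: $\neg\neg P$ is $P$, $\neg(A\wedge B)$ is $\neg A\vee\neg B$, $\neg(A\vee B)$ is $\neg A\wedge\neg B$. Cirquents: for $k\ge 0$, a $k$-ary cirquent is a pair $C=(\mathrm{St},\mathrm{Pl})$ where the pool $\mathrm{Pl}=\langle F_1,\dots,F_k\rangle$ is a sequence of formulas (repetitions allowed; each occurrence is called an oformula) and the structure $\mathrm{St}=\langle\Gamma_1,\dots,\Gamma_m\rangle$, $m\ge 0$, is a sequence of subsets of $\{1,\dots,k\}$ (repetitions allowed; each occurrence is called an ogroup). Ogroup $\Gamma_j$ contains oformula $F_i$ (there is an arc between them) iff $i\in\Gamma_j$. Two oformulas (or ogroups) are adjacent if they are consecutive in the pool (or structure). Merging two adjacent ogroups $\Gamma,\Delta$ means replacing them by the single ogroup $\Gamma\cup\Delta$. Merging two adjacent oformulas $F,G$ into $H$ means replacing them by the single oformula $H$, which is contained in exactly those ogroups that contained $F$ or $G$. The rules of $\mathbf{CL5}$ are: (A) Axioms (no premises): the empty cirquent (empty pool and empty structure); and, for any formula $F$, the identity axiom, i.e. the cirquent with pool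 $\langle\neg F,F\rangle$ and structure $\langle\{1,2\}\rangle$. (M) Mix (two premises): the conclusion is obtained by placing the two premises side by side (concatenating pools and structures, keeping arcs). (E) Exchange (one premise): swap two adjacent oformulas (preserving all arcs), or swap two adjacent ogroups (preserving all arcs). (W) Weakening (one premise): ogroup weakening adds one new arc between an existing ogroup and an existing oformula; pool weakening inserts a new oformula (contained in no ogroup) at any position of the pool. (D) Duplication (one premise): downward duplication replaces an ogroup of the premise by two adjacent ogroups identical to it; upward duplication is the converse: the premise is obtained from the conclusion by replacing an ogroup by two adjacent ogroups identical to it. ($\vee$) $\vee$-introduction (one premise): merge two adjacent oformulas $F$ and $G$ ($G$ immediately after $F$) into $F\vee G$. ($\wedge$) $\wedge$-introduction (one premise): the premise has adjacent oformulas $F$, $G$ ($G$ immediately after $F$) such that no ogroup contains both, every ogroup containing $F$ is immediately followed by an ogroup containing $G$, and every ogroup containing $G$ is immediately preceded by an ogroup containing $F$; the conclusion is obtained by merging each ogroup containing $F$ with the ogroup containing $G$ that immediately follows it, and then merging $F$ and $G$ into $F\wedge G$. A $\mathbf{CL5}$ proof of a cirquent $C$ is a (finite) tree of cirquents with root $C$ in which each node follows from its children by one of the rules above. A formula $F$ is provable in $\mathbf{CL5}$ if there is a proof of the cirquent with pool $\langle F\rangle$ and structure $\langle\{1\}\rangle$. Formulas are encoded as strings over a finite alphabet in a standard way. *)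

theory Defs
  imports
    "HOL-Computational_Algebra.Polynomial"
    "HOL-Combinatorics.Transposition"
begin

section \<open>The calculus CL5\<close>

datatype formula =
    Pos nat
  | Neg nat
  | Conj formula formula
  | Disj formula formula

primrec dual :: "formula \<Rightarrow> formula" where
  "dual (Pos a) = Neg a"
| "dual (Neg a) = Pos a"
| "dual (Conj F G) = Disj (dual F) (dual G)"
| "dual (Disj F G) = Conj (dual F) (dual G)"

text \<open>A cirquent is a pair of a structure and a pool.  Oformulas are numbered from 0, so that in
  a \<open>k\<close>-ary cirquent the ogroups are subsets of \<open>{..<k}\<close>; all rules below preserve this.\<close>

type_synonym cirquent = "nat set list \<times> formula list"

text \<open>How the numbers of the oformulas change when the oformulas \<open>n\<close> and \<open>Suc n\<close> are merged, and when a
  new oformula is inserted so that it gets number \<open>n\<close>.\<close>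

definition merge_index :: "nat \<Rightarrow> nat \<Rightarrow> nat" where
  "merge_index n i = (if i \<le> n then i else i - 1)"

definition insert_index :: "nat \<Rightarrow> nat \<Rightarrow> nat" where
  "insert_index n i = (if i < n then i else Suc i)"

text \<open>Merge each ogroup containing oformula \<open>n\<close> with the ogroup that immediately follows it.  Under
  the side condition \<open>conj_admissible\<close> the pairs to be merged are disjoint, and the last ogroup does
  not contain \<open>n\<close>.\<close>

fun merge_groups :: "nat \<Rightarrow> nat set list \<Rightarrow> nat set list" where
  "merge_groups n [] = []"
| "merge_groups n [\<Gamma>] = [\<Gamma>]"
| "merge_groups n (\<Gamma> # \<Delta> # S) =
     (if n \<in> \<Gamma> then (\<Gamma> \<union> \<Delta>) # merge_groups n S else \<Gamma> # merge_groups n (\<Delta> # S))"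

definition conj_admissible :: "nat \<Rightarrow> nat set list \<Rightarrow> bool" where
  "conj_admissible n S \<longleftrightarrow>
     (\<forall>j<length S.
        \<not> (n \<in> S ! j \<and> Suc n \<in> S ! j) \<and>
        (n \<in> S ! j \<longrightarrow> Suc j < length S \<and> Suc n \<in> S ! Suc j) \<and>
        (Suc n \<in> S ! j \<longrightarrow> 0 < j \<and> n \<in> S ! (j - 1)))"

text \<open>\<open>CL5 C\<close>: the cirquent \<open>C\<close> is the root of a CL5 proof tree.\<close>

inductive CL5 :: "cirquent \<Rightarrow> bool" where
  empty_axiom: "CL5 ([], [])"
| identity_axiom: "CL5 ([{0, 1}], [dual F, F])"
| mix:
    "CL5 (S, P) \<Longrightarrow> CL5 (T, Q) \<Longrightarrow> CL5 (S @ map (\<lambda>\<Gamma>. (\<lambda>i. length P + i) ` \<Gamma>) T, P @ Q)"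
| oformula_exchange:
    "CL5 (S, P @ [F, G] @ Q) \<Longrightarrow>
     CL5 (map (\<lambda>\<Gamma>. Transposition.transpose (length P) (Suc (length P)) ` \<Gamma>) S, P @ [G, F] @ Q)"
| ogroup_exchange:
    "CL5 (S @ [\<Gamma>, \<Delta>] @ T, P) \<Longrightarrow> CL5 (S @ [\<Delta>, \<Gamma>] @ T, P)"
| ogroup_weakening:
    "CL5 (S @ [\<Gamma>] @ T, P) \<Longrightarrow> i < length P \<Longrightarrow> i \<notin> \<Gamma> \<Longrightarrow> CL5 (S @ [insert i \<Gamma>] @ T, P)"
| pool_weakening:
    "CL5 (S, P @ Q) \<Longrightarrow> CL5 (map (\<lambda>\<Gamma>. insert_index (length P) ` \<Gamma>) S, P @ [F] @ Q)"
| downward_duplication: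
    "CL5 (S @ [\<Gamma>] @ T, P) \<Longrightarrow> CL5 (S @ [\<Gamma>, \<Gamma>] @ T, P)"
| upward_duplication:
    "CL5 (S @ [\<Gamma>, \<Gamma>] @ T, P) \<Longrightarrow> CL5 (S @ [\<Gamma>] @ T, P)"
| disj_introduction:
    "CL5 (S, P @ [F, G] @ Q) \<Longrightarrow>
     CL5 (map (\<lambda>\<Gamma>. merge_index (length P) ` \<Gamma>) S, P @ [Disj F G] @ Q)"
| conj_introduction:
    "CL5 (S, P @ [F, G] @ Q) \<Longrightarrow> conj_admissible (length P) S \<Longrightarrow>
     CL5 (map (\<lambda>\<Gamma>. merge_index (length P) ` \<Gamma>) (merge_groups (length P) S), P @ [Conj F G] @ Q)"

definition CL5_provable :: "formula \<Rightarrow> bool" where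
  "CL5_provable F \<longleftrightarrow> CL5 ([{0}], [F])"

section \<open>Turing machines\<close>

text \<open>Strings are lists of positive natural numbers; \<open>0\<close> is the blank.  A string over an alphabet
  of \<open>g\<close> letters is an element of \<open>words g\<close>.\<close>

definition words :: "nat \<Rightarrow> nat list set" where
  "words g = lists {1..g}"

datatype direction = Left_Move | No_Move | Right_Move

text \<open>A machine is a nondeterministic multi-tape oracle machine given by a finite set of
  instructions.  The instruction \<open>((q, rs), (q', as))\<close> is applicable in state \<open>q\<close> if \<open>rs\<close> lists the symbols
  currently scanned on the tapes; it leads to state \<open>q'\<close>, and \<open>as\<close> lists for each tape the symbol to be
  written and the move of the head.  States and symbols are natural numbers; by finiteness of the
  instruction set only finitely many of them matter.\<close>

record machine =
  tapes :: nat
  instructions :: "((nat \<times> nat list) \<times> (nat \<times> (nat \<times> direction) list)) set"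
  start_state :: nat
  accept_state :: nat
  query_state :: nat
  yes_state :: nat
  no_state :: nat

definition wf_machine :: "machine \<Rightarrow> bool" where
  "wf_machine M \<longleftrightarrow> 0 < tapes M \<and> finite (instructions M) \<and>
     (\<forall>((q, rs), (q', as)) \<in> instructions M. length rs = tapes M \<and> length as = tapes M)"

definition deterministic :: "machine \<Rightarrow> bool" where
  "deterministic M \<longleftrightarrow> single_valued (instructions M)"

text \<open>Tapes are infinite in both directions and consist of the cell contents and the head position.
  A configuration consists of the state and the tapes.\<close>

type_synonym tape = "(int \<Rightarrow> nat) \<times> int"
type_synonym config = "nat \<times> tape list"

definition scan :: "tape \<Rightarrow> nat" where
  "scan t = fst t (snd t)"

primrec shift :: "direction \<Rightarrow> int \<Rightarrow> int" where
  "shift Left_Move i = i - 1"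
| "shift No_Move i = i"
| "shift Right_Move i = i + 1"

definition act :: "nat \<times> direction \<Rightarrow> tape \<Rightarrow> tape" where
  "act a t = ((fst t)(snd t := fst a), shift (snd a) (snd t))"

definition input_tape :: "nat list \<Rightarrow> tape" where
  "input_tape x = ((\<lambda>i. if 0 \<le> i \<and> i < int (length x) then x ! nat i else 0), 0)"

definition blank_tape :: tape where
  "blank_tape = ((\<lambda>i. 0), 0)"

text \<open>The string on a tape extends from cell 0 to the first blank.  All tapes of a configuration
  reachable from an initial configuration have only finitely many nonblank cells.\<close>

definition tape_word :: "tape \<Rightarrow> nat list" where
  "tape_word t = map (\<lambda>i. fst t (int i)) [0..<(LEAST n. fst t (int n) = 0)]"

definition initial :: "machine \<Rightarrow> nat list \<Rightarrow> config" where
  "initial M x = (start_state M, input_tape x # replicate (tapes M - 1) blank_tape)"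

text \<open>One step with oracle \<open>A\<close>.  The input is on the first tape; the last tape serves as oracle tape
  and as output tape.  In the query state the only possible step is to ask the oracle.\<close>

inductive step :: "nat list set \<Rightarrow> machine \<Rightarrow> config \<Rightarrow> config \<Rightarrow> bool"
  for A :: "nat list set" and M :: machine where
  instruction:
    "q \<noteq> query_state M \<Longrightarrow> ((q, map scan ts), (q', as)) \<in> instructions M \<Longrightarrow>
     step A M (q, ts) (q', map2 act as ts)"
| query:
    "step A M (query_state M, ts)
       (if tape_word (last ts) \<in> A then yes_state M else no_state M, ts)"

section \<open>Complexity classes\<close>

definition accepts :: "nat list set \<Rightarrow> machine \<Rightarrow> nat list \<Rightarrow> bool" where
  "accepts A M x \<longleftrightarrow> (\<exists>ts. (step A M)\<^sup>*\<^sup>* (initial M x) (accept_state M, ts))"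

text \<open>\<open>NP_oracle A g\<close> is the class NP relative to the oracle \<open>A\<close>, restricted to languages over an
  alphabet of \<open>g\<close> letters: every computation path is polynomially bounded, and \<open>x\<close> is in the language
  iff some path reaches the accepting state.\<close>

definition NP_oracle :: "nat list set \<Rightarrow> nat \<Rightarrow> nat list set set" where
  "NP_oracle A g =
     {L. L \<subseteq> words g \<and>
        (\<exists>M (p :: nat poly). wf_machine M \<and>
           (\<forall>x \<in> words g. \<forall>n c. (step A M ^^ n) (initial M x) c \<longrightarrow> n \<le> poly p (length x)) \<and>
           (\<forall>x \<in> words g. x \<in> L \<longleftrightarrow> accepts A M x))}"

text \<open>With the empty oracle a query is an ordinary move to the no-state, so this is plain NP.\<close>

definition NP :: "nat \<Rightarrow> nat list set set" where
  "NP g = NP_oracle {} g"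

definition Sigma2p :: "nat \<Rightarrow> nat list set set" where
  "Sigma2p g = (\<Union>h. \<Union>A \<in> NP h. NP_oracle A g)"

definition poly_time_computable :: "nat \<Rightarrow> (nat list \<Rightarrow> nat list) \<Rightarrow> bool" where
  "poly_time_computable g f \<longleftrightarrow>
     (\<exists>M (p :: nat poly). wf_machine M \<and> deterministic M \<and>
        (\<forall>x \<in> words g. \<exists>n q ts. n \<le> poly p (length x) \<and>
           (step {} M ^^ n) (initial M x) (q, ts) \<and> (\<nexists>c. step {} M (q, ts) c) \<and>
           tape_word (last ts) = f x))"

definition poly_many_one_reducible ::
    "nat \<Rightarrow> nat list set \<Rightarrow> nat \<Rightarrow> nat list set \<Rightarrow> bool" where
  "poly_many_one_reducible g L h K \<longleftrightarrow>
     (\<exists>f. poly_time_computable g f \<and> (\<forall>x \<in> words g. f x \<in> words h) \<and>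
        (\<forall>x \<in> words g. x \<in> L \<longleftrightarrow> f x \<in> K))"

definition Sigma2p_complete :: "nat \<Rightarrow> nat list set \<Rightarrow> bool" where
  "Sigma2p_complete h K \<longleftrightarrow>
     K \<in> Sigma2p h \<and> (\<forall>g. \<forall>L \<in> Sigma2p g. poly_many_one_reducible g L h K)"

section \<open>The decision problem\<close>

text \<open>Formulas are written in fully parenthesized infix notation, with atoms written as the letter
  \<open>p\<close> followed by their number in binary (most significant digit first).  The letters 1 to 8 stand for
  left parenthesis, right parenthesis, \<open>\<not>\<close>, \<open>\<and>\<close>, \<open>\<or>\<close>, \<open>p\<close>, and the digits zero and one.\<close>

fun encode_nat :: "nat \<Rightarrow> nat list" where
  "encode_nat n = (if n < 2 then [7 + n] else encode_nat (n div 2) @ [7 + n mod 2])"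

declare encode_nat.simps [simp del]

primrec encode :: "formula \<Rightarrow> nat list" where
  "encode (Pos a) = [6] @ encode_nat a"
| "encode (Neg a) = [3, 6] @ encode_nat a"
| "encode (Conj F G) = [1] @ encode F @ [4] @ encode G @ [2]"
| "encode (Disj F G) = [1] @ encode F @ [5] @ encode G @ [2]"

definition CL5_problem :: "nat list set" where
  "CL5_problem = {encode F | F. CL5_provable F}"

end

(* A formula is provable in CL5 iff it is an instance of a tautology in which no literal occurs twice;
   soundness is an induction over proofs, completeness duplicates ogroups and reduces to pairwise dual oformulas.

   Membership: guess which occurrences of an atom are identified, by tagging every atom with a position, and use
   the oracle to exclude an assignment that falsifies the tagged formula; a repeated literal is refuted likewise.

   Hardness: acceptance by a machine with an oracle is an exists-forall statement about clauses that describe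
   the computations of both machines.  As literals must not repeat, every occurrence of a variable in these
   clauses becomes an atom of its own, and gadgets tie the occurrences together: the choice of an instance plays
   the role of the existential assignment, the truth assignment that of the universal one.  These formulas are so
   regular that nested loops over tapes of polynomial length print them. *)

theory Submission
  imports Defs "HOL-Library.Multiset" "HOL-Library.Nat_Bijection"
begin

section \<open>CL5 and binary tautologies\<close>

text \<open>In a formula without repeated literals each atom occurs at most once in either polarity,
  so an instance of this kind amounts to a matching of positive with negative occurrences of the
  same atom. In the hardness proof this matching is the only existential freedom; hence the one
  negative literal with two possible partners for every existential variable. To be unrepeated, an
  occurrence in the matrix carries its place (part, clause, literal, loop values) in its name, and
  the gadgets range over all conceivable places, whether or not something occurs there.

  Clauses have a fixed form while times and cells grow with the input. They are therefore named by
  sums of loop positions, and the time bound K is named by a head that stays parked on cell K of a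
  tape. Letters of the input enter names in the same way.

  The complexity classes bound every computation path, so the machines come from programs whose
  correctness statement \<open>exact\<close> covers at once the bound on all paths, the possible
  outcomes and their reachability.\<close>

primrec rename :: "(nat => nat) => formula => formula" where
  "rename \<sigma> (Pos a) = Pos (\<sigma> a)"
| "rename \<sigma> (Neg a) = Neg (\<sigma> a)"
| "rename \<sigma> (Conj F G) = Conj (rename \<sigma> F) (rename \<sigma> G)"
| "rename \<sigma> (Disj F G) = Disj (rename \<sigma> F) (rename \<sigma> G)"

primrec lits :: "formula => (bool \<times> nat) list" where
  "lits (Pos a) = [(True, a)]"
| "lits (Neg a) = [(False, a)]"
| "lits (Conj F G) = lits F @ lits G"
| "lits (Disj F G) = lits F @ lits G"

primrec ev :: "(nat => bool) => formula => bool" where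
  "ev v (Pos a) = v a"
| "ev v (Neg a) = (\<not> v a)"
| "ev v (Conj F G) = (ev v F \<and> ev v G)"
| "ev v (Disj F G) = (ev v F \<or> ev v G)"

lemma rename_rename: "rename \<sigma> (rename \<tau> F) = rename (\<sigma> \<circ> \<tau>) F" by (induction F) auto

lemma rename_cong: "(!!s a. (s, a) \<in> set (lits F) ==> \<sigma> a = \<tau> a) ==> rename \<sigma> F = rename \<tau> F" by (induction F) auto

lemma lits_rename: "lits (rename \<sigma> F) = map (%(s, a). (s, \<sigma> a)) (lits F)" by (induction F) auto

lemma ev_rename: "ev v (rename \<sigma> F) = ev (v \<circ> \<sigma>) F" by (induction F) auto

lemma dual_rename: "dual (rename \<sigma> F) = rename \<sigma> (dual F)" by (induction F) auto

lemma lits_dual: "lits (dual F) = map (%(s, a). (\<not> s, a)) (lits F)" by (induction F) auto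

lemma ev_dual: "ev v (dual F) = (\<not> ev v F)" by (induction F) auto

text \<open>Two independently chosen instances are put side by side by moving the atoms of one to
  even and those of the other to odd numbers. Their literals then differ, and one renaming serves
  both.\<close>

definition glue :: "(nat => nat) => (nat => nat) => nat => nat" where
  "glue \<sigma> \<tau> a = (if even a then \<sigma> (a div 2) else \<tau> (a div 2))"

abbreviation evens :: "formula => formula" where "evens \<equiv> rename (%a. 2 * a)"
abbreviation odds :: "formula => formula" where "odds \<equiv> rename (%a. Suc (2 * a))"

lemma glue_evens: "rename (glue \<sigma> \<tau>) (evens F) = rename \<sigma> F"
  and glue_odds: "rename (glue \<sigma> \<tau>) (odds F) = rename \<tau> F" by (auto simp: rename_rename glue_def intro!: rename_cong)

lemma distinct_odds: "distinct (lits (odds F)) = distinct (lits F)" by (auto simp: lits_rename distinct_map inj_on_def)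

lemma concat_lits_evens: "concat (map (lits \<circ> evens) P) = map (%(s, a). (s, 2 * a)) (concat (map lits P))"
  and concat_lits_odds: "concat (map (lits \<circ> odds) P) = map (%(s, a). (s, Suc (2 * a))) (concat (map lits P))"
  by (induction P) (auto simp: lits_rename)

text \<open>Even the atoms are kept apart, not just the literals: in the identity axiom the formula
  stands beside its dual, and each atom then occurs once in each polarity.\<close>

lemma linear_version: "\<exists>\<sigma> G. rename \<sigma> G = F \<and> distinct (map snd (lits G))" proof (induction F)
  case (Pos a)
  show ?case by (rule exI[of _ id], rule exI[of _ "Pos a"]) simp
next
  case (Neg a)
  show ?case by (rule exI[of _ id], rule exI[of _ "Neg a"]) simp
next
  case (Conj F1 F2)
  then obtain \<sigma> G \<tau> H where GH: "rename \<sigma> G = F1" "distinct (map snd (lits G))"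
    "rename \<tau> H = F2" "distinct (map snd (lits H))" by auto
  have "distinct (map snd (lits (Conj (evens G) (odds H))))"
    using GH(2,4) by (auto simp: lits_rename distinct_map inj_on_def case_prod_beta) presburger
  then show ?case using GH glue_evens glue_odds by (intro exI[of _ "glue \<sigma> \<tau>"] exI[of _ "Conj (evens G) (odds H)"]) auto
next
  case (Disj F1 F2)
  then obtain \<sigma> G \<tau> H where GH: "rename \<sigma> G = F1" "distinct (map snd (lits G))"
    "rename \<tau> H = F2" "distinct (map snd (lits H))" by auto
  have "distinct (map snd (lits (Disj (evens G) (odds H))))"
    using GH(2,4) by (auto simp: lits_rename distinct_map inj_on_def case_prod_beta) presburger
  then show ?case using GH glue_evens glue_odds by (intro exI[of _ "glue \<sigma> \<tau>"] exI[of _ "Disj (evens G) (odds H)"]) auto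
qed

text \<open>The soundness invariant: the pool is an instance of a pool in which no literal occurs twice, and
  every ogroup of the latter is a tautology.\<close>

definition sound_cirquent :: "cirquent => bool" where
  "sound_cirquent C \<longleftrightarrow> (\<exists>\<sigma> Q. map (rename \<sigma>) Q = snd C \<and> distinct (concat (map lits Q)) \<and>
     (\<forall>v. \<forall>\<Gamma>\<in>set (fst C). \<exists>i\<in>\<Gamma>. i < length Q \<and> ev v (Q ! i)))"

section \<open>Soundness of the rules\<close>

fun conj_adm :: "nat => nat set list => bool" where
  "conj_adm n [] = True"
| "conj_adm n [\<Gamma>] = (n \<notin> \<Gamma> \<and> Suc n \<notin> \<Gamma>)"
| "conj_adm n (\<Gamma> # \<Delta> # S) = (Suc n \<notin> \<Gamma> \<and>
     (if n \<in> \<Gamma> then Suc n \<in> \<Delta> \<and> n \<notin> \<Delta> \<and> conj_adm n S else conj_adm n (\<Delta> # S)))"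

lemma conj_admissible_iff: "conj_admissible n S \<longleftrightarrow> conj_adm n S" proof (induction n S rule: conj_adm.induct)
  case (3 n \<Gamma> \<Delta> S)
  show ?case proof (cases "n \<in> \<Gamma>")
    case True
    have "conj_admissible n (\<Gamma> # \<Delta> # S) \<longleftrightarrow> Suc n \<notin> \<Gamma> \<and> Suc n \<in> \<Delta> \<and> n \<notin> \<Delta> \<and> conj_admissible n S"
      using True unfolding conj_admissible_def by (cases S) (auto simp: All_less_Suc2 nth_Cons' split: if_splits)
    then show ?thesis using 3(1) True by simp
  next
    case False
    have "conj_admissible n (\<Gamma> # \<Delta> # S) \<longleftrightarrow> Suc n \<notin> \<Gamma> \<and> conj_admissible n (\<Delta> # S)"
      using False unfolding conj_admissible_def by (auto simp: All_less_Suc2 nth_Cons')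
    then show ?thesis using 3(2) False by simp
  qed
qed (auto simp: conj_admissible_def)

text \<open>\<open>conj_adm\<close> consumes the ogroups in the same way as
  \<open>merge_groups\<close>, so a single induction sees each merged ogroup as the union of one
  with the left and one with the right conjunct.\<close>

lemma merge_groups_cases:
  assumes "conj_adm n S" "X \<in> set (merge_groups n S)"
  obtains "X \<in> set S" "n \<notin> X" "Suc n \<notin> X"
  | \<Gamma> \<Delta> where "X = \<Gamma> \<union> \<Delta>" "\<Gamma> \<in> set S" "\<Delta> \<in> set S" "n \<in> \<Gamma>" "Suc n \<in> \<Delta>" "Suc n \<notin> \<Gamma>" "n \<notin> \<Delta>"
proof -
  have "conj_adm n S ==> X \<in> set (merge_groups n S) ==> (X \<in> set S \<and> n \<notin> X \<and> Suc n \<notin> X) \<or>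
    (\<exists>\<Gamma> \<Delta>. X = \<Gamma> \<union> \<Delta> \<and> \<Gamma> \<in> set S \<and> \<Delta> \<in> set S \<and> n \<in> \<Gamma> \<and> Suc n \<in> \<Delta> \<and> Suc n \<notin> \<Gamma> \<and> n \<notin> \<Delta>)"
  proof (induction n S rule: merge_groups.induct)
    case (3 n \<Gamma> \<Delta> S)
    show ?case proof (cases "n \<in> \<Gamma>")
      case True
      then consider "X = \<Gamma> \<union> \<Delta>" | "X \<in> set (merge_groups n S)" using 3(4) by auto
      then show ?thesis proof cases
        case 1
        then show ?thesis using True 3(3) by auto
      next
        case 2
        have "conj_adm n S" using 3(3) True by simp
        from 3(1)[OF True this 2] show ?thesis unfolding set_simps insert_iff by blast
      qed
    next
      case False
      then consider "X = \<Gamma>" | "X \<in> set (merge_groups n (\<Delta> # S))" using 3(4) by auto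
      then show ?thesis proof cases
        case 1
        then show ?thesis using False 3(3) by auto
      next
        case 2
        have "conj_adm n (\<Delta> # S)" using 3(3) False by simp
        from 3(2)[OF False this 2] show ?thesis unfolding set_simps insert_iff by blast
      qed
    qed
  qed auto
  then show thesis using assms that by blast
qed

lemma nth_exchange: "i < length P + 2 + length R ==>
  (P @ [G, F] @ R) ! (Transposition.transpose (length P) (Suc (length P)) i) = (P @ [F, G] @ R) ! i"
  by (auto simp: nth_append transpose_def nth_Cons')

lemma nth_insert: "(P @ [F] @ R) ! (insert_index (length P) i) = (P @ R) ! i" by (auto simp: nth_append insert_index_def nth_Cons')

lemma merge_index_eq: "(P @ [H] @ R) ! (merge_index (length P) i) =
  (if i = length P \<or> i = Suc (length P) then H else (P @ [F, G] @ R) ! i)" by (auto simp: nth_append merge_index_def nth_Cons' split: if_splits)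

lemma sound_pair_E:
  assumes "sound_cirquent (S, P @ F # G # R)"
  obtains \<sigma> P' F' G' R' where "map (rename \<sigma>) P' = P" "rename \<sigma> F' = F" "rename \<sigma> G' = G" "map (rename \<sigma>) R' = R"
    "distinct (concat (map lits (P' @ [F', G'] @ R')))" "length P' = length P"
    "\<forall>v. \<forall>\<Gamma>\<in>set S. \<exists>i\<in>\<Gamma>. i < length (P' @ [F', G'] @ R') \<and> ev v ((P' @ [F', G'] @ R') ! i)" proof -
  obtain \<sigma> Q where Q: "map (rename \<sigma>) Q = P @ [F, G] @ R" "distinct (concat (map lits Q))"
    "!!v \<Gamma>. \<Gamma> \<in> set S ==> \<exists>i\<in>\<Gamma>. i < length Q \<and> ev v (Q ! i)"
    using assms unfolding sound_cirquent_def by auto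
  obtain P' F' G' R' where "Q = P' @ [F', G'] @ R'" "map (rename \<sigma>) P' = P" "rename \<sigma> F' = F"
      "rename \<sigma> G' = G" "map (rename \<sigma>) R' = R" using Q(1) by (auto simp: map_eq_append_conv map_eq_Cons_conv)
  then show thesis using that Q by auto
qed

text \<open>Each rule is applied in parallel to the pool of which the given pool is an instance.
  What remains is to find, for each valuation, a true member in every ogroup of the
  conclusion.\<close>

lemma sound_cirquent_CL5: "CL5 C ==> sound_cirquent C" proof (induction rule: CL5.induct)
  case empty_axiom
  then show ?case by (simp add: sound_cirquent_def)
next
  case (identity_axiom F)
  obtain \<sigma> G where G: "rename \<sigma> G = F" "distinct (map snd (lits G))" using linear_version by blast
  have "distinct (concat (map lits [dual G, G]))" using G(2) by (auto simp: lits_dual distinct_map inj_on_def)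
      (smt (verit, best) snd_conv fst_conv)+
  then show ?case using G unfolding sound_cirquent_def by (intro exI[of _ \<sigma>] exI[of _ "[dual G, G]"]) (auto simp: dual_rename ev_dual)
next
  case (mix S P T Q)
  then obtain \<sigma> P' \<tau> Q' where P: "map (rename \<sigma>) P' = P" "distinct (concat (map lits P'))"
      "!!v \<Gamma>. \<Gamma> \<in> set S ==> \<exists>i\<in>\<Gamma>. i < length P' \<and> ev v (P' ! i)"
    and Q: "map (rename \<tau>) Q' = Q" "distinct (concat (map lits Q'))"
      "!!v \<Gamma>. \<Gamma> \<in> set T ==> \<exists>i\<in>\<Gamma>. i < length Q' \<and> ev v (Q' ! i)" unfolding sound_cirquent_def by auto
  let ?R = "map evens P' @ map odds Q'"
  have "distinct (concat (map lits ?R))" using P(2) Q(2) unfolding map_append concat_append map_map concat_lits_evens concat_lits_odds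
    by (auto simp: distinct_map inj_on_def) presburger
  moreover have "map (rename (glue \<sigma> \<tau>)) ?R = P @ Q" using P(1) Q(1) by (auto simp: glue_evens glue_odds)
  moreover have "\<exists>i\<in>\<Gamma>. i < length ?R \<and> ev v (?R ! i)"
    if \<Gamma>: "\<Gamma> \<in> set (S @ map (%\<Gamma>. (%i. length P + i) ` \<Gamma>) T)" for v \<Gamma> proof -
    have len: "length P = length P'" using P(1) by auto
    show ?thesis proof (cases "\<Gamma> \<in> set S")
      case True
      from P(3)[OF this, of "v \<circ> (%a. 2 * a)"] show ?thesis by (auto simp: nth_append ev_rename intro!: bexI)
    next
      case False
      then obtain \<Delta> where "\<Delta> \<in> set T" "\<Gamma> = (%i. length P + i) ` \<Delta>" using \<Gamma> by auto
      with Q(3)[of \<Delta> "v \<circ> (%a. Suc (2 * a))"] show ?thesis by (auto simp: nth_append ev_rename len)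
    qed
  qed
  ultimately show ?case unfolding sound_cirquent_def fst_conv snd_conv by blast
next
  case (oformula_exchange S P F G Q)
  have "sound_cirquent (S, P @ F # G # Q)" using oformula_exchange.IH by simp
  then obtain \<sigma> P' F' G' Q' where *: "map (rename \<sigma>) P' = P" "rename \<sigma> F' = F" "rename \<sigma> G' = G" "map (rename \<sigma>) Q' = Q"
      "distinct (concat (map lits (P' @ [F', G'] @ Q')))" "length P' = length P"
      "\<forall>v. \<forall>\<Gamma>\<in>set S. \<exists>i\<in>\<Gamma>. i < length (P' @ [F', G'] @ Q') \<and> ev v ((P' @ [F', G'] @ Q') ! i)"
    by (rule sound_pair_E)
  let ?t = "Transposition.transpose (length P) (Suc (length P))"
  have "\<exists>i\<in>?t ` \<Gamma>. i < length (P' @ [G', F'] @ Q') \<and> ev v ((P' @ [G', F'] @ Q') ! i)" if \<Gamma>: "\<Gamma> \<in> set S" for v \<Gamma>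
  proof -
    obtain i where i: "i \<in> \<Gamma>" "i < length P' + 2 + length Q'" "ev v ((P' @ [F', G'] @ Q') ! i)"
      using *(7)[rule_format, OF \<Gamma>, of v] by auto
    have "?t i < length (P' @ [G', F'] @ Q')" using i(2) *(6) by (auto simp: transpose_def)
    moreover have "ev v ((P' @ [G', F'] @ Q') ! ?t i)" using nth_exchange[OF i(2)] i(3) *(6) by simp
    ultimately show ?thesis using i(1) by blast
  qed
  moreover have "map (rename \<sigma>) (P' @ [G', F'] @ Q') = P @ [G, F] @ Q" using *(1-4) by simp
  moreover have "distinct (concat (map lits (P' @ [G', F'] @ Q')))" using *(5) by auto
  ultimately show ?case unfolding sound_cirquent_def fst_conv snd_conv set_map ball_simps by blast
next
  case (pool_weakening S P Q F)
  then obtain \<sigma> P' Q' where *: "map (rename \<sigma>) (P' @ Q') = P @ Q" "length P' = length P" "length Q' = length Q"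
      "distinct (concat (map lits (P' @ Q')))"
      "!!v \<Gamma>. \<Gamma> \<in> set S ==> \<exists>i\<in>\<Gamma>. i < length (P' @ Q') \<and> ev v ((P' @ Q') ! i)"
    unfolding sound_cirquent_def by (auto simp: map_eq_append_conv)
  obtain \<tau> G where G: "rename \<tau> G = F" "distinct (map snd (lits G))" using linear_version by blast
  let ?R = "map evens P' @ [odds G] @ map evens Q'"
  have "distinct (lits (odds G))" using G(2) by (simp add: distinct_odds distinct_map)
  moreover have "distinct (concat (map lits (map evens (P' @ Q'))))"
    unfolding map_map concat_lits_evens distinct_map by (rule conjI[OF *(4)]) (auto simp: inj_on_def)
  moreover have "set (lits (odds G)) \<inter> set (concat (map lits (map evens (P' @ Q')))) = {}"
    unfolding map_map concat_lits_evens lits_rename by (auto simp: Suc_double_not_eq_double)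
  ultimately have "distinct (concat (map lits ?R))" by auto
  moreover have "map (rename (glue \<sigma> \<tau>)) ?R = P @ [F] @ Q" using *(1-3) G(1) by (auto simp: glue_evens glue_odds)
  moreover have "\<exists>i\<in>insert_index (length P) ` \<Gamma>. i < length ?R \<and> ev v (?R ! i)" if \<Gamma>: "\<Gamma> \<in> set S" for v \<Gamma>
  proof -
    obtain i where i: "i \<in> \<Gamma>" "i < length (P' @ Q')" "ev (v \<circ> (%a. 2 * a)) ((P' @ Q') ! i)" using *(5)[OF \<Gamma>] by blast
    have "?R ! (insert_index (length P) i) = map evens (P' @ Q') ! i" using nth_insert[of "map evens P'" "odds G" "map evens Q'" i] *(2) by simp
    also have "\<dots> = evens ((P' @ Q') ! i)" using i(2) by (rule nth_map)
    finally have "ev v (?R ! insert_index (length P) i)" using i(3) by (simp add: ev_rename)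
    moreover have "insert_index (length P) i < length ?R" using i(2) by (auto simp: insert_index_def)
    ultimately show ?thesis using i(1) by blast
  qed
  ultimately show ?case unfolding sound_cirquent_def fst_conv snd_conv set_map ball_simps by blast
next
  case (disj_introduction S P F G Q)
  have "sound_cirquent (S, P @ F # G # Q)" using disj_introduction.IH by simp
  then obtain \<sigma> P' F' G' Q' where *: "map (rename \<sigma>) P' = P" "rename \<sigma> F' = F" "rename \<sigma> G' = G" "map (rename \<sigma>) Q' = Q"
      "distinct (concat (map lits (P' @ [F', G'] @ Q')))" "length P' = length P"
      "\<forall>v. \<forall>\<Gamma>\<in>set S. \<exists>i\<in>\<Gamma>. i < length (P' @ [F', G'] @ Q') \<and> ev v ((P' @ [F', G'] @ Q') ! i)"
    by (rule sound_pair_E)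
  let ?R = "P' @ [Disj F' G'] @ Q'"
  have "\<exists>i\<in>merge_index (length P) ` \<Gamma>. i < length ?R \<and> ev v (?R ! i)" if \<Gamma>: "\<Gamma> \<in> set S" for v \<Gamma>
  proof -
    obtain i where i: "i \<in> \<Gamma>" "i < length (P' @ [F', G'] @ Q')" "ev v ((P' @ [F', G'] @ Q') ! i)"
      using *(7)[rule_format, OF \<Gamma>, of v] by blast
    have "ev v (?R ! merge_index (length P) i)" using i(3) unfolding *(6)[symmetric] merge_index_eq[of P' _ Q' i F' G'] by (auto simp: nth_append)
    moreover have "merge_index (length P) i < length ?R" using i(2) *(6) by (auto simp: merge_index_def)
    ultimately show ?thesis using i(1) by blast
  qed
  moreover have "map (rename \<sigma>) (P' @ [Disj F' G'] @ Q') = P @ [Disj F G] @ Q" using *(1-4) by simp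
  moreover have "distinct (concat (map lits (P' @ [Disj F' G'] @ Q')))" using *(5) by auto
  ultimately show ?case unfolding sound_cirquent_def fst_conv snd_conv set_map ball_simps by blast
next
  case (conj_introduction S P F G Q)
  have "sound_cirquent (S, P @ F # G # Q)" using conj_introduction.IH by simp
  then obtain \<sigma> P' F' G' Q' where *: "map (rename \<sigma>) P' = P" "rename \<sigma> F' = F" "rename \<sigma> G' = G" "map (rename \<sigma>) Q' = Q"
      "distinct (concat (map lits (P' @ [F', G'] @ Q')))" "length P' = length P"
      "\<forall>v. \<forall>\<Gamma>\<in>set S. \<exists>i\<in>\<Gamma>. i < length (P' @ [F', G'] @ Q') \<and> ev v ((P' @ [F', G'] @ Q') ! i)"
    by (rule sound_pair_E)
  have adm: "conj_adm (length P') S" using conj_introduction.hyps(2) conj_admissible_iff *(6) by simp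
  let ?R = "P' @ [Conj F' G'] @ Q'" and ?n = "length P'"
  have "\<exists>i\<in>merge_index ?n ` X. i < length ?R \<and> ev v (?R ! i)" if X: "X \<in> set (merge_groups ?n S)" for v X proof -
    have other: "merge_index ?n i < length ?R \<and> ev v (?R ! merge_index ?n i)"
      if "i ~= ?n" "i ~= Suc ?n" "i < length (P' @ [F', G'] @ Q')" "ev v ((P' @ [F', G'] @ Q') ! i)" for i
      using that merge_index_eq[of P' "Conj F' G'" Q' i F' G'] by (auto simp: merge_index_def)
    from adm X show ?thesis proof (cases rule: merge_groups_cases)
      case 1
      with *(7)[rule_format, OF 1(1), of v] other show ?thesis by (metis imageI)
    next
      case (2 \<Gamma> \<Delta>)
      obtain i where i: "i \<in> \<Gamma>" "i < length (P' @ [F', G'] @ Q')" "ev v ((P' @ [F', G'] @ Q') ! i)"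
        using *(7)[rule_format, OF 2(2), of v] by blast
      obtain j where j: "j \<in> \<Delta>" "j < length (P' @ [F', G'] @ Q')" "ev v ((P' @ [F', G'] @ Q') ! j)"
        using *(7)[rule_format, OF 2(3), of v] by blast
      \<comment> \<open>The conjunction itself is needed only if the true members found in the two
        merged ogroups are just the two conjuncts; otherwise one of them survives the merging
        unchanged.\<close>
      consider "i ~= ?n" | "j ~= Suc ?n" | "i = ?n" "j = Suc ?n" by blast
      then show ?thesis proof cases
        case 1
        then have "i ~= Suc ?n" using i(1) 2 by auto
        then show ?thesis using other[OF 1 _ i(2,3)] i(1) 2(1) by blast
      next
        case c: 2
        then have "j ~= ?n" using j(1) 2 by auto
        then show ?thesis using other[OF _ c j(2,3)] j(1) 2(1) by blast
      next
        case 3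
        then have "ev v F'" "ev v G'" using i(3) j(3) by (auto simp: nth_append)
        then have "ev v (?R ! ?n)" by (simp add: nth_append)
        moreover have "?n \<in> merge_index ?n ` X" using i(1) 3 2(1) by (auto simp: merge_index_def)
        ultimately show ?thesis by (intro bexI[of _ ?n]) auto
      qed
    qed
  qed
  moreover have "map (rename \<sigma>) (P' @ [Conj F' G'] @ Q') = P @ [Conj F G] @ Q" using *(1-4) by simp
  moreover have "distinct (concat (map lits (P' @ [Conj F' G'] @ Q')))" using *(5) by auto
  ultimately show ?case unfolding sound_cirquent_def fst_conv snd_conv set_map ball_simps *(6)[symmetric] by blast
next
  case (ogroup_weakening S \<Gamma> T P i)
  then show ?case unfolding sound_cirquent_def by auto (metis)
next
  case (ogroup_exchange S \<Gamma> \<Delta> T P)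
  have "set (S @ [\<Gamma>, \<Delta>] @ T) = set (S @ [\<Delta>, \<Gamma>] @ T)" by auto
  with ogroup_exchange.IH show ?case unfolding sound_cirquent_def fst_conv snd_conv by (simp only:)
qed (auto simp: sound_cirquent_def)

section \<open>Derived rules: renaming, rearrangement and weakening\<close>

lemma CL5_rename: "CL5 (S, P) ==> CL5 (S, map (rename \<sigma>) P)" proof (induction "(S, P)" arbitrary: S P rule: CL5.induct)
  case empty_axiom
  show ?case using CL5.empty_axiom by simp
next
  case (identity_axiom F)
  show ?case using CL5.identity_axiom[of "rename \<sigma> F"] by (simp add: dual_rename)
next
  case (mix S P T Q)
  show ?case using CL5.mix[OF mix.hyps(2,4)] by simp
next
  case (oformula_exchange S P F G Q)
  show ?case using CL5.oformula_exchange[of S "map (rename \<sigma>) P"] oformula_exchange by simp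
next
  case (ogroup_exchange S \<Gamma> \<Delta> T P)
  show ?case using CL5.ogroup_exchange[OF ogroup_exchange.hyps(2)] by simp
next
  case (ogroup_weakening S \<Gamma> T P i)
  show ?case using CL5.ogroup_weakening[OF ogroup_weakening.hyps(2)] ogroup_weakening.hyps by simp
next
  case (pool_weakening S P Q F)
  show ?case using CL5.pool_weakening[of S "map (rename \<sigma>) P"] pool_weakening by simp
next
  case (downward_duplication S \<Gamma> T P)
  show ?case using CL5.downward_duplication[OF downward_duplication.hyps(2)] by simp
next
  case (upward_duplication S \<Gamma> T P)
  show ?case using CL5.upward_duplication[OF upward_duplication.hyps(2)] by simp
next
  case (disj_introduction S P F G Q)
  show ?case using CL5.disj_introduction[of S "map (rename \<sigma>) P"] disj_introduction by simp
next
  case (conj_introduction S P F G Q)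
  show ?case using CL5.conj_introduction[of S "map (rename \<sigma>) P"] conj_introduction by simp
qed

lemma CL5_move_group: "CL5 (A @ [x] @ B @ C, P) \<longleftrightarrow> CL5 (A @ B @ [x] @ C, P)" proof (induction B arbitrary: A)
  case (Cons y B)
  have "CL5 (A @ [x] @ (y # B) @ C, P) \<longleftrightarrow> CL5 ((A @ [y]) @ [x] @ B @ C, P)"
    using CL5.ogroup_exchange[of A x y "B @ C" P] CL5.ogroup_exchange[of A y x "B @ C" P] by auto
  then show ?case using Cons[of "A @ [y]"] by simp
qed simp

lemma CL5_mset_groups:
  assumes "mset S = mset T" shows "CL5 (A @ S, P) ==> CL5 (A @ T, P)" using assms proof (induction S arbitrary: A T)
  case (Cons x S)
  obtain B C where T: "T = B @ x # C" using Cons.prems(2) by (metis list.set_intros(1) set_mset_mset split_list)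
  then have "mset S = mset (B @ C)" using Cons.prems(2) by simp
  from Cons.IH[of "A @ [x]", OF _ this] Cons.prems(1) have "CL5 (A @ [x] @ B @ C, P)" by simp
  then show ?case using T CL5_move_group[of A x B C P] by simp
qed simp

lemma CL5_remdups: "CL5 (A @ S, P) \<longleftrightarrow> CL5 (A @ remdups S, P)" proof (induction S arbitrary: A)
  case (Cons x S)
  show ?case proof (cases "x \<in> set S")
    case True
    then obtain B C where S: "S = B @ x # C" by (meson split_list)
    have m: "mset (x # S) = mset (x # x # B @ C)" "mset S = mset (x # B @ C)" using S by auto
    have "CL5 (A @ x # S, P) \<longleftrightarrow> CL5 (A @ [x, x] @ B @ C, P)"
      using CL5_mset_groups[OF m(1)] CL5_mset_groups[OF m(1)[symmetric]] by auto
    also have "\<dots> \<longleftrightarrow> CL5 (A @ [x] @ B @ C, P)"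
      using CL5.downward_duplication[of A x "B @ C" P] CL5.upward_duplication[of A x "B @ C" P] by auto
    also have "\<dots> \<longleftrightarrow> CL5 (A @ S, P)" using CL5_mset_groups[OF m(2)] CL5_mset_groups[OF m(2)[symmetric]] by auto
    finally show ?thesis using Cons[of A] True by simp
  next
    case False
    then show ?thesis using Cons[of "A @ [x]"] by simp
  qed
qed simp

text \<open>Exchange makes the order of ogroups irrelevant and the two duplications their
  multiplicity.\<close>

lemma CL5_set_groups:
  assumes "CL5 (S, P)" "set S = set T" shows "CL5 (T, P)" proof -
  have "mset (remdups S) = mset (remdups T)" using assms(2) set_eq_iff_mset_remdups_eq by blast
  then show ?thesis using CL5_mset_groups[of "remdups S" "remdups T" "[]" P] assms(1)
    CL5_remdups[of "[]" S P] CL5_remdups[of "[]" T P] by simp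
qed

lemma CL5_weaken_group:
  assumes "CL5 (S @ [\<Gamma>] @ T, P)" "\<Gamma> \<subseteq> \<Delta>" "\<Delta> \<subseteq> {..<length P}" shows "CL5 (S @ [\<Delta>] @ T, P)"
proof -
  have "finite (\<Delta> - \<Gamma>)" using assms(3) finite_subset by blast
  then have "CL5 (S @ [\<Gamma> \<union> (\<Delta> - \<Gamma>)] @ T, P)" using assms(3)
  proof (induction "\<Delta> - \<Gamma>" arbitrary: \<Delta> rule: finite_induct)
    case empty
    then have "\<Gamma> \<union> (\<Delta> - \<Gamma>) = \<Gamma>" by blast
    then show ?case using assms(1) by simp
  next
    case (insert x F)
    have F: "F = (\<Delta> - {x}) - \<Gamma>" using insert.hyps by blast
    have "CL5 (S @ [\<Gamma> \<union> ((\<Delta> - {x}) - \<Gamma>)] @ T, P)" using insert.hyps(3)[OF F] insert.prems by auto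
    from CL5.ogroup_weakening[OF this, of x]
    have "CL5 (S @ [insert x (\<Gamma> \<union> (\<Delta> - {x} - \<Gamma>))] @ T, P)" using insert.hyps insert.prems by blast
    moreover have "insert x (\<Gamma> \<union> (\<Delta> - {x} - \<Gamma>)) = \<Gamma> \<union> (\<Delta> - \<Gamma>)" using insert.hyps(4) by blast
    ultimately show ?case by simp
  qed
  moreover have "\<Gamma> \<union> (\<Delta> - \<Gamma>) = \<Delta>" using assms(2) by blast
  ultimately show ?thesis by simp
qed

lemma CL5_weaken_groups:
  assumes "list_all2 (%\<Gamma> \<Delta>. \<Gamma> \<subseteq> \<Delta> \<and> \<Delta> \<subseteq> {..<length P}) S T" "CL5 (A @ S, P)"
  shows "CL5 (A @ T, P)" using assms proof (induction arbitrary: A rule: list_all2_induct)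
  case (Cons \<Gamma> S \<Delta> T)
  have "CL5 (A @ [\<Delta>] @ S, P)" using CL5_weaken_group[of A \<Gamma> S P \<Delta>] Cons by auto
  then show ?case using Cons.IH[of "A @ [\<Delta>]"] by simp
qed simp

lemma CL5_no_groups: "CL5 ([], P)" proof (induction P)
  case (Cons F P)
  then show ?case using CL5.pool_weakening[of "[]" "[]" P F] by simp
qed (rule CL5.empty_axiom)

definition swap_pool :: "nat => nat => formula list => formula list" where
  "swap_pool a b P = P[a := P ! b, b := P ! a]"

lemma length_swap_pool [simp]: "length (swap_pool a b P) = length P" by (simp add: swap_pool_def)

lemma nth_swap_pool:
  "a < length P ==> b < length P ==> i < length P ==> swap_pool a b P ! Transposition.transpose a b i = P ! i"
  by (auto simp: swap_pool_def nth_list_update transpose_def)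

lemma CL5_swap_adjacent:
  assumes "CL5 (S, P)" "Suc a < length P" shows "CL5 (map ((`) (Transposition.transpose a (Suc a))) S, swap_pool a (Suc a) P)" proof -
  let ?A = "take a P" and ?B = "drop (Suc (Suc a)) P"
  have P: "P = ?A @ [P ! a, P ! Suc a] @ ?B" using assms(2) by (simp add: Cons_nth_drop_Suc)
  have len: "length ?A = a" using assms(2) by simp
  have "swap_pool a (Suc a) P = ?A @ [P ! Suc a, P ! a] @ ?B"
    using assms(2) by (auto simp: swap_pool_def list_eq_iff_nth_eq nth_list_update nth_append nth_Cons' min_def)
      (rule arg_cong[where f = "(!) P"], linarith)
  then show ?thesis using CL5.oformula_exchange[of S ?A "P ! a" "P ! Suc a" ?B] assms(1) P len by simp
qed

text \<open>A transposition over a longer distance is a shorter one conjugated by an exchange of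
  neighbours.\<close>

lemma CL5_swap:
  assumes "CL5 (S, P)" "a + Suc k < length P" shows "CL5 (map ((`) (Transposition.transpose a (a + Suc k))) S, swap_pool a (a + Suc k) P)" using assms
proof (induction k arbitrary: S P)
  case 0
  then show ?case using CL5_swap_adjacent by simp
next
  case (Suc k)
  let ?b = "a + Suc k"
  let ?t = "Transposition.transpose ?b (Suc ?b)" and ?u = "Transposition.transpose a ?b"
  have "CL5 (map ((`) ?t) S, swap_pool ?b (Suc ?b) P)" using CL5_swap_adjacent Suc.prems by simp
  then have "CL5 (map ((`) ?u) (map ((`) ?t) S), swap_pool a ?b (swap_pool ?b (Suc ?b) P))"
    using Suc.prems by (intro Suc.IH) (auto simp: swap_pool_def)
  then have "CL5 (map ((`) ?t) (map ((`) ?u) (map ((`) ?t) S)),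
      swap_pool ?b (Suc ?b) (swap_pool a ?b (swap_pool ?b (Suc ?b) P)))" using Suc.prems by (intro CL5_swap_adjacent) (auto simp: swap_pool_def)
  moreover have "?t (?u (?t x)) = Transposition.transpose a (Suc ?b) x" for x by (auto simp: transpose_def)
  then have "map ((`) ?t) (map ((`) ?u) (map ((`) ?t) S)) = map ((`) (Transposition.transpose a (Suc ?b))) S"
    by (simp only: map_map comp_def image_image)
  moreover have "swap_pool ?b (Suc ?b) (swap_pool a ?b (swap_pool ?b (Suc ?b) P)) = swap_pool a (Suc ?b) P"
    using Suc.prems by (auto simp: swap_pool_def list_eq_iff_nth_eq nth_list_update)
  ultimately show ?case by (simp only: add_Suc_right)
qed

lemma CL5_swap_iff:
  assumes "a < length P" "b < length P" shows "CL5 (map ((`) (Transposition.transpose a b)) S, swap_pool a b P) \<longleftrightarrow> CL5 (S, P)"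
proof -
  have *: "CL5 (map ((`) (Transposition.transpose a b)) S, swap_pool a b P)"
    if "CL5 (S, P)" "a < length P" "b < length P" for S P proof -
    consider "a < b" | "b < a" | "a = b" by linarith
    then show ?thesis proof cases
      case 1
      then obtain k where "b = a + Suc k" using less_iff_Suc_add by auto
      then show ?thesis using CL5_swap that by simp
    next
      case 2
      then obtain k where k: "a = b + Suc k" using less_iff_Suc_add by auto
      have "swap_pool a b P = swap_pool b a P" using 2 by (simp add: swap_pool_def list_update_swap)
      then show ?thesis using CL5_swap[of S P b k] that k by (simp add: transpose_commute)
    next
      case 3
      then show ?thesis using that by (simp add: swap_pool_def image_def)
    qed
  qed
  have "map ((`) (Transposition.transpose a b)) (map ((`) (Transposition.transpose a b)) S) = S" by (auto simp: image_comp intro!: map_idI)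
  moreover have "swap_pool a b (swap_pool a b P) = P" using assms by (auto simp: swap_pool_def list_eq_iff_nth_eq nth_list_update)
  ultimately show ?thesis using *[of S P] *[of "map ((`) (Transposition.transpose a b)) S" "swap_pool a b P"] assms by (auto simp: swap_pool_def)
qed

text \<open>Mix puts an identity axiom in front. The other ogroups avoid its two positions, so
  subtracting 2 loses nothing and mix adds it again.\<close>

lemma CL5_shift:
  assumes "CL5 (map ((`) (%i. i - 2)) D, R)" "!!d. d \<in> set D ==> d \<subseteq> {2..}" shows "CL5 ({0, 1} # D, dual F # F # R)" proof -
  have "(%i. 2 + i) ` (%i. i - 2) ` d = d" if "d \<in> set D" for d proof -
    have "!!i. i \<in> d ==> 2 + (i - 2) = i" using assms(2)[OF that] by auto
    then show ?thesis unfolding image_image by simp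
  qed
  then have "map (%\<Gamma>. (%i. 2 + i) ` \<Gamma>) (map ((`) (%i. i - 2)) D) = D" by (simp only: map_map comp_def map_idI)
  then show ?thesis using CL5.mix[OF CL5.identity_axiom[of F] assms(1)] by (simp add: numeral_2_eq_2)
qed

text \<open>The base case of completeness.\<close>

lemma CL5_pairs:
  assumes "distinct D" "distinct Q"
    and "!!d. d \<in> set D ==> \<exists>i j. d = {i, j} \<and> i < length Q \<and> j < length Q \<and> i ~= j \<and> Q ! i = dual (Q ! j) \<and> Q ! j = dual (Q ! i)"
  shows "CL5 (D, Q)" using assms proof (induction "length D" arbitrary: D Q)
  case 0
  then show ?case using CL5_no_groups by simp
next
  case (Suc n D0)
  then obtain d D where D0: "D0 = d # D" "length D = n" by (metis Suc_length_conv)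
  note Cons = Suc[unfolded D0(1)]
  obtain i j where ij: "d = {i, j}" "i < length Q" "j < length Q" "i ~= j" "Q ! i = dual (Q ! j)" "Q ! j = dual (Q ! i)" using Cons(5)[of d] by auto
  \<comment> \<open>Two transpositions bring the pair \<open>d\<close> to the positions 0 and 1,
    where it is split off as an identity axiom.\<close>
  define t where "t = Transposition.transpose 0 i"
  define u where "u = Transposition.transpose 1 (t j)"
  define Q' where "Q' = swap_pool 1 (t j) (swap_pool 0 i Q)"
  have tj: "t j < length Q" "t j ~= 0" using ij by (auto simp: t_def transpose_def)
  have len: "1 < length Q" using ij by linarith
  have Q'len: "length Q' = length Q" by (simp add: Q'_def swap_pool_def)
  have Q'nth: "Q' ! (u (t k)) = Q ! k" if "k < length Q" for k proof -
    have "t k < length Q" using that ij(2) len by (auto simp: t_def transpose_def)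
    then have "Q' ! u (t k) = swap_pool 0 i Q ! t k" unfolding Q'_def u_def using len tj by (intro nth_swap_pool) auto
    also have "\<dots> = Q ! k" unfolding t_def using that ij(2) len by (intro nth_swap_pool) auto
    finally show ?thesis .
  qed
  have ut: "u (t i) = 0" "u (t j) = 1" using tj by (auto simp: u_def t_def transpose_def)
  have inj: "inj (%k. u (t k))" unfolding u_def t_def inj_def by (metis transpose_involutory)
  have utlen: "u (t k) < length Q" if "k < length Q" for k using that ij len tj unfolding u_def t_def by (auto simp: transpose_def)
  have dist': "distinct Q'" proof -
    have "0 < length Q" using len by linarith
    then show ?thesis unfolding Q'_def swap_pool_def using Cons(4) ij(2) tj(1) len by (simp add: distinct_swap)
  qed
  obtain R where R: "Q' = dual (Q ! j) # (Q ! j) # R" proof -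
    have "Q' ! 0 = dual (Q ! j)" using Q'nth[OF ij(2), unfolded ut(1)] ij(5) by (simp only:)
    moreover have "Q' ! 1 = Q ! j" using Q'nth[OF ij(3), unfolded ut(2)] .
    ultimately show thesis using that len Q'len by (cases Q'; cases "tl Q'") auto
  qed
  define D' where "D' = map ((`) (%k. u (t k))) D"
  have D'ge: "e \<subseteq> {2..}" if e: "e \<in> set D'" for e proof -
    obtain d' where d': "d' \<in> set D" "e = (%k. u (t k)) ` d'" using e by (auto simp: D'_def)
    obtain i' j' where ij': "d' = {i', j'}" "i' < length Q" "j' < length Q" "i' ~= j'" "Q ! i' = dual (Q ! j')" "Q ! j' = dual (Q ! i')"
      using Cons(5)[of d'] d'(1) by auto
    have "d' ~= d" using d'(1) Cons(3) by auto
    have eq: "!!x y. x < length Q ==> y < length Q ==> Q ! x = Q ! y ==> x = y" using Cons(4) nth_eq_iff_index_eq by blast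
    \<comment> \<open>In a pool without repetitions a formula has only one dual partner, so two
      pairs that share a position coincide.\<close>
    have "i' \<notin> d \<and> j' \<notin> d" proof (rule ccontr)
      assume "\<not> ?thesis"
      then consider "i' = i \<and> j' = j" | "i' = j \<and> j' = i"
        using ij ij' eq[OF ij'(3) ij(3)] eq[OF ij'(3) ij(2)] eq[OF ij'(2) ij(3)] eq[OF ij'(2) ij(2)] by (metis insertE singletonD)
      then have "d' = d" using ij(1) ij'(1) by cases (simp_all add: insert_commute)
      then show False using \<open>d' ~= d\<close> by simp
    qed
    then have ne: "k ~= i \<and> k ~= j" if "k \<in> d'" for k using that ij(1) ij'(1) by blast
    show ?thesis
    proof
      fix x assume "x \<in> e"
      then obtain k where k: "k \<in> d'" "x = u (t k)" using d'(2) by blast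
      have "x ~= 0" "x ~= 1" using ne[OF k(1)] k(2) injD[OF inj, of k i] injD[OF inj, of k j] ut by auto
      then show "x \<in> {2..}" by simp
    qed
  qed
  have "CL5 (map ((`) (%i. i - 2)) D', R)" proof (rule Suc.hyps(1))
    show "n = length (map ((`) (%i. i - 2)) D')" by (simp add: D'_def D0(2))
  next
    have injD': "inj_on ((`) (%k. u (t k))) (set D)" by (rule inj_onI) (metis inj inj_image_eq_iff)
    then have "distinct D'" unfolding D'_def using Cons(3) by (simp add: distinct_map)
    moreover have "inj_on ((`) (%i. i - 2)) (set D')" proof (rule inj_onI)
      fix x y assume xy: "x \<in> set D'" "y \<in> set D'" "(%i. i - 2) ` x = (%i. i - 2) ` y"
      have inj2: "inj_on (%i::nat. i - 2) {2..}" by (auto simp: inj_on_def)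
      show "x = y" using inj_on_image_eq_iff[OF inj2] D'ge xy by blast
    qed
    ultimately show "distinct (map ((`) (%i. i - 2)) D')" by (simp add: distinct_map)
    show "distinct R" using dist' R by simp
    fix e assume "e \<in> set (map ((`) (%i. i - 2)) D')"
    then obtain d' where d': "d' \<in> set D" "e = (%i. i - 2) ` (%k. u (t k)) ` d'" by (auto simp: D'_def)
    obtain i' j' where ij': "d' = {i', j'}" "i' < length Q" "j' < length Q" "i' ~= j'" "Q ! i' = dual (Q ! j')" "Q ! j' = dual (Q ! i')"
      using Cons(5)[of d'] d'(1) by auto
    have ge: "2 <= u (t i')" "2 <= u (t j')" proof -
      have "(%k. u (t k)) ` d' \<in> set D'" unfolding D'_def set_map by (rule imageI) (fact d'(1))
      then show "2 <= u (t i')" "2 <= u (t j')" using D'ge ij'(1) by fastforce+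
    qed
    have Rn: "R ! (k - 2) = Q' ! k" if "2 <= k" for k using that R by (auto simp: nth_Cons' diff_diff_eq numeral_2_eq_2)
    have lR: "length R = length Q - 2" using R Q'len by (cases Q) auto
    show "\<exists>i j. e = {i, j} \<and> i < length R \<and> j < length R \<and> i ~= j \<and> R ! i = dual (R ! j) \<and> R ! j = dual (R ! i)"
    proof (intro exI conjI)
      show "e = {u (t i') - 2, u (t j') - 2}" using d'(2) ij'(1) by simp
      show "u (t i') - 2 < length R" "u (t j') - 2 < length R" using utlen[OF ij'(2)] utlen[OF ij'(3)] ge lR by auto
      show "u (t i') - 2 ~= u (t j') - 2" using ge ij'(4) inj by (metis inj_eq le_add_diff_inverse2)
      show "R ! (u (t i') - 2) = dual (R ! (u (t j') - 2))" "R ! (u (t j') - 2) = dual (R ! (u (t i') - 2))"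
        unfolding Rn[OF ge(1)] Rn[OF ge(2)] Q'nth[OF ij'(2)] Q'nth[OF ij'(3)] by (fact ij')+
    qed
  qed
  from CL5_shift[OF this D'ge] have "CL5 ({0, 1} # D', Q')" using R by simp
  moreover have "{0, 1} # D' = map ((`) u) (map ((`) t) (d # D))" using ut ij(1) by (simp add: D'_def image_comp comp_def)
  ultimately have "CL5 (map ((`) u) (map ((`) t) (d # D)), Q')" by simp
  moreover have "1 < length (swap_pool 0 i Q)" "t j < length (swap_pool 0 i Q)" using len tj by simp_all
  ultimately have "CL5 (map ((`) t) (d # D), swap_pool 0 i Q)" unfolding u_def Q'_def using CL5_swap_iff by blast
  moreover have "0 < length Q" using len by linarith
  ultimately show ?case unfolding D0(1) t_def using CL5_swap_iff ij(2) by blast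
qed

section \<open>Completeness for tautologies without repeated literals\<close>

definition bin_valid :: "nat set list => formula list => bool" where
  "bin_valid S Q \<longleftrightarrow> distinct (concat (map lits Q)) \<and> (\<forall>\<Gamma>\<in>set S. \<Gamma> \<subseteq> {..<length Q}) \<and>
     (\<forall>v. \<forall>\<Gamma>\<in>set S. \<exists>i\<in>\<Gamma>. ev v (Q ! i))"

text \<open>A tautological ogroup of literals contains a dual pair. One pair is kept from each
  ogroup, and weakening restores the rest.\<close>

lemma bin_valid_literals:
  assumes "bin_valid S Q" "!!F. F \<in> set Q ==> (\<exists>a. F = Pos a \<or> F = Neg a)" shows "CL5 (S, Q)" proof -
  have pair: "\<exists>i j. i \<in> \<Gamma> \<and> j \<in> \<Gamma> \<and> i ~= j \<and> Q ! i = dual (Q ! j) \<and> Q ! j = dual (Q ! i)" if \<Gamma>: "\<Gamma> \<in> set S" for \<Gamma>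
  proof -
    \<comment> \<open>This valuation falsifies every negative literal in \<Gamma>, so the true
      member is positive, and an atom is made true only if its negation lies in \<Gamma>.\<close>
    obtain i where i: "i \<in> \<Gamma>" "ev (%a. \<exists>j\<in>\<Gamma>. Q ! j = Neg a) (Q ! i)"
      using assms(1) \<Gamma> unfolding bin_valid_def by blast
    have "i < length Q" using i(1) \<Gamma> assms(1) unfolding bin_valid_def by blast
    then obtain a where "Q ! i = Pos a \<or> Q ! i = Neg a" using assms(2) nth_mem by blast
    then show ?thesis
    proof
      assume a: "Q ! i = Pos a"
      with i(2) obtain j where "j \<in> \<Gamma>" "Q ! j = Neg a" by auto
      moreover from this a have "i ~= j" by auto
      moreover have "Q ! i = dual (Q ! j) \<and> Q ! j = dual (Q ! i)" using calculation a by simp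
      ultimately show ?thesis using i(1) by blast
    qed (use i in auto)
  qed
  define pr where "pr \<Gamma> = (SOME d. \<exists>i j. d = {i, j} \<and> i \<in> \<Gamma> \<and> j \<in> \<Gamma> \<and> i ~= j \<and> Q ! i = dual (Q ! j) \<and> Q ! j = dual (Q ! i))" for \<Gamma>
  have pr: "\<exists>i j. pr \<Gamma> = {i, j} \<and> i \<in> \<Gamma> \<and> j \<in> \<Gamma> \<and> i ~= j \<and> Q ! i = dual (Q ! j) \<and> Q ! j = dual (Q ! i)" if "\<Gamma> \<in> set S" for \<Gamma>
    unfolding pr_def by (rule someI_ex) (use pair[OF that] in blast)
  have sub: "\<Gamma> \<subseteq> {..<length Q}" if "\<Gamma> \<in> set S" for \<Gamma> using assms(1) that unfolding bin_valid_def by blast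
  have "distinct Q" proof -
    have "!!F. F \<in> set Q ==> lits F ~= []" using assms(2) by fastforce
    moreover have "distinct (concat (map lits Q))" using assms(1) unfolding bin_valid_def by blast
    ultimately show ?thesis proof (induction Q)
      case (Cons F Q)
      have "lits F ~= []" using Cons.prems(1) by simp
      moreover have "set (lits F) \<inter> set (concat (map lits Q)) = {}" using Cons.prems(2) by simp
      moreover have "set (lits F) \<subseteq> set (concat (map lits Q))" if "F \<in> set Q" using that by auto
      ultimately have "F \<notin> set Q" by (metis inf.absorb_iff1 set_empty)
      then show ?case using Cons by auto
    qed simp
  qed
  have "CL5 (remdups (map pr S), Q)" proof (rule CL5_pairs)
    fix d assume "d \<in> set (remdups (map pr S))"
    then obtain \<Gamma> where "\<Gamma> \<in> set S" "d = pr \<Gamma>" by auto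
    then show "\<exists>i j. d = {i, j} \<and> i < length Q \<and> j < length Q \<and> i ~= j \<and> Q ! i = dual (Q ! j) \<and> Q ! j = dual (Q ! i)"
      using pr[of \<Gamma>] sub[of \<Gamma>] by blast
  qed (use \<open>distinct Q\<close> in auto)
  then have "CL5 (map pr S, Q)" using CL5_set_groups by (metis set_remdups)
  moreover have "list_all2 (%\<Gamma> \<Delta>. \<Gamma> \<subseteq> \<Delta> \<and> \<Delta> \<subseteq> {..<length Q}) (map pr S) S"
    unfolding list.rel_map proof (rule list.rel_refl_strong)
    fix \<Gamma> assume \<Gamma>: "\<Gamma> \<in> set S"
    obtain i j where "pr \<Gamma> = {i, j}" "i \<in> \<Gamma>" "j \<in> \<Gamma>" using pr[OF \<Gamma>] by blast
    then show "pr \<Gamma> \<subseteq> \<Gamma> \<and> \<Gamma> \<subseteq> {..<length Q}" using sub[OF \<Gamma>] by simp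
  qed
  ultimately show ?thesis using CL5_weaken_groups[of Q "map pr S" S "[]"] by simp
qed

lemma image_vimage_merge_index: "merge_index n ` (merge_index n -` X) = X" proof -
  have "i \<in> merge_index n ` (merge_index n -` X)" if "i \<in> X" for i
    using that by (intro image_eqI[of _ _ "if i <= n then i else Suc i"]) (auto simp: merge_index_def)
  then show ?thesis by auto
qed

text \<open>The inverse of merging under \<and>-introduction: an ogroup with the conjunction becomes
  two adjacent ones with the same remaining members, the first with the left conjunct and the second
  with the right one.\<close>

definition split_group :: "nat => nat set => nat set list" where
  "split_group n \<Gamma> = (let \<Delta> = merge_index n -` \<Gamma> in if n \<in> \<Gamma> then [\<Delta> - {Suc n}, \<Delta> - {n}] else [\<Delta>])"

lemma merge_split:
  "conj_adm n (concat (map (split_group n) S)) \<and>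
   map ((`) (merge_index n)) (merge_groups n (concat (map (split_group n) S))) = S" proof (induction S)
  case (Cons \<Gamma> S)
  let ?V = "merge_index n -` \<Gamma>"
  have V: "n \<in> ?V \<longleftrightarrow> n \<in> \<Gamma>" "Suc n \<in> ?V \<longleftrightarrow> n \<in> \<Gamma>" by (auto simp: merge_index_def)
  have cons: "merge_groups n (X # S) = X # merge_groups n S" "conj_adm n (X # S) \<longleftrightarrow> Suc n \<notin> X \<and> conj_adm n S"
    if "n \<notin> X" for X S using that by (cases S; simp)+
  show ?case proof (cases "n \<in> \<Gamma>")
    case True
    have "?V - {Suc n} \<union> (?V - {n}) = ?V" by auto
    then show ?thesis using True Cons V image_vimage_merge_index[of n \<Gamma>] by (simp add: split_group_def Let_def)
  next
    case False
    then show ?thesis using Cons V image_vimage_merge_index[of n \<Gamma>] by (simp add: split_group_def Let_def cons)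
  qed
qed simp

lemma bin_valid_disj:
  assumes "bin_valid S (P @ [Disj F G] @ R)" shows "bin_valid (map ((-`) (merge_index (length P))) S) (P @ [F, G] @ R)" proof -
  have "\<exists>i\<in>merge_index (length P) -` \<Gamma>. ev v ((P @ [F, G] @ R) ! i)" if \<Gamma>: "\<Gamma> \<in> set S" for v \<Gamma> proof -
    obtain i where i: "i \<in> \<Gamma>" "ev v ((P @ [Disj F G] @ R) ! i)" using assms \<Gamma> unfolding bin_valid_def by blast
    let ?k = "if i < length P \<or> (i = length P \<and> ev v F) then i else Suc i"
    have "merge_index (length P) ?k = i" by (auto simp: merge_index_def)
    moreover have "ev v ((P @ [F, G] @ R) ! ?k)" using i(2) by (auto simp: nth_append nth_Cons' split: if_splits)
    ultimately show ?thesis using i(1) by (metis vimageI)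
  qed
  moreover have "merge_index (length P) -` \<Gamma> \<subseteq> {..<length (P @ [F, G] @ R)}" if "\<Gamma> \<in> set S" for \<Gamma>
    using assms that unfolding bin_valid_def by (fastforce simp: merge_index_def split: if_splits)
  moreover have "distinct (concat (map lits (P @ [F, G] @ R)))" using assms unfolding bin_valid_def by simp
  ultimately show ?thesis unfolding bin_valid_def by auto
qed

lemma bin_valid_conj:
  assumes "bin_valid S (P @ [Conj F G] @ R)" shows "bin_valid (concat (map (split_group (length P)) S)) (P @ [F, G] @ R)" proof -
  let ?n = "length P"
  have "\<exists>i\<in>X. ev v ((P @ [F, G] @ R) ! i)" if \<Gamma>: "\<Gamma> \<in> set S" and X: "X \<in> set (split_group ?n \<Gamma>)" for v \<Gamma> X
  proof -
    obtain i where i: "i \<in> \<Gamma>" "ev v ((P @ [Conj F G] @ R) ! i)" using assms \<Gamma> unfolding bin_valid_def by blast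
    let ?k = "if i < ?n then i else if i = ?n then (if ?n \<in> X then ?n else Suc ?n) else Suc i"
    have "?k \<in> X" using X i(1) unfolding split_group_def Let_def by (auto simp: merge_index_def split: if_splits)
    moreover have "ev v ((P @ [F, G] @ R) ! ?k)" using i(2) by (auto simp: nth_append nth_Cons' split: if_splits)
    ultimately show ?thesis by blast
  qed
  moreover have "X \<subseteq> {..<length (P @ [F, G] @ R)}" if "\<Gamma> \<in> set S" "X \<in> set (split_group ?n \<Gamma>)" for \<Gamma> X proof -
    have "X \<subseteq> merge_index ?n -` \<Gamma>" using that(2) unfolding split_group_def Let_def by (auto split: if_splits)
    also have "\<dots> \<subseteq> {..<length (P @ [F, G] @ R)}"
    proof
      fix x assume "x \<in> merge_index ?n -` \<Gamma>"
      then have "merge_index ?n x < length (P @ [Conj F G] @ R)" using assms that(1) unfolding bin_valid_def by blast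
      then show "x \<in> {..<length (P @ [F, G] @ R)}" by (auto simp: merge_index_def split: if_splits)
    qed
    finally show ?thesis .
  qed
  moreover have "distinct (concat (map lits (P @ [F, G] @ R)))" using assms unfolding bin_valid_def by simp
  ultimately show ?thesis unfolding bin_valid_def by auto
qed

text \<open>Both connectives can be removed by reading their introduction rules backwards without
  losing validity, and each removal decreases the total size of the pool.\<close>

lemma bin_valid_CL5: "bin_valid S Q ==> CL5 (S, Q)" proof (induction "sum_list (map size Q)" arbitrary: S Q rule: less_induct)
  case less
  show ?case proof (cases "\<forall>F\<in>set Q. \<exists>a. F = Pos a \<or> F = Neg a")
    case True
    then show ?thesis using bin_valid_literals less.prems by blast
  next
    case False
    then obtain H where H: "H \<in> set Q" "!!a. H ~= Pos a" "!!a. H ~= Neg a" by blast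
    obtain P R where Q: "Q = P @ [H] @ R" using H(1) by (metis append_Cons append_Nil split_list)
    from H(2,3) consider F G where "H = Conj F G" | F G where "H = Disj F G" by (cases H) auto
    then show ?thesis proof cases
      case (1 F G)
      have "CL5 (concat (map (split_group (length P)) S), P @ [F, G] @ R)" using bin_valid_conj less.prems Q 1 by (intro less.hyps) auto
      then have "CL5 (map ((`) (merge_index (length P))) (merge_groups (length P) (concat (map (split_group (length P)) S))),
          P @ [Conj F G] @ R)" using merge_split[of "length P" S] by (intro CL5.conj_introduction) (auto simp: conj_admissible_iff)
      then show ?thesis using merge_split[of "length P" S] Q 1 by simp
    next
      case (2 F G)
      have "CL5 (map ((-`) (merge_index (length P))) S, P @ [F, G] @ R)" using bin_valid_disj less.prems Q 2 by (intro less.hyps) auto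
      moreover have "map ((`) (merge_index (length P))) (map ((-`) (merge_index (length P))) S) = S"
        by (simp only: map_map comp_def image_vimage_merge_index map_ident)
      ultimately show ?thesis using CL5.disj_introduction[of "map ((-`) (merge_index (length P))) S" P F G R] Q 2
        by (simp only: append_Cons append_Nil)
    qed
  qed
qed

theorem CL5_provable_iff:
  "CL5_provable F \<longleftrightarrow> (\<exists>\<sigma> G. rename \<sigma> G = F \<and> distinct (lits G) \<and> (\<forall>v. ev v G))"
proof
  assume "CL5_provable F"
  then have "sound_cirquent ([{0}], [F])" unfolding CL5_provable_def by (rule sound_cirquent_CL5)
  then show "\<exists>\<sigma> G. rename \<sigma> G = F \<and> distinct (lits G) \<and> (\<forall>v. ev v G)"
    unfolding sound_cirquent_def by (auto simp: map_eq_Cons_conv) blast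
next
  assume "\<exists>\<sigma> G. rename \<sigma> G = F \<and> distinct (lits G) \<and> (\<forall>v. ev v G)"
  then obtain \<sigma> G where G: "rename \<sigma> G = F" "distinct (lits G)" "\<forall>v. ev v G" by blast
  then have "bin_valid [{0}] [G]" unfolding bin_valid_def by simp
  \<comment> \<open>The proof is built for the formula without repeated literals and only then are
    its atoms identified.\<close>
  from CL5_rename[OF bin_valid_CL5[OF this], of \<sigma>] show "CL5_provable F" using G(1) unfolding CL5_provable_def by simp
qed

section \<open>A language of bounded loops on tapes\<close>

definition lst :: "nat list => int => tape" where
  "lst l p = ((%i. if 0 <= i \<and> i < int (length l) then l ! nat i else 0), p)"

lemma fst_lst: "fst (lst l p) i = (if 0 <= i \<and> i < int (length l) then l ! nat i else 0)"
  and snd_lst [simp]: "snd (lst l p) = p" by (simp_all add: lst_def)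

lemma lst_move [simp]: "(fst (lst l p), q) = lst l q" by (simp add: lst_def)

lemma input_tape_lst: "input_tape x = lst x 0" by (simp add: input_tape_def lst_def)

lemma blank_tape_lst: "blank_tape = lst [] 0" by (auto simp: blank_tape_def lst_def)

lemma scan_lst: "scan (lst l p) = (if 0 <= p \<and> p < int (length l) then l ! nat p else 0)" by (simp add: scan_def lst_def)

lemma act_keep: "act (scan t, d) t = (fst t, shift d (snd t))" by (cases t) (simp add: act_def scan_def)

lemma act_keep_lst: "act (scan (lst l p), d) (lst l p) = lst l (shift d p)" by (simp add: act_keep)

lemma act_append: "act (a, Right_Move) (lst l (int (length l))) = lst (l @ [a]) (int (length l) + 1)"
  by (auto simp: act_def lst_def fun_eq_iff nth_append)

lemma act_write: "0 <= p ==> p < int (length l) ==> act (a, d) (lst l p) = lst (l[nat p := a]) (shift d p)"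
  by (auto simp: act_def lst_def fun_eq_iff nth_list_update)

lemma tape_word_lst:
  assumes "0 \<notin> set l" shows "tape_word (lst l p) = l" proof -
  have "(LEAST n. fst (lst l p) (int n) = 0) = length l"
    using assms by (intro Least_equality) (auto simp: fst_lst in_set_conv_nth not_less[symmetric])
  then show ?thesis unfolding tape_word_def by (auto simp: fst_lst intro!: nth_equalityI)
qed

type_synonym tapes = "nat => tape"

text \<open>\<open>Rep v w u a\<close> appends to tape \<open>u\<close> as many symbols \<open>a\<close> as the position of the head of \<open>v\<close> says;
  the tape \<open>w\<close> serves to restore that position.  \<open>For v c d\<close> runs \<open>c\<close> with the head of \<open>v\<close> on each
  letter of \<open>v\<close> and \<open>d\<close> with the head on the blank behind them.\<close>

datatype com =
  Upd "(nat => nat) => nat => nat \<times> direction"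
| Seq com com
| Cond "(nat => nat) => bool" com com
| Choice com com
| Fail
| Rep nat nat nat nat
| For nat com com

definition syms :: "tapes => nat => nat" where
  "syms s v = scan (s v)"

definition upd :: "((nat => nat) => nat => nat \<times> direction) => tapes => tapes" where
  "upd f s = (%v. act (f (syms s) v) (s v))"

definition adv :: "nat => tapes => tapes" where
  "adv v s = s(v := (fst (s v), snd (s v) + 1))"

definition rew :: "nat => tapes => tapes" where
  "rew v s = s(v := (fst (s v), 0))"

primrec iter :: "nat => ('a => 'a set) => 'a => 'a set" where
  "iter 0 R s = {s}"
| "iter (Suc n) R s = (\<Union>t\<in>R s. iter n R t)"

text \<open>\<open>E\<close> gives the contents of the tapes over which loops run.\<close>

primrec run :: "(nat => nat list) => com => tapes => tapes set" where
  "run E (Upd f) s = {upd f s}"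
| "run E (Seq c d) s = (\<Union>t\<in>run E c s. run E d t)"
| "run E (Cond b c d) s = (if b (syms s) then run E c s else run E d s)"
| "run E (Choice c d) s = run E c s \<union> run E d s"
| "run E Fail s = {}"
| "run E (Rep v w u a) s = {s(u := (act (a, Right_Move) ^^ nat (snd (s v))) (s u))}"
| "run E (For v c d) s = (\<Union>t\<in>iter (length (E v)) (%s. adv v ` run E c s) s. rew v ` run E d t)"

primrec csize :: "com => nat" where
  "csize (Upd f) = 1"
| "csize (Seq c d) = csize c + csize d"
| "csize (Cond b c d) = 1 + csize c + csize d"
| "csize (Choice c d) = 1 + csize c + csize d"
| "csize Fail = 1"
| "csize (Rep v w u a) = 4"
| "csize (For v c d) = 4 + csize c + csize d"

type_synonym code = "((nat \<times> nat list) \<times> (nat \<times> (nat \<times> direction) list)) set"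

definition look :: "nat list => nat => nat" where
  "look rs u = (if u < length rs then rs ! u else 0)"

text \<open>The behaviour in state q is a function of the scanned symbols, tabulated over all
  readings with symbols up to G.\<close>

definition row :: "nat => nat => nat => ((nat => nat) => nat \<times> (nat => nat \<times> direction)) => code" where
  "row k G q f = (%rs. ((q, rs), (fst (f (look rs)), map (snd (f (look rs))) [0..<k]))) ` {rs. length rs = k \<and> set rs \<subseteq> {..G}}"

definition stay :: "(nat => nat) => nat => nat \<times> direction" where
  "stay r v = (r v, No_Move)"

abbreviation turn :: "nat => direction => (nat => nat) => nat => nat \<times> direction" where
  "turn v d r \<equiv> (stay r)(v := (r v, d))"

text \<open>Entry is q, exit is q', and the code owns the \<open>csize c\<close> labels from q on.
  \<open>Fail\<close> owns a label without instructions, where the machine is stuck;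
  \<open>Choice\<close> has two rows for the same label.\<close>

primrec comp :: "nat => nat => com => nat => nat => code" where
  "comp k G (Upd f) q q' = row k G q (%r. (q', f r))"
| "comp k G (Seq c d) q q' = comp k G c q (q + csize c) \<union> comp k G d (q + csize c) q'"
| "comp k G (Cond b c d) q q' = row k G q (%r. (if b r then q + 1 else q + 1 + csize c, stay r)) \<union>
     comp k G c (q + 1) q' \<union> comp k G d (q + 1 + csize c) q'"
| "comp k G (Choice c d) q q' = row k G q (%r. (q + 1, stay r)) \<union> row k G q (%r. (q + 1 + csize c, stay r)) \<union>
     comp k G c (q + 1) q' \<union> comp k G d (q + 1 + csize c) q'"
| "comp k G Fail q q' = {}"
| "comp k G (Rep v w u a) q q' =
     row k G q (%r. (q + 1, turn v Left_Move r)) \<union>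
     row k G (q + 1) (%r. if r v = 0 then (q + 2, turn v Right_Move r)
       else (q + 1, (turn v Left_Move r)(w := (r w, Right_Move), u := (a, Right_Move)))) \<union>
     row k G (q + 2) (%r. (q + 3, turn w Left_Move r)) \<union>
     row k G (q + 3) (%r. if r w = 0 then (q', turn w Right_Move r)
       else (q + 3, (turn w Left_Move r)(v := (r v, Right_Move))))"
| "comp k G (For v c d) q q' =
     row k G q (%r. (if r v = 0 then q + 2 + csize c else q + 1, stay r)) \<union>
     comp k G c (q + 1) (q + 1 + csize c) \<union>
     row k G (q + 1 + csize c) (%r. (q, turn v Right_Move r)) \<union>
     comp k G d (q + 2 + csize c) (q + 2 + csize c + csize d) \<union>
     row k G (q + 2 + csize c + csize d) (%r. (Suc (q + 2 + csize c + csize d), turn v Left_Move r)) \<union>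
     row k G (Suc (q + 2 + csize c + csize d)) (%r. if r v = 0 then (q', turn v Right_Move r)
       else (Suc (q + 2 + csize c + csize d), turn v Left_Move r))"

text \<open>The argument of these polynomials is a common bound on the lengths of the tapes over
  which loops run, not the length of the input.\<close>

primrec tbound :: "com => nat poly" where
  "tbound (Upd f) = 1"
| "tbound (Seq c d) = tbound c + tbound d"
| "tbound (Cond b c d) = 1 + tbound c + tbound d"
| "tbound (Choice c d) = 1 + tbound c + tbound d"
| "tbound Fail = 1"
| "tbound (Rep v w u a) = [:4, 2:]"
| "tbound (For v c d) = [:0, 1:] * (tbound c + 3) + tbound d + [:3:]"

text \<open>The tapes whose heads have to be on cell 0 at the start: those driving loops and the
  auxiliary ones of \<open>Rep\<close>.\<close>

primrec lps :: "com => nat set" where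
  "lps (Upd f) = {}"
| "lps (Seq c d) = lps c \<union> lps d"
| "lps (Cond b c d) = lps c \<union> lps d"
| "lps (Choice c d) = lps c \<union> lps d"
| "lps Fail = {}"
| "lps (Rep v w u a) = {w}"
| "lps (For v c d) = insert v (lps c \<union> lps d)"

text \<open>\<open>Z\<close> is the set of tapes that only loops may touch.\<close>

primrec wfc :: "nat => nat => nat set => (nat => nat list) => com => bool" where
  "wfc k G Z E (Upd f) = (\<forall>r v. (k <= v \<or> v \<in> Z --> f r v = (r v, No_Move)) \<and> ((\<forall>u. r u <= G) --> fst (f r v) <= G))"
| "wfc k G Z E (Seq c d) = (wfc k G Z E c \<and> wfc k G Z E d)"
| "wfc k G Z E (Cond b c d) = (wfc k G Z E c \<and> wfc k G Z E d)"
| "wfc k G Z E (Choice c d) = (wfc k G Z E c \<and> wfc k G Z E d)"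
| "wfc k G Z E Fail = True"
| "wfc k G Z E (Rep v w u a) = (v < k \<and> w < k \<and> u < k \<and> v ~= w \<and> v \<in> Z \<and> w \<in> Z \<and> u \<notin> Z \<and> a <= G \<and> length (E v) <= length (E w))"
| "wfc k G Z E (For v c d) = (v < k \<and> v \<in> Z \<and> v \<notin> lps c \<union> lps d \<and> wfc k G Z E c \<and> wfc k G Z E d)"

definition okst :: "nat => nat => tapes => bool" where
  "okst k G s \<longleftrightarrow> (\<forall>v i. fst (s v) i <= G) \<and> (\<forall>v\<ge>k. s v = blank_tape)"

text \<open>The words on these tapes contain no blank, so that a blank marks both of their
  ends.\<close>

definition frz :: "nat set => (nat => nat list) => nat => tapes => bool" where
  "frz Z E L s \<longleftrightarrow> (\<forall>v\<in>Z. 0 <= snd (s v) \<and> snd (s v) <= int (length (E v)) \<and> s v = lst (E v) (snd (s v)) \<and>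
     0 \<notin> set (E v) \<and> length (E v) <= L)"

lemma okst_scan: "okst k G s ==> syms s v <= G" by (simp add: okst_def syms_def scan_def)

lemma okst_act: "okst k G s ==> a <= G ==> v < k ==> okst k G (s(v := act (a, d) (s v)))" by (auto simp: okst_def act_def)

lemma okst_move: "okst k G s ==> v < k ==> okst k G (s(v := (fst (s v), p)))" by (auto simp: okst_def)

lemma okst_upd:
  assumes "okst k G s" "!!v. k <= v ==> f (syms s) v = (syms s v, No_Move)" "!!v. fst (f (syms s) v) <= G" shows "okst k G (upd f s)" proof -
  have "upd f s v = s v" if "k <= v" for v using assms(2)[OF that] act_keep[of "s v" No_Move] by (simp add: upd_def syms_def)
  moreover have "fst (upd f s v) i <= G" for v i using assms(1,3) by (auto simp: upd_def act_def okst_def)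
  ultimately show ?thesis using assms(1) by (simp add: okst_def)
qed

lemma okst_repeat:
  assumes "okst k G s" "a <= G" "v < k" shows "okst k G (s(v := (act (a, d) ^^ n) (s v)))" proof (induction n)
  case (Suc n)
  from okst_act[OF this assms(2,3), of d] show ?case by (simp only: fun_upd_same fun_upd_upd funpow.simps comp_apply)
qed (use assms in simp)

lemma lps_subset: "wfc k G Z E c ==> lps c \<subseteq> Z" by (induction c) auto

lemma frz_cong: "frz Z E L s ==> (!!v. v \<in> Z ==> t v = s v) ==> frz Z E L t" by (simp add: frz_def)

lemma run_invariant:
  assumes "wfc k G Z E c" "okst k G s" "frz Z E L s" "!!v. v \<in> lps c ==> snd (s v) = 0" "s' \<in> run E c s"
  shows "okst k G s' \<and> (\<forall>v\<in>Z. s' v = s v)" using assms proof (induction c arbitrary: s s')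
  case (Upd f)
  have w: "k <= v \<or> v \<in> Z ==> f r v = (r v, No_Move)" "(\<forall>u. r u <= G) ==> fst (f r v) <= G" for r v
    using Upd.prems(1) unfolding wfc.simps by blast+
  have "okst k G (upd f s)" by (rule okst_upd[OF Upd.prems(2)]) (use w okst_scan[OF Upd.prems(2)] in blast)+
  moreover have "upd f s v = s v" if "v \<in> Z" for v using w(1) that act_keep[of "s v" No_Move] by (simp add: upd_def syms_def)
  ultimately show ?case using Upd.prems(5) by simp
next
  case (Seq c d)
  from Seq.prems(5) obtain t where t: "t \<in> run E c s" "s' \<in> run E d t" by auto
  have w: "wfc k G Z E c" "wfc k G Z E d" using Seq.prems(1) by simp_all
  have *: "okst k G t \<and> (\<forall>v\<in>Z. t v = s v)" by (rule Seq.IH(1)[OF w(1) Seq.prems(2,3) _ t(1)]) (use Seq.prems(4) in simp)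
  have "okst k G s' \<and> (\<forall>v\<in>Z. s' v = t v)" proof (rule Seq.IH(2)[OF w(2) _ _ _ t(2)])
    show "okst k G t" using * by simp
    show "frz Z E L t" using frz_cong[OF Seq.prems(3)] * by simp
    show "snd (t v) = 0" if "v \<in> lps d" for v using * that lps_subset[OF w(2)] Seq.prems(4) by (metis UnCI lps.simps(2) subsetD)
  qed
  then show ?case using * by simp
next
  case (Cond b c d)
  have w: "wfc k G Z E c" "wfc k G Z E d" "!!v. v \<in> lps c ==> snd (s v) = 0" "!!v. v \<in> lps d ==> snd (s v) = 0" using Cond.prems(1,4) by auto
  show ?case proof (cases "b (syms s)")
    case True
    then show ?thesis using Cond.prems(5) by (intro Cond.IH(1)[OF w(1) Cond.prems(2,3) w(3)]) auto
  next
    case False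
    then show ?thesis using Cond.prems(5) by (intro Cond.IH(2)[OF w(2) Cond.prems(2,3) w(4)]) auto
  qed
next
  case (Choice c d)
  have w: "wfc k G Z E c" "wfc k G Z E d" "!!v. v \<in> lps c ==> snd (s v) = 0" "!!v. v \<in> lps d ==> snd (s v) = 0"
    using Choice.prems(1,4) by auto
  from Choice.prems(5) consider "s' \<in> run E c s" | "s' \<in> run E d s" by auto
  then show ?case proof cases
    case 1
    then show ?thesis by (intro Choice.IH(1)[OF w(1) Choice.prems(2,3) w(3)])
  next
    case 2
    then show ?thesis by (intro Choice.IH(2)[OF w(2) Choice.prems(2,3) w(4)])
  qed
next
  case (Rep v w u a)
  then have s': "s' = s(u := (act (a, Right_Move) ^^ nat (snd (s v))) (s u))" "a <= G" "u < k" "u \<notin> Z"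
    by (simp_all only: run.simps singleton_iff wfc.simps not_False_eq_True)
  have "s' z = s z" if "z \<in> Z" for z using s'(1,4) that by auto
  then show ?case using okst_repeat[OF Rep.prems(2) s'(2,3)] unfolding s'(1) by blast
next
  case (For v c d)
  have w: "wfc k G Z E c" "wfc k G Z E d" using For.prems(1) by simp_all
  have v: "v \<in> Z" "v < k" "v \<notin> lps c" "v \<notin> lps d" "snd (s v) = 0" using For.prems(1,4) by auto
  have pos: "snd (s u) = 0" if "u \<in> lps c \<union> lps d" for u using For.prems(4) that by auto
  obtain t t' where t: "t \<in> iter (length (E v)) (%s. adv v ` run E c s) s" "t' \<in> run E d t" "s' = rew v t'" using For.prems(5) by auto
  have sv: "s v = lst (E v) 0" using For.prems(3) v by (auto simp: frz_def)
  have frz: "frz Z E L t" if "\<forall>u\<in>Z - {v}. t u = s u" "t v = lst (E v) (int i)" "i <= length (E v)" for t i unfolding frz_def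
  proof
    fix u assume "u \<in> Z"
    then show "0 <= snd (t u) \<and> snd (t u) <= int (length (E u)) \<and> t u = lst (E u) (snd (t u)) \<and>
       0 \<notin> set (E u) \<and> length (E u) <= L" using For.prems(3) that unfolding frz_def by (cases "u = v") auto
  qed
  have "okst k G t \<and> (\<forall>u\<in>Z - {v}. t u = s u) \<and> t v = lst (E v) (int (i + n))"
    if "t \<in> iter n (%s. adv v ` run E c s) t0" "okst k G t0" "\<forall>u\<in>Z - {v}. t0 u = s u" "t0 v = lst (E v) (int i)"
      "i + n <= length (E v)" for t t0 i n using that proof (induction n arbitrary: t0 i)
    case (Suc n)
    from Suc.prems(1) obtain t1 where t1: "t1 \<in> run E c t0" "t \<in> iter n (%s. adv v ` run E c s) (adv v t1)" by auto
    have t01: "okst k G t1 \<and> (\<forall>u\<in>Z. t1 u = t0 u)" proof (rule For.IH(1)[OF w(1) Suc.prems(2) _ _ t1(1)])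
      show "frz Z E L t0" by (rule frz[OF Suc.prems(3,4)]) (use Suc.prems(5) in simp)
      show "snd (t0 u) = 0" if "u \<in> lps c" for u proof -
        have "u \<in> Z - {v}" using that lps_subset[OF w(1)] v(3) by blast
        then show ?thesis using Suc.prems(3) pos that by simp
      qed
    qed
    have "okst k G (adv v t1)" unfolding adv_def using okst_move t01 v(2) by blast
    moreover have "\<forall>u\<in>Z - {v}. adv v t1 u = s u" using t01 Suc.prems(3) by (simp add: adv_def)
    moreover have "adv v t1 v = lst (E v) (int (Suc i))" using t01 Suc.prems(4) v(1) by (simp add: adv_def algebra_simps)
    ultimately show ?case using Suc.IH[OF t1(2), of "Suc i"] Suc.prems(5) by simp
  qed simp
  from this[OF t(1) For.prems(2), of 0] have tt: "okst k G t" "\<forall>u\<in>Z - {v}. t u = s u" "t v = lst (E v) (int (length (E v)))"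
    using sv by auto
  have t': "okst k G t' \<and> (\<forall>u\<in>Z. t' u = t u)" proof (rule For.IH(2)[OF w(2) tt(1) frz[OF tt(2,3) order_refl] _ t(2)])
    show "snd (t u) = 0" if "u \<in> lps d" for u proof -
      have "u \<in> Z - {v}" using that lps_subset[OF w(2)] v(4) by blast
      then show ?thesis using tt(2) pos that by simp
    qed
  qed
  have "okst k G s'" unfolding t(3) rew_def using okst_move t' v(2) by blast
  moreover have "s' u = s u" if "u \<in> Z" for u using t' tt sv v(1) that unfolding t(3) rew_def by (cases "u = v") auto
  ultimately show ?case by blast
qed simp

section \<open>Compilation to Turing machines\<close>

primrec hits :: "('c => 'c => bool) => 'c set => nat => 'c set => 'c => bool" where
  "hits R B 0 Q c = (c \<in> Q)"
| "hits R B (Suc n) Q c = (c \<in> Q \<or> c \<in> B \<and> (\<forall>d. R c d --> hits R B n Q d))"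

text \<open>A path that gets stuck satisfies \<open>hits\<close>: it is a failing branch of a nondeterministic program.\<close>

definition exact :: "('c => 'c => bool) => 'c set => nat => 'c set => 'c => bool" where
  "exact R B n Q c \<longleftrightarrow> hits R B n Q c \<and> (\<forall>d\<in>Q. \<exists>m\<le>n. (R ^^ m) c d)"

lemma hits_mono: "hits R B n Q c ==> n <= m ==> Q \<subseteq> P ==> hits R B m P c" proof (induction n arbitrary: c m)
  case 0
  then show ?case by (cases m) auto
next
  case (Suc n)
  then obtain m' where "m = Suc m'" "n <= m'" by (metis Suc_le_D Suc_le_mono)
  then show ?case using Suc by auto
qed

lemma hits_trans: "hits R B n Q c ==> (!!d. d \<in> Q ==> hits R B m P d) ==> hits R B (n + m) P c" proof (induction n arbitrary: c)
  case (Suc n)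
  show ?case proof (cases "c \<in> Q")
    case True
    then show ?thesis using hits_mono[of R B m P c "Suc n + m" P] Suc by simp
  next
    case False
    then show ?thesis using Suc by auto
  qed
qed simp

text \<open>A path that has not yet met Q is short and inside B. Once Q consists of halting
  configurations, this bounds the length of all paths and locates their last configurations.\<close>

lemma hits_path:
  "hits R B n Q c ==> (R ^^ m) c d ==>
    (\<exists>j\<le>n. j <= m \<and> (\<exists>e\<in>Q. (R ^^ j) c e \<and> (R ^^ (m - j)) e d)) \<or> (d \<in> B \<and> m < n)"
proof (induction n arbitrary: c m)
  case 0
  then show ?case by auto
next
  case (Suc n)
  show ?case proof (cases "c \<in> Q")
    case True
    then show ?thesis using Suc.prems by (intro disjI1 exI[of _ 0]) auto
  next
    case F: False
    show ?thesis proof (cases m)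
      case 0
      then show ?thesis using F Suc.prems by auto
    next
      case (Suc m')
      then obtain c' where c': "R c c'" "(R ^^ m') c' d" using Suc.prems(2) relpowp_Suc_D2 by metis
      have "hits R B n Q c'" using F Suc.prems(1) c'(1) by simp
      from Suc.IH[OF this c'(2)] show ?thesis
      proof
        assume "\<exists>j\<le>n. j <= m' \<and> (\<exists>e\<in>Q. (R ^^ j) c' e \<and> (R ^^ (m' - j)) e d)"
        then obtain j e where "j <= n" "j <= m'" "e \<in> Q" "(R ^^ j) c' e" "(R ^^ (m' - j)) e d" by blast
        moreover from this c'(1) have "(R ^^ Suc j) c e" using relpowp_Suc_I2 by metis
        ultimately show ?thesis using Suc by (intro disjI1 exI[of _ "Suc j"] conjI bexI[of _ e]) (simp_all del: relpowp.simps)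
      qed (use Suc in simp)
    qed
  qed
qed

lemma hits_pathE:
  assumes "hits R B n Q c" "(R ^^ m) c d"
  obtains j e where "j <= n" "j <= m" "e \<in> Q" "(R ^^ j) c e" "(R ^^ (m - j)) e d" | "d \<in> B" "m < n" using hits_path[OF assms] by metis

lemma exact_mono: "exact R B n Q c ==> n <= m ==> exact R B m Q c"
  using hits_mono[of R B n Q c m Q] unfolding exact_def by (meson le_trans order_refl)

lemma exact_trans:
  assumes "exact R B n Q c" "!!d. d \<in> Q ==> exact R B m (P d) d" shows "exact R B (n + m) (\<Union>d\<in>Q. P d) c" unfolding exact_def
proof (intro conjI ballI)
  show "hits R B (n + m) (\<Union>d\<in>Q. P d) c" proof (rule hits_trans)
    show "hits R B n Q c" using assms(1) by (simp add: exact_def)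
    show "hits R B m (\<Union>d\<in>Q. P d) d" if "d \<in> Q" for d
      using assms(2)[OF that] that hits_mono[of R B m "P d" d m "\<Union>d\<in>Q. P d"] by (auto simp: exact_def)
  qed
  fix e assume "e \<in> (\<Union>d\<in>Q. P d)"
  then obtain d where d: "d \<in> Q" "e \<in> P d" by blast
  obtain i where i: "i <= n" "(R ^^ i) c d" using assms(1) d(1) by (auto simp: exact_def)
  obtain j where j: "j <= m" "(R ^^ j) d e" using assms(2)[OF d(1)] d(2) by (auto simp: exact_def)
  have "(R ^^ (i + j)) c e" using i(2) j(2) by (metis relcomppI relpowp_add)
  then show "\<exists>k\<le>n + m. (R ^^ k) c e" using i(1) j(1) by (intro exI[of _ "i + j"]) simp
qed

lemma exact_step:
  assumes "c \<in> B" shows "exact R B 1 {d. R c d} c" using assms by (auto simp: exact_def intro!: exI[of _ 1])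

lemma exact_seq:
  assumes "exact R B n (f ` Q) c" "!!s. s \<in> Q ==> exact R B m (f' ` P s) (f s)" "n + m <= l" shows "exact R B l (f' ` (\<Union>s\<in>Q. P s)) c"
proof -
  \<comment> \<open>The function f need not be injective, since \<open>cfg\<close> forgets all but
    finitely many tapes; the outcomes are therefore collected over all s with the same
    image.\<close>
  have "exact R B (n + m) (\<Union>d\<in>f ` Q. \<Union>s\<in>{s\<in>Q. f s = d}. f' ` P s) c" proof (rule exact_trans[OF assms(1)])
    fix d assume "d \<in> f ` Q"
    then obtain s0 where s0: "s0 \<in> Q" "d = f s0" by blast
    let ?U = "\<Union>s\<in>{s\<in>Q. f s = d}. f' ` P s"
    have "hits R B m ?U d" using assms(2)[OF s0(1)] s0 hits_mono[of R B m "f' ` P s0" d m ?U] by (auto simp: exact_def)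
    moreover have "\<forall>e\<in>?U. \<exists>i\<le>m. (R ^^ i) d e" using assms(2) by (fastforce simp: exact_def)
    ultimately show "exact R B m ?U d" by (simp add: exact_def)
  qed
  moreover have "(\<Union>d\<in>f ` Q. \<Union>s\<in>{s\<in>Q. f s = d}. f' ` P s) = f' ` (\<Union>s\<in>Q. P s)" by auto
  ultimately show ?thesis using exact_mono assms(3) by metis
qed

definition cfg :: "nat => nat => tapes => config" where
  "cfg k q s = (q, map s [0..<k])"

text \<open>Pieces of code have disjoint label ranges, so the behaviour of a piece depends only on
  the instructions whose label lies in its own range.\<close>

definition agrees :: "code => code => nat => nat => bool" where
  "agrees I C lo hi \<longleftrightarrow> (\<forall>p rs y. lo <= p \<and> p < hi --> (((p, rs), y) \<in> I \<longleftrightarrow> ((p, rs), y) \<in> C))"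

lemma row_label: "((p, rs), y) \<in> row k G q f ==> p = q" by (auto simp: row_def)

lemma comp_label: "((p, rs), y) \<in> comp k G c q q' ==> q <= p \<and> p < q + csize c" proof (induction c arbitrary: q q')
  case (Seq c d)
  then show ?case by (fastforce)
next
  case (Cond b c d)
  then show ?case by (fastforce dest: row_label)
next
  case (Choice c d)
  then show ?case by (fastforce dest: row_label)
next
  case (For v c d)
  then show ?case by (fastforce dest: row_label)
qed (auto dest!: row_label)

lemma look_syms:
  assumes "okst k G s" shows "look (map (scan \<circ> s) [0..<k]) = syms s"
  using assms by (auto simp: look_def syms_def okst_def blank_tape_lst scan_lst fun_eq_iff)

lemma step_rows:
  assumes "!!rs y. ((q, rs), y) \<in> instructions M \<longleftrightarrow> (\<exists>f\<in>F. ((q, rs), y) \<in> row k G q f)"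
    and "q ~= query_state M" "okst k G s"
  shows "step A M (cfg k q s) c \<longleftrightarrow> (\<exists>f\<in>F. c = cfg k (fst (f (syms s))) (upd (%r. snd (f r)) s))" proof -
  let ?rs = "map (scan \<circ> s) [0..<k]"
  have rs: "length ?rs = k \<and> set ?rs \<subseteq> {..G}" using okst_scan[OF assms(3)] by (auto simp: syms_def)
  have in_row: "((q, ?rs), y) \<in> row k G q f \<longleftrightarrow> y = (fst (f (syms s)), map (snd (f (syms s))) [0..<k])" for y f
    using rs look_syms[OF assms(3)] by (auto simp: row_def image_iff)
  have map2: "map2 act (map g [0..<k]) (map s [0..<k]) = map (%v. act (g v) (s v)) [0..<k]" for g by (rule nth_equalityI) auto
  show ?thesis
  proof
    assume "step A M (cfg k q s) c"
    then show "\<exists>f\<in>F. c = cfg k (fst (f (syms s))) (upd (%r. snd (f r)) s)" proof cases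
      case (instruction q0 ts q' as)
      then obtain f where "f \<in> F" "((q, ?rs), (q', as)) \<in> row k G q f" using assms(1) by (auto simp: cfg_def)
      then show ?thesis using instruction map2 unfolding in_row by (intro bexI[of _ f]) (auto simp: cfg_def upd_def)
    next
      case (query ts)
      then show ?thesis using assms(2) by (simp add: cfg_def)
    qed
  next
    assume "\<exists>f\<in>F. c = cfg k (fst (f (syms s))) (upd (%r. snd (f r)) s)"
    then obtain f where f: "f \<in> F" and c: "c = cfg k (fst (f (syms s))) (upd (%r. snd (f r)) s)" by blast
    have "((q, map scan (map s [0..<k])), (fst (f (syms s)), map (snd (f (syms s))) [0..<k])) \<in> instructions M" using in_row assms(1) f by auto
    from step.instruction[where A = A, OF assms(2) this] show "step A M (cfg k q s) c" unfolding c cfg_def upd_def map2 .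
  qed
qed

lemma step_row:
  assumes "!!rs y. ((q, rs), y) \<in> instructions M \<longleftrightarrow> ((q, rs), y) \<in> row k G q f"
    and "q ~= query_state M" "okst k G s" shows "step A M (cfg k q s) c \<longleftrightarrow> c = cfg k (fst (f (syms s))) (upd (%r. snd (f r)) s)"
  using step_rows[of q M "{f}" k G s A c] assms by simp

lemma exact_row:
  assumes "!!rs y. ((q, rs), y) \<in> instructions M \<longleftrightarrow> ((q, rs), y) \<in> row k G q f"
    and "q ~= query_state M" "okst k G s" "!!s. cfg k q s \<in> B"
    and "q' = fst (f (syms s))" "s' = upd (%r. snd (f r)) s" shows "exact (step A M) B 1 {cfg k q' s'} (cfg k q s)"
  using exact_step[of "cfg k q s" B "step A M"] step_row[OF assms(1-3)] assms(4-6) by simp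

lemma upd_stay: "upd stay s = s" using act_keep[of _ No_Move] by (auto simp: upd_def stay_def syms_def fun_eq_iff)

lemma upd_turn: "upd (turn v d) s = s(v := (fst (s v), shift d (snd (s v))))"
  using act_keep[of _ No_Move] act_keep[of _ d] by (auto simp: upd_def stay_def syms_def fun_eq_iff)

lemma upd_cong: "f (syms s) = g (syms s) ==> upd f s = upd g s" by (simp add: upd_def)

lemma poly_mono_nat: "x <= y ==> poly (p :: nat poly) x <= poly p y" by (induction p) (auto intro!: add_mono mult_mono)

lemma agrees_part:
  assumes "agrees I C lo hi" "lo <= a" "b <= hi"
    and "!!p rs y. a <= p ==> p < b ==> ((p, rs), y) \<in> C \<longleftrightarrow> ((p, rs), y) \<in> D" shows "agrees I D a b" unfolding agrees_def
proof (intro allI impI)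
  fix p rs y assume p: "a <= p \<and> p < b"
  then have "lo <= p \<and> p < hi" using assms(2,3) by linarith
  then have "((p, rs), y) \<in> I \<longleftrightarrow> ((p, rs), y) \<in> C" using assms(1) unfolding agrees_def by blast
  then show "((p, rs), y) \<in> I \<longleftrightarrow> ((p, rs), y) \<in> D" using assms(4) p by blast
qed

lemma agrees_row:
  assumes "agrees I C lo hi" "lo <= a" "a < hi"
    and "!!rs y. ((a, rs), y) \<in> C \<longleftrightarrow> ((a, rs), y) \<in> D"
  shows "((a, rs), y) \<in> I \<longleftrightarrow> ((a, rs), y) \<in> D" using assms unfolding agrees_def by blast

lemma exact_cong: "exact R B n Q c ==> Q = P ==> n <= m ==> exact R B m P c" by (metis exact_mono)

lemma exact_seq1:
  assumes "exact R B n {d} c" "exact R B m Q d" "n + m <= l" shows "exact R B l Q c" proof -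
  have "exact R B (n + m) (\<Union>e\<in>{d}. Q) c" by (rule exact_trans[OF assms(1)]) (use assms(2) in auto)
  then show ?thesis using exact_mono assms(3) by (auto intro: exact_cong)
qed

context
  fixes A :: "nat list set" and M :: machine and k G L :: nat and Z :: "nat set" and E :: "nat => nat list" and B :: "config set"
begin

abbreviation ex :: "nat => config set => config => bool" where
  "ex \<equiv> exact (step A M) B"

definition code_at :: "com => nat => nat => bool" where
  "code_at c q q' \<longleftrightarrow> agrees (instructions M) (comp k G c q q') q (q + csize c) \<and>
     (\<forall>p. q <= p \<and> p < q + csize c --> p ~= query_state M \<and> (\<forall>s. cfg k p s \<in> B))"

lemma code_at_part:
  assumes "code_at c q q'" "q <= a" "a + csize d <= q + csize c"
    and "!!p rs y. a <= p ==> p < a + csize d ==> ((p, rs), y) \<in> comp k G c q q' \<longleftrightarrow> ((p, rs), y) \<in> comp k G d a b"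
  shows "code_at d a b" using assms agrees_part[of "instructions M" "comp k G c q q'" q "q + csize c" a "a + csize d" "comp k G d a b"]
  unfolding code_at_def by auto

lemma code_at_row:
  assumes "code_at c q q'" "q <= a" "a < q + csize c"
    and "!!rs y. ((a, rs), y) \<in> comp k G c q q' \<longleftrightarrow> ((a, rs), y) \<in> row k G a f"
    and "okst k G s" "p = fst (f (syms s))" "s' = upd (%r. snd (f r)) s" shows "ex 1 {cfg k p s'} (cfg k a s)" proof (rule exact_row)
  show "((a, rs), y) \<in> instructions M \<longleftrightarrow> ((a, rs), y) \<in> row k G a f" for rs y
    using assms(1) agrees_row[OF _ assms(2-4)] unfolding code_at_def by blast
qed (use assms in "auto simp: code_at_def")

definition pre :: "com => tapes => bool" where
  "pre c s \<longleftrightarrow> wfc k G Z E c \<and> okst k G s \<and> frz Z E L s \<and> (\<forall>v\<in>lps c. snd (s v) = 0)"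

lemma pre_invariant: "pre c s ==> s' \<in> run E c s ==> okst k G s' \<and> (\<forall>v\<in>Z. s' v = s v)"
  unfolding pre_def using run_invariant by blast

lemma pre_Seq: "pre (Seq c d) s ==> t \<in> run E c s ==> pre c s \<and> pre d t" proof -
  assume *: "pre (Seq c d) s" "t \<in> run E c s"
  then have c: "pre c s" by (simp add: pre_def)
  have t: "okst k G t" "\<forall>v\<in>Z. t v = s v" using pre_invariant[OF c *(2)] by auto
  have w: "wfc k G Z E d" using *(1) by (simp add: pre_def)
  have "frz Z E L t" by (rule frz_cong[of Z E L s]) (use *(1) t in \<open>auto simp: pre_def\<close>)
  moreover have "snd (t v) = 0" if "v \<in> lps d" for v using that lps_subset[OF w] t(2) *(1) by (auto simp: pre_def)
  ultimately show ?thesis using c t(1) w by (simp add: pre_def)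
qed

text \<open>A state that returns to itself until the head of v meets a blank; \<open>S i\<close> is
  the contents of the tapes at its i-th visit.\<close>

lemma exact_loop:
  assumes "code_at c q q'" "q <= p" "p < q + csize c"
    and row: "!!rs y. ((p, rs), y) \<in> comp k G c q q' \<longleftrightarrow> ((p, rs), y) \<in> row k G p (%r. if r v = 0 then (p', h' r) else (p, h r))"
    and ok: "!!i. i <= n ==> okst k G (S i)"
    and step: "!!i. i < n ==> syms (S i) v ~= 0 \<and> upd h (S i) = S (Suc i)"
    and last: "syms (S n) v = 0" "upd h' (S n) = t" shows "ex (n + 1) {cfg k p' t} (cfg k p (S 0))" proof -
  let ?f = "%r. if r v = 0 then (p', h' r) else (p, h r)"
  have "ex (m + 1) {cfg k p' t} (cfg k p (S i))" if "i + m = n" for i m using that proof (induction m arbitrary: i)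
    case 0
    then have "upd (%r. snd (?f r)) (S i) = upd h' (S i)" by (intro upd_cong) (use last in simp)
    then have "t = upd (%r. snd (?f r)) (S i)" using 0 last by simp
    then show ?case using code_at_row[OF assms(1-3) row ok, of i p' t] 0 last by simp
  next
    case (Suc m)
    then have i: "i < n" by simp
    have "upd (%r. snd (?f r)) (S i) = upd h (S i)" by (rule upd_cong) (use step[OF i] in simp)
    then have "S (Suc i) = upd (%r. snd (?f r)) (S i)" using step[OF i] by simp
    then have a: "ex 1 {cfg k p (S (Suc i))} (cfg k p (S i))" by (intro code_at_row[OF assms(1-3) row ok]) (use i step[OF i] in simp_all)
    have b: "ex (m + 1) {cfg k p' t} (cfg k p (S (Suc i)))" by (rule Suc.IH) (use Suc.prems in simp)
    show ?case by (rule exact_seq1[OF a b]) simp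
  qed
  from this[of 0 n] show ?thesis by simp
qed

lemma scan_word: "0 \<notin> set l ==> i < length l ==> scan (lst l (int i)) ~= 0" by (auto simp: scan_lst in_set_conv_nth)

text \<open>The head of v walks left to the blank in cell -1 while u is extended and the head of w
  walks right as a counter; then w walks back and takes v with it. The word on w is long enough for
  its head to stay on letters meanwhile.\<close>

lemma exact_Rep:
  assumes "code_at (Rep v w u a) q q'" "pre (Rep v w u a) s" shows "ex (poly (tbound (Rep v w u a)) L) (cfg k q' ` run E (Rep v w u a) s) (cfg k q s)"
proof -
  define n where "n = nat (snd (s v))"
  have w: "v < k" "w < k" "u < k" "v ~= w" "v \<in> Z" "w \<in> Z" "u \<notin> Z" "a <= G" "length (E v) <= length (E w)" "snd (s w) = 0"
    and ok: "okst k G s" and fz: "frz Z E L s" using assms(2) by (auto simp: pre_def)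
  have uv: "u ~= v" "u ~= w" using w by auto
  have sv: "s v = lst (E v) (int n)" "n <= length (E v)" "s w = lst (E w) 0" "length (E v) <= L" "0 \<notin> set (E v)" "0 \<notin> set (E w)"
    using fz w(5,6,10) by (auto simp: frz_def n_def)
  define T where "T p q m = s(v := lst (E v) p, w := lst (E w) q, u := (act (a, Right_Move) ^^ m) (s u))" for p q m
  have okT: "okst k G (T p q m)" for p q m proof -
    have "okst k G (s(v := lst (E v) p))" using okst_move[OF ok w(1), of p] sv(1) by simp
    from okst_move[OF this w(2), of q] have "okst k G (s(v := lst (E v) p, w := lst (E w) q))" using sv(3) w(4) by simp
    from okst_repeat[OF this w(8,3), where d = Right_Move and n = m] show ?thesis using uv by (simp add: T_def)
  qed
  have r: "((p, rs), y) \<in> comp k G (Rep v w u a) q q' \<longleftrightarrow> ((p, rs), y) \<in> row k G p f"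
    if "(p, f) \<in> {(q, %r. (q + 1, turn v Left_Move r)), (q + 1, %r. if r v = 0 then (q + 2, turn v Right_Move r)
       else (q + 1, (turn v Left_Move r)(w := (r w, Right_Move), u := (a, Right_Move)))),
       (q + 2, %r. (q + 3, turn w Left_Move r)), (q + 3, %r. if r w = 0 then (q', turn w Right_Move r)
       else (q + 3, (turn w Left_Move r)(v := (r v, Right_Move))))}" for p f rs y using that by (auto dest: row_label)
  have T: "syms (T p q m) v = scan (lst (E v) p)" "syms (T p q m) w = scan (lst (E w) q)"
    "upd (turn v d) (T p q m) = T (shift d p) q m" "upd (turn w d) (T p q m) = T p (shift d q) m" for d p q m
    using uv w(4) by (auto simp: T_def syms_def upd_turn fun_eq_iff)
  have "T (int n) 0 0 = s" using sv by (auto simp: T_def)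
  then have 1: "ex 1 {cfg k (q + 1) (T (int n - 1) 0 0)} (cfg k q s)"
    using T(3)[of Left_Move "int n" 0 0] by (intro code_at_row[OF assms(1) _ _ r]) (auto simp: ok)
  have nz: "scan (lst (E z) (int n - 1 - int i)) ~= 0" if "i < n" "z = v \<or> z = w" for i z proof -
    have e: "int n - 1 - int i = int (n - 1 - i)" using that by linarith
    show ?thesis unfolding e by (rule scan_word) (use that sv w(9) in auto)
  qed
  have 2: "ex (n + 1) {cfg k (q + 2) (T 0 (int n) n)} (cfg k (q + 1) (T (int n - 1 - int 0) (int 0) 0))"
  proof (rule exact_loop[OF assms(1) _ _ r, where S = "%i. T (int n - 1 - int i) (int i) i" and v = v and h' = "turn v Right_Move"
        and h = "%r. (turn v Left_Move r)(w := (r w, Right_Move), u := (a, Right_Move))"])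
    fix i assume "i < n"
    moreover have "upd (%r. (turn v Left_Move r)(w := (r w, Right_Move), u := (a, Right_Move))) (T (int n - 1 - int i) (int i) i) =
        T (int n - 1 - int (Suc i)) (int (Suc i)) (Suc i)"
      using uv w(4) by (auto simp: T_def upd_def fun_eq_iff stay_def syms_def act_keep act_keep[of _ No_Move] algebra_simps)
    ultimately show "syms (T (int n - 1 - int i) (int i) i) v ~= 0 \<and>
        upd (%r. (turn v Left_Move r)(w := (r w, Right_Move), u := (a, Right_Move))) (T (int n - 1 - int i) (int i) i) =
        T (int n - 1 - int (Suc i)) (int (Suc i)) (Suc i)" using nz by (simp add: T)
  next
    show "upd (turn v Right_Move) (T (int n - 1 - int n) (int n) n) = T 0 (int n) n" using T(3)[of Right_Move "int n - 1 - int n"] by simp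
  qed (simp_all add: okT T scan_lst)
  have 3: "ex 1 {cfg k (q + 3) (T 0 (int n - 1) n)} (cfg k (q + 2) (T 0 (int n) n))"
    using T(4)[of Left_Move 0 "int n" n] by (intro code_at_row[OF assms(1) _ _ r]) (auto simp: okT)
  have 4: "ex (n + 1) {cfg k q' (T (int n) 0 n)} (cfg k (q + 3) (T (int 0) (int n - 1 - int 0) n))"
  proof (rule exact_loop[OF assms(1) _ _ r, where S = "%i. T (int i) (int n - 1 - int i) n" and v = w and h' = "turn w Right_Move"
        and h = "%r. (turn w Left_Move r)(v := (r v, Right_Move))"])
    fix i assume "i < n"
    moreover have "upd (%r. (turn w Left_Move r)(v := (r v, Right_Move))) (T (int i) (int n - 1 - int i) n) = T (int (Suc i)) (int n - 1 - int (Suc i)) n"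
      using uv w(4) by (auto simp: T_def upd_def fun_eq_iff stay_def syms_def act_keep act_keep[of _ No_Move] algebra_simps)
    ultimately show "syms (T (int i) (int n - 1 - int i) n) w ~= 0 \<and>
        upd (%r. (turn w Left_Move r)(v := (r v, Right_Move))) (T (int i) (int n - 1 - int i) n) = T (int (Suc i)) (int n - 1 - int (Suc i)) n"
      using nz by (simp add: T)
  next
    show "upd (turn w Right_Move) (T (int n) (int n - 1 - int n) n) = T (int n) 0 n" using T(4)[of Right_Move "int n" "int n - 1 - int n"] by simp
  qed (simp_all add: okT T scan_lst)
  have "run E (Rep v w u a) s = {T (int n) 0 n}" using sv uv w(4) by (auto simp: T_def n_def fun_eq_iff)
  moreover have "ex (poly (tbound (Rep v w u a)) L) {cfg k q' (T (int n) 0 n)} (cfg k q s)"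
    using exact_seq1[OF 1 exact_seq1[OF 2[unfolded of_nat_0 diff_0_right] exact_seq1[OF 3 4[unfolded of_nat_0 diff_0_right] order_refl] order_refl]] sv(2,4) by simp
  ultimately show ?thesis by simp
qed

lemma exact_For:
  assumes "code_at (For v c d) q q'" "pre (For v c d) s"
    and c: "!!q q' s. code_at c q q' ==> pre c s ==> ex (poly (tbound c) L) (cfg k q' ` run E c s) (cfg k q s)"
    and d: "!!q q' s. code_at d q q' ==> pre d s ==> ex (poly (tbound d) L) (cfg k q' ` run E d s) (cfg k q s)"
  shows "ex (poly (tbound (For v c d)) L) (cfg k q' ` run E (For v c d) s) (cfg k q s)" proof -
  let ?T = "poly (tbound c) L" and ?U = "poly (tbound d) L" and ?N = "length (E v)"
  let ?R = "%s. adv v ` run E c s"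
  define qc where "qc = q + 1 + csize c"
  define qd where "qd = q + 2 + csize c"
  define qr where "qr = q + 2 + csize c + csize d"
  have w: "v < k" "v \<in> Z" "v \<notin> lps c" "v \<notin> lps d" "wfc k G Z E c" "wfc k G Z E d" "okst k G s" "frz Z E L s"
    "!!u. u \<in> insert v (lps c \<union> lps d) ==> snd (s u) = 0" using assms(2) by (auto simp: pre_def)
  have sv: "s v = lst (E v) 0" "?N <= L" "0 \<notin> set (E v)" using w(2,8) w(9)[of v] by (auto simp: frz_def)
  have at_c: "code_at c (q + 1) qc" by (rule code_at_part[OF assms(1)]) (auto simp: qc_def dest: row_label comp_label)
  have at_d: "code_at d qd qr" by (rule code_at_part[OF assms(1)]) (auto simp: qd_def qr_def dest: row_label comp_label)
  have r0: "((q, rs), y) \<in> comp k G (For v c d) q q' \<longleftrightarrow> ((q, rs), y) \<in> row k G q (%r. (if r v = 0 then qd else q + 1, stay r))" for rs y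
    unfolding qd_def by (auto simp: numeral_3_eq_3 dest: row_label comp_label)
  have r1: "((qc, rs), y) \<in> comp k G (For v c d) q q' \<longleftrightarrow> ((qc, rs), y) \<in> row k G qc (%r. (q, turn v Right_Move r))" for rs y
    unfolding qc_def by (auto simp: numeral_3_eq_3 dest: row_label comp_label)
  have r2: "((qr, rs), y) \<in> comp k G (For v c d) q q' \<longleftrightarrow> ((qr, rs), y) \<in> row k G qr (%r. (Suc qr, turn v Left_Move r))" for rs y
    unfolding qr_def by (auto simp: numeral_3_eq_3 dest: row_label comp_label)
  have r3: "((Suc qr, rs), y) \<in> comp k G (For v c d) q q' \<longleftrightarrow>
      ((Suc qr, rs), y) \<in> row k G (Suc qr) (%r. if r v = 0 then (q', turn v Right_Move r) else (Suc qr, turn v Left_Move r))" for rs y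
    unfolding qr_def by (auto simp: numeral_3_eq_3 dest: row_label comp_label)
  note lt = qc_def qd_def qr_def
  define good where "good i t \<longleftrightarrow> okst k G t \<and> (\<forall>u\<in>Z - {v}. t u = s u) \<and> t v = lst (E v) (int i)" for i :: nat and t
  have pre: "pre b t" if "good i t" "i <= ?N" "b = c \<or> b = d" for b t i proof -
    have "frz Z E L t" unfolding frz_def
    proof
      fix u assume "u \<in> Z"
      then show "0 <= snd (t u) \<and> snd (t u) <= int (length (E u)) \<and> t u = lst (E u) (snd (t u)) \<and>
         0 \<notin> set (E u) \<and> length (E u) <= L" using w(8) that(1,2) unfolding frz_def good_def by (cases "u = v") auto
    qed
    moreover have "snd (t u) = 0" if u: "u \<in> lps b" for u proof -
      have "u \<in> Z - {v}" using u lps_subset[OF w(5)] lps_subset[OF w(6)] w(3,4) \<open>b = c \<or> b = d\<close> by blast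
      then show ?thesis using \<open>good i t\<close> w(9)[of u] u \<open>b = c \<or> b = d\<close> by (auto simp: good_def)
    qed
    ultimately show ?thesis using w(5,6) that(1,3) by (auto simp: pre_def good_def)
  qed
  have next_good: "good (Suc i) (adv v t1)" if "good i t" "i <= ?N" "t1 \<in> run E c t" for t t1 i proof -
    have "okst k G t1 \<and> (\<forall>u\<in>Z. t1 u = t u)" using pre_invariant[OF pre[OF that(1,2)] that(3)] by simp
    then show ?thesis using that(1) w(1,2) okst_move[of k G t1 v] by (auto simp: good_def adv_def algebra_simps)
  qed
  have A: "ex (m * (?T + 2) + 1) (cfg k qd ` iter m ?R t) (cfg k q t) \<and> (\<forall>t'\<in>iter m ?R t. good ?N t')"
    if "good i t" "i + m = ?N" for i m t using that proof (induction m arbitrary: i t)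
    case 0
    then have z: "syms t v = 0" by (simp add: good_def syms_def scan_lst)
    have "ex 1 {cfg k qd t} (cfg k q t)" by (rule code_at_row[OF assms(1) _ _ r0]) (use 0 z in "auto simp: good_def upd_stay lt")
    then show ?case using 0 by simp
  next
    case (Suc m)
    have nz: "syms t v ~= 0" using Suc.prems sv(3) by (auto simp: good_def syms_def scan_lst in_set_conv_nth)
    have i: "i <= ?N" using Suc.prems(2) by simp
    have 1: "ex 1 {cfg k (q + 1) t} (cfg k q t)" by (rule code_at_row[OF assms(1) _ _ r0]) (use Suc.prems nz in "auto simp: good_def upd_stay lt")
    have 2: "ex ?T (cfg k qc ` run E c t) (cfg k (q + 1) t)" by (rule c[OF at_c pre[OF Suc.prems(1) i]]) simp
    have 3: "ex 1 (cfg k q ` {adv v t1}) (cfg k qc t1)" if t1: "t1 \<in> run E c t" for t1 proof -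
      have "okst k G t1" using pre_invariant[OF pre[OF Suc.prems(1) i] t1] by simp
      then have "ex 1 {cfg k q (adv v t1)} (cfg k qc t1)" by (intro code_at_row[OF assms(1) _ _ r1]) (auto simp: adv_def upd_turn lt)
      then show ?thesis by simp
    qed
    have time: "1 + (?T + 1) <= ?T + 2" by simp
    have 4: "ex (?T + 2) (cfg k q ` (\<Union>t1\<in>run E c t. {adv v t1})) (cfg k q t)" by (rule exact_seq1[OF 1 exact_seq[OF 2 3 order_refl] time])
    have 5: "ex (m * (?T + 2) + 1) (cfg k qd ` iter m ?R t2) (cfg k q t2) \<and> (\<forall>t'\<in>iter m ?R t2. good ?N t')"
      if t2: "t2 \<in> ?R t" for t2 proof -
      from t2 obtain t1 where "t1 \<in> run E c t" "t2 = adv v t1" by blast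
      then show ?thesis using Suc.IH[OF next_good[OF Suc.prems(1) i]] Suc.prems(2) by simp
    qed
    have "(\<Union>t1\<in>run E c t. {adv v t1}) = ?R t" by blast
    with 4 have 6: "ex (?T + 2) (cfg k q ` ?R t) (cfg k q t)" by simp
    have "ex (Suc m * (?T + 2) + 1) (cfg k qd ` (\<Union>t2\<in>?R t. iter m ?R t2)) (cfg k q t)" by (rule exact_seq[OF 6]) (use 5 in auto)
    moreover have "\<forall>t'\<in>iter (Suc m) ?R t. good ?N t'" using 5 unfolding iter.simps by blast
    ultimately show ?case by simp
  qed
  \<comment> \<open>The rewinding phase: from the last letter to the blank in cell -1, and one step
    back to cell 0.\<close>
  have C: "ex (?N + 1) {cfg k q' (rew v t)} (cfg k (Suc qr) (t(v := lst (E v) (int ?N - 1))))"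
    if ok: "okst k G t" and tv: "t v = lst (E v) (int ?N)" for t proof -
    have "ex (?N + 1) {cfg k q' (rew v t)} (cfg k (Suc qr) (t(v := lst (E v) (int ?N - 1 - int 0))))"
    proof (rule exact_loop[OF assms(1) _ _ r3, where S = "%i. t(v := lst (E v) (int ?N - 1 - int i))"])
      show "okst k G (t(v := lst (E v) (int ?N - 1 - int i)))" for i using okst_move[OF ok w(1), of "int ?N - 1 - int i"] tv by simp
      show "syms (t(v := lst (E v) (int ?N - 1 - int i))) v ~= 0 \<and>
          upd (turn v Left_Move) (t(v := lst (E v) (int ?N - 1 - int i))) = t(v := lst (E v) (int ?N - 1 - int (Suc i)))" if "i < ?N" for i
        using scan_word[OF sv(3), of "?N - 1 - i"] that by (simp add: syms_def upd_turn of_nat_diff algebra_simps)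
    qed (simp_all add: syms_def scan_lst upd_turn rew_def tv lt)
    then show ?thesis by simp
  qed
  have B: "ex (?U + ?N + 2) (cfg k q' ` (rew v ` run E d t)) (cfg k qd t)" if t: "good ?N t" for t proof -
    have 1: "ex ?U (cfg k qr ` run E d t) (cfg k qd t)" by (rule d[OF at_d pre[OF t]]) auto
    have 2: "ex (?N + 2) (cfg k q' ` {rew v t'}) (cfg k qr t')" if t': "t' \<in> run E d t" for t' proof -
      have ok: "okst k G t'" "t' v = t v" using pre_invariant[OF pre[OF t] t'] w(2) by auto
      let ?t = "t'(v := lst (E v) (int ?N - 1))"
      have a: "ex 1 {cfg k (Suc qr) ?t} (cfg k qr t')" by (rule code_at_row[OF assms(1) _ _ r2]) (use ok t in "auto simp: upd_turn good_def lt")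
      have b: "ex (?N + 1) {cfg k q' (rew v t')} (cfg k (Suc qr) ?t)" by (rule C) (use ok t in "auto simp: good_def")
      then show ?thesis using exact_seq1[OF a b, of "?N + 2"] by simp
    qed
    have "(\<Union>t'\<in>run E d t. {rew v t'}) = rew v ` run E d t" by blast
    then show ?thesis using exact_seq[OF 1 2, of "?U + ?N + 2"] by simp
  qed
  have g0: "good 0 s" using w(7) sv by (simp add: good_def)
  from A[OF g0, of ?N] have 1: "ex (?N * (?T + 2) + 1) (cfg k qd ` iter ?N ?R s) (cfg k q s)"
    and 2: "!!t. t \<in> iter ?N ?R s ==> good ?N t" by auto
  have time: "(?N * (?T + 2) + 1) + (?U + ?N + 2) <= poly (tbound (For v c d)) L" proof -
    have "?N * (?T + 2) + ?N = ?N * (?T + 3)" by (simp add: algebra_simps)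
    also have "\<dots> <= L * (?T + 3)" using sv(2) by (rule mult_right_mono) simp
    finally show ?thesis by simp
  qed
  show ?thesis using exact_seq[OF 1 B[OF 2] time] by simp
qed

text \<open>The induction carries the same set of outcomes on both sides: branches that fail in
  \<open>run\<close> correspond to stuck paths, which \<open>hits\<close> permits.\<close>

theorem compile_exact:
  assumes "code_at c q q'" "pre c s" shows "ex (poly (tbound c) L) (cfg k q' ` run E c s) (cfg k q s)" using assms
proof (induction c arbitrary: q q' s)
  case (Upd f)
  have "ex 1 {cfg k q' (upd f s)} (cfg k q s)"
    by (rule code_at_row[OF Upd.prems(1), where f = "%r. (q', f r)"]) (use Upd.prems(2) in \<open>auto simp: pre_def\<close>)
  then show ?case by simp
next
  case (Seq c d)
  have c: "code_at c q (q + csize c)" by (rule code_at_part[OF Seq.prems(1)]) (auto dest: comp_label)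
  have d: "code_at d (q + csize c) q'" by (rule code_at_part[OF Seq.prems(1)]) (auto dest: comp_label)
  have "pre c s" using Seq.prems(2) by (simp add: pre_def)
  from exact_seq[OF Seq.IH(1)[OF c this] Seq.IH(2)[OF d]] pre_Seq[OF Seq.prems(2)]
  show ?case by simp
next
  case (Cond b c d)
  have c: "code_at c (q + 1) q'" by (rule code_at_part[OF Cond.prems(1)]) (auto dest: row_label comp_label)
  have d: "code_at d (q + 1 + csize c) q'" by (rule code_at_part[OF Cond.prems(1)]) (auto dest: row_label comp_label)
  have p: "pre c s" "pre d s" "okst k G s" using Cond.prems(2) by (auto simp: pre_def)
  have r: "((q, rs), y) \<in> comp k G (Cond b c d) q q' \<longleftrightarrow> ((q, rs), y) \<in> row k G q (%r. (if b r then q + 1 else q + 1 + csize c, stay r))" for rs y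
    by (auto dest: row_label comp_label)
  have 1: "ex 1 {cfg k (if b (syms s) then q + 1 else q + 1 + csize c) s} (cfg k q s)"
    by (rule code_at_row[OF Cond.prems(1) _ _ r p(3)]) (auto simp: upd_stay)
  show ?case proof (cases "b (syms s)")
    case True
    then show ?thesis using exact_seq1[OF _ Cond.IH(1)[OF c p(1)]] 1 by simp
  next
    case False
    then show ?thesis using exact_seq1[OF _ Cond.IH(2)[OF d p(2)]] 1 by simp
  qed
next
  case (Choice c d)
  have c: "code_at c (q + 1) q'" by (rule code_at_part[OF Choice.prems(1)]) (auto dest: row_label comp_label)
  have d: "code_at d (q + 1 + csize c) q'" by (rule code_at_part[OF Choice.prems(1)]) (auto dest: row_label comp_label)
  have p: "pre c s" "pre d s" "okst k G s" using Choice.prems(2) by (auto simp: pre_def)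
  let ?F = "{%r. (q + 1, stay r), %r. (q + 1 + csize c, stay r)}"
  have r: "((q, rs), y) \<in> comp k G (Choice c d) q q' \<longleftrightarrow> (\<exists>f\<in>?F. ((q, rs), y) \<in> row k G q f)" for rs y
    by (auto dest: row_label comp_label)
  have r': "((q, rs), y) \<in> instructions M \<longleftrightarrow> (\<exists>f\<in>?F. ((q, rs), y) \<in> row k G q f)" for rs y proof -
    have ag: "agrees (instructions M) (comp k G (Choice c d) q q') q (q + csize (Choice c d))" using Choice.prems(1) unfolding code_at_def by blast
    have "((q, rs), y) \<in> instructions M \<longleftrightarrow> ((q, rs), y) \<in> comp k G (Choice c d) q q'"
      by (rule agrees_row[OF ag order_refl]) simp_all
    then show ?thesis using r by simp
  qed
  have nq: "q ~= query_state M" and B: "cfg k q s \<in> B" using Choice.prems(1) unfolding code_at_def by auto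
  have "{c. step A M (cfg k q s) c} = {cfg k (q + 1) s, cfg k (q + 1 + csize c) s}" using step_rows[OF r' nq p(3), of A] by (auto simp: upd_stay)
  then have 1: "ex 1 {cfg k (q + 1) s, cfg k (q + 1 + csize c) s} (cfg k q s)" using exact_step[OF B, of "step A M"] by simp
  let ?T = "poly (tbound c) L + poly (tbound d) L"
  have 2: "ex ?T (cfg k q' ` run E c s) (cfg k (q + 1) s)" using exact_mono[OF Choice.IH(1)[OF c p(1)], of ?T] by simp
  have 3: "ex ?T (cfg k q' ` run E d s) (cfg k (q + 1 + csize c) s)" using exact_mono[OF Choice.IH(2)[OF d p(2)], of ?T] by simp
  let ?P = "%e. if e = cfg k (q + 1) s then cfg k q' ` run E c s else cfg k q' ` run E d s"
  \<comment> \<open>The two successors must be different configurations so that each can be given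
    its own set of outcomes; they are, because every piece of code owns at least one label.\<close>
  have ne: "cfg k (q + 1 + csize c) s ~= cfg k (q + 1) s" proof -
    have "0 < csize c" by (induction c) auto
    then show ?thesis by (simp add: cfg_def)
  qed
  have "ex (1 + ?T) (\<Union>e\<in>{cfg k (q + 1) s, cfg k (q + 1 + csize c) s}. ?P e) (cfg k q s)" by (rule exact_trans[OF 1]) (use 2 3 ne in auto)
  moreover have "(\<Union>e\<in>{cfg k (q + 1) s, cfg k (q + 1 + csize c) s}. ?P e) = cfg k q' ` run E (Choice c d) s" using ne by auto
  ultimately show ?case by (auto simp: add_ac elim: exact_cong)
next
  case Fail
  have ag: "agrees (instructions M) (comp k G Fail q q') q (q + csize Fail)" using Fail.prems(1) unfolding code_at_def by blast
  have r': "((q, rs), y) \<in> instructions M \<longleftrightarrow> (\<exists>f\<in>{}. ((q, rs), y) \<in> row k G q f)" for rs y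
    using agrees_row[OF ag order_refl, of "{}"] by simp
  have nq: "q ~= query_state M" and B: "cfg k q s \<in> B" using Fail.prems(1) unfolding code_at_def by auto
  have eq: "{c. step A M (cfg k q s) c} = {}" using step_rows[OF r' nq, of s A] Fail.prems(2) by (auto simp: pre_def)
  have "ex 1 {} (cfg k q s)" using exact_step[OF B, of "step A M"] unfolding eq .
  then show ?case by simp
next
  case (Rep v w u a)
  then show ?case using exact_Rep by blast
next
  case (For v c d)
  show ?case by (rule exact_For[OF For.prems For.IH])
qed

end

section \<open>Machines obtained from programs\<close>

lemma code_at_Seq:
  assumes "code_at M k G B (Seq c d) q q'" shows "code_at M k G B c q (q + csize c)" "code_at M k G B d (q + csize c) q'"
  by (rule code_at_part[OF assms]; auto dest: comp_label)+

lemma comp_props: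
  assumes "((p, rs), (p', as)) \<in> comp k G c q q'" shows "length rs = k \<and> length as = k"
  using assms by (induction c arbitrary: q q') (auto simp: row_def)

lemma finite_comp: "finite (comp k G c q q')" proof -
  have "finite (row k G q f)" for q f unfolding row_def using finite_lists_length_eq[of "{..G}" k] by (auto simp: conj_commute)
  then show ?thesis by (induction c arbitrary: q q') auto
qed

primrec det :: "com => bool" where
  "det (Upd f) = True"
| "det (Seq c d) = (det c \<and> det d)"
| "det (Cond b c d) = (det c \<and> det d)"
| "det (Choice c d) = False"
| "det Fail = True"
| "det (Rep v w u a) = True"
| "det (For v c d) = (det c \<and> det d)"

lemma single_valued_Un:
  assumes "single_valued X" "single_valued Y" "!!p rs y p' rs' y'. ((p, rs), y) \<in> X ==> ((p', rs'), y') \<in> Y ==> p ~= (p' :: nat)"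
  shows "single_valued (X \<union> Y)" using assms unfolding single_valued_def by (metis Un_iff surj_pair)

lemma single_valued_row: "single_valued (row k G q f)" by (auto simp: single_valued_def row_def)

lemma single_valued_comp: "det c ==> single_valued (comp k G c q q')" proof (induction c arbitrary: q q')
  case (Upd f)
  show ?case by (simp add: single_valued_row)
next
  case (Seq c d)
  then show ?case by (auto intro!: single_valued_Un dest!: comp_label)
next
  case (Cond b c d)
  then show ?case by (auto intro!: single_valued_Un single_valued_row dest!: comp_label row_label)
next
  case (For v c d)
  then show ?case by (auto intro!: single_valued_Un single_valued_row dest!: comp_label row_label)
next
  case (Rep v w u a)
  show ?case by (auto intro!: single_valued_Un single_valued_row dest!: row_label)
qed auto

text \<open>The exit of the code is the label \<open>csize c\<close>. With this as accepting state
  and a query state that is out of reach one obtains an ordinary acceptor; with this as query state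
  and the no-state as accepting state, a machine that asks once and accepts on the answer
  no.\<close>

definition machine_of :: "nat => nat => com => nat => nat => machine" where
  "machine_of k G c acc qry = \<lparr>tapes = k, instructions = comp k G c 0 (csize c), start_state = 0,
     accept_state = acc, query_state = qry, yes_state = csize c + 2, no_state = csize c + 1\<rparr>"

definition inner :: "com => config set" where
  "inner c = {C. fst C < csize c}"

definition input_tapes :: "nat list => tapes" where
  "input_tapes x v = (if v = 0 then lst x 0 else blank_tape)"

lemma wf_machine_of: "0 < k ==> wf_machine (machine_of k G c acc qry)" using finite_comp comp_props by (fastforce simp: wf_machine_def machine_of_def)

lemma deterministic_machine_of: "det c ==> deterministic (machine_of k G c acc qry)"
  using single_valued_comp by (auto simp: deterministic_def machine_of_def)

lemma code_at_machine_of: "csize c <= qry ==> code_at (machine_of k G c acc qry) k G (inner c) c 0 (csize c)"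
  by (auto simp: code_at_def machine_of_def agrees_def inner_def cfg_def)

lemma initial_machine_of: "0 < k ==> initial (machine_of k G c acc qry) x = cfg k 0 (input_tapes x)"
  by (auto simp: initial_def machine_of_def cfg_def input_tapes_def input_tape_lst nth_Cons'
    intro!: nth_equalityI)

lemma okst_input_tapes: "set x \<subseteq> {..G} ==> 0 < k ==> okst k G (input_tapes x)"
  by (auto simp: okst_def input_tapes_def fst_lst blank_tape_lst) (metis atMost_iff nat_less_iff nth_mem subsetD)

lemma no_step_machine_of:
  assumes "csize c <= q" "q ~= qry" shows "\<not> step A (machine_of k G c acc qry) (q, ts) C"
proof
  assume "step A (machine_of k G c acc qry) (q, ts) C"
  then show False proof cases
    case (instruction q' as)
    then have "((q, map scan ts), (q', as)) \<in> comp k G c 0 (csize c)" by (simp add: machine_of_def)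
    from comp_label[OF this] show False using assms by simp
  next
    case query
    then show False using assms by (simp add: machine_of_def)
  qed
qed

lemma relpowp_stuck:
  fixes R :: "'a => 'a => bool" shows "(R ^^ n) c d ==> \<not> (\<exists>e. R c e) ==> n = 0" proof (cases n)
  case (Suc m)
  assume "(R ^^ n) c d" "\<not> (\<exists>e. R c e)"
  then show ?thesis using relpowp_Suc_D2[of m R c d] Suc by blast
qed

lemma rtranclp_path: "R\<^sup>*\<^sup>* c d \<longleftrightarrow> (\<exists>n. (R ^^ n) c d)" by (simp add: rtranclp_power)

lemma nondeterministic_machine:
  fixes c :: com and k G :: nat
  defines "M \<equiv> machine_of k G c (csize c) (csize c + 3)"
  assumes "exact (step A M) (inner c) T (cfg k (csize c) ` S) (initial M x)"
  shows "(\<forall>n C. (step A M ^^ n) (initial M x) C --> n <= T) \<and> (accepts A M x \<longleftrightarrow> S ~= {})" proof -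
  have stuck: "\<not> (\<exists>e. step A M (cfg k (csize c) s) e)" for s unfolding M_def cfg_def using no_step_machine_of by simp
  have path: "n <= T \<and> (fst C < csize c \<or> C \<in> cfg k (csize c) ` S)" if p: "(step A M ^^ n) (initial M x) C" for n C proof -
    have "hits (step A M) (inner c) T (cfg k (csize c) ` S) (initial M x)" using assms(2) by (simp add: exact_def)
    from this p show ?thesis proof (cases rule: hits_pathE)
      case j: (1 j e)
      then obtain s where "e = cfg k (csize c) s" by blast
      then have "n - j = 0" using relpowp_stuck[OF j(5)] stuck by simp
      then show ?thesis using j by auto
    qed (auto simp: inner_def)
  qed
  moreover have "accepts A M x \<longleftrightarrow> S ~= {}"
  proof
    assume "accepts A M x"
    then obtain ts n where "(step A M ^^ n) (initial M x) (csize c, ts)" unfolding accepts_def rtranclp_path by (auto simp: M_def machine_of_def)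
    from path[OF this] show "S ~= {}" by auto
  next
    assume "S ~= {}"
    then obtain s where "s \<in> S" by blast
    then obtain n where "(step A M ^^ n) (initial M x) (cfg k (csize c) s)" using assms(2) by (auto simp: exact_def)
    then show "accepts A M x" unfolding accepts_def rtranclp_path by (auto simp: M_def machine_of_def cfg_def)
  qed
  ultimately show ?thesis by blast
qed

text \<open>Acceptance on a negative answer fits an oracle that consists of the refutable
  certificates. The query costs one step beyond those of the code.\<close>

lemma query_machine:
  fixes c :: com and k G :: nat
  defines "M \<equiv> machine_of k G c (csize c + 1) (csize c)"
  assumes "exact (step A M) (inner c) T (cfg k (csize c) ` S) (initial M x)" "0 < k"
  shows "(\<forall>n C. (step A M ^^ n) (initial M x) C --> n <= T + 1) \<and>
    (accepts A M x \<longleftrightarrow> (\<exists>s\<in>S. tape_word (s (k - 1)) \<notin> A))" proof -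
  let ?e = "csize c"
  let ?ans = "%s. cfg k (if tape_word (s (k - 1)) \<in> A then ?e + 2 else ?e + 1) s"
  have last: "last (map s [0..<k]) = s (k - 1)" for s :: tapes using assms(3) by (simp add: last_map)
  have query: "step A M (cfg k ?e s) C \<longleftrightarrow> C = ?ans s" for s C
  proof
    assume "step A M (cfg k ?e s) C"
    then show "C = ?ans s" by cases (auto simp: M_def machine_of_def cfg_def last)
  next
    assume "C = ?ans s"
    then show "step A M (cfg k ?e s) C" using step.query[of A M "map s [0..<k]"] by (auto simp: M_def machine_of_def cfg_def last split: if_splits)
  qed
  have stuck: "\<not> (\<exists>e. step A M (?ans s) e)" for s unfolding M_def cfg_def using no_step_machine_of by simp
  have path: "n <= T + 1 \<and> (fst C <= ?e \<or> C \<in> ?ans ` S)" if p: "(step A M ^^ n) (initial M x) C" for n C proof -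
    have "hits (step A M) (inner c) T (cfg k ?e ` S) (initial M x)" using assms(2) by (simp add: exact_def)
    from this p show ?thesis proof (cases rule: hits_pathE)
      case (1 j e)
      then obtain s where j: "j <= T" "j <= n" "s \<in> S" "(step A M ^^ (n - j)) (cfg k ?e s) C" by blast
      show ?thesis proof (cases "n - j")
        case 0
        then show ?thesis using j by (auto simp: cfg_def)
      next
        case (Suc i)
        then obtain C' where "step A M (cfg k ?e s) C'" "(step A M ^^ i) C' C" using relpowp_Suc_D2[OF j(4)[unfolded Suc]] by blast
        then have C': "(step A M ^^ i) (?ans s) C" using query by simp
        then have "i = 0" using relpowp_stuck[OF C'] stuck by blast
        then show ?thesis using j C' Suc by auto
      qed
    qed (auto simp: inner_def)
  qed
  moreover have "accepts A M x \<longleftrightarrow> (\<exists>s\<in>S. tape_word (s (k - 1)) \<notin> A)"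
  proof
    assume "accepts A M x"
    then obtain ts n where "(step A M ^^ n) (initial M x) (?e + 1, ts)" unfolding accepts_def rtranclp_path by (auto simp: M_def machine_of_def)
    from path[OF this] show "\<exists>s\<in>S. tape_word (s (k - 1)) \<notin> A" by (auto simp: cfg_def split: if_splits)
  next
    assume "\<exists>s\<in>S. tape_word (s (k - 1)) \<notin> A"
    then obtain s where s: "s \<in> S" "tape_word (s (k - 1)) \<notin> A" by blast
    then obtain n where "(step A M ^^ n) (initial M x) (cfg k ?e s)" using assms(2) by (auto simp: exact_def)
    moreover have "step A M (cfg k ?e s) (cfg k (?e + 1) s)" using query s(2) by simp
    ultimately have "(step A M ^^ Suc n) (initial M x) (cfg k (?e + 1) s)" by (rule relpowp_Suc_I)
    then show "accepts A M x" unfolding accepts_def rtranclp_path by (auto simp: M_def machine_of_def cfg_def simp del: relpowp.simps)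
  qed
  ultimately show ?thesis by blast
qed

lemma function_machine:
  fixes c :: com and k G :: nat
  defines "M \<equiv> machine_of k G c (csize c) (csize c + 3)"
  assumes "exact (step A M) (inner c) T {cfg k (csize c) s} (initial M x)" "0 < k" "tape_word (s (k - 1)) = y"
  shows "\<exists>n q ts. n <= T \<and> (step A M ^^ n) (initial M x) (q, ts) \<and> (\<nexists>C. step A M (q, ts) C) \<and> tape_word (last ts) = y"
proof -
  have last: "last (map s [0..<k]) = s (k - 1)" using assms(3) by (simp add: last_map)
  obtain n where "n <= T" "(step A M ^^ n) (initial M x) (cfg k (csize c) s)" using assms(2) by (auto simp: exact_def)
  moreover have "\<nexists>C. step A M (cfg k (csize c) s) C" unfolding M_def cfg_def using no_step_machine_of by simp
  ultimately show ?thesis using assms(4) last by (intro exI[of _ n] exI[of _ "csize c"] exI[of _ "map s [0..<k]"]) (simp add: cfg_def)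
qed

section \<open>Certificates for provability\<close>

declare One_nat_def [simp del]

text \<open>A certificate for the formula \<open>x\<close> inserts after each letter 6 (for \<open>p\<close>) a tag, which is a number in
  unary (letter 9).  It stands for a formula whose atoms are pairs of an atom of \<open>x\<close> and a tag.\<close>

definition name :: "nat => nat" where "name c = fst (prod_decode c)"
definition tag :: "nat => nat" where "tag c = snd (prod_decode c)"

primrec tagged :: "formula => nat list" where
  "tagged (Pos c) = 6 # replicate (tag c) 9 @ encode_nat (name c)"
| "tagged (Neg c) = 3 # 6 # replicate (tag c) 9 @ encode_nat (name c)"
| "tagged (Conj F G) = 1 # tagged F @ 4 # tagged G @ [2]"
| "tagged (Disj F G) = 1 # tagged F @ 5 # tagged G @ [2]"

lemma encode_nat_digits: "set (encode_nat n) \<subseteq> {7, 8}" proof (induction n rule: less_induct)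
  case (less n)
  have "n mod 2 = 0 \<or> n mod 2 = 1" by auto
  then show ?case using less[of "n div 2"] by (auto simp: encode_nat.simps[of n] less_Suc_eq numeral_2_eq_2)
qed

lemma encode_nat_ne [simp]: "encode_nat n ~= []" "[] ~= encode_nat n" by (simp_all add: encode_nat.simps[of n])

lemma encode_nat_double: "0 < n ==> b < 2 ==> encode_nat (2 * n + b) = encode_nat n @ [7 + b]" by (subst encode_nat.simps) auto

lemma encode_nat_0 [simp]: "encode_nat 0 = [7]" and encode_nat_1 [simp]: "encode_nat 1 = [8]" "encode_nat (Suc 0) = [8]"
  by (simp_all add: encode_nat.simps)

lemma encode_nat_pos: "0 < n ==> \<exists>ds. encode_nat n = 8 # ds \<and> set ds \<subseteq> {7, 8}" proof (induction n rule: less_induct)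
  case (less n)
  show ?case proof (cases "n < 2")
    case True
    then have "n = 1" using less by simp
    then show ?thesis by simp
  next
    case False
    then obtain ds where "encode_nat (n div 2) = 8 # ds" "set ds \<subseteq> {7, 8}" using less.IH[of "n div 2"] by auto
    moreover have "n mod 2 = 0 \<or> n mod 2 = 1" by auto
    ultimately show ?thesis using False by (auto simp: encode_nat.simps[of n])
  qed
qed

lemma encode_nat_inj: "encode_nat m = encode_nat n ==> m = n" proof (induction m arbitrary: n rule: less_induct)
  case (less m)
  show ?case proof (cases "m < 2")
    case True
    then show ?thesis using less.prems by (auto simp: encode_nat.simps[of m] encode_nat.simps[of n] split: if_splits)
  next
    case False
    then have n: "\<not> n < 2" using less.prems by (auto simp: encode_nat.simps[of m] encode_nat.simps[of n] split: if_splits)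
    have "encode_nat (m div 2) = encode_nat (n div 2)" "m mod 2 = n mod 2"
      using less.prems False n by (auto simp: encode_nat.simps[of m] encode_nat.simps[of n])
    then have "m div 2 = n div 2" using less.IH[of "m div 2" "n div 2"] False by simp
    then show ?thesis using \<open>m mod 2 = n mod 2\<close> by (metis div_mult_mod_eq)
  qed
qed

lemma set_encode: "set (encode F) \<subseteq> {1..8}" using encode_nat_digits by (induction F) fastforce+

lemma filter_tagged: "filter (%a. a ~= 9) (tagged T) = encode (rename name T)" proof -
  have "filter (%a. a ~= 9) (encode_nat n) = encode_nat n" for n using encode_nat_digits[of n] by (intro filter_True) auto
  then show ?thesis by (induction T) auto
qed

subsection \<open>Evaluation with a stack\<close>

text \<open>Stack symbols: 15 is the bottom, 1 a left parenthesis, 3 a negation, 6 and 16 an unfinished positive or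
  negative literal, 14 an error.  Values are 10 to 13 (odd for true; 12 and 13 if the value
  belongs to a literal to which further digits may be appended); 18 to 21 are a value together with a
  connective.  An entry of the table is a truth value (1 or 2), increased by 2 and 4 if the positive and
  the negative literal with that tag have already occurred.\<close>

definition is_val :: "nat => bool" where "is_val s \<longleftrightarrow> 10 <= s \<and> s <= 13"
definition is_lit :: "nat => bool" where "is_lit s \<longleftrightarrow> s = 6 \<or> s = 16"
definition is_op :: "nat => bool" where "is_op s \<longleftrightarrow> 18 <= s \<and> s <= 21"

text \<open>In binary, \<open>e - 1\<close> consists of the truth value, the mark of the positive
  and the mark of the negative literal. Reading 0 means that the tag points beyond the
  table.\<close>

definition fresh_lit :: "nat => nat => bool" where
  "fresh_lit s e \<longleftrightarrow> is_lit s \<and> e ~= 0 \<and> even ((e - 1) div (if s = 6 then 2 else 4))"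

text \<open>A numeral with leading digit 7 yields 10 or 11, to which no digit may be appended, and
  one with leading digit 8 yields 12 or 13. Thus only canonical binary numerals pass. The marks are
  even, so the parity of an entry is its truth value.\<close>

definition new_top :: "nat => nat => nat => nat" where
  "new_top a s e = (if a = 9 then (if is_lit s then s else 14)
     else if a = 7 \<or> a = 8 then
       (if fresh_lit s e then (if a = 7 then 10 else 12) + of_bool ((s = 6) = even e) else if s = 12 \<or> s = 13 then s else 14)
     else if a = 4 \<or> a = 5 then (if is_val s then (if a = 4 then 18 else 20) + s mod 2 else 14)
     else 14)"

definition new_entry :: "nat => nat => nat => nat" where
  "new_entry a s e = (if (a = 7 \<or> a = 8) \<and> fresh_lit s e then e + (if s = 6 then 2 else 4) else e)"

definition combine :: "nat => nat => nat" where
  "combine d v = 10 + of_bool (if d < 20 then odd d \<and> odd v else odd d \<or> odd v)"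

definition reduce :: "nat list => nat list" where
  "reduce st = (if is_val (hd st) then
     (if is_op (hd (tl st)) then (if hd (tl (tl st)) = 1 then combine (hd (tl st)) (hd st) else 14) # tl (tl (tl st))
      else 14 # tl (tl st))
     else 14 # tl st)"

definition nth0 :: "nat list => nat => nat" where
  "nth0 l p = (if p < length l then l ! p else 0)"

type_synonym estate = "nat list \<times> nat list \<times> nat"

fun estep :: "estate => nat => estate" where
  "estep (st, tb, p) a =
     (if a = 1 \<or> a = 3 then (a # st, tb, p)
      else if a = 6 then (if hd st = 3 then 16 # tl st else 6 # st, tb, 0)
      else if a = 2 then (reduce st, tb, p)
      else (new_top a (hd st) (nth0 tb p) # tl st, tb[p := new_entry a (hd st) (nth0 tb p)],
            if a = 9 \<and> is_lit (hd st) then p + 1 else p))"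

text \<open>The table as it looks after the literals in L have been read: evaluation changes entries
  only by marking them.\<close>

definition marks :: "nat list => (bool \<times> nat) set => nat list" where
  "marks tb L = map (%k. tb ! k + (if (True, k) \<in> L then 2 else 0) + (if (False, k) \<in> L then 4 else 0)) [0..<length tb]"

definition truth :: "nat list => nat => bool" where
  "truth tb k \<longleftrightarrow> nth0 tb k = 2"

lemma length_marks [simp]: "length (marks tb L) = length tb" by (simp add: marks_def)

lemma marks_empty [simp]: "marks tb {} = tb" by (simp add: marks_def map_nth)

lemma marks_update:
  assumes "k < length tb" "set tb \<subseteq> {1, 2}" "is_lit s" shows "fresh_lit s (nth0 (marks tb L) k) \<longleftrightarrow> (s = 6, k) \<notin> L"
    and "(s = 6, k) \<notin> L ==> (marks tb L)[k := new_entry 7 s (nth0 (marks tb L) k)] = marks tb (insert (s = 6, k) L)"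
    and "(s = 6, k) \<notin> L ==> new_entry 8 s (nth0 (marks tb L) k) = new_entry 7 s (nth0 (marks tb L) k)"
    and "even (nth0 (marks tb L) k) \<longleftrightarrow> truth tb k" proof -
  have e: "tb ! k = 1 \<or> tb ! k = 2" using assms(1,2) nth_mem by blast
  have n: "nth0 (marks tb L) k = tb ! k + (if (True, k) \<in> L then 2 else 0) + (if (False, k) \<in> L then 4 else 0)"
    using assms(1) by (simp add: nth0_def marks_def)
  show f: "fresh_lit s (nth0 (marks tb L) k) \<longleftrightarrow> (s = 6, k) \<notin> L"
    using e assms(3) unfolding n fresh_lit_def is_lit_def by auto
  show "(marks tb L)[k := new_entry 7 s (nth0 (marks tb L) k)] = marks tb (insert (s = 6, k) L)" if "(s = 6, k) \<notin> L" proof (rule nth_equalityI)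
    fix i assume "i < length ((marks tb L)[k := new_entry 7 s (nth0 (marks tb L) k)])"
    then have i: "i < length tb" by simp
    have "new_entry 7 s (nth0 (marks tb L) k) = nth0 (marks tb L) k + (if s = 6 then 2 else 4)" using f that by (simp add: new_entry_def)
    then show "(marks tb L)[k := new_entry 7 s (nth0 (marks tb L) k)] ! i = marks tb (insert (s = 6, k) L) ! i"
      using i that n assms(1,3) by (auto simp: marks_def nth_list_update is_lit_def)
  qed simp
  show "new_entry 8 s (nth0 (marks tb L) k) = new_entry 7 s (nth0 (marks tb L) k)" if "(s = 6, k) \<notin> L"
    using f that by (simp add: new_entry_def)
  show "even (nth0 (marks tb L) k) \<longleftrightarrow> truth tb k" using e assms(1) unfolding n by (auto simp: truth_def nth0_def)
qed

lemma estep_marks: "is_lit s ==> foldl estep (s # st, tb, p) (replicate k 9) = (s # st, tb, p + k)" proof (induction k arbitrary: p)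
  case (Suc k)
  have "tb[p := new_entry 9 s (nth0 tb p)] = tb" by (cases "p < length tb") (auto simp: new_entry_def nth0_def list_update_beyond)
  then have "estep (s # st, tb, p) 9 = (s # st, tb, p + 1)" using Suc.prems by (simp add: new_top_def)
  then show ?case using Suc by simp
qed simp

lemma estep_digits: "s = 12 \<or> s = 13 ==> set ds \<subseteq> {7, 8} ==> foldl estep (s # st, tb, p) ds = (s # st, tb, p)" proof (induction ds)
  case (Cons d ds)
  then have "d = 7 \<or> d = 8" by simp
  have "\<not> is_lit s" using Cons.prems by (auto simp: is_lit_def)
  then have f: "\<not> fresh_lit s e" for e by (simp add: fresh_lit_def)
  have "tb[p := new_entry d s (nth0 tb p)] = tb" using f by (cases "p < length tb") (auto simp: new_entry_def nth0_def list_update_beyond)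
  then have "estep (s # st, tb, p) d = (s # st, tb, p)" using Cons.prems f \<open>d = 7 \<or> d = 8\<close> by (auto simp: new_top_def)
  then show ?case using Cons by simp
qed simp

lemma eval_literal:
  assumes "is_lit s" "tag c < length tb" "set tb \<subseteq> {1, 2}" "(s = 6, tag c) \<notin> L"
  shows "\<exists>v. foldl estep (s # st, marks tb L, 0) (replicate (tag c) 9 @ encode_nat (name c)) =
    (v # st, marks tb (insert (s = 6, tag c) L), tag c) \<and> is_val v \<and> (odd v \<longleftrightarrow> ((s = 6) = truth tb (tag c)))" proof -
  let ?k = "tag c" and ?tb = "marks tb L"
  note u = marks_update[OF assms(2,3,1), of L]
  have 7: "estep (s # st, ?tb, ?k) 7 = ((10 + of_bool ((s = 6) = truth tb ?k)) # st, marks tb (insert (s = 6, ?k) L), ?k)"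
    using u assms(4) by (simp add: new_top_def)
  have 8: "estep (s # st, ?tb, ?k) 8 = ((12 + of_bool ((s = 6) = truth tb ?k)) # st, marks tb (insert (s = 6, ?k) L), ?k)"
    using u assms(4) by (simp add: new_top_def)
  show ?thesis proof (cases "name c = 0")
    case True
    then show ?thesis using 7 estep_marks[OF assms(1), of st ?tb 0 ?k]
      by (intro exI[of _ "10 + of_bool ((s = 6) = truth tb ?k)"]) (auto simp: is_val_def)
  next
    case False
    then obtain ds where ds: "encode_nat (name c) = 8 # ds" "set ds \<subseteq> {7, 8}" using encode_nat_pos by blast
    let ?v = "12 + of_bool ((s = 6) = truth tb ?k) :: nat"
    have "foldl estep (?v # st, marks tb (insert (s = 6, ?k) L), ?k) ds = (?v # st, marks tb (insert (s = 6, ?k) L), ?k)"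
      by (rule estep_digits[OF _ ds(2)]) auto
    then show ?thesis using 8 estep_marks[OF assms(1), of st ?tb 0 ?k] ds(1) by (intro exI[of _ ?v]) (auto simp: is_val_def)
  qed
qed

lemma estep_op:
  assumes "is_val v" "a = 4 \<or> a = 5" shows "estep (v # st, tb, p) a = (((if a = 4 then 18 else 20) + v mod 2) # st, tb, p)" proof -
  have "\<not> is_lit v" using assms(1) by (auto simp: is_val_def is_lit_def)
  then have "tb[p := new_entry a v (nth0 tb p)] = tb" using assms(2) by (cases "p < length tb") (auto simp: new_entry_def nth0_def list_update_beyond)
  moreover have "estep (v # st, tb, p) a = (new_top a v (nth0 tb p) # st, tb[p := new_entry a v (nth0 tb p)], p)" using assms(2) by auto
  moreover have "new_top a v (nth0 tb p) = (if a = 4 then 18 else 20) + v mod 2" using assms by (auto simp: new_top_def)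
  ultimately show ?thesis by (simp only:)
qed

lemma ev_cong: "(!!s k. (s, k) \<in> set (lits F) ==> f k = g k) ==> ev f F = ev g F" by (induction F) auto

text \<open>A 3 on top of the stack would turn a following letter 6 into a negative literal; this is
  excluded by a condition on the stack, which the pushed parentheses and operators satisfy in the
  induction.\<close>

lemma eval_tagged:
  assumes "distinct (lits (rename tag T))" "set (lits (rename tag T)) \<inter> L = {}"
    and "!!s k. (s, k) \<in> set (lits (rename tag T)) ==> k < length tb" "set tb \<subseteq> {1, 2}" "st ~= []" "hd st ~= 3"
  shows "\<exists>v q. foldl estep (st, marks tb L, p) (tagged T) = (v # st, marks tb (L \<union> set (lits (rename tag T))), q) \<and>
    is_val v \<and> (odd v \<longleftrightarrow> ev (truth tb) (rename tag T))" using assms proof (induction T arbitrary: L p st)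
  case (Pos c)
  have "estep (st, marks tb L, p) 6 = (6 # st, marks tb L, 0)" using Pos.prems by simp
  then show ?case using eval_literal[of 6 c tb L st] Pos.prems by (auto simp: is_lit_def Un_insert_right)
next
  case (Neg c)
  have "foldl estep (st, marks tb L, p) [3, 6] = (16 # st, marks tb L, 0)" using Neg.prems by simp
  then show ?case using eval_literal[of 16 c tb L st] Neg.prems by (auto simp: is_lit_def Un_insert_right)
next
  case (Conj F G)
  let ?F = "rename tag F" and ?G = "rename tag G"
  obtain v q where v: "foldl estep (1 # st, marks tb L, p) (tagged F) = (v # 1 # st, marks tb (L \<union> set (lits ?F)), q)"
      "is_val v" "odd v \<longleftrightarrow> ev (truth tb) ?F" using Conj.IH(1)[of L "1 # st" p] Conj.prems by (auto simp: Int_Un_distrib2)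
  let ?d = "18 + v mod 2"
  have d: "?d ~= 3" "is_op ?d" "?d < 20" "odd ?d \<longleftrightarrow> odd v" by (auto simp: is_op_def mod_2_eq_odd)
  obtain u q' where u: "foldl estep (?d # 1 # st, marks tb (L \<union> set (lits ?F)), q) (tagged G) =
      (u # ?d # 1 # st, marks tb (L \<union> set (lits ?F) \<union> set (lits ?G)), q')" "is_val u" "odd u \<longleftrightarrow> ev (truth tb) ?G"
    using Conj.IH(2)[of "L \<union> set (lits ?F)" "?d # 1 # st" q] Conj.prems d(1) by (auto simp: Int_Un_distrib2 Int_Un_distrib Int_commute)
  have "reduce (u # ?d # 1 # st) = combine ?d u # st" using u(2) d(2) by (simp add: reduce_def)
  then have "foldl estep (st, marks tb L, p) (tagged (Conj F G)) = (combine ?d u # st, marks tb (L \<union> set (lits ?F) \<union> set (lits ?G)), q')"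
    using v(1) u(1) estep_op[OF v(2), of 4] by simp
  moreover have "is_val (combine ?d u)" "odd (combine ?d u) \<longleftrightarrow> ev (truth tb) ?F \<and> ev (truth tb) ?G"
    using d v(3) u(3) by (auto simp: combine_def is_val_def)
  ultimately show ?case by (simp add: Un_assoc)
next
  case (Disj F G)
  let ?F = "rename tag F" and ?G = "rename tag G"
  obtain v q where v: "foldl estep (1 # st, marks tb L, p) (tagged F) = (v # 1 # st, marks tb (L \<union> set (lits ?F)), q)"
      "is_val v" "odd v \<longleftrightarrow> ev (truth tb) ?F" using Disj.IH(1)[of L "1 # st" p] Disj.prems by (auto simp: Int_Un_distrib2)
  let ?d = "20 + v mod 2"
  have d: "?d ~= 3" "is_op ?d" "\<not> ?d < 20" "odd ?d \<longleftrightarrow> odd v" by (auto simp: is_op_def mod_2_eq_odd)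
  obtain u q' where u: "foldl estep (?d # 1 # st, marks tb (L \<union> set (lits ?F)), q) (tagged G) =
      (u # ?d # 1 # st, marks tb (L \<union> set (lits ?F) \<union> set (lits ?G)), q')" "is_val u" "odd u \<longleftrightarrow> ev (truth tb) ?G"
    using Disj.IH(2)[of "L \<union> set (lits ?F)" "?d # 1 # st" q] Disj.prems d(1) by (auto simp: Int_Un_distrib2 Int_Un_distrib Int_commute)
  have "reduce (u # ?d # 1 # st) = combine ?d u # st" using u(2) d(2) by (simp add: reduce_def)
  then have "foldl estep (st, marks tb L, p) (tagged (Disj F G)) = (combine ?d u # st, marks tb (L \<union> set (lits ?F) \<union> set (lits ?G)), q')"
    using v(1) u(1) estep_op[OF v(2), of 5] by simp
  moreover have "is_val (combine ?d u)" "odd (combine ?d u) \<longleftrightarrow> ev (truth tb) ?F \<or> ev (truth tb) ?G"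
    using d v(3) u(3) by (auto simp: combine_def is_val_def)
  ultimately show ?case by (simp add: Un_assoc)
qed

text \<open>What a stack without errors says about the letters read so far: each of its symbols stands for a
  segment of them, and \<open>L\<close> lists the literals in these segments.\<close>

inductive parsed :: "nat list => nat list => (bool \<times> nat) list => nat => bool" where
  bottom: "parsed [15] [] [] p"
| paren: "parsed st u L p ==> parsed (1 # st) (u @ [1]) L q"
| negation: "parsed st u L p ==> parsed (3 # st) (u @ [3]) L q"
| positive: "parsed st u L p ==> parsed (6 # st) (u @ 6 # replicate k 9) L k"
| negative: "parsed st u L p ==> parsed (16 # st) (u @ 3 # 6 # replicate k 9) L k"
| subformula: "parsed st u L p ==> is_val v ==>
    (12 <= v ==> \<exists>c. (T = Pos c \<or> T = Neg c) \<and> 0 < name c) ==>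
    parsed (v # st) (u @ tagged T) (L @ lits (rename tag T)) q"
| operator: "parsed st u L p ==> is_op d ==> a = (if d < 20 then 4 else 5) ==>
    parsed (d # st) (u @ tagged T @ [a]) (L @ lits (rename tag T)) q"

lemma parsed_valE:
  assumes "parsed (v # st) u L p" "is_val v"
  obtains T u' L' q where "parsed st u' L' q" "u = u' @ tagged T" "L = L' @ lits (rename tag T)"
    "12 <= v ==> \<exists>c. (T = Pos c \<or> T = Neg c) \<and> 0 < name c"
  using assms by (cases rule: parsed.cases) (auto simp: is_val_def is_op_def)

lemma parsed_opE:
  assumes "parsed (d # st) u L p" "is_op d"
  obtains T u' L' q where "parsed st u' L' q" "u = u' @ tagged T @ [if d < 20 then 4 else 5]" "L = L' @ lits (rename tag T)"
  using assms by (cases rule: parsed.cases) (auto simp: is_val_def is_op_def)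

lemma parsed_parenE:
  assumes "parsed (1 # st) u L p"
  obtains u' q where "parsed st u' L q" "u = u' @ [1]" using assms by (cases rule: parsed.cases) (auto simp: is_val_def is_op_def)

lemma parsed_negE:
  assumes "parsed (3 # st) u L p"
  obtains u' q where "parsed st u' L q" "u = u' @ [3]" using assms by (cases rule: parsed.cases) (auto simp: is_val_def is_op_def)

lemma parsed_litE:
  assumes "parsed (s # st) u L p" "is_lit s"
  obtains u' q where "parsed st u' L q" "u = u' @ (if s = 6 then [6] else [3, 6]) @ replicate p 9"
  using assms by (cases rule: parsed.cases) (auto simp: is_val_def is_op_def is_lit_def)

text \<open>The evaluator doubles as a parser: as long as no error symbol is on the stack, the
  letters read form segments of a tagged formula, and the marks in the table show that no literal
  has been repeated.\<close>

lemma parsed_step: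
  assumes "parsed st u L p" "distinct L" "set tb \<subseteq> {1, 2}"
    and "estep (st, marks tb (set L), p) a = (st', tb', p')" "14 \<notin> set st'"
  shows "\<exists>L'. parsed st' (u @ [a]) L' p' \<and> distinct L' \<and> tb' = marks tb (set L')" proof -
  obtain s st0 where st: "st = s # st0" using assms(1) by cases auto
  let ?tb = "marks tb (set L)"
  consider "a = 1" | "a = 3" | "a = 6" | "a = 2" | "a = 9" | "a = 7 \<or> a = 8" | "a = 4 \<or> a = 5"
    | "a \<notin> {1, 2, 3, 4, 5, 6, 7, 8, 9}" by auto
  then show ?thesis proof cases
    case 1
    then show ?thesis using assms paren[OF assms(1)] by auto
  next
    case 2
    then show ?thesis using assms negation[OF assms(1)] by auto
  next
    case 3
    show ?thesis proof (cases "s = 3")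
      case True
      then have "parsed (3 # st0) u L p" using assms(1) st by simp
      then obtain u' q where u': "parsed st0 u' L q" "u = u' @ [3]" by (rule parsed_negE)
      show ?thesis using assms(2,4) 3 st True negative[OF u'(1), of 0] u'(2) by auto
    next
      case False
      then show ?thesis using assms 3 st positive[OF assms(1), of 0] by auto
    qed
  next
    case 4
    then have st': "st' = reduce st" "tb' = ?tb" "p' = p" using assms(4) by auto
    have v: "is_val s" using assms(5) st st'(1) by (auto simp: reduce_def split: if_splits)
    have "parsed (s # st0) u L p" using assms(1) st by simp
    from parsed_valE[OF this v] obtain T u1 L1 q1 where T: "parsed st0 u1 L1 q1" "u = u1 @ tagged T" "L = L1 @ lits (rename tag T)" by metis
    obtain d st1 where st0: "st0 = d # st1" using T(1) by cases auto
    have d: "is_op d" using assms(5) st st0 st'(1) v by (auto simp: reduce_def split: if_splits)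
    from parsed_opE[OF T(1)[unfolded st0] d] obtain U u2 L2 q2 where U: "parsed st1 u2 L2 q2"
      "u1 = u2 @ tagged U @ [if d < 20 then 4 else 5]" "L1 = L2 @ lits (rename tag U)" by metis
    obtain o1 st2 where st1: "st1 = o1 # st2" using U(1) by cases auto
    have o1: "o1 = 1" using assms(5) st st0 st1 st'(1) v d by (auto simp: reduce_def split: if_splits)
    from parsed_parenE[OF U(1)[unfolded st1 o1]] obtain u3 q3 where u3: "parsed st2 u3 L2 q3" "u2 = u3 @ [1]" by metis
    have "st' = combine d s # st2" using st'(1) st st0 st1 o1 v d by (simp add: reduce_def)
    moreover have "is_val (combine d s)" "\<not> 12 <= combine d s" by (auto simp: combine_def is_val_def)
    then have "parsed (combine d s # st2) (u3 @ tagged (if d < 20 then Conj U T else Disj U T))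
        (L2 @ lits (rename tag (if d < 20 then Conj U T else Disj U T))) p" using subformula[OF u3(1), of "combine d s"] by blast
    moreover have "u @ [a] = u3 @ tagged (if d < 20 then Conj U T else Disj U T)" using 4 T(2) U(2) u3(2) by simp
    moreover have "L = L2 @ lits (rename tag (if d < 20 then Conj U T else Disj U T))" using T(3) U(3) by simp
    ultimately show ?thesis using assms(2) st' by (intro exI[of _ L]) simp
  next
    case 5
    then have s: "is_lit s" using assms(4,5) st by (auto simp: new_top_def split: if_splits)
    have tb': "?tb[p := new_entry 9 s (nth0 ?tb p)] = ?tb" by (cases "p < length ?tb") (auto simp: new_entry_def nth0_def list_update_beyond)
    have eq: "st' = s # st0" "tb' = ?tb" "p' = Suc p" using assms(4) st 5 s tb' by (auto simp: new_top_def)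
    from parsed_litE[OF assms(1)[unfolded st] s] obtain u' q where u': "parsed st0 u' L q"
      "u = u' @ (if s = 6 then [6] else [3, 6]) @ replicate p 9" by metis
    have "parsed st' (u @ [a]) L p'" using positive[OF u'(1), of "Suc p"] negative[OF u'(1), of "Suc p"] u'(2) s eq 5
      by (auto simp: is_lit_def replicate_append_same)
    then show ?thesis using assms(2) eq by blast
  next
    case 6
    show ?thesis proof (cases "is_lit s")
      case True
      have fr: "fresh_lit s (nth0 ?tb p)" using assms(4,5) 6 st True by (auto simp: new_top_def is_lit_def split: if_splits)
      then have p: "p < length tb" by (auto simp: fresh_lit_def nth0_def split: if_splits)
      note m = marks_update[OF p assms(3) True, of "set L"]
      have nL: "(s = 6, p) \<notin> set L" using m(1) fr by simp
      have tb': "tb' = marks tb (insert (s = 6, p) (set L))" using assms(4) 6 st m nL by auto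
      from parsed_litE[OF assms(1)[unfolded st] True] obtain u' q where u': "parsed st0 u' L q"
        "u = u' @ (if s = 6 then [6] else [3, 6]) @ replicate p 9" by metis
      define c where "c = prod_encode (a - 7, p)"
      have c: "name c = a - 7" "tag c = p" by (simp_all add: c_def name_def tag_def)
      define T where "T = (if s = 6 then Pos c else Neg c)"
      have T: "lits (rename tag T) = [(s = 6, p)]" "u @ [a] = u' @ tagged T" using 6 True u'(2) c by (auto simp: T_def is_lit_def)
      define v where "v = new_top a s (nth0 ?tb p)"
      have "estep (s # st0, ?tb, p) a = (v # st0, ?tb[p := new_entry a s (nth0 ?tb p)], p)" unfolding v_def using 6 by auto
      then have v: "st' = v # st0" "p' = p" using assms(4) st by simp_all
      have "is_val v" "12 <= v ==> a = 8" using fr 6 unfolding v_def by (auto simp: new_top_def is_val_def of_bool_def split: if_splits)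
      then have "parsed (v # st0) (u' @ tagged T) (L @ lits (rename tag T)) p'"
        using u'(1) c by (intro parsed.subformula[where p = q]) (auto simp: T_def)
      then show ?thesis using T v(1) tb' nL assms(2) by (intro exI[of _ "L @ [(s = 6, p)]"]) auto
    next
      case False
      then have s: "s = 12 \<or> s = 13" "st' = st" "p' = p" "tb' = ?tb"
        using assms(4,5) 6 st by (auto simp: new_top_def fresh_lit_def new_entry_def nth0_def list_update_beyond split: if_splits)
      then have v: "is_val s" "12 <= s" by (auto simp: is_val_def)
      from parsed_valE[OF assms(1)[unfolded st] v(1)] v(2) obtain T u1 L1 q c where T: "parsed st0 u1 L1 q" "u = u1 @ tagged T"
        "L = L1 @ lits (rename tag T)" "T = Pos c \<or> T = Neg c" "0 < name c" by metis
      \<comment> \<open>Appending a digit doubles the name. This describes the longer numeral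
        because the name is positive, which is what the stack symbols 12 and 13 record.\<close>
      define c' where "c' = prod_encode (2 * name c + (a - 7), tag c)"
      have c': "name c' = 2 * name c + (a - 7)" "tag c' = tag c" by (simp_all add: c'_def name_def tag_def)
      have e: "encode_nat (name c') = encode_nat (name c) @ [a]" unfolding c'(1) using encode_nat_double[OF T(5), of "a - 7"] 6 by auto
      define T' where "T' = (if T = Pos c then Pos c' else Neg c')"
      have "tagged T' = tagged T @ [a]" "lits (rename tag T') = lits (rename tag T)" "(T' = Pos c' \<or> T' = Neg c') \<and> 0 < name c'"
        using T(4,5) c' e by (auto simp: T'_def)
      then have "parsed (s # st0) (u @ [a]) L p'" using parsed.subformula[OF T(1) v(1), of T' p'] T(2,3) by auto
      then show ?thesis using assms(2) s st by blast
    qed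
  next
    case 7
    then have v: "is_val s" using assms(4,5) st by (auto simp: new_top_def split: if_splits)
    have eq: "st' = ((if a = 4 then 18 else 20) + s mod 2) # st0" "tb' = ?tb" using assms(4) st estep_op[OF v 7] by auto
    from parsed_valE[OF assms(1)[unfolded st] v] obtain T u1 L1 q where T: "parsed st0 u1 L1 q" "u = u1 @ tagged T"
        "L = L1 @ lits (rename tag T)" by metis
    have d: "is_op ((if a = 4 then 18 else 20) + s mod 2)" "a = (if (if a = 4 then 18 else 20) + s mod 2 < 20 then 4 else 5)"
      using 7 by (auto simp: is_op_def mod_2_eq_odd)
    show ?thesis using operator[OF T(1) d, of T p'] T(2,3) assms(2) eq by (intro exI[of _ L]) simp
  next
    case 8
    then have "hd st' = 14" "st' ~= []" using assms(4) by (auto simp: new_top_def)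
    then show ?thesis using assms(5) by (metis list.set_sel(1))
  qed
qed

lemma error_step: "14 \<in> set st ==> 14 \<in> set (fst (estep (st, tb, p) a))" proof -
  assume e: "14 \<in> set st"
  then obtain s st0 where st: "st = s # st0" by (cases st) auto
  have r: "14 \<in> set (reduce st)" if "14 \<in> set st" for st using that unfolding reduce_def
    by (cases st; cases "tl st"; cases "tl (tl st)") (auto simp: is_val_def is_op_def)
  have n: "new_top a 14 e = 14" for e by (auto simp: new_top_def is_lit_def fresh_lit_def is_val_def)
  show ?thesis using e r[OF e] n unfolding st by auto
qed

lemma parsed_run:
  assumes "set tb \<subseteq> {1, 2}" "foldl estep ([15], tb, 0) w = (st, tb', p)" "14 \<notin> set st"
  shows "\<exists>L. parsed st w L p \<and> distinct L \<and> tb' = marks tb (set L)" using assms(2,3)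
proof (induction w arbitrary: st tb' p rule: rev_induct)
  case Nil
  then show ?case using bottom[of 0] by (intro exI[of _ "[]"]) auto
next
  case (snoc a w)
  obtain st0 tb0 p0 where 0: "foldl estep ([15], tb, 0) w = (st0, tb0, p0)" by (metis prod_cases3)
  have 1: "estep (st0, tb0, p0) a = (st, tb', p)" using snoc.prems(1) 0 by simp
  then have "14 \<notin> set st0" using error_step[of st0 tb0 p0 a] snoc.prems(2) by auto
  from snoc.IH[OF 0 this] obtain L where L: "parsed st0 w L p0" "distinct L" "tb0 = marks tb (set L)" by blast
  show ?case using parsed_step[OF L(1,2) assms(1) _ snoc.prems(2)] 1 L(3) by simp
qed

definition good :: "nat list => nat list => bool" where
  "good w tb \<longleftrightarrow> fst (foldl estep ([15], tb, 0) w) \<in> {[11, 15], [13, 15]}"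

lemma tags_bounded: "(s, k) \<in> set (lits (rename tag T)) ==> k < length (tagged T)" by (induction T) auto

text \<open>A single table, here the one with all values false, already decides syntax and
  distinctness of the literals. The others run through all valuations, since every tag is smaller
  than the length of the certificate that contains it in unary.\<close>

lemma all_good_iff:
  "(\<forall>tb. length tb = length w \<and> set tb \<subseteq> {1, 2} --> good w tb) \<longleftrightarrow>
   (\<exists>T. w = tagged T \<and> distinct (lits (rename tag T)) \<and> (\<forall>v. ev v (rename tag T)))"
proof
  assume all: "\<forall>tb. length tb = length w \<and> set tb \<subseteq> {1, 2} --> good w tb"
  let ?tb = "replicate (length w) 1"
  obtain st tb' p where st: "foldl estep ([15], ?tb, 0) w = (st, tb', p)" by (metis prod_cases3)
  have "length ?tb = length w \<and> set ?tb \<subseteq> {1, 2}" by auto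
  then have "good w ?tb" using all by blast
  then obtain v where v: "st = [v, 15]" "v = 11 \<or> v = 13" using st by (auto simp: good_def)
  have "set ?tb \<subseteq> {1, 2}" "14 \<notin> set st" using v by auto
  from parsed_run[OF this(1) st this(2)] obtain L where L: "parsed st w L p" "distinct L" by blast
  have iv: "is_val v" using v by (auto simp: is_val_def)
  from parsed_valE[OF L(1)[unfolded v(1)] iv] obtain T u' L' q where T: "parsed [15] u' L' q" "w = u' @ tagged T" "L = L' @ lits (rename tag T)"
    by metis
  have "u' = [] \<and> L' = []" using T(1) by cases (auto simp: is_val_def is_op_def)
  then have w: "w = tagged T" "distinct (lits (rename tag T))" using T L(2) by auto
  have "ev v (rename tag T)" for v proof -
    define tb where "tb = map (%k. if v k then 2 else 1 :: nat) [0..<length w]"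
    have tb: "length tb = length w" "set tb \<subseteq> {1, 2}" by (auto simp: tb_def)
    have "ev (truth tb) (rename tag T) = ev v (rename tag T)" proof (rule ev_cong)
      fix s k assume "(s, k) \<in> set (lits (rename tag T))"
      then have "k < length w" using tags_bounded w(1) by blast
      then show "truth tb k = v k" by (simp add: truth_def tb_def nth0_def)
    qed
    moreover obtain u q where "foldl estep ([15], marks tb {}, 0) (tagged T) = (u # [15], marks tb ({} \<union> set (lits (rename tag T))), q)"
        "odd u \<longleftrightarrow> ev (truth tb) (rename tag T)"
      using eval_tagged[OF w(2), of "{}" tb "[15]" 0] tags_bounded[of _ _ T] tb w(1) by auto
    moreover have "good w tb" using all tb by blast
    ultimately show ?thesis using w(1) by (auto simp: good_def)
  qed
  then show "\<exists>T. w = tagged T \<and> distinct (lits (rename tag T)) \<and> (\<forall>v. ev v (rename tag T))" using w by blast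
next
  assume "\<exists>T. w = tagged T \<and> distinct (lits (rename tag T)) \<and> (\<forall>v. ev v (rename tag T))"
  then obtain T where T: "w = tagged T" "distinct (lits (rename tag T))" "!!v. ev v (rename tag T)" by blast
  show "\<forall>tb. length tb = length w \<and> set tb \<subseteq> {1, 2} --> good w tb" proof (intro allI impI)
    fix tb assume tb: "length tb = length w \<and> set tb \<subseteq> {1, 2 :: nat}"
    obtain u q where "foldl estep ([15], marks tb {}, 0) (tagged T) = (u # [15], marks tb ({} \<union> set (lits (rename tag T))), q)"
        "is_val u" "odd u \<longleftrightarrow> ev (truth tb) (rename tag T)"
      using eval_tagged[OF T(2), of "{}" tb "[15]" 0] tags_bounded[of _ _ T] tb T(1) by auto
    moreover from this have "odd u" using T(3) by blast
    then have "u = 11 \<or> u = 13" using \<open>is_val u\<close> unfolding is_val_def by presburger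
    ultimately show "good w tb" using T(1) by (auto simp: good_def)
  qed
qed

subsection \<open>Guessing a certificate\<close>

text \<open>\<open>guessed x u p w p'\<close>: reading the letters \<open>u\<close> while a second head on \<open>x\<close> moves from \<open>p\<close> to
  \<open>p'\<close> can produce \<open>w\<close>.  A tag is a position in \<open>x\<close> from where the second head verifies the name.\<close>

inductive guessed :: "nat list => nat list => nat => nat list => nat => bool" for x where
  nil: "guessed x [] p [] p"
| digit: "a = 7 \<or> a = 8 ==> nth0 x p = a ==> guessed x u (Suc p) w p' ==> guessed x (a # u) p (a # w) p'"
| literal: "nth0 x p \<notin> {7, 8} ==> nth0 x q = 6 ==> guessed x u (Suc q) w p' ==>
    guessed x (6 # u) p (6 # replicate q 9 @ w) p'"
| other: "a \<notin> {6, 7, 8} ==> nth0 x p \<notin> {7, 8} ==> guessed x u p w p' ==> guessed x (a # u) p (a # w) p'"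

section \<open>Tags as positions of atoms in the input\<close>

definition occurs_at :: "nat list => nat => nat => bool" where
  "occurs_at x q a \<longleftrightarrow> nth0 x q = 6 \<and> (\<forall>i<length (encode_nat a). nth0 x (Suc q + i) = encode_nat a ! i) \<and>
     nth0 x (Suc q + length (encode_nat a)) \<notin> {7, 8}"

text \<open>The numeral at a position ends at the first letter that is not a digit. Hence equal tags
  belong to the same atom of the input, and the tag alone determines it.\<close>

lemma occurs_at_unique:
  assumes "occurs_at x q a" "occurs_at x q b" shows "a = b" proof -
  have *: "length (encode_nat a) <= length (encode_nat b)" if "occurs_at x q a" "occurs_at x q b" for a b proof (rule ccontr)
    assume "\<not> ?thesis"
    then have l: "length (encode_nat b) < length (encode_nat a)" by simp
    then have "nth0 x (Suc q + length (encode_nat b)) = encode_nat a ! length (encode_nat b)" using that(1) by (simp add: occurs_at_def)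
    also have "\<dots> \<in> {7, 8}" using encode_nat_digits l nth_mem by blast
    finally show False using that(2) by (simp add: occurs_at_def)
  qed
  then have "length (encode_nat a) = length (encode_nat b)" using assms le_antisym by blast
  then have "encode_nat a = encode_nat b" using assms by (intro nth_equalityI) (auto simp: occurs_at_def)
  then show ?thesis by (rule encode_nat_inj)
qed

lemma guessed_filter: "guessed x u p w p' ==> 9 \<notin> set u ==> filter (%a. a ~= 9) w = u" by (induction rule: guessed.induct) auto

lemma guessed_head: "guessed x u p w p' ==> 9 \<notin> set u ==> w = [] \<or> hd w ~= 9" by (induction rule: guessed.induct) auto

lemma guessed_digits:
  "guessed x u p (ds @ w) p' ==> set ds \<subseteq> {7, 8} ==> 9 \<notin> set u ==>
    \<exists>u'. guessed x u' (p + length ds) w p' \<and> 9 \<notin> set u' \<and> (\<forall>i<length ds. nth0 x (p + i) = ds ! i)"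
proof (induction ds arbitrary: u p)
  case Nil
  then show ?case by auto
next
  case (Cons d ds)
  from Cons.prems(1) obtain u1 where u1: "u = d # u1" "nth0 x p = d" "guessed x u1 (Suc p) (ds @ w) p'" using Cons.prems(2) by cases auto
  from Cons.IH[OF u1(3)] Cons.prems u1(1) obtain u' where u': "guessed x u' (Suc p + length ds) w p'" "9 \<notin> set u'"
    "\<forall>i<length ds. nth0 x (Suc p + i) = ds ! i" by auto
  have "nth0 x (p + i) = (d # ds) ! i" if "i < length (d # ds)" for i using that u1(2) u'(3) by (cases i) auto
  then show ?case using u' by auto
qed

text \<open>That the numeral at the tagged position does not continue is noticed only when the next
  letter other than a digit is read, or at the very end; until then the conclusion is
  conditional.\<close>

lemma guessed_literal:
  assumes "guessed x u p (6 # replicate (tag c) 9 @ encode_nat (name c) @ w) p'" "9 \<notin> set u"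
  shows "\<exists>u' q. guessed x u' q w p' \<and> 9 \<notin> set u' \<and> (nth0 x q \<notin> {7, 8} --> occurs_at x (tag c) (name c))" proof -
  from assms(1) obtain q w' u1 where q: "nth0 x q = 6" "guessed x u1 (Suc q) w' p'" "u = 6 # u1"
    "replicate q 9 @ w' = replicate (tag c) 9 @ encode_nat (name c) @ w" by cases auto
  have h: "w' = [] \<or> hd w' ~= 9" using guessed_head[OF q(2)] assms(2) q(3) by simp
  have e: "hd (encode_nat (name c) @ w) ~= 9" proof -
    have "hd (encode_nat (name c)) \<in> {7, 8}" using encode_nat_digits hd_in_set encode_nat_ne(1) by blast
    then show ?thesis by auto
  qed
  have tw: "takeWhile (%a. a = 9) (replicate n 9 @ z) = replicate n (9 :: nat)" if "z = [] \<or> hd z ~= 9" for n z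
    using that by (induction n) (cases z; auto)+
  have "replicate q (9 :: nat) = replicate (tag c) 9" using tw[of w' q] tw[of "encode_nat (name c) @ w" "tag c"] h e q(4) by simp
  then have qk: "q = tag c" by (metis length_replicate)
  then have "w' = encode_nat (name c) @ w" using q(4) by simp
  from guessed_digits[OF q(2)[unfolded this] encode_nat_digits] assms(2) q(3)
  obtain u' where "guessed x u' (Suc q + length (encode_nat (name c))) w p'" "9 \<notin> set u'"
    "\<forall>i<length (encode_nat (name c)). nth0 x (Suc q + i) = encode_nat (name c) ! i" by auto
  then show ?thesis using q(1) qk by (intro exI[of _ u'] exI[of _ "Suc q + length (encode_nat (name c))"]) (auto simp: occurs_at_def)
qed

lemma guessed_otherE:
  assumes "guessed x u p (a # w) p'" "a \<in> {1, 2, 3, 4, 5}" "9 \<notin> set u"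
  obtains u' where "guessed x u' p w p'" "9 \<notin> set u'" "nth0 x p \<notin> {7, 8}" using assms by cases auto

lemma guessed_sound:
  "guessed x u p (tagged T @ w) p' ==> 9 \<notin> set u ==>
    \<exists>u' q. guessed x u' q w p' \<and> 9 \<notin> set u' \<and>
      (nth0 x q \<notin> {7, 8} --> (\<forall>s c. (s, c) \<in> set (lits T) --> occurs_at x (tag c) (name c)))" proof (induction T arbitrary: u p w)
  case (Pos c)
  then show ?case using guessed_literal[of x u p c w p'] by auto
next
  case (Neg c)
  then obtain u1 where "guessed x u1 p (6 # replicate (tag c) 9 @ encode_nat (name c) @ w) p'" "9 \<notin> set u1" by (auto elim: guessed_otherE)
  then show ?case using guessed_literal[of x u1 p c w p'] by auto
next
  case (Conj F G)
  then have "guessed x u p (1 # tagged F @ 4 # tagged G @ 2 # w) p'" by simp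
  then obtain u1 where u1: "guessed x u1 p (tagged F @ 4 # tagged G @ 2 # w) p'" "9 \<notin> set u1"
    using Conj.prems(2) by (auto elim: guessed_otherE)
  from Conj.IH(1)[OF u1] obtain u2 q2 where u2: "guessed x u2 q2 (4 # tagged G @ 2 # w) p'" "9 \<notin> set u2"
    "nth0 x q2 \<notin> {7, 8} --> (\<forall>s c. (s, c) \<in> set (lits F) --> occurs_at x (tag c) (name c))" by blast
  from u2(1,2) obtain u3 where u3: "guessed x u3 q2 (tagged G @ 2 # w) p'" "9 \<notin> set u3" "nth0 x q2 \<notin> {7, 8}"
    by (auto elim: guessed_otherE)
  from Conj.IH(2)[OF u3(1,2)] obtain u4 q4 where u4: "guessed x u4 q4 (2 # w) p'" "9 \<notin> set u4"
    "nth0 x q4 \<notin> {7, 8} --> (\<forall>s c. (s, c) \<in> set (lits G) --> occurs_at x (tag c) (name c))" by blast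
  from u4(1,2) obtain u5 where "guessed x u5 q4 w p'" "9 \<notin> set u5" "nth0 x q4 \<notin> {7, 8}" by (auto elim: guessed_otherE)
  then show ?case using u2(3) u3(3) u4(3) by auto
next
  case (Disj F G)
  then have "guessed x u p (1 # tagged F @ 5 # tagged G @ 2 # w) p'" by simp
  then obtain u1 where u1: "guessed x u1 p (tagged F @ 5 # tagged G @ 2 # w) p'" "9 \<notin> set u1"
    using Disj.prems(2) by (auto elim: guessed_otherE)
  from Disj.IH(1)[OF u1] obtain u2 q2 where u2: "guessed x u2 q2 (5 # tagged G @ 2 # w) p'" "9 \<notin> set u2"
    "nth0 x q2 \<notin> {7, 8} --> (\<forall>s c. (s, c) \<in> set (lits F) --> occurs_at x (tag c) (name c))" by blast
  from u2(1,2) obtain u3 where u3: "guessed x u3 q2 (tagged G @ 2 # w) p'" "9 \<notin> set u3" "nth0 x q2 \<notin> {7, 8}"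
    by (auto elim: guessed_otherE)
  from Disj.IH(2)[OF u3(1,2)] obtain u4 q4 where u4: "guessed x u4 q4 (2 # w) p'" "9 \<notin> set u4"
    "nth0 x q4 \<notin> {7, 8} --> (\<forall>s c. (s, c) \<in> set (lits G) --> occurs_at x (tag c) (name c))" by blast
  from u4(1,2) obtain u5 where "guessed x u5 q4 w p'" "9 \<notin> set u5" "nth0 x q4 \<notin> {7, 8}" by (auto elim: guessed_otherE)
  then show ?case using u2(3) u3(3) u4(3) by auto
qed

lemma guessed_digits_complete:
  "set ds \<subseteq> {7, 8} ==> (\<forall>i<length ds. nth0 x (p + i) = ds ! i) ==> guessed x u (p + length ds) w p' ==>
    guessed x (ds @ u) p (ds @ w) p'" proof (induction ds arbitrary: p)
  case (Cons d ds)
  have "nth0 x p = d" "\<forall>i<length ds. nth0 x (Suc p + i) = ds ! i" using Cons.prems(2) by auto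
  then show ?case using Cons.IH[of "Suc p"] Cons.prems by (auto intro: guessed.digit)
qed simp

lemma guessed_literal_complete:
  assumes "occurs_at x (tag c) (name c)" "nth0 x p \<notin> {7, 8}"
    "guessed x u (Suc (tag c) + length (encode_nat (name c))) w p'"
  shows "guessed x (6 # encode_nat (name c) @ u) p (6 # replicate (tag c) 9 @ encode_nat (name c) @ w) p'"
  using assms guessed_digits_complete[OF encode_nat_digits, of "name c" x "Suc (tag c)" u w p'] by (intro guessed.literal) (auto simp: occurs_at_def)

lemma guessed_complete:
  assumes "!!s c. (s, c) \<in> set (lits T) ==> occurs_at x (tag c) (name c)" "nth0 x p \<notin> {7, 8}"
  shows "\<exists>q. nth0 x q \<notin> {7, 8} \<and>
    (\<forall>u w p'. guessed x u q w p' --> guessed x (encode (rename name T) @ u) p (tagged T @ w) p')" using assms proof (induction T arbitrary: p)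
  case (Pos c)
  then show ?case using guessed_literal_complete[of x c p]
    by (intro exI[of _ "Suc (tag c) + length (encode_nat (name c))"]) (auto simp: occurs_at_def)
next
  case (Neg c)
  have o: "occurs_at x (tag c) (name c)" using Neg.prems(1)[of False c] by simp
  have "guessed x (encode (rename name (Neg c)) @ u) p (tagged (Neg c) @ w) p'"
    if "guessed x u (Suc (tag c) + length (encode_nat (name c))) w p'" for u w p'
    using guessed.other[OF _ Neg.prems(2) guessed_literal_complete[OF o Neg.prems(2) that], of 3] by simp
  then show ?case using o by (intro exI[of _ "Suc (tag c) + length (encode_nat (name c))"]) (auto simp: occurs_at_def)
next
  case (Conj F G)
  obtain q where q: "nth0 x q \<notin> {7, 8}" "!!u w p'. guessed x u q w p' ==> guessed x (encode (rename name F) @ u) p (tagged F @ w) p'"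
    using Conj.IH(1)[of p] Conj.prems by auto
  obtain q' where q': "nth0 x q' \<notin> {7, 8}" "!!u w p'. guessed x u q' w p' ==> guessed x (encode (rename name G) @ u) q (tagged G @ w) p'"
    using Conj.IH(2)[of q] Conj.prems q(1) by auto
  show ?case using q q' Conj.prems(2) by (intro exI[of _ q']) (auto intro!: guessed.other q(2) q'(2))
next
  case (Disj F G)
  obtain q where q: "nth0 x q \<notin> {7, 8}" "!!u w p'. guessed x u q w p' ==> guessed x (encode (rename name F) @ u) p (tagged F @ w) p'"
    using Disj.IH(1)[of p] Disj.prems by auto
  obtain q' where q': "nth0 x q' \<notin> {7, 8}" "!!u w p'. guessed x u q' w p' ==> guessed x (encode (rename name G) @ u) q (tagged G @ w) p'"
    using Disj.IH(2)[of q] Disj.prems q(1) by auto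
  show ?case using q q' Disj.prems(2) by (intro exI[of _ q']) (auto intro!: guessed.other q(2) q'(2))
qed

lemma nth0_append: "nth0 (u @ v) (length u + i) = nth0 v i" by (simp add: nth0_def nth_append)

lemma occurs_at_encode:
  assumes "nth0 r 0 \<notin> {7, 8}" shows "occurs_at (u @ 6 # encode_nat a @ r) (length u) a" proof -
  have "nth0 (u @ 6 # encode_nat a @ r) (Suc (length u) + i) = nth0 (encode_nat a @ r) i" for i
    using nth0_append[of "u @ [6]" "encode_nat a @ r" i] by simp
  then show ?thesis using assms nth0_append[of u "6 # encode_nat a @ r" 0] nth0_append[of "encode_nat a" r 0]
    by (auto simp: occurs_at_def) (auto simp: nth0_def nth_append)
qed

text \<open>The tags of two subformulas lie in disjoint intervals of positions, so an atom that
  occurs in both can keep its tag from the first one.\<close>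

lemma merge_tags:
  fixes \<kappa> \<kappa>' :: "'a => nat"
  assumes "inj_on \<kappa> A" "inj_on \<kappa>' B" "\<forall>b\<in>A. P (\<kappa> b) b \<and> l <= \<kappa> b \<and> \<kappa> b < m" "\<forall>b\<in>B. P (\<kappa>' b) b \<and> m <= \<kappa>' b \<and> \<kappa>' b < n"
    "l <= m" "m <= n" shows "\<exists>k. inj_on k (A \<union> B) \<and> (\<forall>b\<in>A \<union> B. P (k b) b \<and> l <= k b \<and> k b < n)"
proof (intro exI conjI)
  let ?k = "%b. if b \<in> A then \<kappa> b else \<kappa>' b"
  show "inj_on ?k (A \<union> B)" proof (rule inj_onI)
    fix b b' assume "b \<in> A \<union> B" "b' \<in> A \<union> B" "?k b = ?k b'"
    moreover have "\<kappa> a ~= \<kappa>' c" if "a \<in> A" "c \<in> B" for a c using assms(3,4) that by fastforce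
    ultimately show "b = b'" using assms(1,2) unfolding inj_on_def by (metis UnE)
  qed
  show "\<forall>b\<in>A \<union> B. P (?k b) b \<and> l <= ?k b \<and> ?k b < n" using assms(3-6) by force
qed

text \<open>Every atom gets the position of one of its occurrences as tag.\<close>

lemma occurrence_tags:
  "nth0 r 0 \<notin> {7, 8} ==> \<exists>\<kappa>. inj_on \<kappa> (snd ` set (lits G)) \<and>
    (\<forall>b\<in>snd ` set (lits G). occurs_at (u @ encode (rename \<sigma> G) @ r) (\<kappa> b) (\<sigma> b) \<and>
      length u <= \<kappa> b \<and> \<kappa> b < length u + length (encode (rename \<sigma> G)))" proof (induction G arbitrary: u r)
  case (Pos b)
  then show ?case using occurs_at_encode[of r u "\<sigma> b"] by (intro exI[of _ "%_. length u"]) auto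
next
  case (Neg b)
  then show ?case using occurs_at_encode[of r "u @ [3]" "\<sigma> b"] by (intro exI[of _ "%_. Suc (length u)"]) auto
next
  case (Conj F G)
  let ?x = "u @ encode (rename \<sigma> (Conj F G)) @ r"
  let ?l = "Suc (length u)" and ?m = "Suc (length u + length (encode (rename \<sigma> F)))"
  have "nth0 ([4] @ encode (rename \<sigma> G) @ [2] @ r) 0 \<notin> {7, 8}" by (simp add: nth0_def)
  from Conj.IH(1)[OF this, of "u @ [1]"] obtain \<kappa> where k: "inj_on \<kappa> (snd ` set (lits F))"
    "\<forall>b\<in>snd ` set (lits F). occurs_at ?x (\<kappa> b) (\<sigma> b) \<and> ?l <= \<kappa> b \<and> \<kappa> b < ?m" by auto
  have "nth0 ([2] @ r) 0 \<notin> {7, 8}" by (simp add: nth0_def)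
  from Conj.IH(2)[OF this, of "u @ [1] @ encode (rename \<sigma> F) @ [4]"] obtain \<kappa>' where k': "inj_on \<kappa>' (snd ` set (lits G))"
    "\<forall>b\<in>snd ` set (lits G). occurs_at ?x (\<kappa>' b) (\<sigma> b) \<and> Suc ?m <= \<kappa>' b \<and>
      \<kappa>' b < Suc (Suc (length u + length (encode (rename \<sigma> F)) + length (encode (rename \<sigma> G))))" by auto
  have k0: "\<forall>b\<in>snd ` set (lits F). occurs_at ?x (\<kappa> b) (\<sigma> b) \<and> length u <= \<kappa> b \<and> \<kappa> b < ?m"
    using k(2) by force
  have k'': "\<forall>b\<in>snd ` set (lits G). occurs_at ?x (\<kappa>' b) (\<sigma> b) \<and> ?m <= \<kappa>' b \<and>
      \<kappa>' b < length u + length (encode (rename \<sigma> (Conj F G)))" using k'(2) by force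
  from merge_tags[OF k(1) k'(1), of "%q b. occurs_at ?x q (\<sigma> b)", OF k0 k''] show ?case by (auto simp: image_Un)
next
  case (Disj F G)
  let ?x = "u @ encode (rename \<sigma> (Disj F G)) @ r"
  let ?l = "Suc (length u)" and ?m = "Suc (length u + length (encode (rename \<sigma> F)))"
  have "nth0 ([5] @ encode (rename \<sigma> G) @ [2] @ r) 0 \<notin> {7, 8}" by (simp add: nth0_def)
  from Disj.IH(1)[OF this, of "u @ [1]"] obtain \<kappa> where k: "inj_on \<kappa> (snd ` set (lits F))"
    "\<forall>b\<in>snd ` set (lits F). occurs_at ?x (\<kappa> b) (\<sigma> b) \<and> ?l <= \<kappa> b \<and> \<kappa> b < ?m" by auto
  have "nth0 ([2] @ r) 0 \<notin> {7, 8}" by (simp add: nth0_def)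
  from Disj.IH(2)[OF this, of "u @ [1] @ encode (rename \<sigma> F) @ [5]"] obtain \<kappa>' where k': "inj_on \<kappa>' (snd ` set (lits G))"
    "\<forall>b\<in>snd ` set (lits G). occurs_at ?x (\<kappa>' b) (\<sigma> b) \<and> Suc ?m <= \<kappa>' b \<and>
      \<kappa>' b < Suc (Suc (length u + length (encode (rename \<sigma> F)) + length (encode (rename \<sigma> G))))" by auto
  have k0: "\<forall>b\<in>snd ` set (lits F). occurs_at ?x (\<kappa> b) (\<sigma> b) \<and> length u <= \<kappa> b \<and> \<kappa> b < ?m"
    using k(2) by force
  have k'': "\<forall>b\<in>snd ` set (lits G). occurs_at ?x (\<kappa>' b) (\<sigma> b) \<and> ?m <= \<kappa>' b \<and>
      \<kappa>' b < length u + length (encode (rename \<sigma> (Disj F G)))" using k'(2) by force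
  from merge_tags[OF k(1) k'(1), of "%q b. occurs_at ?x q (\<sigma> b)", OF k0 k''] show ?case by (auto simp: image_Un)
qed

section \<open>The criterion for membership\<close>

definition bad_tables :: "nat list set" where
  "bad_tables = {w \<in> words 9. \<exists>tb. length tb = length w \<and> set tb \<subseteq> {1, 2} \<and> \<not> good w tb}"

theorem CL5_problem_iff:
  assumes "x \<in> words 8"
  shows "x \<in> CL5_problem \<longleftrightarrow> (\<exists>w p'. guessed x x 0 w p' \<and> nth0 x p' \<notin> {7, 8} \<and> w \<notin> bad_tables)"
proof
  assume "x \<in> CL5_problem"
  then obtain F where F: "x = encode F" "CL5_provable F" by (auto simp: CL5_problem_def)
  then obtain \<sigma> G where G: "rename \<sigma> G = F" "distinct (lits G)" "!!v. ev v G" using CL5_provable_iff by blast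
  obtain \<kappa> where k: "inj_on \<kappa> (snd ` set (lits G))" "!!b. b \<in> snd ` set (lits G) ==> occurs_at x (\<kappa> b) (\<sigma> b)"
    using occurrence_tags[of "[]" G "[]" \<sigma>] F(1) G(1) by (auto simp: nth0_def)
  \<comment> \<open>An atom b of G becomes the pair of the atom of which it is a preimage and the
    position of an occurrence. Since \<kappa> is injective on the atoms of G, renaming by tags keeps
    them apart.\<close>
  define T where "T = rename (%b. prod_encode (\<sigma> b, \<kappa> b)) G"
  have n: "rename name T = F" "rename tag T = rename \<kappa> G"
    unfolding T_def rename_rename G(1)[symmetric] by (auto simp: name_def tag_def intro!: rename_cong)
  have at: "occurs_at x (tag c) (name c)" if "(s, c) \<in> set (lits T)" for s c proof -
    from that obtain b where "(s, b) \<in> set (lits G)" "c = prod_encode (\<sigma> b, \<kappa> b)" by (auto simp: T_def lits_rename)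
    then show ?thesis using k(2)[of b] by (force simp: name_def tag_def)
  qed
  have d: "distinct (lits (rename tag T))" unfolding n lits_rename distinct_map using G(2) k(1) by (auto simp: inj_on_def)
  have t: "ev v (rename tag T)" for v using G(3) by (simp add: n ev_rename)
  have "nth0 x 0 \<notin> {7, 8}" using F(1) by (cases F) (auto simp: nth0_def)
  then have "\<exists>q. nth0 x q \<notin> {7, 8} \<and>
      (\<forall>u w p'. guessed x u q w p' --> guessed x (encode (rename name T) @ u) 0 (tagged T @ w) p')"
    by (intro guessed_complete) (use at in blast)+
  then obtain q where q: "nth0 x q \<notin> {7, 8}"
    "!!u w p'. guessed x u q w p' ==> guessed x (encode (rename name T) @ u) 0 (tagged T @ w) p'" by blast
  have "guessed x x 0 (tagged T) q" using q(2)[OF guessed.nil] n(1) F(1) by simp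
  moreover have "tagged T \<notin> bad_tables" using all_good_iff[of "tagged T"] d t by (auto simp: bad_tables_def)
  ultimately show "\<exists>w p'. guessed x x 0 w p' \<and> nth0 x p' \<notin> {7, 8} \<and> w \<notin> bad_tables" using q(1) by blast
next
  assume "\<exists>w p'. guessed x x 0 w p' \<and> nth0 x p' \<notin> {7, 8} \<and> w \<notin> bad_tables"
  then obtain w p' where w: "guessed x x 0 w p'" "nth0 x p' \<notin> {7, 8}" "w \<notin> bad_tables" by blast
  have x9: "9 \<notin> set x" using assms by (auto simp: words_def in_lists_conv_set)
  have f: "filter (%a. a ~= 9) w = x" using guessed_filter[OF w(1) x9] .
  have "w \<in> words 9" proof -
    have "a \<in> {1..9}" if "a \<in> set w" for a proof (cases "a = 9")
      case False
      then have "a \<in> set x" using f that by auto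
      then show ?thesis using assms by (auto simp: words_def in_lists_conv_set)
    qed simp
    then show ?thesis by (auto simp: words_def in_lists_conv_set)
  qed
  then have "\<forall>tb. length tb = length w \<and> set tb \<subseteq> {1, 2} --> good w tb" using w(3) by (auto simp: bad_tables_def)
  then obtain T where T: "w = tagged T" "distinct (lits (rename tag T))" "!!v. ev v (rename tag T)" unfolding all_good_iff by blast
  have x: "x = encode (rename name T)" using f T(1) filter_tagged by simp
  have at: "occurs_at x (tag c) (name c)" if c: "(s, c) \<in> set (lits T)" for s c proof -
    from guessed_sound[of x x 0 T "[]" p'] w(1) T(1) x9 obtain u' q where *: "guessed x u' q [] p'"
      "nth0 x q \<notin> {7, 8} --> (\<forall>s c. (s, c) \<in> set (lits T) --> occurs_at x (tag c) (name c))" by auto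
    have "q = p'" using *(1) by cases auto
    then show ?thesis using *(2) w(2) c by blast
  qed
  \<comment> \<open>The converse passage: a tag is mapped back to the atom that occurs at this
    position of x.\<close>
  define \<sigma> where "\<sigma> k = (SOME a. occurs_at x k a)" for k
  have "\<sigma> (tag c) = name c" if "(s, c) \<in> set (lits T)" for s c unfolding \<sigma>_def using at[OF that] by (metis occurs_at_unique someI)
  then have "rename \<sigma> (rename tag T) = rename name T" unfolding rename_rename by (intro rename_cong) auto
  then have "CL5_provable (rename name T)" using CL5_provable_iff T(2,3) by blast
  then show "x \<in> CL5_problem" using x by (auto simp: CL5_problem_def)
qed

section \<open>Membership\<close>

definition mk4 :: "tape => tape => tape => tape => tapes" where
  "mk4 a b c d v = (if v = 0 then a else if v = 1 then b else if v = 2 then c else if v = 3 then d else blank_tape)"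

lemma syms_mk4 [simp]:
  "syms (mk4 a b c d) 0 = scan a" "syms (mk4 a b c d) 1 = scan b" "syms (mk4 a b c d) 2 = scan c" "syms (mk4 a b c d) 3 = scan d"
  by (simp_all add: syms_def mk4_def)

lemma act_stay [simp]: "act (scan t, No_Move) t = t" by (simp add: act_keep)

lemma upd_mk4:
  assumes "!!v. 4 <= v ==> f (syms (mk4 a b c d)) v = (syms (mk4 a b c d) v, No_Move)"
  shows "upd f (mk4 a b c d) = (let r = syms (mk4 a b c d) in mk4 (act (f r 0) a) (act (f r 1) b) (act (f r 2) c) (act (f r 3) d))" proof (rule ext)
  fix v :: nat
  consider "v = 0" | "v = 1" | "v = 2" | "v = 3" | "4 <= v" by linarith
  then show "upd f (mk4 a b c d) v = (let r = syms (mk4 a b c d) in mk4 (act (f r 0) a) (act (f r 1) b) (act (f r 2) c) (act (f r 3) d)) v"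
  proof cases
    case 5
    then have "mk4 x y z u v = blank_tape" for x y z u by (simp add: mk4_def)
    then show ?thesis using assms[OF 5] act_stay[of blank_tape] by (simp add: upd_def Let_def syms_def)
  qed (simp_all add: upd_def Let_def mk4_def)
qed

lemma adv_mk4 [simp]: "adv 0 (mk4 a b c d) = mk4 (fst a, snd a + 1) b c d" "adv 1 (mk4 a b c d) = mk4 a (fst b, snd b + 1) c d"
  and rew_mk4 [simp]: "rew 0 (mk4 a b c d) = mk4 (fst a, 0) b c d" "rew 1 (mk4 a b c d) = mk4 a (fst b, 0) c d"
  by (auto simp: adv_def rew_def mk4_def)

lemma input_tapes_mk4: "input_tapes x = mk4 (lst x 0) (lst [] 0) (lst [] 0) (lst [] 0)" by (auto simp: input_tapes_def mk4_def blank_tape_lst)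

lemma iter_sets:
  assumes "!!i. i < n ==> (\<Union>s\<in>SS i. R s) = SS (Suc i)" shows "(\<Union>s\<in>SS 0. iter n R s) = SS n" proof -
  have "j + m = n ==> (\<Union>s\<in>SS j. iter m R s) = SS n" for j m proof (induction m arbitrary: j)
    case (Suc m)
    have "(\<Union>s\<in>SS j. iter (Suc m) R s) = (\<Union>s\<in>(\<Union>s\<in>SS j. R s). iter m R s)" by simp
    also have "(\<Union>s\<in>SS j. R s) = SS (Suc j)" using assms Suc.prems by simp
    finally show ?case using Suc.IH[of "Suc j"] Suc.prems by simp
  qed simp
  then show ?thesis by simp
qed

lemma run_For:
  assumes "length (E v) = n" "SS 0 = {s}" "!!i. i < n ==> (\<Union>s\<in>SS i. adv v ` run E c s) = SS (Suc i)"
  shows "run E (For v c d) s = (\<Union>t\<in>SS n. rew v ` run E d t)"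
  using iter_sets[where n = n and SS = SS and R = "%s. adv v ` run E c s"] assms by simp

lemma run_For_det:
  assumes "length (E v) = n" "S 0 = s" "!!i. i < n ==> adv v ` run E c (S i) = {S (Suc i)}" shows "run E (For v c d) s = rew v ` run E d (S n)"
  using run_For[of E v n "%i. {S i}" s c d] assms by simp

lemma UN_singletons:
  "(!!q. H (h q) = {h' q}) ==> (\<Union>t\<in>{h q | q. P q}. H t) = {h' q | q. P q}" by auto

lemma UN_singletons2:
  "(!!q w. H (h q w) = {h' q w}) ==> (\<Union>t\<in>{h q w | q w. P q w}. H t) = {h' q w | q w. P q w}" by auto blast

definition skip :: com where "skip = Upd stay"

lemma run_skip [simp]: "run E skip s = {s}" by (simp add: skip_def upd_stay)

lemma wfc_skip [simp]: "wfc k G Z E skip" and lps_skip [simp]: "lps skip = {}" by (auto simp: skip_def stay_def)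

lemma act_erase: "act (0, d) (lst (l @ [a]) (int (length l))) = lst l (shift d (int (length l)))"
  by (auto simp: act_def lst_def fun_eq_iff nth_append)

lemma act_write_end: "act (a, No_Move) (lst l (int (length l))) = lst (l @ [a]) (int (length l))"
  by (auto simp: act_def lst_def fun_eq_iff nth_append)

lemma act_blank: "p <= -1 \<or> int (length l) <= p ==> act (0, d) (lst l p) = lst l (shift d p)" by (auto simp: act_def lst_def fun_eq_iff)

lemma scan_nth0: "scan (lst l (int p)) = nth0 l p" by (simp add: scan_lst nth0_def)

lemma act_nth0: "act (nth0 l p, d) (lst l (int p)) = lst l (shift d (int p))" using act_keep_lst[of l "int p" d] by (simp add: scan_nth0)

text \<open>Tape 1 serves as a clock.\<close>

definition rewind2 :: com where
  "rewind2 = Seq (Upd (turn 2 Left_Move)) (Seq (For 1 (Cond (%r. r 2 = 0) skip (Upd (turn 2 Left_Move))) skip) (Upd (turn 2 Right_Move)))"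

lemma turn_mk4:
  "upd (turn 2 m) (mk4 a b c d) = mk4 a b (fst c, shift m (snd c)) d"
  "upd (turn 3 m) (mk4 a b c d) = mk4 a b c (fst d, shift m (snd d))" by (subst upd_mk4; simp add: stay_def act_keep Let_def)+

lemma run_rewind2:
  assumes "E 1 = y" "length l = length y" "0 \<notin> set l" "p <= length l"
  shows "run E rewind2 (mk4 a (lst y 0) (lst l (int p)) d) = {mk4 a (lst y 0) (lst l 0) d}" proof -
  \<comment> \<open>Once on the blank in cell -1 the head stays there; as many ticks as the clock
    has letters suffice because \<open>p <= length l\<close>.\<close>
  let ?S = "%i. mk4 a (lst y (int i)) (lst l (max (int p - 1 - int i) (-1))) d"
  have "run E (For 1 (Cond (%r. r 2 = 0) skip (Upd (turn 2 Left_Move))) skip) (?S 0) =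
      rew 1 ` run E skip (?S (length y))" proof (rule run_For_det[where S = ?S])
    fix i assume "i < length y"
    let ?q = "max (int p - 1 - int i) (-1)"
    show "adv 1 ` run E (Cond (%r. r 2 = 0) skip (Upd (turn 2 Left_Move))) (?S i) = {?S (Suc i)}" proof (cases "?q = -1")
      case True
      then have "max (int p - 1 - int (Suc i)) (-1) = -1" by linarith
      then show ?thesis using True by (simp add: scan_lst add.commute)
    next
      case False
      then have q: "?q = int p - 1 - int i" "0 <= ?q" "?q < int (length l)" using assms(4) by linarith+
      then have "nat ?q < length l" by linarith
      then have "l ! nat ?q ~= 0" using assms(3) by (metis nth_mem)
      then have "scan (lst l ?q) ~= 0" using q by (simp add: scan_lst)
      moreover have "max (int p - 1 - int (Suc i)) (-1) = ?q - 1" using q by linarith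
      ultimately show ?thesis by (simp add: turn_mk4 add.commute)
    qed
  qed (use assms in auto)
  moreover have "max (int p - 1 - int (length y)) (-1) = -1" using assms by linarith
  moreover have "max (int p - 1 - int 0) (-1) = int p - 1" by simp
  ultimately show ?thesis by (simp add: rewind2_def turn_mk4)
qed

lemma wfc_rewind2: "4 <= k ==> 1 \<in> Z ==> 2 \<notin> Z ==> wfc k G Z E rewind2" and lps_rewind2: "lps rewind2 = {1}"
  by (auto simp: rewind2_def stay_def)

text \<open>The stages have their own sets of frozen tapes, so tapes written by the first can drive
  the loops of the second.\<close>

lemma exact_stages:
  assumes "code_at M k G B (Seq c1 c2) q q'" "pre k G L1 Z1 E1 c1 s"
    and "!!t. t \<in> run E1 c1 s ==> pre k G L2 Z2 E2 c2 t" shows "exact (step A M) B (poly (tbound c1) L1 + poly (tbound c2) L2)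
    (cfg k q' ` (\<Union>t\<in>run E1 c1 s. run E2 c2 t)) (cfg k q s)" by (rule exact_seq[OF compile_exact[OF code_at_Seq(1)[OF assms(1)] assms(2)]
        compile_exact[OF code_at_Seq(2)[OF assms(1)] assms(3)] order_refl])

text \<open>Nested loops need different tapes: tape 0 drives the loop over the input, the first copy
  the inner loops, and the second copy carries the head that verifies names.\<close>

definition copy12 :: com where
  "copy12 = For 0 (Upd (%r. (stay r)(1 := (r 0, Right_Move), 2 := (r 0, Right_Move)))) skip"

definition back12 :: com where
  "back12 = For 0 (Upd (%r. (stay r)(1 := (r 1, Left_Move), 2 := (r 2, Left_Move)))) skip"

lemma lst_take_Suc: "i < length x ==> act (nth0 x i, Right_Move) (lst (take i x) (int i)) = lst (take (Suc i) x) (1 + int i)"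
  using act_append[of "x ! i" "take i x"] by (simp add: take_Suc_conv_app_nth min_def add.commute nth0_def)

lemma run_copy12:
  assumes "E 0 = x" shows "run E copy12 (mk4 (lst x 0) (lst [] 0) (lst [] 0) d) = {mk4 (lst x 0) (lst x (int (length x))) (lst x (int (length x))) d}"
proof -
  let ?S = "%i. mk4 (lst x (int i)) (lst (take i x) (int i)) (lst (take i x) (int i)) d"
  have "run E copy12 (?S 0) = rew 0 ` run E skip (?S (length x))" unfolding copy12_def proof (rule run_For_det[where S = ?S])
    fix i assume i: "i < length x"
    show "adv 0 ` run E (Upd (%r. (stay r)(1 := (r 0, Right_Move), 2 := (r 0, Right_Move)))) (?S i) = {?S (Suc i)}"
      unfolding run.simps by (subst upd_mk4) (use i lst_take_Suc in "simp_all add: stay_def Let_def scan_nth0 act_nth0 add.commute")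
  qed (use assms in auto)
  then show ?thesis by simp
qed

lemma run_back12:
  assumes "E 0 = x" shows "run E back12 (mk4 (lst x 0) (lst y (int (length x))) (lst z (int (length x))) d) = {mk4 (lst x 0) (lst y 0) (lst z 0) d}"
proof -
  let ?S = "%i. mk4 (lst x (int i)) (lst y (int (length x) - int i)) (lst z (int (length x) - int i)) d"
  have "run E back12 (?S 0) = rew 0 ` run E skip (?S (length x))" unfolding back12_def proof (rule run_For_det[where S = ?S])
    fix i assume i: "i < length x"
    show "adv 0 ` run E (Upd (%r. (stay r)(1 := (r 1, Left_Move), 2 := (r 2, Left_Move)))) (?S i) = {?S (Suc i)}"
      unfolding run.simps by (subst upd_mk4) (use i in "simp_all add: stay_def Let_def act_keep_lst algebra_simps")
  qed (use assms in auto)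
  then show ?thesis by simp
qed

lemma okst_mk4:
  assumes "set l0 \<subseteq> {..G}" "set l1 \<subseteq> {..G}" "set l2 \<subseteq> {..G}" "set l3 \<subseteq> {..G}" "4 <= k"
  shows "okst k G (mk4 (lst l0 p0) (lst l1 p1) (lst l2 p2) (lst l3 p3))" proof -
  have "fst (lst l p) i <= G" if "set l \<subseteq> {..G}" for l p i proof (cases "0 <= i \<and> i < int (length l)")
    case True
    then have "nat i < length l" by linarith
    then show ?thesis using that nth_mem by (force simp: fst_lst)
  qed (auto simp: fst_lst)
  then show ?thesis using assms by (auto simp: okst_def mk4_def blank_tape_lst)
qed

subsection \<open>The machine that guesses certificates\<close>

text \<open>At each tick the second head either rests or advances while writing a letter 9, so that
  it ends on an arbitrary position with that position in unary on the output tape.\<close>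

definition guess_tag :: com where
  "guess_tag = Seq rewind2
     (Seq (For 1 (Choice skip (Upd (%r. (stay r)(2 := (r 2, Right_Move), 3 := (9, Right_Move))))) skip)
       (Cond (%r. r 2 = 6) (Upd (turn 2 Right_Move)) Fail))"

definition guess_letter :: com where
  "guess_letter = Cond (%r. r 0 = 7 \<or> r 0 = 8)
     (Cond (%r. r 2 = r 0) (Upd (%r. (stay r)(2 := (r 2, Right_Move), 3 := (r 0, Right_Move)))) Fail)
     (Cond (%r. r 2 = 7 \<or> r 2 = 8) Fail
       (Seq (Upd (%r. (stay r)(3 := (r 0, Right_Move)))) (Cond (%r. r 0 = 6) guess_tag skip)))"

definition guess_all :: com where
  "guess_all = Seq (For 0 guess_letter skip) (Cond (%r. r 2 = 7 \<or> r 2 = 8) Fail skip)"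

definition gst :: "nat list => nat => nat => nat list => tapes" where
  "gst x i p u = mk4 (lst x (int i)) (lst x 0) (lst x (int p)) (lst u (int (length u)))"

lemma gst_append: "act (a, Right_Move) (lst u (int (length u))) = lst (u @ [a]) (int (length (u @ [a])))"
  using act_append[of a u] by (simp add: add.commute)

lemma run_guess_tag:
  assumes "E 1 = x" "0 \<notin> set x" "p <= length x" shows "run E guess_tag (gst x i p u) = {gst x i (Suc q) (u @ replicate q 9) | q. nth0 x q = 6}"
proof -
  let ?SS = "%j. {mk4 (lst x (int i)) (lst x (int j)) (lst x (int q)) (lst (u @ replicate q 9) (int (length u + q))) | q. q <= j}"
  let ?c = "Choice skip (Upd (%r. (stay r)(2 := (r 2, Right_Move), 3 := (9, Right_Move))))"
  have upd: "upd (%r. (stay r)(2 := (r 2, Right_Move), 3 := (9, Right_Move)))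
      (mk4 (lst x (int i)) (lst x (int j)) (lst x (int q)) (lst (u @ replicate q 9) (int (length u + q)))) =
    mk4 (lst x (int i)) (lst x (int j)) (lst x (int (Suc q))) (lst (u @ replicate (Suc q) 9) (int (length u + Suc q)))" for j q
    using gst_append[of 9 "u @ replicate q 9"] by (subst upd_mk4) (auto simp: stay_def Let_def act_keep add_ac replicate_append_same)
  have "run E (For 1 ?c skip) (mk4 (lst x (int i)) (lst x 0) (lst x 0) (lst u (int (length u)))) =
    (\<Union>t\<in>?SS (length x). rew 1 ` run E skip t)" proof (rule run_For[where SS = ?SS])
    fix j assume "j < length x"
    show "(\<Union>s\<in>?SS j. adv 1 ` run E ?c s) = ?SS (Suc j)" (is "?A = ?B")
    proof
      have "mk4 (lst x (int i)) (lst x (int j + 1)) (lst x (int q)) (lst (u @ replicate q 9) (int (length u + q))) \<in> ?B"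
        "mk4 (lst x (int i)) (lst x (int j + 1)) (lst x (int (Suc q))) (lst (u @ replicate (Suc q) 9) (int (length u + Suc q))) \<in> ?B"
        if "q <= j" for q using that by (simp add: add.commute, intro exI[of _ q]; simp)
            (simp only: mem_Collect_eq, intro exI[of _ "Suc q"], simp add: that add.commute)
      then show "?A \<subseteq> ?B" by (auto simp: upd simp del: replicate.simps of_nat_Suc of_nat_add)
      show "?B \<subseteq> ?A"
      proof
        fix s assume "s \<in> ?B"
        then obtain q where q: "q <= Suc j"
          "s = mk4 (lst x (int i)) (lst x (int (Suc j))) (lst x (int q)) (lst (u @ replicate q 9) (int (length u + q)))" by blast
        show "s \<in> ?A" proof (cases "q = Suc j")
          case True
          let ?s = "mk4 (lst x (int i)) (lst x (int j)) (lst x (int j)) (lst (u @ replicate j 9) (int (length u + j)))"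
          have "s = adv 1 (upd (%r. (stay r)(2 := (r 2, Right_Move), 3 := (9, Right_Move))) ?s)" unfolding upd q(2) True by (simp add: add.commute)
          moreover have "?s \<in> ?SS j" by blast
          ultimately show ?thesis by (intro UN_I[of ?s]) auto
        next
          case False
          let ?s = "mk4 (lst x (int i)) (lst x (int j)) (lst x (int q)) (lst (u @ replicate q 9) (int (length u + q)))"
          have "s = adv 1 ?s" unfolding q(2) by (simp add: add.commute)
          moreover have "?s \<in> ?SS j" using False q(1) le_Suc_eq by blast
          ultimately show ?thesis by (intro UN_I[of ?s]) auto
        qed
      qed
    qed
  qed (use assms in auto)
  also have "\<dots> = {gst x i q (u @ replicate q 9) | q. q <= length x}" proof -
    have "rew 1 (mk4 (lst x (int i)) (lst x (int j)) (lst x (int q)) (lst (u @ replicate q 9) (int (length u + q)))) = gst x i q (u @ replicate q 9)" for j q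
      by (simp add: gst_def)
    then have r: "rew 1 ` run E skip (mk4 (lst x (int i)) (lst x (int j)) (lst x (int q)) (lst (u @ replicate q 9) (int (length u + q)))) =
        {gst x i q (u @ replicate q 9)}" for j q by simp
    show ?thesis by (rule UN_singletons) (rule r)
  qed
  finally have loop: "run E (For 1 ?c skip) (gst x i 0 u) = {gst x i q (u @ replicate q 9) | q. q <= length x}" by (simp add: gst_def)
  have "run E rewind2 (gst x i p u) = {gst x i 0 u}" unfolding gst_def using run_rewind2[where E = E, OF assms(1) refl assms(2,3)] by simp
  then have "run E guess_tag (gst x i p u) = (\<Union>t\<in>{gst x i q (u @ replicate q 9) | q. q <= length x}.
      run E (Cond (%r. r 2 = 6) (Upd (turn 2 Right_Move)) Fail) t)" by (simp add: guess_tag_def loop del: run.simps(3-7))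
  also have "\<dots> = (\<Union>q\<in>{..length x}. if nth0 x q = 6 then {gst x i (Suc q) (u @ replicate q 9)} else {})"
    by (auto simp: gst_def scan_nth0 turn_mk4 add.commute split: if_splits)
  also have "\<dots> = {gst x i (Suc q) (u @ replicate q 9) | q. nth0 x q = 6}" by (auto simp: nth0_def split: if_splits intro: less_imp_le)
  finally show ?thesis .
qed

lemma guessed_append:
  "guessed x (u @ v) p w p' \<longleftrightarrow> (\<exists>w1 w2 q. w = w1 @ w2 \<and> guessed x u p w1 q \<and> guessed x v q w2 p')"
proof
  show "guessed x (u @ v) p w p' ==> \<exists>w1 w2 q. w = w1 @ w2 \<and> guessed x u p w1 q \<and> guessed x v q w2 p'"
  proof (induction u arbitrary: p w)
    case Nil
    then show ?case using guessed.nil by fastforce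
  next
    case (Cons a u)
    from Cons.prems have "guessed x (a # (u @ v)) p w p'" by simp
    then show ?case proof cases
      case (digit w')
      with Cons.IH[OF digit(4)] show ?thesis using guessed.digit[of a x p u] by (metis append_Cons)
    next
      case (literal q w')
      from Cons.IH[OF literal(5)] obtain w1 w2 q' where "w' = w1 @ w2" "guessed x u (Suc q) w1 q'" "guessed x v q' w2 p'" by blast
      moreover from this have "guessed x (a # u) p (6 # replicate q 9 @ w1) q'" "w = (6 # replicate q 9 @ w1) @ w2"
        using guessed.literal[OF literal(3,4), of u w1 q'] literal by simp_all
      ultimately show ?thesis by blast
    next
      case (other w')
      with Cons.IH[OF other(4)] show ?thesis using guessed.other[of a x p u] by (metis append_Cons)
    qed
  qed
  show "\<exists>w1 w2 q. w = w1 @ w2 \<and> guessed x u p w1 q \<and> guessed x v q w2 p' ==> guessed x (u @ v) p w p'" proof -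
    have "guessed x u p w1 q ==> guessed x v q w2 p' ==> guessed x (u @ v) p (w1 @ w2) p'" for w1 w2 q
      by (induction rule: guessed.induct) (auto intro: guessed.intros)
    then show "\<exists>w1 w2 q. w = w1 @ w2 \<and> guessed x u p w1 q \<and> guessed x v q w2 p' ==> guessed x (u @ v) p w p'" by blast
  qed
qed

lemma run_guess_letter:
  assumes "E 1 = x" "0 \<notin> set x" "p <= length x" "i < length x"
  shows "run E guess_letter (gst x i p u) = {gst x i p' (u @ w) | p' w. guessed x [x ! i] p w p'}" proof -
  let ?a = "x ! i"
  have s: "syms (gst x i p u) 0 = ?a" "syms (gst x i p u) 2 = nth0 x p"
    using assms(4) scan_nth0[of x i] by (simp_all add: gst_def scan_nth0) (simp add: nth0_def)
  have h: "act (?a, No_Move) (lst x (int i)) = lst x (int i)" using act_nth0[of x i No_Move] assms(4) by (simp add: nth0_def)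
  have nil: "guessed x [] q w p' \<longleftrightarrow> w = [] \<and> p' = q" for q w p' by (auto elim: guessed.cases intro: guessed.nil)
  consider "?a = 7 \<or> ?a = 8" | "?a = 6" | "?a \<notin> {6, 7, 8}" by auto
  then show ?thesis proof cases
    case 1
    then have g: "guessed x [?a] p w p' \<longleftrightarrow> nth0 x p = ?a \<and> w = [?a] \<and> p' = Suc p" for w p'
      by (auto elim: guessed.cases simp: nil intro!: guessed.digit guessed.nil)
    have "upd (%r. (stay r)(2 := (r 2, Right_Move), 3 := (r 0, Right_Move))) (gst x i p u) = gst x i (Suc p) (u @ [?a])"
      using gst_append[of ?a u] s unfolding gst_def by (subst upd_mk4) (auto simp: stay_def Let_def act_nth0 h add.commute)
    then show ?thesis using 1 s unfolding g by (auto simp: guess_letter_def)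
  next
    case 2
    then have g: "guessed x [?a] p w p' \<longleftrightarrow> nth0 x p \<notin> {7, 8} \<and> (\<exists>q. nth0 x q = 6 \<and> w = 6 # replicate q 9 \<and> p' = Suc q)" for w p'
      by (auto elim!: guessed.cases simp: nil) (metis append_Nil2 guessed.literal guessed.nil insertE singletonD)
    have h6: "act (6, No_Move) (lst x (int i)) = lst x (int i)" using h 2 by simp
    have up: "upd (%r. (stay r)(3 := (r 0, Right_Move))) (gst x i p u) = gst x i p (u @ [6])" using gst_append[of 6 u] s 2 unfolding gst_def
      by (subst upd_mk4) (auto simp: stay_def Let_def act_nth0 h6 add.commute)
    have s': "syms (gst x i p (u @ [6])) 0 = 6" using assms(4) 2 by (simp add: gst_def scan_nth0 nth0_def)
    have "run E guess_letter (gst x i p u) =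
        (if nth0 x p \<in> {7, 8} then {} else {gst x i (Suc q) ((u @ [6]) @ replicate q 9) | q. nth0 x q = 6})"
      using 2 s s' up run_guess_tag[where E = E, OF assms(1-3), of i "u @ [6]"] by (simp add: guess_letter_def)
    then show ?thesis unfolding g by auto
  next
    case 3
    then have g: "guessed x [?a] p w p' \<longleftrightarrow> nth0 x p \<notin> {7, 8} \<and> w = [?a] \<and> p' = p" for w p'
      by (auto elim: guessed.cases simp: nil intro!: guessed.other guessed.nil)
    have up: "upd (%r. (stay r)(3 := (r 0, Right_Move))) (gst x i p u) = gst x i p (u @ [?a])" using gst_append[of ?a u] s unfolding gst_def
      by (subst upd_mk4) (auto simp: stay_def Let_def act_nth0 h add.commute)
    have s': "syms (gst x i p (u @ [?a])) 0 = ?a" using assms(4) by (simp add: gst_def scan_nth0 nth0_def)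
    show ?thesis using 3 s s' up unfolding g by (auto simp: guess_letter_def)
  qed
qed

lemma guessed_bound: "guessed x u p w p' ==> p <= length x ==> p' <= length x"
  by (induction rule: guessed.induct) (auto simp: nth0_def Suc_le_eq split: if_splits)

lemma run_guess_all:
  assumes "E 0 = x" "E 1 = x" "0 \<notin> set x"
  shows "run E guess_all (gst x 0 0 []) = {gst x 0 p' w | p' w. guessed x x 0 w p' \<and> nth0 x p' \<notin> {7, 8}}" proof -
  let ?SS = "%i. {gst x i p w | p w. guessed x (take i x) 0 w p}"
  have 1: "run E (For 0 guess_letter skip) (gst x 0 0 []) = (\<Union>t\<in>?SS (length x). rew 0 ` run E skip t)" proof (rule run_For[where SS = ?SS])
    show "?SS 0 = {gst x 0 0 []}" by (auto elim: guessed.cases intro: guessed.nil)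
    fix i assume i: "i < length x"
    have adv: "adv 0 (gst x i p w) = gst x (Suc i) p w" for p w by (simp add: gst_def add.commute)
    have "(\<Union>s\<in>?SS i. adv 0 ` run E guess_letter s) =
        {gst x (Suc i) p' (w @ w') | p w p' w'. guessed x (take i x) 0 w p \<and> guessed x [x ! i] p w' p'}" proof -
      have "run E guess_letter (gst x i p w) = {gst x i p' (w @ w') | p' w'. guessed x [x ! i] p w' p'}"
        if "guessed x (take i x) 0 w p" for p w using run_guess_letter[where E = E, OF assms(2,3) _ i] guessed_bound[OF that] by simp
      then show ?thesis by (auto simp: adv[symmetric]) blast+
    qed
    also have "\<dots> = ?SS (Suc i)" unfolding take_Suc_conv_app_nth[OF i] guessed_append by blast
    finally show "(\<Union>s\<in>?SS i. adv 0 ` run E guess_letter s) = ?SS (Suc i)" .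
  qed (use assms in simp)
  have rew: "rew 0 (gst x i p w) = gst x 0 p w" for i p w by (simp add: gst_def)
  have 2: "run E (For 0 guess_letter skip) (gst x 0 0 []) = {gst x 0 p w | p w. guessed x x 0 w p}"
    unfolding 1 take_all[OF order_refl] by (rule UN_singletons2) (simp add: rew)
  have 3: "syms (gst x 0 p w) 2 = nth0 x p" for p w by (simp add: gst_def scan_nth0)
  show ?thesis unfolding guess_all_def run.simps(2) 2 by (auto simp: 3 split: if_splits) blast
qed

lemma wf_guess:
  "wfc 4 9 {0} E copy12" "wfc 4 9 {0} E back12" "lps copy12 = {0}" "lps back12 = {0}"
  "wfc 4 9 {0, 1} E guess_all" "lps guess_all = {0, 1}"
  by (auto simp: copy12_def back12_def guess_all_def guess_letter_def guess_tag_def stay_def wfc_rewind2 lps_rewind2)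

subsection \<open>The machine that refutes certificates\<close>

definition put :: "nat => com" where
  "put a = Upd (%r. (stay r)(3 := (a, No_Move)))"

definition push :: "nat => com" where
  "push a = Seq (Upd (turn 3 Right_Move)) (put a)"

text \<open>A popped symbol is erased from the tape and remembered by the branch of the program:
  \<open>reduce2\<close> is entered with the parity of the right operand, \<open>reduce3\<close>
  with the result.\<close>

definition reduce3 :: "nat => com" where
  "reduce3 v = Seq (Upd (%r. (stay r)(3 := (0, Left_Move)))) (Cond (%r. r 3 = 1) (put v) (put 14))"

definition reduce2 :: "nat => com" where
  "reduce2 v = Seq (Upd (%r. (stay r)(3 := (0, Left_Move))))
     (Cond (%r. is_op (r 3)) (Cond (%r. odd (combine (r 3) v)) (reduce3 11) (reduce3 10)) (put 14))"

text \<open>The minimum with 21 keeps the written symbols inside the alphabet for every reading, as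
  \<open>wfc\<close> demands; on the readings that arise it changes nothing.\<close>

definition eval_letter :: com where
  "eval_letter =
     Cond (%r. r 0 = 1) (push 1) (Cond (%r. r 0 = 3) (push 3)
       (Cond (%r. r 0 = 6) (Seq (Cond (%r. r 3 = 3) (put 16) (push 6)) rewind2)
         (Cond (%r. r 0 = 2) (Cond (%r. is_val (r 3)) (Cond (%r. odd (r 3)) (reduce2 1) (reduce2 0)) (put 14))
           (Upd (%r. (stay r)(2 := (min 21 (new_entry (r 0) (r 3) (r 2)), if r 0 = 9 \<and> is_lit (r 3) then Right_Move else No_Move),
              3 := (min 21 (new_top (r 0) (r 3) (r 2)), No_Move)))))))"

text \<open>The test is inverted: a run fails on a true value directly above the bottom and succeeds
  otherwise, so that accepting means refuting.\<close>

definition eval_all :: com where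
  "eval_all = Seq (For 0 eval_letter skip)
     (Cond (%r. r 3 = 11 \<or> r 3 = 13) (Seq (Upd (turn 3 Left_Move)) (Cond (%r. r 3 = 15) Fail skip)) skip)"

definition guess_table :: com where
  "guess_table = Seq (For 0 (Seq (Upd (%r. (stay r)(1 := (r 0, Right_Move))))
       (Choice (Upd (%r. (stay r)(2 := (1, Right_Move)))) (Upd (%r. (stay r)(2 := (2, Right_Move)))))) skip)
     (Seq back12 (put 15))"

definition stk :: "nat list => tape" where
  "stk st = lst (rev st) (int (length st) - 1)"

definition est :: "nat list => nat => estate => tapes" where
  "est w i S = mk4 (lst w (int i)) (lst w 0) (lst (fst (snd S)) (int (snd (snd S)))) (stk (fst S))"

text \<open>Only an error symbol can replace the bottom 15, which occurs nowhere else. Hence a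
  proper value or operator always has a symbol below it, and finding 15 below the top shows that the
  stack has two symbols.\<close>

definition stack_ok :: "nat list => bool" where
  "stack_ok st \<longleftrightarrow> st ~= [] \<and> last st \<in> {14, 15} \<and> 15 \<notin> set (butlast st) \<and> set st \<subseteq> {..21}"

definition est_ok :: "nat list => nat => estate => bool" where
  "est_ok w i S \<longleftrightarrow> stack_ok (fst S) \<and> length (fst (snd S)) = length w \<and> set (fst (snd S)) \<subseteq> {1..8} \<and> snd (snd S) <= i"

lemma scan_stk: "scan (stk (s # st)) = s" by (simp add: stk_def scan_lst nth_append)

lemma act_stk: "act (a, No_Move) (stk (s # st)) = stk (a # st)" using act_write[of "int (length st)" "rev st @ [s]" a No_Move]
  by (simp add: stk_def list_update_append)

lemma erase_stk: "act (0, Left_Move) (stk (s # st)) = stk st" using act_erase[of Left_Move "rev st" s] by (simp add: stk_def)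

lemma push_stk: "act (a, No_Move) (fst (stk st), snd (stk st) + 1) = stk (a # st)" using act_write_end[of a "rev st"] by (simp add: stk_def)

lemma run_put: "run E (put v) (mk4 a b c (stk (s # st))) = {mk4 a b c (stk (v # st))}"
  unfolding put_def run.simps by (subst upd_mk4) (auto simp: stay_def Let_def act_stk)

lemma run_push: "run E (push v) (mk4 a b c (stk st)) = {mk4 a b c (stk (v # st))}" unfolding push_def run.simps put_def turn_mk4
  by (simp, subst upd_mk4) (auto simp: stay_def Let_def push_stk)

lemma run_erase: "upd (%r. (stay r)(3 := (0, Left_Move))) (mk4 a b c (stk (s # st))) = mk4 a b c (stk st)"
  by (subst upd_mk4) (auto simp: stay_def Let_def erase_stk)

lemma run_reduce3: "run E (reduce3 v) (mk4 a b c (stk (d # s # st))) = {mk4 a b c (stk ((if s = 1 then v else 14) # st))}"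
  by (simp add: reduce3_def run_erase scan_stk run_put)

lemma run_reduce2:
  assumes "is_op d ==> st ~= []" "odd v = odd u" shows "run E (reduce2 v) (mk4 a b c (stk (u # d # st))) =
    {mk4 a b c (stk (if is_op d then (if hd st = 1 then combine d u else 14) # tl st else 14 # st))}" proof -
  have c: "combine d v = combine d u" using assms(2) by (simp add: combine_def)
  have o: "odd (combine d u) ==> combine d u = 11" "even (combine d u) ==> combine d u = 10" proof -
    have "combine d u = 10 \<or> combine d u = 11" by (simp add: combine_def of_bool_def)
    then show "odd (combine d u) ==> combine d u = 11" "even (combine d u) ==> combine d u = 10" by auto
  qed
  show ?thesis proof (cases "is_op d")
    case True
    then obtain s st' where "st = s # st'" using assms(1) by (cases st) auto
    then show ?thesis using True c o by (auto simp: reduce2_def run_erase scan_stk run_reduce3)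
  next
    case False
    then show ?thesis by (simp add: reduce2_def run_erase scan_stk run_put)
  qed
qed

lemma new_top_bound: "s <= 21 ==> new_top a s e <= 21" by (auto simp: new_top_def is_val_def)

lemma new_entry_bound: "1 <= e ==> e <= 8 ==> 1 <= new_entry a s e \<and> new_entry a s e <= 8" proof -
  assume e: "1 <= e" "e <= 8"
  then have "e \<in> {1, 2, 3, 4, 5, 6, 7, 8}" by auto
  then show ?thesis by (auto simp: new_entry_def fresh_lit_def)
qed

lemma new_entry_0: "new_entry a s 0 = 0" by (simp add: new_entry_def fresh_lit_def)

lemma stack_ok_top: "stack_ok (s # st) ==> s \<notin> {14, 15} ==> st ~= [] \<and> stack_ok st" by (cases st) (auto simp: stack_ok_def)

lemma stack_ok_push: "stack_ok st ==> a <= 21 ==> a ~= 15 ==> stack_ok (a # st)" by (auto simp: stack_ok_def)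

lemma stack_ok_error: "stack_ok (s # st) ==> stack_ok (14 # st)" by (cases st) (auto simp: stack_ok_def)

lemma run_eval_letter:
  assumes "est_ok w i S" "i < length w" "E 1 = w"
  shows "run E eval_letter (est w i S) = {est w i (estep S (w ! i))} \<and> est_ok w (Suc i) (estep S (w ! i))" proof -
  obtain s st tb p where S: "S = (s # st, tb, p)" using assms(1) by (cases S) (auto simp: est_ok_def stack_ok_def neq_Nil_conv)
  let ?a = "w ! i"
  have ok: "stack_ok (s # st)" "length tb = length w" "set tb \<subseteq> {1..8}" "p <= i" "s <= 21"
    using assms(1) S by (auto simp: est_ok_def stack_ok_def)
  have e: "est w i (st', tb', q) = mk4 (lst w (int i)) (lst w 0) (lst tb' (int q)) (stk st')" for st' tb' q by (simp add: est_def)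
  have a: "scan (lst w (int i)) = ?a" using assms(2) by (simp add: scan_nth0 nth0_def)
  have 0: "0 \<notin> set tb" using ok(3) by auto
  note rw = run_rewind2[where E = E, OF assms(3) ok(2) 0]
  consider "?a = 1" | "?a = 3" | "?a = 6" | "?a = 2" "is_val s" | "?a = 2" "\<not> is_val s" | "?a \<notin> {1, 2, 3, 6}" by auto
  then show ?thesis proof cases
    case 1
    then show ?thesis using ok S a stack_ok_push[OF ok(1), of 1] by (simp add: e eval_letter_def run_push est_ok_def)
  next
    case 2
    then show ?thesis using ok S a stack_ok_push[OF ok(1), of 3] by (simp add: e eval_letter_def run_push est_ok_def)
  next
    case 3
    have r: "run E rewind2 (mk4 (lst w (int i)) (lst w 0) (lst tb (int p)) d) = {mk4 (lst w (int i)) (lst w 0) (lst tb 0) d}" for d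
      using rw ok(2,4) assms(2) by simp
    show ?thesis proof (cases "s = 3")
      case True
      have "stack_ok (16 # st)" using stack_ok_top[OF ok(1)] True stack_ok_push by simp
      then show ?thesis using True 3 ok S a r by (simp add: e eval_letter_def run_put scan_stk est_ok_def)
    next
      case False
      have "stack_ok (6 # s # st)" using stack_ok_push[OF ok(1)] by simp
      then show ?thesis using False 3 ok S a r by (simp add: e eval_letter_def run_push scan_stk est_ok_def)
    qed
  next
    case 4
    have t: "st ~= []" "stack_ok st" using stack_ok_top[OF ok(1)] 4(2) by (auto simp: is_val_def)
    then obtain d st' where st: "st = d # st'" by (cases st) auto
    have t': "is_op d ==> st' ~= [] \<and> stack_ok st'" using stack_ok_top[of d st'] t(2) st by (auto simp: is_op_def)
    have red: "reduce (s # st) = (if is_op d then (if hd st' = 1 then combine d s else 14) # tl st' else 14 # st')"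
      using 4 st by (simp add: reduce_def)
    have "stack_ok (reduce (s # st))" proof (cases "is_op d")
      case True
      obtain o1 st2 where st2: "st' = o1 # st2" using t' True by (cases st') auto
      have "stack_ok (combine d s # st2)" if "o1 = 1"
        using that t' True st2 stack_ok_top[of o1 st2] stack_ok_push[of st2 "combine d s"] by (auto simp: combine_def)
      moreover have "stack_ok (14 # st2)" using t' True st2 stack_ok_error[of o1 st2] by simp
      ultimately show ?thesis using red True st2 by auto
    next
      case False
      then show ?thesis using red t(2) st stack_ok_error by auto
    qed
    moreover have "run E eval_letter (est w i S) = {est w i (reduce (s # st), tb, p)}"
      using 4 S a st t' run_reduce2[of d st' 1 s E] run_reduce2[of d st' 0 s E] unfolding red by (auto simp: e eval_letter_def scan_stk)
    ultimately show ?thesis using 4 S ok by (simp add: est_ok_def)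
  next
    case 5
    then have "reduce (s # st) = 14 # st" by (simp add: reduce_def)
    then show ?thesis using 5 S ok a stack_ok_error[OF ok(1)] by (simp add: e eval_letter_def run_put scan_stk est_ok_def)
  next
    case 6
    let ?e = "nth0 tb p"
    let ?tb = "tb[p := new_entry ?a s ?e]" and ?s = "new_top ?a s ?e" and ?m = "if ?a = 9 \<and> is_lit s then Right_Move else No_Move"
    have E: "estep S ?a = (?s # st, ?tb, if ?a = 9 \<and> is_lit s then p + 1 else p)" using 6 S by auto
    have le: "new_entry ?a s ?e <= 8" proof (cases "p < length tb")
      case True
      then have "?e \<in> set tb" by (simp add: nth0_def)
      then show ?thesis using ok(3) new_entry_bound[of ?e ?a s] by force
    qed (simp add: nth0_def new_entry_0)
    have table: "act (new_entry ?a s ?e, ?m) (lst tb (int p)) = lst ?tb (int (if ?a = 9 \<and> is_lit s then p + 1 else p))"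
    proof (cases "p < length tb")
      case True
      then show ?thesis using act_write[of "int p" tb "new_entry ?a s ?e" ?m] by simp
    next
      case False
      then show ?thesis using act_blank[of "int p" tb ?m] by (simp add: nth0_def new_entry_0 list_update_beyond)
    qed
    have n: "nth0 w i = ?a" using assms(2) by (simp add: nth0_def)
    have "min 21 (new_entry ?a s ?e) = new_entry ?a s ?e" "min 21 ?s = ?s" using le new_top_bound[OF ok(5)] by simp_all
    moreover have "upd (%r. (stay r)(2 := (min 21 (new_entry (r 0) (r 3) (r 2)), if r 0 = 9 \<and> is_lit (r 3) then Right_Move else No_Move),
              3 := (min 21 (new_top (r 0) (r 3) (r 2)), No_Move))) (mk4 (lst w (int i)) (lst w 0) (lst tb (int p)) (stk (s # st))) =
       mk4 (lst w (int i)) (lst w 0) (act (min 21 (new_entry (nth0 w i) s ?e), if nth0 w i = 9 \<and> is_lit s then Right_Move else No_Move) (lst tb (int p)))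
         (stk (min 21 (new_top (nth0 w i) s ?e) # st))"
      by (subst upd_mk4) (simp_all add: stay_def Let_def scan_stk scan_nth0 act_stk act_nth0 split del: if_split)
    ultimately have "run E eval_letter (est w i S) = {mk4 (lst w (int i)) (lst w 0) (act (new_entry ?a s ?e, ?m) (lst tb (int p))) (stk (?s # st))}"
      using 6 S a unfolding n by (simp add: e eval_letter_def split del: if_split)
    then have "run E eval_letter (est w i S) = {est w i (estep S ?a)}" unfolding table E e .
    moreover have "set ?tb \<subseteq> {1..8}" proof (cases "p < length tb")
      case True
      then have "?e \<in> set tb" by (simp add: nth0_def)
      then have "new_entry ?a s ?e \<in> {1..8}" using ok(3) new_entry_bound[of ?e ?a s] by force
      then show ?thesis using ok(3) set_update_subset_insert[of tb p] by fastforce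
    qed (use ok(3) in \<open>simp add: list_update_beyond\<close>)
    moreover have "stack_ok (?s # st)" proof (cases "s \<in> {14, 15}")
      case True
      then have "?s = 14" by (auto simp: new_top_def is_lit_def is_val_def fresh_lit_def)
      then show ?thesis using stack_ok_error[OF ok(1)] by simp
    next
      case False
      then have "?s ~= 15" by (auto simp: new_top_def is_lit_def split: if_splits)
      then show ?thesis using stack_ok_top[OF ok(1) False] stack_ok_push new_top_bound[OF ok(5)] by blast
    qed
    ultimately show ?thesis using ok unfolding E by (simp add: est_ok_def)
  qed
qed

lemma run_eval_all:
  assumes "length tb = length w" "set tb \<subseteq> {1, 2}" "E 0 = w" "E 1 = w"
  shows "run E eval_all (est w 0 ([15], tb, 0)) ~= {} \<longleftrightarrow> \<not> good w tb" proof -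
  let ?S = "%i. foldl estep ([15], tb, 0) (take i w)"
  have ok: "est_ok w i (?S i)" if "i <= length w" for i using that proof (induction i)
    case 0
    have "set tb \<subseteq> {1..8}" using assms(2) by auto
    then show ?case using assms(1) by (simp add: est_ok_def stack_ok_def)
  next
    case (Suc i)
    then show ?case using run_eval_letter[of w i "?S i" E] assms(4) by (simp add: take_Suc_conv_app_nth)
  qed
  have "run E (For 0 eval_letter skip) (est w 0 ([15], tb, 0)) = rew 0 ` run E skip (est w (length w) (?S (length w)))"
  proof (rule run_For_det[where S = "%i. est w i (?S i)"])
    fix i assume i: "i < length w"
    have "run E eval_letter (est w i (?S i)) = {est w i (?S (Suc i))}"
      using run_eval_letter[where E = E, OF ok i assms(4)] i by (simp add: take_Suc_conv_app_nth)
    then show "adv 0 ` run E eval_letter (est w i (?S i)) = {est w (Suc i) (?S (Suc i))}" by (simp add: est_def add.commute)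
  qed (use assms in simp_all)
  also have "\<dots> = {est w 0 (foldl estep ([15], tb, 0) w)}" by (simp add: est_def)
  finally have 1: "run E (For 0 eval_letter skip) (est w 0 ([15], tb, 0)) = {est w 0 (foldl estep ([15], tb, 0) w)}" .
  obtain s st tb' p where S: "foldl estep ([15], tb, 0) w = (s # st, tb', p)"
    using ok[of "length w"] by (cases "foldl estep ([15], tb, 0) w") (auto simp: est_ok_def stack_ok_def neq_Nil_conv)
  have sok: "stack_ok (s # st)" using ok[of "length w"] S by (simp add: est_ok_def)
  have e: "est w 0 (s # st, tb', p) = mk4 (lst w 0) (lst w 0) (lst tb' (int p)) (stk (s # st))" by (simp add: est_def)
  let ?final = "Cond (%r. r 3 = 11 \<or> r 3 = 13) (Seq (Upd (turn 3 Left_Move)) (Cond (%r. r 3 = 15) Fail skip)) skip"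
  have all: "run E eval_all (est w 0 ([15], tb, 0)) = run E ?final (est w 0 (s # st, tb', p))"
    unfolding eval_all_def run.simps(2)[of E "For 0 eval_letter skip"] 1 S UN_insert UN_empty Un_empty_right ..
  have "run E eval_all (est w 0 ([15], tb, 0)) = {} \<longleftrightarrow> (s = 11 \<or> s = 13) \<and> st = [15]" proof (cases "s = 11 \<or> s = 13")
    case True
    then obtain t st' where st: "st = t # st'" using stack_ok_top[OF sok] by (cases st) auto
    have "upd (turn 3 Left_Move) (mk4 a b c (stk (s # st))) = mk4 a b c (lst (rev st @ [s]) (int (length st) - 1))" for a b c
      by (simp add: turn_mk4 stk_def)
    moreover have "scan (lst (rev st @ [s]) (int (length st) - 1)) = t" using st by (simp add: scan_lst nth_append)
    ultimately have "run E eval_all (est w 0 ([15], tb, 0)) = {} \<longleftrightarrow> t = 15" using True unfolding all e by (simp add: scan_stk)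
    moreover have "t = 15 \<longleftrightarrow> st = [15]" using stack_ok_top[OF sok] True st by (cases st') (auto simp: stack_ok_def)
    ultimately show ?thesis using True by simp
  next
    case False
    then show ?thesis unfolding all e by (simp add: scan_stk)
  qed
  then show ?thesis using S by (auto simp: good_def)
qed

lemma run_guess_table:
  assumes "E 0 = w" shows "run E guess_table (input_tapes w) = {est w 0 ([15], tb, 0) | tb. length tb = length w \<and> set tb \<subseteq> {1, 2}}"
proof -
  let ?SS = "%i. {mk4 (lst w (int i)) (lst (take i w) (int i)) (lst tb (int i)) (lst [] 0) | tb. length tb = i \<and> set tb \<subseteq> {1, 2}}"
  let ?c = "Seq (Upd (%r. (stay r)(1 := (r 0, Right_Move))))
       (Choice (Upd (%r. (stay r)(2 := (1, Right_Move)))) (Upd (%r. (stay r)(2 := (2, Right_Move)))))"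
  have "run E (For 0 ?c skip) (mk4 (lst w 0) (lst [] 0) (lst [] 0) (lst [] 0)) = (\<Union>t\<in>?SS (length w). rew 0 ` run E skip t)"
  proof (rule run_For[where SS = ?SS])
    fix i assume i: "i < length w"
    have c: "adv 0 ` run E ?c (mk4 (lst w (int i)) (lst (take i w) (int i)) (lst tb (int i)) (lst [] 0)) =
       (%b. mk4 (lst w (int (Suc i))) (lst (take (Suc i) w) (int (Suc i))) (lst (tb @ [b]) (int (Suc i))) (lst [] 0)) ` {1, 2}"
      if tb: "length tb = i" for tb proof -
      have 1: "upd (%r. (stay r)(1 := (r 0, Right_Move))) (mk4 (lst w (int i)) (lst (take i w) (int i)) (lst tb (int i)) (lst [] 0)) =
        mk4 (lst w (int i)) (lst (take (Suc i) w) (int (Suc i))) (lst tb (int i)) (lst [] 0)"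
        by (subst upd_mk4) (use i lst_take_Suc[OF i] in "simp_all add: stay_def Let_def scan_nth0 act_nth0")
      have 2: "upd (%r. (stay r)(2 := (b, Right_Move))) (mk4 x y (lst tb (int i)) z) = mk4 x y (lst (tb @ [b]) (int (Suc i))) z" for b x y z
        using act_append[of b tb] tb by (subst upd_mk4) (simp_all add: stay_def Let_def add.commute)
      show ?thesis by (simp add: 1 2 add.commute insert_commute)
    qed
    show "(\<Union>s\<in>?SS i. adv 0 ` run E ?c s) = ?SS (Suc i)" (is "?A = ?B")
    proof
      show "?A \<subseteq> ?B"
      proof
        fix s assume "s \<in> ?A"
        then obtain tb where tb: "length tb = i" "set tb \<subseteq> {1, 2}"
          "s \<in> adv 0 ` run E ?c (mk4 (lst w (int i)) (lst (take i w) (int i)) (lst tb (int i)) (lst [] 0))" by blast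
        then obtain b where "b \<in> {1, 2}" "s = mk4 (lst w (int (Suc i))) (lst (take (Suc i) w) (int (Suc i))) (lst (tb @ [b]) (int (Suc i))) (lst [] 0)"
          unfolding c[OF tb(1)] by blast
        then show "s \<in> ?B" using tb(1,2) by (intro CollectI exI[of _ "tb @ [b]"]) auto
      qed
      show "?B \<subseteq> ?A"
      proof
        fix s assume "s \<in> ?B"
        then obtain tb' where tb': "length tb' = Suc i" "set tb' \<subseteq> {1, 2}"
          "s = mk4 (lst w (int (Suc i))) (lst (take (Suc i) w) (int (Suc i))) (lst tb' (int (Suc i))) (lst [] 0)" by blast
        then obtain tb b where tb: "tb' = tb @ [b]" "length tb = i" by (metis length_Suc_conv_rev)
        have "s \<in> adv 0 ` run E ?c (mk4 (lst w (int i)) (lst (take i w) (int i)) (lst tb (int i)) (lst [] 0))"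
          unfolding c[OF tb(2)] using tb' tb by auto
        then show "s \<in> ?A" using tb' tb by (intro UN_I[OF CollectI]) auto
      qed
    qed
  qed (use assms in auto)
  also have "\<dots> = {mk4 (lst w 0) (lst w (int (length w))) (lst tb (int (length w))) (lst [] 0) | tb. length tb = length w \<and> set tb \<subseteq> {1, 2}}"
    by auto
  finally have 1: "run E (For 0 ?c skip) (input_tapes w) =
      {mk4 (lst w 0) (lst w (int (length w))) (lst tb (int (length w))) (lst [] 0) | tb. length tb = length w \<and> set tb \<subseteq> {1, 2}}"
    unfolding input_tapes_mk4 .
  have 2: "run E (put 15) (mk4 a b c (lst [] 0)) = {mk4 a b c (stk [15])}" for a b c
    unfolding put_def run.simps using act_write_end[of 15 "[]"] by (subst upd_mk4) (simp_all add: stay_def Let_def stk_def)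
  show ?thesis unfolding guess_table_def run.simps(2)[of E _ "Seq back12 (put 15)"] 1 by (auto simp: run_back12[where E = E, OF assms] 2 est_def)
qed

lemma wf_eval:
  "wfc 4 21 {0} E guess_table" "lps guess_table = {0}" "wfc 4 21 {0, 1} E eval_all" "lps eval_all = {0, 1}" proof -
  show "wfc 4 21 {0} E guess_table" "lps guess_table = {0}" by (auto simp: guess_table_def back12_def put_def stay_def)
  show "wfc 4 21 {0, 1} E eval_all"
    by (auto simp: eval_all_def eval_letter_def put_def push_def reduce2_def reduce3_def stay_def wfc_rewind2 lps_rewind2)
  show "lps eval_all = {0, 1}" by (auto simp: eval_all_def eval_letter_def put_def push_def reduce2_def reduce3_def lps_rewind2)
qed

lemma frz_mk4:
  assumes "0 \<notin> set x" "length x <= L" "E 0 = x" "E 1 = x"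
  shows "frz {0} E L (mk4 (lst x 0) b c d)" "frz {0, 1} E L (mk4 (lst x 0) (lst x 0) c d)" using assms by (auto simp: frz_def mk4_def)

lemma bad_tables_NP: "bad_tables \<in> NP 9" proof -
  let ?c = "Seq guess_table eval_all"
  let ?M = "machine_of 4 21 ?c (csize ?c) (csize ?c + 3)"
  let ?p = "tbound guess_table + tbound eval_all"
  have main: "(\<forall>n C. (step {} ?M ^^ n) (initial ?M w) C --> n <= poly ?p (length w)) \<and>
      (accepts {} ?M w \<longleftrightarrow> w \<in> bad_tables)" if w: "w \<in> words 9" for w proof -
    let ?E = "%v :: nat. w"
    have l: "0 \<notin> set w" "set w \<subseteq> {..21}" using w by (auto simp: words_def in_lists_conv_set)
    have "exact (step {} ?M) (inner ?c) (poly (tbound guess_table) (length w) + poly (tbound eval_all) (length w))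
      (cfg 4 (csize ?c) ` (\<Union>t\<in>run ?E guess_table (input_tapes w). run ?E eval_all t)) (cfg 4 0 (input_tapes w))" proof (rule exact_stages)
      show "code_at ?M 4 21 (inner ?c) ?c 0 (csize ?c)" by (rule code_at_machine_of) simp
      show "pre 4 21 (length w) {0} ?E guess_table (input_tapes w)"
        using frz_mk4(1)[OF l(1), of _ ?E] okst_input_tapes[OF l(2), of 4] wf_eval by (simp add: pre_def input_tapes_mk4)
          (simp add: mk4_def)
      fix t assume "t \<in> run ?E guess_table (input_tapes w)"
      then obtain tb where tb: "t = est w 0 ([15], tb, 0)" "length tb = length w" "set tb \<subseteq> {1, 2}" using run_guess_table[of ?E w] by auto
      have "okst 4 21 t" unfolding tb(1) est_def stk_def using l(2) tb(3) by (intro okst_mk4) auto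
      then show "pre 4 21 (length w) {0, 1} ?E eval_all t"
        using frz_mk4(2)[OF l(1), of _ ?E] wf_eval tb(1) by (simp add: pre_def est_def) (simp add: mk4_def)
    qed
    then have ex: "exact (step {} ?M) (inner ?c) (poly ?p (length w))
      (cfg 4 (csize ?c) ` (\<Union>t\<in>run ?E guess_table (input_tapes w). run ?E eval_all t)) (initial ?M w)"
      using initial_machine_of[of 4 21 ?c] by simp
    have "(\<Union>t\<in>run ?E guess_table (input_tapes w). run ?E eval_all t) ~= {} \<longleftrightarrow> w \<in> bad_tables"
      using run_eval_all[of _ w ?E] w unfolding run_guess_table[of ?E w, OF refl] bad_tables_def by auto
    then show ?thesis using nondeterministic_machine[OF ex] by simp
  qed
  have "bad_tables \<subseteq> words 9" by (auto simp: bad_tables_def)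
  moreover have "wf_machine ?M" by (rule wf_machine_of) simp
  ultimately show ?thesis using main unfolding NP_def NP_oracle_def by blast
qed

lemma encode_words: "encode F \<in> words 8" using set_encode[of F] by (auto simp: words_def in_lists_conv_set)

theorem CL5_problem_Sigma2p: "CL5_problem \<in> Sigma2p 8" proof -
  let ?c1 = "Seq copy12 back12"
  let ?c = "Seq ?c1 guess_all"
  let ?M = "machine_of 4 9 ?c (csize ?c + 1) (csize ?c)"
  let ?p = "tbound ?c1 + tbound guess_all + 1"
  have main: "(\<forall>n C. (step bad_tables ?M ^^ n) (initial ?M x) C --> n <= poly ?p (length x)) \<and>
      (accepts bad_tables ?M x \<longleftrightarrow> x \<in> CL5_problem)" if x: "x \<in> words 8" for x proof -
    let ?E = "%v :: nat. x"
    have l: "0 \<notin> set x" "set x \<subseteq> {..9}" using x by (auto simp: words_def in_lists_conv_set)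
    have r1: "run ?E ?c1 (input_tapes x) = {gst x 0 0 []}" by (simp add: input_tapes_mk4 run_copy12 run_back12 gst_def)
    have "exact (step bad_tables ?M) (inner ?c) (poly (tbound ?c1) (length x) + poly (tbound guess_all) (length x))
      (cfg 4 (csize ?c) ` (\<Union>t\<in>run ?E ?c1 (input_tapes x). run ?E guess_all t)) (cfg 4 0 (input_tapes x))" proof (rule exact_stages)
      show "code_at ?M 4 9 (inner ?c) ?c 0 (csize ?c)" by (rule code_at_machine_of) simp
      show "pre 4 9 (length x) {0} ?E ?c1 (input_tapes x)"
        using frz_mk4(1)[OF l(1), of _ ?E] okst_input_tapes[OF l(2), of 4] wf_guess by (simp add: pre_def input_tapes_mk4)
          (simp add: mk4_def)
      fix t assume "t \<in> run ?E ?c1 (input_tapes x)"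
      then have t: "t = gst x 0 0 []" unfolding r1 by simp
      have "okst 4 9 t" unfolding t gst_def using l(2) by (intro okst_mk4) auto
      then show "pre 4 9 (length x) {0, 1} ?E guess_all t"
        using frz_mk4(2)[OF l(1), of _ ?E] wf_guess t by (simp add: pre_def gst_def) (simp add: mk4_def)
    qed
    then have ex: "exact (step bad_tables ?M) (inner ?c) (poly (tbound ?c1) (length x) + poly (tbound guess_all) (length x))
      (cfg 4 (csize ?c) ` run ?E guess_all (gst x 0 0 [])) (initial ?M x)" using initial_machine_of[of 4 9 ?c] unfolding r1 by simp
    have "(\<exists>s\<in>run ?E guess_all (gst x 0 0 []). tape_word (s (4 - 1)) \<notin> bad_tables) \<longleftrightarrow> x \<in> CL5_problem"
    proof -
      have "tape_word (gst x 0 p w (4 - 1)) = w" if "guessed x x 0 w p" for p w proof -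
        have "0 \<notin> set w"
        proof
          assume "0 \<in> set w"
          then have "0 \<in> set (filter (%a. a ~= 9) w)" by simp
          moreover have "9 \<notin> set x" using x by (auto simp: words_def in_lists_conv_set)
          ultimately show False using guessed_filter[OF that] l(1) by simp
        qed
        then show ?thesis by (simp add: gst_def mk4_def tape_word_lst)
      qed
      then have "(\<exists>s\<in>{gst x 0 p' w | p' w. guessed x x 0 w p' \<and> nth0 x p' \<notin> {7, 8}}. tape_word (s (4 - 1)) \<notin> bad_tables) \<longleftrightarrow>
          (\<exists>w p'. guessed x x 0 w p' \<and> nth0 x p' \<notin> {7, 8} \<and> w \<notin> bad_tables)" by fastforce
      then show ?thesis unfolding CL5_problem_iff[OF x] run_guess_all[of ?E x, OF refl refl l(1)] .
    qed
    then show ?thesis using query_machine[OF ex] by (simp add: algebra_simps)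
  qed
  have "CL5_problem \<subseteq> words 8" using encode_words by (auto simp: CL5_problem_def)
  moreover have "wf_machine ?M" by (rule wf_machine_of) simp
  ultimately have "CL5_problem \<in> NP_oracle bad_tables 8" using main unfolding NP_oracle_def by blast
  then show ?thesis using bad_tables_NP unfolding Sigma2p_def by blast
qed

section \<open>Formula templates\<close>

text \<open>Atoms are named by lists of numbers, written in binary as their unary encoding behind a leading
  digit one.\<close>

definition unary :: "nat list => nat list" where
  "unary l = concat (map (%a. replicate a 8 @ [7]) l)"

definition atom :: "nat list => nat" where
  "atom l = foldl (%n a. 2 * n + (a - 7)) 1 (unary l)"

lemma set_unary: "set (unary l) \<subseteq> {7, 8}" by (auto simp: unary_def)

lemma encode_nat_foldl:
  "0 < n ==> set ds \<subseteq> {7, 8} ==> encode_nat (foldl (%n a. 2 * n + (a - 7)) n ds) = encode_nat n @ ds" proof (induction ds arbitrary: n)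
  case (Cons d ds)
  then show ?case using encode_nat_double[of n "d - 7"] by auto
qed simp

lemma encode_atom: "encode_nat (atom l) = 8 # unary l" using encode_nat_foldl[of 1 "unary l"] set_unary by (simp add: atom_def)

lemma unary_inj: "unary l = unary m ==> l = m" proof (induction l arbitrary: m)
  case Nil
  then show ?case by (cases m) (auto simp: unary_def)
next
  case (Cons a l)
  then obtain b m' where m: "m = b # m'" by (cases m) (auto simp: unary_def)
  have tw: "takeWhile (%x. x = 8) (replicate n 8 @ 7 # xs) = replicate n (8 :: nat)" for n xs by (induction n) auto
  have eq: "replicate a 8 @ 7 # unary l = replicate b 8 @ 7 # unary m'" using Cons.prems m by (simp add: unary_def)
  then have "replicate a (8 :: nat) = replicate b 8" using tw by metis
  then have "a = b" by (metis length_replicate)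
  then show ?case using eq Cons.IH m by simp
qed

lemma inj_atom: "inj atom" using encode_atom unary_inj by (metis injI list.inject)

lemma atom_eq_iff [simp]: "atom l = atom m \<longleftrightarrow> l = m" using inj_atom by (simp add: inj_eq)

definition unatom :: "nat => nat list" where "unatom = inv atom"

lemma unatom_atom [simp]: "unatom (atom l) = l" by (simp add: unatom_def inj_atom)

text \<open>Each component of the name of an atom is a sum; \<open>Letter v\<close> is the letter of the tape \<open>v\<close> at the
  current position \<open>Idx v\<close>.\<close>

datatype summand = Cst nat | Idx nat | Letter nat

type_synonym comps = "summand list list"

datatype tmpl = TLit bool comps | TConj tmpl tmpl | TDisj tmpl tmpl | TAll nat tmpl | TEx nat tmpl

primrec sval :: "(nat => nat list) => (nat => nat) => summand => nat" where
  "sval E e (Cst c) = c"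
| "sval E e (Idx v) = e v"
| "sval E e (Letter v) = nth0 (E v) (e v)"

definition cval :: "(nat => nat list) => (nat => nat) => summand list => nat" where
  "cval E e ss = sum_list (map (sval E e) ss)"

definition names :: "(nat => nat list) => (nat => nat) => comps => nat list" where
  "names E e cs = map (cval E e) cs"

text \<open>A loop over a word of length m has m + 1 members, one for each position including the
  blank behind the word. The program \<open>For\<close> treats that blank separately, and there the
  last member is printed.\<close>

primrec chain :: "(formula => formula => formula) => (nat => formula) => nat => nat => formula" where
  "chain C f p 0 = f p"
| "chain C f p (Suc m) = C (f p) (chain C f (Suc p) m)"

primrec interp :: "(nat => nat list) => tmpl => (nat => nat) => formula" where
  "interp E (TLit s cs) e = (if s then Pos (atom (names E e cs)) else Neg (atom (names E e cs)))"
| "interp E (TConj a b) e = Conj (interp E a e) (interp E b e)"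
| "interp E (TDisj a b) e = Disj (interp E a e) (interp E b e)"
| "interp E (TAll v a) e = chain Conj (%p. interp E a (e(v := p))) 0 (length (E v))"
| "interp E (TEx v a) e = chain Disj (%p. interp E a (e(v := p))) 0 (length (E v))"

text \<open>The two literals of an atom are evaluated independently because in an instance without
  repeated literals they may belong to different atoms.\<close>

primrec evl :: "(bool \<times> nat => bool) => formula => bool" where
  "evl w (Pos a) = w (True, a)"
| "evl w (Neg a) = w (False, a)"
| "evl w (Conj F G) = (evl w F \<and> evl w G)"
| "evl w (Disj F G) = (evl w F \<or> evl w G)"

lemma ev_evl: "ev v F = evl (%(s, a). v a = s) F" by (induction F) auto

lemma evl_mono: "evl w F ==> (!!l. l \<in> set (lits F) ==> w l ==> w' l) ==> evl w' F" by (induction F) auto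

lemma evl_chain_Conj: "evl w (chain Conj f p m) \<longleftrightarrow> (\<forall>q. p <= q \<and> q <= p + m --> evl w (f q))"
proof (induction m arbitrary: p)
  case (Suc m)
  have "(\<forall>q. p <= q \<and> q <= p + Suc m --> evl w (f q)) \<longleftrightarrow> evl w (f p) \<and> (\<forall>q. Suc p <= q \<and> q <= Suc p + m --> evl w (f q))"
  proof -
    have "p <= q \<and> q <= p + Suc m \<longleftrightarrow> q = p \<or> Suc p <= q \<and> q <= Suc p + m" for q by linarith
    then show ?thesis by metis
  qed
  then show ?case using Suc by simp
qed (auto dest: le_antisym)

lemma evl_chain_Disj: "evl w (chain Disj f p m) \<longleftrightarrow> (\<exists>q. p <= q \<and> q <= p + m \<and> evl w (f q))"
proof (induction m arbitrary: p)
  case (Suc m)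
  have "(\<exists>q. p <= q \<and> q <= p + Suc m \<and> evl w (f q)) \<longleftrightarrow> evl w (f p) \<or> (\<exists>q. Suc p <= q \<and> q <= Suc p + m \<and> evl w (f q))"
  proof -
    have "p <= q \<and> q <= p + Suc m \<longleftrightarrow> q = p \<or> Suc p <= q \<and> q <= Suc p + m" for q by linarith
    then show ?thesis by metis
  qed
  then show ?case using Suc by simp
qed (auto dest: le_antisym)

lemma evl_TAll: "evl w (interp E (TAll v a) e) \<longleftrightarrow> (\<forall>p\<le>length (E v). evl w (interp E a (e(v := p))))"
  and evl_TEx: "evl w (interp E (TEx v a) e) \<longleftrightarrow> (\<exists>p\<le>length (E v). evl w (interp E a (e(v := p))))"
  by (simp_all add: evl_chain_Conj evl_chain_Disj)

lemma lits_chain: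
  assumes "!!F G. lits (C F G) = lits F @ lits G" shows "lits (chain C f p m) = concat (map (%q. lits (f q)) [p..<p + Suc m])"
proof (induction m arbitrary: p)
  case (Suc m)
  have "[p..<p + Suc (Suc m)] = p # [Suc p..<Suc p + Suc m]" by (simp add: upt_conv_Cons)
  then show ?case using Suc assms by (simp del: upt_Suc)
qed (simp add: assms)

lemma set_lits_loop:
  "set (lits (interp E (TAll v a) e)) = (\<Union>p\<le>length (E v). set (lits (interp E a (e(v := p)))))"
  "set (lits (interp E (TEx v a) e)) = (\<Union>p\<le>length (E v). set (lits (interp E a (e(v := p)))))"
  by (auto simp: lits_chain atLeast0LessThan less_Suc_eq_le simp del: upt_Suc)

lemma distinct_concat_map:
  assumes "distinct xs" "!!x. x \<in> set xs ==> distinct (f x)"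
    "!!x y z. x \<in> set xs ==> y \<in> set xs ==> z \<in> set (f x) ==> z \<in> set (f y) ==> x = y" shows "distinct (concat (map f xs))"
  using assms proof (induction xs)
  case (Cons x xs)
  have "distinct (concat (map f xs))" using Cons.prems by (intro Cons.IH) auto
  moreover have "set (f x) \<inter> set (concat (map f xs)) = {}" proof (rule ccontr)
    assume "\<not> ?thesis"
    then obtain z y where "z \<in> set (f x)" "y \<in> set xs" "z \<in> set (f y)" by auto
    then have "x = y" using Cons.prems(3) by auto
    then show False using Cons.prems(1) \<open>y \<in> set xs\<close> by simp
  qed
  ultimately show ?case using Cons.prems(2) by simp
qed simp

section \<open>Distinctness of the literals of a template\<close>

definition all_lits :: "(nat => nat list) => ((nat => nat) => bool => nat list => bool) => tmpl => bool" where
  "all_lits E P a \<longleftrightarrow> (\<forall>e s b. (s, b) \<in> set (lits (interp E a e)) --> (\<exists>l. b = atom l \<and> P e s l))"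

lemma all_lits_simps [simp]:
  "all_lits E P (TLit s cs) \<longleftrightarrow> (\<forall>e. P e s (names E e cs))"
  "all_lits E P (TConj a b) \<longleftrightarrow> all_lits E P a \<and> all_lits E P b"
  "all_lits E P (TDisj a b) \<longleftrightarrow> all_lits E P a \<and> all_lits E P b" proof -
  show "all_lits E P (TConj a b) \<longleftrightarrow> all_lits E P a \<and> all_lits E P b"
    "all_lits E P (TDisj a b) \<longleftrightarrow> all_lits E P a \<and> all_lits E P b"
    unfolding all_lits_def interp.simps lits.simps set_append Un_iff by blast+
  show "all_lits E P (TLit s cs) \<longleftrightarrow> (\<forall>e. P e s (names E e cs))" by (cases s) (auto simp: all_lits_def)
qed

lemma all_lits_loop:
  assumes "all_lits E P a" "!!e p s l. p <= length (E v) ==> P (e(v := p)) s l ==> Q e s l" shows "all_lits E Q (TAll v a)" "all_lits E Q (TEx v a)"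
proof -
  have "\<exists>l. b = atom l \<and> Q e s l" if m: "(s, b) \<in> set (lits (interp E a (e(v := p))))" "p <= length (E v)" for e s b p proof -
    obtain l where "b = atom l" "P (e(v := p)) s l" using assms(1) m unfolding all_lits_def by blast
    then show ?thesis using assms(2) m(2) by blast
  qed
  then show "all_lits E Q (TAll v a)" "all_lits E Q (TEx v a)" unfolding all_lits_def set_lits_loop by blast+
qed

lemma all_lits_mono: "all_lits E P a ==> (!!e s l. P e s l ==> Q e s l) ==> all_lits E Q a" unfolding all_lits_def by blast

lemma all_litsD:
  assumes "all_lits E P a" "(s, b) \<in> set (lits (interp E a e))" shows "P e s (unatom b) \<and> b = atom (unatom b)" proof -
  obtain l where "b = atom l" "P e s l" using assms unfolding all_lits_def by blast
  then show ?thesis by simp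
qed

definition separated :: "(nat => nat list) => tmpl => bool" where
  "separated E a \<longleftrightarrow> (\<forall>e. distinct (lits (interp E a e)))"

lemma separated_lit [simp]: "separated E (TLit s cs)" by (simp add: separated_def)

lemma separated_binary:
  assumes "separated E a" "separated E b" "all_lits E P a" "all_lits E Q b" "!!e s l. P e s l ==> Q e s l ==> False"
  shows "separated E (TConj a b)" "separated E (TDisj a b)" proof -
  have "set (lits (interp E a e)) \<inter> set (lits (interp E b e)) = {}" for e
    using all_litsD[OF assms(3)] all_litsD[OF assms(4)] assms(5) by fastforce
  then show "separated E (TConj a b)" "separated E (TDisj a b)" using assms(1,2) by (auto simp: separated_def)
qed

text \<open>The function g recovers the loop position from the name of a literal, so different
  iterations cannot share one.\<close>

lemma separated_loop:
  assumes "separated E a" "all_lits E (%e s l. g l = e v) a" shows "separated E (TAll v a)" "separated E (TEx v a)" proof -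
  have "distinct (concat (map (%p. lits (interp E a (e(v := p)))) [0..<0 + Suc (length (E v))]))" for e proof (rule distinct_concat_map)
    fix p q z assume "z \<in> set (lits (interp E a (e(v := p))))" "z \<in> set (lits (interp E a (e(v := q))))"
    then show "p = q" using all_litsD[OF assms(2)] by (metis fun_upd_same surj_pair)
  qed (use assms(1) in \<open>auto simp: separated_def simp del: upt_Suc\<close>)
  then show "separated E (TAll v a)" "separated E (TEx v a)" by (simp_all add: separated_def lits_chain del: upt_Suc)
qed

definition exs :: "nat list => tmpl => tmpl" where
  "exs vs a = foldr TEx vs a"

lemma exs_simps [simp]: "exs [] a = a" "exs (v # vs) a = TEx v (exs vs a)" by (simp_all add: exs_def)

primrec upds :: "(nat => nat) => nat list => nat list => nat => nat" where
  "upds e [] xs = e"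
| "upds e (v # vs) xs = upds (e(v := hd xs)) vs (tl xs)"

lemma upds_other: "v \<notin> set vs ==> upds e vs xs v = e v" by (induction vs arbitrary: e xs) auto

lemma map_upds: "distinct vs ==> length xs = length vs ==> map (upds e vs xs) vs = xs" proof (induction vs arbitrary: e xs)
  case (Cons v vs)
  then show ?case by (cases xs) (auto simp: upds_other)
qed simp

lemma evl_exs:
  assumes "!!v. v \<in> set vs ==> length (E v) = R" shows "evl w (interp E (exs vs a) e) \<longleftrightarrow>
    (\<exists>xs. length xs = length vs \<and> set xs \<subseteq> {..R} \<and> evl w (interp E a (upds e vs xs)))" using assms
proof (induction vs arbitrary: e)
  case (Cons v vs)
  have "evl w (interp E (exs (v # vs) a) e) \<longleftrightarrow> (\<exists>p\<le>R. evl w (interp E (exs vs a) (e(v := p))))"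
    using Cons.prems[of v] by (simp add: evl_TEx del: interp.simps)
  also have "\<dots> \<longleftrightarrow> (\<exists>p\<le>R. \<exists>xs. length xs = length vs \<and> set xs \<subseteq> {..R} \<and> evl w (interp E a (upds (e(v := p)) vs xs)))"
    using Cons.IH Cons.prems by simp
  also have "\<dots> \<longleftrightarrow> (\<exists>xs. length xs = length (v # vs) \<and> set xs \<subseteq> {..R} \<and> evl w (interp E a (upds e (v # vs) xs)))"
    (is "?L \<longleftrightarrow> ?R")
  proof
    assume ?L
    then obtain p xs where "p <= R" "length xs = length vs" "set xs \<subseteq> {..R}" "evl w (interp E a (upds (e(v := p)) vs xs))" by blast
    then show ?R by (intro exI[of _ "p # xs"]) simp
  next
    assume ?R
    then obtain xs where xs: "length xs = length (v # vs)" "set xs \<subseteq> {..R}" "evl w (interp E a (upds e (v # vs) xs))" by blast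
    then obtain p ys where "xs = p # ys" by (cases xs) auto
    then show ?L using xs by auto
  qed
  finally show ?case .
qed simp

lemma all_lits_exs:
  assumes "all_lits E P a" "!!e p s l v. v \<in> set vs ==> P (e(v := p)) s l ==> P e s l" shows "all_lits E P (exs vs a)" using assms
proof (induction vs)
  case (Cons v vs)
  have "all_lits E P (exs vs a)" proof (rule Cons.IH[OF Cons.prems(1)])
    show "P e s l" if "u \<in> set vs" "P (e(u := p)) s l" for e p s l u using Cons.prems(2)[OF _ that(2)] that(1) by simp
  qed
  then have "all_lits E P (TEx v (exs vs a))" by (rule all_lits_loop(2)) (rule Cons.prems(2)[of v], simp)
  then show ?case by simp
qed simp

lemma separated_exs:
  assumes "separated E a" "distinct vs" "all_lits E (%e s l. g l = map e ws) a" "set vs \<subseteq> set ws" shows "separated E (exs vs a)"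
  using assms(2,4) proof (induction vs)
  case (Cons v vs)
  have v: "v \<in> set ws" "v \<notin> set vs" using Cons.prems by auto
  then obtain j where j: "j < length ws" "ws ! j = v" by (auto simp: in_set_conv_nth)
  have "all_lits E (%e s l. g l ! j = e v) a" using assms(3) j unfolding all_lits_def by (metis nth_map)
  then have "all_lits E (%e s l. g l ! j = e v) (exs vs a)" by (rule all_lits_exs) (use v in auto)
  then show ?case using separated_loop(2) Cons by simp
qed (simp add: assms(1))

lemma rename_chain:
  assumes "!!F G. rename \<rho> (C F G) = C (rename \<rho> F) (rename \<rho> G)"
  shows "rename \<rho> (chain C f p m) = chain C (%q. rename \<rho> (f q)) p m" by (induction m arbitrary: p) (simp_all add: assms)

lemma rename_loop:
  assumes "!!e. rename \<rho> (interp E a e) = interp E b e" shows "rename \<rho> (interp E (TEx v a) e) = interp E (TEx v b) e"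
  using assms by (simp add: rename_chain)

lemma rename_exs:
  assumes "!!e. rename \<rho> (interp E a e) = interp E b e" shows "rename \<rho> (interp E (exs vs a) e) = interp E (exs vs b) e" using assms
proof (induction vs arbitrary: e)
  case (Cons v vs)
  have "rename \<rho> (interp E (exs vs a) e) = interp E (exs vs b) e" for e using Cons.IH[OF Cons.prems] by simp
  from rename_loop[of \<rho> E "exs vs a" "exs vs b", OF this] show ?case by simp
qed simp

section \<open>From alternating quantifiers to provability\<close>

primrec relit :: "(bool \<times> nat => nat) => formula => formula" where
  "relit \<theta> (Pos a) = Pos (\<theta> (True, a))"
| "relit \<theta> (Neg a) = Neg (\<theta> (False, a))"
| "relit \<theta> (Conj F G) = Conj (relit \<theta> F) (relit \<theta> G)"
| "relit \<theta> (Disj F G) = Disj (relit \<theta> F) (relit \<theta> G)"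

lemma relit_cong: "(!!l. l \<in> set (lits F) ==> \<theta> l = \<eta> l) ==> relit \<theta> F = relit \<eta> F" by (induction F) auto

lemma lits_relit: "lits (relit \<theta> F) = map (%l. (fst l, \<theta> l)) (lits F)" by (induction F) auto

lemma ev_relit: "ev v (relit \<theta> F) = evl (%l. v (\<theta> l) = fst l) F" by (induction F) auto

lemma relit_append:
  assumes "G1 = relit \<theta> F1" "\<forall>l\<in>set (lits F1). \<sigma> (\<theta> l) = \<rho> (snd l)" "G2 = relit \<eta> F2" "\<forall>l\<in>set (lits F2). \<sigma> (\<eta> l) = \<rho> (snd l)"
    "distinct (lits F1 @ lits F2)"
  shows "\<exists>\<theta>. G1 = relit \<theta> F1 \<and> G2 = relit \<theta> F2 \<and> (\<forall>l\<in>set (lits F1 @ lits F2). \<sigma> (\<theta> l) = \<rho> (snd l))"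
proof -
  let ?t = "%l. if l \<in> set (lits F1) then \<theta> l else \<eta> l"
  have "relit ?t F1 = G1" "relit ?t F2 = G2" unfolding assms(1,3) using assms(5) by (auto intro!: relit_cong)
  then show ?thesis using assms by (intro exI[of _ ?t]) auto
qed

text \<open>Both formulas have the same shape. As F repeats no literal, the atoms of G at
  corresponding places are a function of the literals of F.\<close>

lemma relit_exists:
  assumes "rename \<sigma> G = rename \<rho> F" "distinct (lits F)"
  shows "\<exists>\<theta>. G = relit \<theta> F \<and> (\<forall>l\<in>set (lits F). \<sigma> (\<theta> l) = \<rho> (snd l))" using assms
proof (induction F arbitrary: G)
  case (Pos a)
  then obtain b where "G = Pos b" "\<sigma> b = \<rho> a" by (cases G) auto
  then show ?case by (intro exI[of _ "%_. b"]) simp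
next
  case (Neg a)
  then obtain b where "G = Neg b" "\<sigma> b = \<rho> a" by (cases G) auto
  then show ?case by (intro exI[of _ "%_. b"]) simp
next
  case (Conj F1 F2)
  then obtain G1 G2 where G: "G = Conj G1 G2" "rename \<sigma> G1 = rename \<rho> F1" "rename \<sigma> G2 = rename \<rho> F2" by (cases G) auto
  have "distinct (lits F1)" "distinct (lits F2)" "distinct (lits F1 @ lits F2)" using Conj.prems(2) by simp_all
  with Conj.IH(1)[OF G(2)] Conj.IH(2)[OF G(3)] obtain \<theta> \<eta> where "G1 = relit \<theta> F1" "\<forall>l\<in>set (lits F1). \<sigma> (\<theta> l) = \<rho> (snd l)"
    "G2 = relit \<eta> F2" "\<forall>l\<in>set (lits F2). \<sigma> (\<eta> l) = \<rho> (snd l)" "distinct (lits F1 @ lits F2)" by blast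
  from relit_append[OF this] show ?case using G(1) by auto
next
  case (Disj F1 F2)
  then obtain G1 G2 where G: "G = Disj G1 G2" "rename \<sigma> G1 = rename \<rho> F1" "rename \<sigma> G2 = rename \<rho> F2" by (cases G) auto
  have "distinct (lits F1)" "distinct (lits F2)" "distinct (lits F1 @ lits F2)" using Disj.prems(2) by simp_all
  with Disj.IH(1)[OF G(2)] Disj.IH(2)[OF G(3)] obtain \<theta> \<eta> where "G1 = relit \<theta> F1" "\<forall>l\<in>set (lits F1). \<sigma> (\<theta> l) = \<rho> (snd l)"
    "G2 = relit \<eta> F2" "\<forall>l\<in>set (lits F2). \<sigma> (\<eta> l) = \<rho> (snd l)" "distinct (lits F1 @ lits F2)" by blast
  from relit_append[OF this] show ?case using G(1) by auto
qed

text \<open>A variable is a list of six numbers.  Its occurrences in the matrix are the atoms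
  \<open>[kind, sign] @ occ @ var\<close> (kind 0: existential, 1: universal; \<open>occ\<close> a list of seven numbers), all of them
  positive.  The gadgets read the matrix atoms from the other side.  For a universal variable they ensure
  that either all positive or all negative occurrences are true.  An existential variable has
  one literal \<open>Neg [2] @ var\<close> but two dual ones, and the choice of its partner decides
  whether the positive or the negative occurrences are made true.\<close>

definition var_tapes :: "nat list" where "var_tapes = [7, 8, 9, 10, 11, 12]"
definition occ_tapes :: "nat list" where "occ_tapes = [13, 14, 15, 16, 17, 18, 19]"

abbreviation idxs :: "nat list => comps" where "idxs vs \<equiv> map (%v. [Idx v]) vs"

definition occ_gadget :: "nat => nat => tmpl" where
  "occ_gadget kd sg = exs occ_tapes (TLit False ([[Cst kd], [Cst sg]] @ idxs (occ_tapes @ var_tapes)))"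

definition univ_gadget :: tmpl where
  "univ_gadget = exs var_tapes (TConj (occ_gadget 1 1) (occ_gadget 1 0))"

definition exist_gadget :: "nat => nat => tmpl" where
  "exist_gadget c d = exs var_tapes (TDisj (TLit False ([Cst 2] # idxs var_tapes))
     (TDisj (TConj (TLit True ([Cst c] # idxs var_tapes)) (occ_gadget 0 1))
            (TConj (TLit True ([Cst d] # idxs var_tapes)) (occ_gadget 0 0))))"

text \<open>The choice c = d = 2 gives the formula of the reduction, in which a positive literal is
  repeated. The choice 3 and 4 gives its two occurrences names of their own, which makes all
  literals distinct; every instance is then described by a map on the literals of this
  version.\<close>

definition with_gadgets :: "tmpl => nat => nat => tmpl" where
  "with_gadgets \<phi> c d = TDisj \<phi> (TDisj univ_gadget (exist_gadget c d))"

definition matrix_lit :: "bool => nat list => bool" where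
  "matrix_lit s l \<longleftrightarrow> s \<and> length l = 15 \<and> l ! 0 < 2 \<and> l ! 1 < 2"

definition holds :: "(nat => nat list => bool) => bool \<times> nat => bool" where
  "holds val = (%(s, b). val (unatom b ! 0) (drop 9 (unatom b)) = (unatom b ! 1 = 1))"

lemma names_idxs [simp]: "names E e (idxs vs) = map e vs" by (simp add: names_def cval_def)

lemma names_Cons [simp]: "names E e (c # cs) = cval E e c # names E e cs" by (simp add: names_def)

lemma names_append [simp]: "names E e (cs @ ds) = names E e cs @ names E e ds" by (simp add: names_def)

lemma names_Nil [simp]: "names E e [] = []" by (simp add: names_def)

lemma cval_single [simp]: "cval E e [s] = sval E e s" by (simp add: cval_def)

context
  fixes E :: "nat => nat list" and R :: nat
  assumes gadget_tapes: "!!v. v \<in> set (occ_tapes @ var_tapes) ==> length (E v) = R"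
begin

definition occurs :: "(bool \<times> nat => bool) => nat => nat => nat list => bool" where
  "occurs w kd sg x \<longleftrightarrow> (\<exists>oc. length oc = 7 \<and> set oc \<subseteq> {..R} \<and> w (False, atom ([kd, sg] @ oc @ x)))"

lemma map_gadget_tapes:
  "length oc = 7 ==> map (upds e occ_tapes oc) occ_tapes = oc" "map (upds e occ_tapes oc) var_tapes = map e var_tapes"
  "length x = 6 ==> map (upds e var_tapes x) var_tapes = x" "length occ_tapes = 7" "length var_tapes = 6"
  using map_upds[of occ_tapes oc e] map_upds[of var_tapes x e] by (auto simp: occ_tapes_def var_tapes_def upds_other)

lemma evl_occ_gadget: "evl w (interp E (occ_gadget kd sg) e) \<longleftrightarrow> occurs w kd sg (map e var_tapes)"
  unfolding occ_gadget_def occurs_def by (subst evl_exs[where R = R]) (simp_all add: gadget_tapes map_gadget_tapes del: map_eq_conv cong: conj_cong)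

lemma evl_univ_gadget:
  "evl w (interp E univ_gadget e) \<longleftrightarrow> (\<exists>x. length x = 6 \<and> set x \<subseteq> {..R} \<and> occurs w 1 1 x \<and> occurs w 1 0 x)"
  unfolding univ_gadget_def
  by (subst evl_exs[where R = R]) (simp_all add: gadget_tapes map_gadget_tapes evl_occ_gadget del: map_eq_conv cong: conj_cong)

lemma evl_exist_gadget:
  "evl w (interp E (exist_gadget c d) e) \<longleftrightarrow> (\<exists>x. length x = 6 \<and> set x \<subseteq> {..R} \<and> (w (False, atom (2 # x)) \<or>
    w (True, atom (c # x)) \<and> occurs w 0 1 x \<or> w (True, atom (d # x)) \<and> occurs w 0 0 x))" unfolding exist_gadget_def
  by (subst evl_exs[where R = R]) (simp_all add: gadget_tapes map_gadget_tapes evl_occ_gadget del: map_eq_conv cong: conj_cong)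

text \<open>The variable occupies the last six components of a name, both in names of length 7 and
  in names of length 15.\<close>

definition var_key :: "nat list => nat list" where "var_key l = rev (take 6 (rev l))"

lemma var_key: "length x = 6 ==> var_key (y @ x) = x" by (simp add: var_key_def)

lemma occ_gadget_lits:
  "all_lits E (%e s l. \<not> s \<and> length l = 15 \<and> l ! 0 = kd \<and> l ! 1 = sg \<and> var_key l = map e var_tapes) (occ_gadget kd sg)"
  unfolding occ_gadget_def proof (rule all_lits_exs)
  show "all_lits E (%e s l. \<not> s \<and> length l = 15 \<and> l ! 0 = kd \<and> l ! 1 = sg \<and> var_key l = map e var_tapes)
     (TLit False ([[Cst kd], [Cst sg]] @ idxs (occ_tapes @ var_tapes)))"
    using var_key[of "map e var_tapes" "kd # sg # map e occ_tapes" for e] by (simp add: occ_tapes_def var_tapes_def)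
qed (auto simp: occ_tapes_def var_tapes_def)

lemma occ_gadget_separated: "separated E (occ_gadget kd sg)" unfolding occ_gadget_def
proof (rule separated_exs[where ws = occ_tapes and g = "%l. take 7 (drop 2 l)"])
  show "all_lits E (%e s l. take 7 (drop 2 l) = map e occ_tapes) (TLit False ([[Cst kd], [Cst sg]] @ idxs (occ_tapes @ var_tapes)))"
    by (simp add: occ_tapes_def)
qed (simp_all add: occ_tapes_def)

lemma univ_gadget_separated: "separated E univ_gadget" unfolding univ_gadget_def proof (rule separated_exs[where ws = var_tapes and g = var_key])
  show "separated E (TConj (occ_gadget 1 1) (occ_gadget 1 0))"
    by (rule separated_binary(1)[OF occ_gadget_separated occ_gadget_separated occ_gadget_lits occ_gadget_lits]) simp
  show "all_lits E (%e s l. var_key l = map e var_tapes) (TConj (occ_gadget 1 1) (occ_gadget 1 0))"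
    unfolding all_lits_simps(2) by (intro conjI all_lits_mono[OF occ_gadget_lits]) simp_all
qed (simp_all add: var_tapes_def)

lemma univ_gadget_lits: "all_lits E (%e s l. \<not> s \<and> l ! 0 = 1) univ_gadget" unfolding univ_gadget_def
  by (rule all_lits_exs) (unfold all_lits_simps(2), intro conjI all_lits_mono[OF occ_gadget_lits], simp_all)

lemma exist_gadget_lits:
  "all_lits E (%e s l. \<not> s \<and> l ! 0 = 0 \<or> \<not> s \<and> l ! 0 = 2 \<or> s \<and> l ! 0 = c \<or> s \<and> l ! 0 = d) (exist_gadget c d)"
  unfolding exist_gadget_def by (rule all_lits_exs) (unfold all_lits_simps, intro conjI all_lits_mono[OF occ_gadget_lits], simp_all)

lemma exist_gadget_separated: "separated E (exist_gadget 3 4)" unfolding exist_gadget_def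
proof (rule separated_exs[where ws = var_tapes and g = var_key])
  let ?lit = "%s c. TLit s ([Cst c] # idxs var_tapes)"
  have lit: "all_lits E (%e s' l. s' = s \<and> length l = 7 \<and> l ! 0 = c \<and> var_key l = map e var_tapes) (?lit s c)" for s c
    using var_key[of "map e var_tapes" "[c]" for e] by (simp add: var_tapes_def)
  have conj: "separated E (TConj (?lit True c) (occ_gadget 0 sg))" for c sg
    by (rule separated_binary(1)[OF separated_lit occ_gadget_separated lit occ_gadget_lits]) simp
  have clit: "all_lits E (%e s l. (s \<and> l ! 0 = c \<or> \<not> s \<and> l ! 0 = 0 \<and> l ! 1 = sg) \<and> var_key l = map e var_tapes) (TConj (?lit True c) (occ_gadget 0 sg))" for c sg
    unfolding all_lits_simps(2) by (intro conjI all_lits_mono[OF lit[of True c]] all_lits_mono[OF occ_gadget_lits[of 0 sg]]) auto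
  have disj: "separated E (TDisj (TConj (?lit True 3) (occ_gadget 0 1)) (TConj (?lit True 4) (occ_gadget 0 0)))"
    by (rule separated_binary(2)[OF conj conj clit clit]) auto
  have dlit: "all_lits E (%e s l. (s \<or> \<not> s \<and> l ! 0 = 0) \<and> var_key l = map e var_tapes)
      (TDisj (TConj (?lit True 3) (occ_gadget 0 1)) (TConj (?lit True 4) (occ_gadget 0 0)))" unfolding all_lits_simps(3)
    by (intro conjI all_lits_mono[OF clit[of 3 1]] all_lits_mono[OF clit[of 4 0]]) auto
  show "separated E (TDisj (?lit False 2) (TDisj (TConj (?lit True 3) (occ_gadget 0 1)) (TConj (?lit True 4) (occ_gadget 0 0))))"
    by (rule separated_binary(2)[OF separated_lit disj lit dlit]) auto
  show "all_lits E (%e s l. var_key l = map e var_tapes)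
      (TDisj (?lit False 2) (TDisj (TConj (?lit True 3) (occ_gadget 0 1)) (TConj (?lit True 4) (occ_gadget 0 0))))"
    unfolding all_lits_simps(3)[of E _ "?lit False 2"] by (intro conjI all_lits_mono[OF lit[of False 2]] all_lits_mono[OF dlit]) auto
qed (simp_all add: var_tapes_def)

definition merge_copies :: "nat => nat" where
  "merge_copies b = (if \<exists>x. b = atom (3 # x) \<or> b = atom (4 # x) then atom (2 # tl (unatom b)) else b)"

lemma merge_copies_atom:
  "merge_copies (atom l) = atom (if l ~= [] \<and> (hd l = 3 \<or> hd l = 4) then 2 # tl l else l)" by (cases l) (auto simp: merge_copies_def)

lemma rename_with_gadgets:
  assumes "all_lits E (%e. matrix_lit) \<phi>"
  shows "rename merge_copies (interp E (with_gadgets \<phi> 3 4) e) = interp E (with_gadgets \<phi> 2 2) e" proof -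
  have id: "rename merge_copies F = F" if "!!s b. (s, b) \<in> set (lits F) ==> \<exists>l. b = atom l \<and> l ~= [] \<and> l ! 0 < 3" for F proof -
    have "rename merge_copies F = rename id F" using that by (intro rename_cong) (fastforce simp: merge_copies_atom hd_conv_nth)
    also have "rename id F = F" by (induction F) auto
    finally show ?thesis .
  qed
  have "rename merge_copies (interp E \<phi> e) = interp E \<phi> e" by (rule id) (use assms in "fastforce simp: all_lits_def matrix_lit_def")
  moreover have o: "rename merge_copies (interp E (occ_gadget kd sg) e) = interp E (occ_gadget kd sg) e" if "kd < 2" for kd sg e
    unfolding occ_gadget_def by (rule rename_exs) (use that in "simp add: merge_copies_atom")
  then have "rename merge_copies (interp E univ_gadget e) = interp E univ_gadget e" unfolding univ_gadget_def by (intro rename_exs) simp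
  moreover have "rename merge_copies (interp E (exist_gadget 3 4) e) = interp E (exist_gadget 2 2) e"
    unfolding exist_gadget_def by (intro rename_exs) (simp add: o merge_copies_atom)
  ultimately show ?thesis by (simp add: with_gadgets_def)
qed

text \<open>From provability, X is read off from the matching: x is true if copy 3 shares its atom
  with the negative literal. For every Y there is a valuation under which no gadget is true, so the
  matrix must be. Conversely X prescribes the matching; a valuation that falsifies the gadgets
  makes, for each variable, all occurrences of a suitable sign true, which yields a Y under which
  the true literals of the matrix are true in the valuation as well.\<close>

theorem provable_with_gadgets:
  assumes sep: "separated E \<phi>" and lits: "all_lits E (%e. matrix_lit) \<phi>"
    and bound: "!!s b. (s, b) \<in> set (lits (interp E \<phi> e)) ==> set (drop 2 (unatom b)) \<subseteq> {..R}"
  shows "CL5_provable (interp E (with_gadgets \<phi> 2 2) e) \<longleftrightarrow>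
    (\<exists>X. \<forall>Y. evl (holds (%kd. if kd = 0 then X else Y)) (interp E \<phi> e))" proof -
  let ?F = "interp E (with_gadgets \<phi> 3 4) e"
  have "separated E (with_gadgets \<phi> 3 4)" unfolding with_gadgets_def proof (rule separated_binary(2)[OF sep _ lits])
    show "separated E (TDisj univ_gadget (exist_gadget 3 4))"
      by (rule separated_binary(2)[OF univ_gadget_separated exist_gadget_separated univ_gadget_lits exist_gadget_lits]) auto
    show "all_lits E (%e s l. \<not> s \<or> 2 <= l ! 0) (TDisj univ_gadget (exist_gadget 3 4))" unfolding all_lits_simps(3)
      by (intro conjI all_lits_mono[OF univ_gadget_lits] all_lits_mono[OF exist_gadget_lits[of 3 4]]) auto
  qed (auto simp: matrix_lit_def)
  then have dist: "distinct (lits ?F)" by (simp add: separated_def)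
  have phi: "b = atom (unatom b) \<and> matrix_lit s (unatom b)" if "(s, b) \<in> set (lits (interp E \<phi> e))" for s b
    using all_litsD[OF lits that] by simp
  have evF: "evl w ?F \<longleftrightarrow> evl w (interp E \<phi> e) \<or> evl w (interp E univ_gadget e) \<or> evl w (interp E (exist_gadget 3 4) e)" for w
    by (simp add: with_gadgets_def)
  have mlit: "unatom b ! 0 < 2 \<and> unatom b ! 1 < 2 \<and> (\<exists>oc x. unatom b = [unatom b ! 0, unatom b ! 1] @ oc @ x \<and> length oc = 7 \<and>
      set oc \<subseteq> {..R} \<and> length x = 6 \<and> set x \<subseteq> {..R} \<and> drop 9 (unatom b) = x)"
    if m: "(s, b) \<in> set (lits (interp E \<phi> e))" for s b proof -
    let ?l = "unatom b"
    have l: "length ?l = 15" "?l ! 0 < 2" "?l ! 1 < 2" "set (drop 2 ?l) \<subseteq> {..R}" using phi[OF m] bound[OF m] by (auto simp: matrix_lit_def)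
    obtain a c r where "?l = a # c # r" using l(1) by (cases ?l; cases "tl ?l") auto
    then have "?l = [?l ! 0, ?l ! 1] @ drop 2 ?l" by (simp add: One_nat_def)
    moreover have "drop 2 ?l = take 7 (drop 2 ?l) @ drop 9 ?l" using append_take_drop_id[of 7 "drop 2 ?l"] by simp
    moreover have "set (take 7 (drop 2 ?l)) \<subseteq> {..R}" "set (drop 9 ?l) \<subseteq> {..R}"
      using l(4) set_take_subset[of 7 "drop 2 ?l"] set_drop_subset[of 7 "drop 2 ?l"] by auto
    moreover have "length (take 7 (drop 2 ?l)) = 7" "length (drop 9 ?l) = 6" using l(1) by simp_all
    ultimately show ?thesis using l(2,3) by metis
  qed
  show ?thesis
  proof
    assume "CL5_provable (interp E (with_gadgets \<phi> 2 2) e)"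
    then obtain \<sigma> G where G: "rename \<sigma> G = rename merge_copies ?F" "distinct (lits G)" "!!v. ev v G"
      unfolding CL5_provable_iff rename_with_gadgets[OF lits] by metis
    obtain \<theta> where \<theta>: "G = relit \<theta> ?F" "\<forall>l\<in>set (lits ?F). \<sigma> (\<theta> l) = merge_copies (snd l)"
      using relit_exists[OF G(1) dist] by blast
    define p where "p x = \<theta> (False, atom (2 # x))" for x
    define X where "X x \<longleftrightarrow> (True, atom (3 # x)) \<in> set (lits ?F) \<and> \<theta> (True, atom (3 # x)) = p x" for x
    have "evl (holds (%kd. if kd = 0 then X else Y)) (interp E \<phi> e)" for Y proof -
      define h where "h = holds (%kd. if kd = 0 then X else Y)"
      \<comment> \<open>Among the atoms identified to \<open>2 # x\<close> only that of the negative
        literal is true. So this literal is false, and so is every copy that is not matched with it.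
        An occurrence in the matrix gets the value that X and Y prescribe.\<close>
      define v where "v b \<longleftrightarrow> (if \<exists>x. \<sigma> b = atom (2 # x) then b = p (tl (unatom (\<sigma> b))) else h (True, \<sigma> b))" for b
      define w where "w = (%l. l \<in> set (lits ?F) \<and> v (\<theta> l) = fst l)"
      have "ev v G" by (rule G(3))
      then have "evl w ?F" unfolding \<theta>(1) ev_relit by (rule evl_mono) (simp add: w_def)
      have \<sigma>: "\<sigma> (\<theta> (s, atom l)) = merge_copies (atom l)" if "w (s, atom l)" for s l using \<theta>(2) that by (simp add: w_def)
      have wocc: "h (True, atom ([kd, sg] @ r)) = s" if "kd < 2" "w (s, atom ([kd, sg] @ r))" for s kd sg r
        using \<sigma>[OF that(2)] that by (auto simp: merge_copies_atom w_def v_def)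
      have occ: "(if kd = 0 then X x else Y x) ~= (sg = 1)" if "kd < 2" "occurs w kd sg x" for kd sg x proof -
        obtain oc where "length oc = 7" "w (False, atom ([kd, sg] @ oc @ x))" using \<open>occurs w kd sg x\<close> unfolding occurs_def by blast
        then show ?thesis using wocc[OF that(1), of False sg "oc @ x"] by (auto simp: h_def holds_def One_nat_def)
      qed
      have "\<not> evl w (interp E univ_gadget e)" unfolding evl_univ_gadget using occ[of 1 1] occ[of 1 0] by auto
      moreover have "\<not> evl w (interp E (exist_gadget 3 4) e)"
      proof
        assume "evl w (interp E (exist_gadget 3 4) e)"
        then obtain x where x: "w (False, atom (2 # x)) \<or> w (True, atom (3 # x)) \<and> occurs w 0 1 x \<or> w (True, atom (4 # x)) \<and> occurs w 0 0 x"
          unfolding evl_exist_gadget by blast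
        have e: "(\<theta> (s, atom (c # x)) = p x) = s" if "c \<in> {2, 3, 4}" "w (s, atom (c # x))" for s c
          using \<sigma>[OF that(2)] that by (auto simp: merge_copies_atom w_def v_def)
        from x show False proof (elim disjE conjE)
          assume "w (False, atom (2 # x))"
          then show False using e[of 2 False] by (simp add: p_def)
        next
          assume "w (True, atom (3 # x))" "occurs w 0 1 x"
          then show False using e[of 3 True] occ[of 0 1 x] by (simp add: X_def w_def)
        next
          assume a: "w (True, atom (4 # x))" "occurs w 0 0 x"
          then have "X x" using occ[of 0 0 x] by simp
          then have l: "(True, atom (3 # x)) \<in> set (lits ?F)" "(True, atom (4 # x)) \<in> set (lits ?F)"
            "\<theta> (True, atom (4 # x)) = \<theta> (True, atom (3 # x))" using a(1) e[of 4 True] by (simp_all add: X_def w_def)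
          \<comment> \<open>Both copies would be matched with the one negative literal, so G would
            repeat a positive literal.\<close>
          have "inj_on (%l. (fst l, \<theta> l)) (set (lits ?F))" using G(2) unfolding \<theta>(1) lits_relit by (simp add: distinct_map)
          from inj_onD[OF this _ l(2,1)] l(3) show False by simp
        qed
      qed
      ultimately have "evl w (interp E \<phi> e)" using \<open>evl w ?F\<close> evF by blast
      then show ?thesis unfolding h_def[symmetric] proof (rule evl_mono)
        fix l assume l: "l \<in> set (lits (interp E \<phi> e))" "w l"
        obtain s b where sb: "l = (s, b)" by (cases l)
        have m: "b = atom (unatom b)" "matrix_lit s (unatom b)" using phi l(1) sb by auto
        obtain oc x where ox: "unatom b = [unatom b ! 0, unatom b ! 1] @ oc @ x" using mlit[of s b] l(1) sb by blast
        have "s" using m(2) by (simp add: matrix_lit_def)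
        moreover have "w (s, atom ([unatom b ! 0, unatom b ! 1] @ oc @ x))" using l(2) sb m(1) ox by metis
        moreover have "unatom b ! 0 < 2" using mlit[of s b] l(1) sb by blast
        ultimately have "h (True, atom ([unatom b ! 0, unatom b ! 1] @ oc @ x))" using wocc by blast
        then show "h l" using \<open>s\<close> sb m(1) ox by metis
      qed
    qed
    then show "\<exists>X. \<forall>Y. evl (holds (%kd. if kd = 0 then X else Y)) (interp E \<phi> e)" by blast
  next
    assume "\<exists>X. \<forall>Y. evl (holds (%kd. if kd = 0 then X else Y)) (interp E \<phi> e)"
    then obtain X where X: "!!Y. evl (holds (%kd. if kd = 0 then X else Y)) (interp E \<phi> e)" by blast
    \<comment> \<open>The negative literal is matched with copy 3 if X x holds and with copy 4
      otherwise; the other copy keeps an atom of its own.\<close>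
    define \<rho> where "\<rho> b = (if \<exists>x. b = atom (3 # x) \<and> X x \<or> b = atom (4 # x) \<and> \<not> X x then atom (2 # tl (unatom b)) else b)" for b
    have \<rho>: "\<rho> (atom (3 # x)) = atom ((if X x then 2 else 3) # x)" "\<rho> (atom (4 # x)) = atom ((if X x then 4 else 2) # x)"
      "!!l. l ~= [] ==> hd l \<notin> {3, 4} ==> \<rho> (atom l) = atom l" for x by (auto simp: \<rho>_def)
    let ?G = "rename \<rho> ?F"
    have lF: "s \<and> unatom b ~= [] \<and> (hd (unatom b) < 2 \<or> hd (unatom b) = 3 \<or> hd (unatom b) = 4) \<and> b = atom (unatom b) \<or>
        \<not> s \<and> unatom b ~= [] \<and> (hd (unatom b) < 2 \<or> hd (unatom b) = 2) \<and> b = atom (unatom b)" if sb: "(s, b) \<in> set (lits ?F)" for s b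
    proof -
      have occ: "all_lits E (%e s l. \<not> s \<and> l ~= [] \<and> hd l = kd) (occ_gadget kd sg)" for kd sg
        unfolding occ_gadget_def by (rule all_lits_exs) simp_all
      have u: "all_lits E (%e s l. \<not> s \<and> l ~= [] \<and> hd l < 2) univ_gadget"
        unfolding univ_gadget_def by (rule all_lits_exs) (unfold all_lits_simps, intro conjI all_lits_mono[OF occ], simp_all)
      have x: "all_lits E (%e s l. l ~= [] \<and> (\<not> s \<and> hd l = 0 \<or> \<not> s \<and> hd l = 2 \<or> s \<and> hd l = 3 \<or> s \<and> hd l = 4)) (exist_gadget 3 4)"
        unfolding exist_gadget_def by (rule all_lits_exs) (unfold all_lits_simps, intro conjI all_lits_mono[OF occ], simp_all)
      consider "(s, b) \<in> set (lits (interp E \<phi> e))" | "(s, b) \<in> set (lits (interp E univ_gadget e))"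
        | "(s, b) \<in> set (lits (interp E (exist_gadget 3 4) e))" using sb by (auto simp: with_gadgets_def)
      then show ?thesis proof cases
        case 1
        then have m: "b = atom (unatom b)" "matrix_lit s (unatom b)" using phi by blast+
        then have "unatom b ~= []" "unatom b ! 0 < 2" s by (auto simp: matrix_lit_def)
        then show ?thesis using m(1) by (simp add: hd_conv_nth)
      next
        case 2
        then show ?thesis using all_litsD[OF u 2] by auto
      next
        case 3
        then show ?thesis using all_litsD[OF x 3] by auto
      qed
    qed
    have "rename merge_copies ?G = rename merge_copies ?F" unfolding rename_rename proof (rule rename_cong)
      fix s b assume "(s, b) \<in> set (lits ?F)"
      then have b: "b = atom (unatom b)" "unatom b ~= []" using lF by blast+
      obtain c x where "unatom b = c # x" using b(2) by (cases "unatom b") auto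
      then show "(merge_copies \<circ> \<rho>) b = merge_copies b" using b(1) \<rho> by (cases "c = 3"; cases "c = 4") (auto simp: merge_copies_atom)
    qed
    moreover have "distinct (lits ?G)" unfolding lits_rename distinct_map proof (intro conjI dist inj_onI)
      fix l m assume lm: "l \<in> set (lits ?F)" "m \<in> set (lits ?F)" "(case l of (s, a) => (s, \<rho> a)) = (case m of (s, a) => (s, \<rho> a))"
      obtain s b b' where sb: "l = (s, b)" "m = (s, b')" "\<rho> b = \<rho> b'" using lm(3) by (cases l; cases m) auto
      obtain c x where b: "b = atom (c # x)" "s ==> c < 2 \<or> c = 3 \<or> c = 4" "\<not> s ==> c < 3"
        using lF[of s b] lm(1) sb(1) by (cases "unatom b") auto
      obtain c' x' where b': "b' = atom (c' # x')" "s ==> c' < 2 \<or> c' = 3 \<or> c' = 4" "\<not> s ==> c' < 3"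
        using lF[of s b'] lm(2) sb(2) by (cases "unatom b'") auto
      have r: "\<rho> (atom (c # x)) = atom ((if c = 3 \<and> X x \<or> c = 4 \<and> \<not> X x then 2 else c) # x)" for c x
        using \<rho>(1,2)[of x] \<rho>(3)[of "c # x"] by (cases "c = 3"; cases "c = 4") auto
      have "(if c = 3 \<and> X x \<or> c = 4 \<and> \<not> X x then 2 else c) = (if c' = 3 \<and> X x' \<or> c' = 4 \<and> \<not> X x' then 2 else c') \<and> x = x'"
        using sb(3) unfolding b(1) b'(1) r atom_eq_iff list.inject .
      then have x: "x = x'"
        and e: "(if c = 3 \<and> X x \<or> c = 4 \<and> \<not> X x then 2 else c) = (if c' = 3 \<and> X x \<or> c' = 4 \<and> \<not> X x then 2 else c')"
        by blast+
      have "c = c'" proof (cases s)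
        case True
        then show ?thesis using e b(2) b'(2) by (auto split: if_splits)
      next
        case False
        then show ?thesis using e b(3) b'(3) by (auto split: if_splits)
      qed
      then show "l = m" using sb(1,2) b(1) b'(1) x by simp
    qed
    moreover have "ev v ?G" for v proof -
      define w where "w = (%(s, b). v (\<rho> b) = s)"
      have ev: "ev v ?G = evl w ?F" proof -
        have "evl u (rename \<rho> F) = evl (%(s, b). u (s, \<rho> b)) F" for u F by (induction F) auto
        then show ?thesis unfolding ev_evl w_def by (simp add: case_prod_beta)
      qed
      show ?thesis proof (rule ccontr)
        assume "\<not> ?thesis"
        then have n: "\<not> evl w (interp E \<phi> e)" "\<not> evl w (interp E univ_gadget e)" "\<not> evl w (interp E (exist_gadget 3 4) e)"
          unfolding ev evF by auto
        define ok where "ok kd sg x \<longleftrightarrow> (\<forall>oc. length oc = 7 \<and> set oc \<subseteq> {..R} --> v (atom ([kd, sg] @ oc @ x)))" for kd sg x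
        have okw: "ok kd sg x" if "\<not> occurs w kd sg x" "kd < 2" for kd sg x using that \<rho>(3) unfolding ok_def w_def occurs_def by auto
        \<comment> \<open>If not all positive occurrences of a universal variable are true, the
          universal gadget forces all negative ones to be true, and the value false is
          right.\<close>
        define Y where "Y x \<longleftrightarrow> ok 1 1 x" for x
        have u: "ok 1 1 x \<or> ok 1 0 x" if "length x = 6" "set x \<subseteq> {..R}" for x
          using n(2) that okw[of 1 1 x] okw[of 1 0 x] unfolding evl_univ_gadget by (metis insertE one_less_numeral_iff semiring_norm(76) singletonD)
        have x: "ok 0 (if X x then 1 else 0) x" if "length x = 6" "set x \<subseteq> {..R}" for x proof -
          have "\<not> w (False, atom (2 # x))" using n(3) that unfolding evl_exist_gadget by blast
          then have v2: "v (atom (2 # x))" using \<rho>(3)[of "2 # x"] by (simp add: w_def)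
          show ?thesis proof (cases "X x")
            case True
            then have "w (True, atom (3 # x))" using v2 \<rho>(1) by (simp add: w_def)
            then show ?thesis using n(3) that True okw[of 0 1 x] unfolding evl_exist_gadget by auto
          next
            case False
            then have "w (True, atom (4 # x))" using v2 \<rho>(2) by (simp add: w_def)
            then show ?thesis using n(3) that False okw[of 0 0 x] unfolding evl_exist_gadget by auto
          qed
        qed
        have "evl w (interp E \<phi> e)" using X[of Y] proof (rule evl_mono)
          fix l assume l: "l \<in> set (lits (interp E \<phi> e))" "holds (%kd. if kd = 0 then X else Y) l"
          obtain s b where sb: "l = (s, b)" by (cases l)
          have m: "b = atom (unatom b)" "matrix_lit s (unatom b)" using phi l(1) sb by auto
          obtain oc x where ox: "unatom b = [unatom b ! 0, unatom b ! 1] @ oc @ x" "length oc = 7" "set oc \<subseteq> {..R}" "length x = 6" "set x \<subseteq> {..R}"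
              "drop 9 (unatom b) = x" and lt: "unatom b ! 0 < 2" "unatom b ! 1 < 2" using mlit[of s b] l(1) sb by blast
          have h: "(if unatom b ! 0 = 0 then X x else Y x) = (unatom b ! 1 = 1)" using l(2) ox(6) sb by (auto simp: holds_def)
          have "ok (unatom b ! 0) (unatom b ! 1) x" proof (cases "unatom b ! 0 = 0")
            case True
            then show ?thesis using x[OF ox(4,5)] h lt(2) by (auto simp: less_2_cases_iff split: if_splits)
          next
            case False
            then have k: "unatom b ! 0 = 1" using lt(1) by auto
            show ?thesis proof (cases "unatom b ! 1 = 1")
              case True
              then show ?thesis using h k unfolding Y_def by simp
            next
              case False
              then have "unatom b ! 1 = 0" "\<not> Y x" using h k lt(2) by auto
              then show ?thesis using u[OF ox(4,5)] k unfolding Y_def by simp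
            qed
          qed
          then have "v (atom ([unatom b ! 0, unatom b ! 1] @ oc @ x))" using ox(2,3) unfolding ok_def by blast
          then have "v b" using ox(1) m(1) by metis
          moreover have "\<rho> b = b" proof -
            have "hd (unatom b) = unatom b ! 0" "unatom b ~= []" by (subst ox(1), simp)+
            then have "hd (unatom b) \<notin> {3, 4}" "unatom b ~= []" using lt(1) by auto
            then show ?thesis using \<rho>(3) m(1) by metis
          qed
          moreover have "s" using m(2) by (simp add: matrix_lit_def)
          ultimately show "w l" by (simp add: w_def sb)
        qed
        then show False using n(1) by blast
      qed
    qed
    ultimately show "CL5_provable (interp E (with_gadgets \<phi> 2 2) e)" unfolding CL5_provable_iff rename_with_gadgets[OF lits, symmetric] by blast
  qed
qed

end

section \<open>Computation tableaus\<close>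

type_synonym literal = "bool \<times> nat \<times> comps"

definition true_clause :: "(nat => nat list) => (nat => nat) => (nat => nat list => bool) => literal list => bool" where
  "true_clause E e W c \<longleftrightarrow> (\<exists>(sg, kd, cs) \<in> set c. W kd (names E e cs) = sg)"

definition sat :: "(nat => nat list) => (nat => nat) => (nat => nat list => bool) => literal list list => bool" where
  "sat E e W cs \<longleftrightarrow> (\<forall>c\<in>set cs. true_clause E e W c)"

lemma true_clause_simps [simp]:
  "\<not> true_clause E e W []"
  "true_clause E e W ((sg, kd, cs) # c) \<longleftrightarrow> W kd (names E e cs) = sg \<or> true_clause E e W c"
  "true_clause E e W (map f xs) \<longleftrightarrow> (\<exists>x\<in>set xs. true_clause E e W [f x])" by (auto simp: true_clause_def)

lemma sat_simps [simp]:
  "sat E e W []"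
  "sat E e W (c # cs) \<longleftrightarrow> true_clause E e W c \<and> sat E e W cs"
  "sat E e W (cs @ ds) \<longleftrightarrow> sat E e W cs \<and> sat E e W ds"
  "sat E e W (map f xs) \<longleftrightarrow> (\<forall>x\<in>set xs. true_clause E e W (f x))"
  "sat E e W (concat (map h xs)) \<longleftrightarrow> (\<forall>x\<in>set xs. sat E e W (h x))" by (auto simp: sat_def)

definition var :: "nat => summand list => summand list => nat => summand list => summand list => comps" where
  "var f T tm j i a = [[Cst f], T, tm, [Cst j], i, a]"

lemma cval_simps [simp]: "cval E e [] = 0" "cval E e (s # ss) = sval E e s + cval E e ss" by (simp_all add: cval_def)

lemma names_var [simp]: "names E e (var f T tm j i a) = [f, cval E e T, cval E e tm, j, cval E e i, cval E e a]" by (simp add: var_def)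

type_synonym instr = "(nat \<times> nat list) \<times> (nat \<times> (nat \<times> direction) list)"

text \<open>A tableau has four families of variables: the state (family 0), the head position (1) and the
  contents (2) of the tapes, and the instruction (3) at each time.  The time is the value of tape 2, the cell the
  value of tape 3; cell \<open>i\<close> of the tableau is cell \<open>i - K\<close> of the machine.\<close>

definition before :: "direction => nat" where "before d = (if d = Left_Move then 1 else 0)"
definition after :: "direction => nat" where "after d = (if d = Right_Move then 1 else 0)"

definition instr_clauses :: "nat => nat => summand list => nat => nat => nat => nat => instr => literal list list" where
  "instr_clauses kd b T k Sg Qs \<iota> ins = (case ins of ((q, rs), (q', as)) =>
     map (%p. [(False, kd, var (b + 3) T [Idx 2] \<iota> [] []), (False, kd, var b T [Idx 2] p [] [])]) (filter (%p. p ~= q) [0..<Qs]) @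
     [[(False, kd, var (b + 3) T [Idx 2] \<iota> [] []), (True, kd, var b T [Idx 2, Cst 1] q' [] [])]] @
     concat (map (%j.
       map (%a. [(False, kd, var (b + 3) T [Idx 2] \<iota> [] []), (False, kd, var (b + 1) T [Idx 2] j [Idx 3] []),
                 (False, kd, var (b + 2) T [Idx 2] j [Idx 3] [Cst a])]) (filter (%a. a ~= rs ! j) [0..<Sg]) @
       [[(False, kd, var (b + 3) T [Idx 2] \<iota> [] []), (False, kd, var (b + 1) T [Idx 2] j [Idx 3] []),
         (True, kd, var (b + 2) T [Idx 2, Cst 1] j [Idx 3] [Cst (fst (as ! j))])],
        [(False, kd, var (b + 3) T [Idx 2] \<iota> [] []), (False, kd, var (b + 1) T [Idx 2] j [Idx 3, Cst (before (snd (as ! j)))] []),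
         (True, kd, var (b + 1) T [Idx 2, Cst 1] j [Idx 3, Cst (after (snd (as ! j)))] [])]]) [0..<k]))"

text \<open>\<open>Idx 4\<close> runs over distances: heads at i and at \<open>i + d + 1\<close>
  exclude each other, which makes the head position unique without clauses for each pair of
  cells.\<close>

definition tape_clauses :: "nat => nat => summand list => nat => nat => literal list list" where
  "tape_clauses kd b T Sg j =
     map (%a. [(True, kd, var (b + 1) T [Idx 2] j [Idx 3] []), (False, kd, var (b + 2) T [Idx 2] j [Idx 3] [Cst a]),
               (True, kd, var (b + 2) T [Idx 2, Cst 1] j [Idx 3] [Cst a])]) [0..<Sg] @
     concat (map (%a. map (%a'. [(False, kd, var (b + 2) T [Idx 2] j [Idx 3] [Cst a]),
               (False, kd, var (b + 2) T [Idx 2] j [Idx 3] [Cst a'])]) (filter (%a'. a ~= a') [0..<Sg])) [0..<Sg]) @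
     [[(False, kd, var (b + 1) T [Idx 2] j [Idx 3] []), (False, kd, var (b + 1) T [Idx 2] j [Idx 3, Idx 4, Cst 1] [])]]"

text \<open>The sum T indexes a whole collection of tableaus and b shifts the numbers of their
  families. For the oracle machine the index is the time of a query; the main machine has a single
  tableau.\<close>

definition tableau_clauses :: "nat => nat => summand list => nat => nat => nat => instr list => literal list list" where
  "tableau_clauses kd b T k Sg Qs il =
     [map (%\<iota>. (True, kd, var (b + 3) T [Idx 2] \<iota> [] [])) [0..<length il]] @
     concat (map (%\<iota>. instr_clauses kd b T k Sg Qs \<iota> (il ! \<iota>)) [0..<length il]) @
     concat (map (tape_clauses kd b T Sg) [0..<k])"

definition tableau :: "nat => nat => nat => instr list => (nat => nat => nat => nat => nat => bool) => nat => nat => nat => bool" where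
  "tableau k Sg Qs il U tm i d \<longleftrightarrow>
     (\<exists>\<iota><length il. U 3 tm \<iota> 0 0) \<and>
     (\<forall>\<iota><length il. U 3 tm \<iota> 0 0 --> (case il ! \<iota> of ((q, rs), (q', as)) =>
        (\<forall>p<Qs. p ~= q --> \<not> U 0 tm p 0 0) \<and> U 0 (tm + 1) q' 0 0 \<and>
        (\<forall>j<k. (\<forall>a<Sg. a ~= rs ! j --> U 1 tm j i 0 --> \<not> U 2 tm j i a) \<and>
           (U 1 tm j i 0 --> U 2 (tm + 1) j i (fst (as ! j))) \<and>
           (U 1 tm j (i + before (snd (as ! j))) 0 --> U 1 (tm + 1) j (i + after (snd (as ! j))) 0)))) \<and>
     (\<forall>j<k. (\<forall>a<Sg. U 2 tm j i a --> U 1 tm j i 0 \<or> U 2 (tm + 1) j i a) \<and>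
        (\<forall>a<Sg. \<forall>a'<Sg. a ~= a' --> U 2 tm j i a --> \<not> U 2 tm j i a') \<and>
        (U 1 tm j i 0 --> \<not> U 1 tm j (i + (d + 1)) 0))"

definition family :: "(nat list => bool) => nat => nat => nat => nat => nat => nat => nat => bool" where
  "family V b T f tm j i a = V [b + f, T, tm, j, i, a]"

lemma sat_tableau:
  "sat E e W (tableau_clauses kd b T k Sg Qs il) \<longleftrightarrow>
     tableau k Sg Qs il (family (W kd) b (cval E e T)) (e 2) (e 3) (e 4)" proof -
  let ?U = "family (W kd) b (cval E e T)" and ?t = "e 2" and ?i = "e 3"
  have i: "sat E e W (instr_clauses kd b T k Sg Qs \<iota> ins) \<longleftrightarrow> (?U 3 ?t \<iota> 0 0 --> (case ins of ((q, rs), (q', as)) =>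
      (\<forall>p<Qs. p ~= q --> \<not> ?U 0 ?t p 0 0) \<and> ?U 0 (?t + 1) q' 0 0 \<and>
      (\<forall>j<k. (\<forall>a<Sg. a ~= rs ! j --> ?U 1 ?t j ?i 0 --> \<not> ?U 2 ?t j ?i a) \<and> (?U 1 ?t j ?i 0 --> ?U 2 (?t + 1) j ?i (fst (as ! j))) \<and>
         (?U 1 ?t j (?i + before (snd (as ! j))) 0 --> ?U 1 (?t + 1) j (?i + after (snd (as ! j))) 0))))" for \<iota> ins
    by (cases ins) (auto simp: instr_clauses_def family_def)
  have t: "sat E e W (tape_clauses kd b T Sg j) \<longleftrightarrow> (\<forall>a<Sg. ?U 2 ?t j ?i a --> ?U 1 ?t j ?i 0 \<or> ?U 2 (?t + 1) j ?i a) \<and>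
      (\<forall>a<Sg. \<forall>a'<Sg. a ~= a' --> ?U 2 ?t j ?i a --> \<not> ?U 2 ?t j ?i a') \<and> (?U 1 ?t j ?i 0 --> \<not> ?U 1 ?t j (?i + (e 4 + 1)) 0)" for j
  proof -
    have a: "true_clause E e W [(True, kd, var (b + 1) T [Idx 2] j [Idx 3] []), (False, kd, var (b + 2) T [Idx 2] j [Idx 3] [Cst a]),
        (True, kd, var (b + 2) T [Idx 2, Cst 1] j [Idx 3] [Cst a])] \<longleftrightarrow> (?U 2 ?t j ?i a --> ?U 1 ?t j ?i 0 \<or> ?U 2 (?t + 1) j ?i a)"
      "true_clause E e W [(False, kd, var (b + 2) T [Idx 2] j [Idx 3] [Cst a]), (False, kd, var (b + 2) T [Idx 2] j [Idx 3] [Cst a'])] \<longleftrightarrow>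
        (?U 2 ?t j ?i a --> \<not> ?U 2 ?t j ?i a')"
      "true_clause E e W [(False, kd, var (b + 1) T [Idx 2] j [Idx 3] []), (False, kd, var (b + 1) T [Idx 2] j [Idx 3, Idx 4, Cst 1] [])] \<longleftrightarrow>
        (?U 1 ?t j ?i 0 --> \<not> ?U 1 ?t j (?i + (e 4 + 1)) 0)" for a a' by (auto simp: family_def)
    show ?thesis unfolding tape_clauses_def sat_simps a
      by (simp only: set_filter set_upt Ball_def mem_Collect_eq atLeastLessThan_iff imp_conjL le0 simp_thms sat_simps(1))
  qed
  show ?thesis unfolding tableau_clauses_def tableau_def sat_simps i t by (simp add: family_def Ball_def Bex_def)
qed

definition moves :: "instr list => config => nat => config => bool" where
  "moves il c \<iota> c' \<longleftrightarrow> \<iota> < length il \<and>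
     (\<exists>q' as. il ! \<iota> = ((fst c, map scan (snd c)), (q', as)) \<and> c' = (q', map2 act as (snd c)))"

definition fit_instrs :: "nat => nat => nat => instr list => bool" where
  "fit_instrs k Sg Qs il \<longleftrightarrow> (\<forall>((q, rs), (q', as)) \<in> set il. q < Qs \<and> q' < Qs \<and> length rs = k \<and> length as = k \<and>
     (\<forall>a\<in>set as. fst a < Sg))"

text \<open>Bounds that hold \<open>m\<close> steps after the start on an input of length \<open>n\<close>.\<close>

definition fit_config :: "nat => nat => nat => nat => nat => config => bool" where
  "fit_config k Sg Qs n m c \<longleftrightarrow> fst c < Qs \<and> length (snd c) = k \<and>
     (\<forall>t\<in>set (snd c). \<bar>snd t\<bar> <= int m \<and> (\<forall>i. fst t i < Sg \<and> (fst t i ~= 0 --> i < int n + int m)))"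

definition described :: "nat => nat => nat => (nat => nat => nat => nat => nat => bool) => nat => config => bool" where
  "described k K N U tm c \<longleftrightarrow> U 0 tm (fst c) 0 0 \<and>
     (\<forall>j<k. U 1 tm j (nat (snd (snd c ! j) + int K)) 0 \<and>
       (\<forall>i\<le>N. U 2 tm j i (fst (snd c ! j) (int i - int K))))"

text \<open>Heads are at most m < K away from the origin, so their tableau cells lie strictly
  between 0 and N. Neighbouring cells and all relevant distances are then covered by the clauses,
  which force the next configuration.\<close>

lemma tableau_step:
  assumes tab: "!!i d. i <= N ==> d <= N ==> tableau k Sg Qs il U tm i d"
    and desc: "described k K N U tm c" and fit: "fit_config k Sg Qs n m c" "fit_instrs k Sg Qs il"
    and m: "m < K" "2 * K <= N" shows "\<exists>\<iota> c'. U 3 tm \<iota> 0 0 \<and> moves il c \<iota> c' \<and> described k K N U (tm + 1) c'"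
proof -
  obtain q ts where c: "c = (q, ts)" by (cases c)
  have ts: "q < Qs" "length ts = k" "!!j. j < k ==> \<bar>snd (ts ! j)\<bar> <= int m" "!!j i. j < k ==> fst (ts ! j) i < Sg"
    using fit(1) unfolding fit_config_def c by auto
  have d: "U 0 tm q 0 0" "!!j. j < k ==> U 1 tm j (nat (snd (ts ! j) + int K)) 0"
      "!!j i. j < k ==> i <= N ==> U 2 tm j i (fst (ts ! j) (int i - int K))" using desc unfolding described_def c by auto
  define h where "h j = nat (snd (ts ! j) + int K)" for j
  have h: "int (h j) = snd (ts ! j) + int K" "1 <= h j" "h j + 1 <= N" if "j < k" for j using ts(3)[OF that] m unfolding h_def by linarith+
  have scan: "fst (ts ! j) (int (h j) - int K) = scan (ts ! j)" if "j < k" for j using h(1)[OF that] by (simp add: scan_def)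
  have tab0: "tableau k Sg Qs il U tm i 0" if "i <= N" for i using tab[OF that] by simp
  from tab0[of 0] obtain \<iota> where io: "\<iota> < length il" "U 3 tm \<iota> 0 0" unfolding tableau_def by auto
  obtain q0 rs q' as where ins: "il ! \<iota> = ((q0, rs), (q', as))" by (metis surj_pair)
  have wf: "q' < Qs" "length rs = k" "length as = k" "!!j. j < k ==> fst (as ! j) < Sg"
    using fit(2) io(1) ins unfolding fit_instrs_def by (metis (mono_tags, lifting) case_prod_conv nth_mem)+
  have I: "(\<forall>p<Qs. p ~= q0 --> \<not> U 0 tm p 0 0) \<and> U 0 (tm + 1) q' 0 0 \<and>
        (\<forall>j<k. (\<forall>a<Sg. a ~= rs ! j --> U 1 tm j i 0 --> \<not> U 2 tm j i a) \<and>
           (U 1 tm j i 0 --> U 2 (tm + 1) j i (fst (as ! j))) \<and>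
           (U 1 tm j (i + before (snd (as ! j))) 0 --> U 1 (tm + 1) j (i + after (snd (as ! j))) 0))" if "i <= N" for i
    using tab0[OF that] io ins unfolding tableau_def by fastforce
  have P: "!!a. a < Sg ==> U 2 tm j i a ==> \<not> U 1 tm j i 0 ==> U 2 (tm + 1) j i a"
    "!!d. d <= N ==> U 1 tm j i 0 ==> \<not> U 1 tm j (i + (d + 1)) 0" if "i <= N" "j < k" for i j proof -
    have t: "(\<forall>a<Sg. U 2 tm j i a --> U 1 tm j i 0 \<or> U 2 (tm + 1) j i a) \<and>
        (\<forall>a<Sg. \<forall>a'<Sg. a ~= a' --> U 2 tm j i a --> \<not> U 2 tm j i a') \<and>
        (U 1 tm j i 0 --> \<not> U 1 tm j (i + (d + 1)) 0)" if "d <= N" for d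
      using tab[OF \<open>i <= N\<close> that] \<open>j < k\<close> unfolding tableau_def by simp
    show "a < Sg ==> U 2 tm j i a ==> \<not> U 1 tm j i 0 ==> U 2 (tm + 1) j i a" for a using t[of 0] by simp
    show "d <= N ==> U 1 tm j i 0 ==> \<not> U 1 tm j (i + (d + 1)) 0" for d using t[of d] by blast
  qed
  have q: "q0 = q" using I[of 0] d(1) ts(1) by auto
  have rs: "rs = map scan ts" proof (rule nth_equalityI)
    fix j assume "j < length rs"
    then have j: "j < k" using wf by simp
    have "h j <= N" using h(3)[OF j] by simp
    have "fst (ts ! j) (int (h j) - int K) = rs ! j"
      using I[OF \<open>h j <= N\<close>] j d(2)[OF j] d(3)[OF j \<open>h j <= N\<close>] ts(4)[OF j] unfolding h_def by metis
    then show "rs ! j = map scan ts ! j" using scan[OF j] j ts(2) by simp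
  qed (simp add: wf ts)
  define c' where "c' = (q', map2 act as ts)"
  have c'j: "snd c' ! j = act (as ! j) (ts ! j)" if "j < k" for j using that wf ts by (simp add: c'_def)
  have "moves il c \<iota> c'" using io(1) ins q rs unfolding moves_def c c'_def by simp
  moreover have "described k K N U (tm + 1) c'" unfolding described_def proof (intro conjI allI impI)
    show "U 0 (tm + 1) (fst c') 0 0" using I[of 0] by (simp add: c'_def)
  next
    fix j assume j: "j < k"
    \<comment> \<open>The clause for moves is applied in the cell i with \<open>i + before\<close>
      equal to the head position; the subtraction is exact because heads are never on cell
      0.\<close>
    define i where "i = h j - before (snd (as ! j))"
    have i: "i <= N" "i + before (snd (as ! j)) = h j" "nat (snd (act (as ! j) (ts ! j)) + int K) = i + after (snd (as ! j))"
      using h[OF j] by (cases "snd (as ! j)"; simp add: i_def before_def after_def act_def)+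
    show "U 1 (tm + 1) j (nat (snd (snd c' ! j) + int K)) 0"
      using I[OF i(1)] j d(2)[OF j] unfolding c'j[OF j] i(3) h_def[symmetric] using i(2) by metis
  next
    fix j i assume j: "j < k" and i: "i <= N"
    show "U 2 (tm + 1) j i (fst (snd c' ! j) (int i - int K))" proof (cases "i = h j")
      case True
      then have "fst (act (as ! j) (ts ! j)) (int i - int K) = fst (as ! j)" using h(1)[OF j] by (simp add: act_def)
      then show ?thesis using I[OF i] j d(2)[OF j] True unfolding c'j[OF j] h_def by simp
    next
      case False
      then have "fst (act (as ! j) (ts ! j)) (int i - int K) = fst (ts ! j) (int i - int K)" using h(1)[OF j] by (simp add: act_def)
      moreover have "\<not> U 1 tm j i 0"
      proof
        assume u: "U 1 tm j i 0"
        have hN: "h j <= N" using h(3)[OF j] by simp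
        show False proof (cases "i < h j")
          case True
          then have e: "i + ((h j - i - 1) + 1) = h j" by simp
          have "\<not> U 1 tm j (i + ((h j - i - 1) + 1)) 0" by (rule P(2)[OF i j _ u]) (use hN in linarith)
          then have "\<not> U 1 tm j (h j) 0" unfolding e .
          then show False using d(2)[OF j] unfolding h_def by simp
        next
          case F: False
          then have e: "h j + ((i - h j - 1) + 1) = i" using False by simp
          have "\<not> U 1 tm j (h j + ((i - h j - 1) + 1)) 0" by (rule P(2)[OF hN j]) (use i d(2)[OF j] in \<open>simp_all add: h_def\<close>)
          then show False using u unfolding e by blast
        qed
      qed
      ultimately show ?thesis using P(1)[OF i j ts(4)[OF j] d(3)[OF j i]] unfolding c'j[OF j] by simp
    qed
  qed
  ultimately show ?thesis using io(2) by blast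
qed

definition canonical :: "nat => (nat => config) => (nat => nat) => nat => nat => nat => nat => nat => bool" where
  "canonical K cf io f tm j i a \<longleftrightarrow>
     (if f = 0 then j = fst (cf tm)
      else if f = 1 then int i = snd (snd (cf tm) ! j) + int K
      else if f = 2 then a = fst (snd (cf tm) ! j) (int i - int K)
      else j = io tm)"

lemma canonical_simps [simp]:
  "canonical K cf io 0 tm j i a \<longleftrightarrow> j = fst (cf tm)"
  "canonical K cf io 1 tm j i a \<longleftrightarrow> int i = snd (snd (cf tm) ! j) + int K"
  "canonical K cf io 2 tm j i a \<longleftrightarrow> a = fst (snd (cf tm) ! j) (int i - int K)"
  "canonical K cf io 3 tm j i a \<longleftrightarrow> j = io tm" by (simp_all add: canonical_def)

lemma tableau_canonical:
  assumes mv: "moves il (cf tm) (io tm) (cf (tm + 1))" and "fit_instrs k Sg Qs il" shows "tableau k Sg Qs il (canonical K cf io) tm i d" proof -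
  obtain q ts where c: "cf tm = (q, ts)" by (cases "cf tm")
  obtain q' as where ins: "io tm < length il" "il ! io tm = ((q, map scan ts), (q', as))" "cf (tm + 1) = (q', map2 act as ts)"
    using mv unfolding moves_def c by auto
  have wf: "length ts = k" "length as = k"
    using assms(2) ins(1,2) unfolding fit_instrs_def by (metis (mono_tags, lifting) case_prod_conv nth_mem length_map)+
  have t': "snd (cf (tm + 1)) ! j = act (as ! j) (ts ! j)" if "j < k" for j using that wf ins(3) by simp
  show ?thesis unfolding tableau_def proof (intro conjI allI impI)
    show "\<exists>\<iota><length il. canonical K cf io 3 tm \<iota> 0 0" using ins(1) by auto
  next
    fix \<iota> assume "\<iota> < length il" "canonical K cf io 3 tm \<iota> 0 0"
    then have [simp]: "\<iota> = io tm" by simp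
    show "case il ! \<iota> of ((q, rs), (q', as)) =>
        (\<forall>p<Qs. p ~= q --> \<not> canonical K cf io 0 tm p 0 0) \<and> canonical K cf io 0 (tm + 1) q' 0 0 \<and>
        (\<forall>j<k. (\<forall>a<Sg. a ~= rs ! j --> canonical K cf io 1 tm j i 0 --> \<not> canonical K cf io 2 tm j i a) \<and>
           (canonical K cf io 1 tm j i 0 --> canonical K cf io 2 (tm + 1) j i (fst (as ! j))) \<and>
           (canonical K cf io 1 tm j (i + before (snd (as ! j))) 0 -->
            canonical K cf io 1 (tm + 1) j (i + after (snd (as ! j))) 0))" unfolding \<open>\<iota> = io tm\<close> ins(2) prod.case
    proof (intro conjI allI impI)
      show "\<not> canonical K cf io 0 tm p 0 0" if "p ~= q" for p using that c by simp
      show "canonical K cf io 0 (tm + 1) q' 0 0" using ins(3) by simp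
      fix j assume j: "j < k"
      show "\<not> canonical K cf io 2 tm j i a" if "a ~= map scan ts ! j" "canonical K cf io 1 tm j i 0" for a
        using that j wf c by (simp add: scan_def)
      show "canonical K cf io 2 (tm + 1) j i (fst (as ! j))" if "canonical K cf io 1 tm j i 0" using that t'[OF j] c by (simp add: act_def)
      show "canonical K cf io 1 (tm + 1) j (i + after (snd (as ! j))) 0" if "canonical K cf io 1 tm j (i + before (snd (as ! j))) 0"
        using that t'[OF j] c by (cases "snd (as ! j)") (simp_all add: act_def before_def after_def)
    qed
  next
    fix j assume j: "j < k"
    show "canonical K cf io 1 tm j i 0 \<or> canonical K cf io 2 (tm + 1) j i a" if "canonical K cf io 2 tm j i a" for a
      using that t'[OF j] c by (auto simp: act_def)
    show "\<not> canonical K cf io 2 tm j i a'" if "a ~= a'" "canonical K cf io 2 tm j i a" for a a' using that by simp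
    show "\<not> canonical K cf io 1 tm j (i + (d + 1)) 0" if "canonical K cf io 1 tm j i 0" using that by simp
  qed
qed

text \<open>Queries and idle steps become ordinary instructions: first the negative answers, then the positive
  answers, then the idle steps.\<close>

definition keep :: "nat => nat => nat list => instr" where
  "keep q q' rs = ((q, rs), (q', map (%r. (r, No_Move)) rs))"

definition readings :: "nat => nat => nat list list" where
  "readings k Sg = List.n_lists k [0..<Sg]"

definition extended :: "nat => nat => nat => machine => instr list => instr list" where
  "extended k Sg Qs M il = map (keep (query_state M) (no_state M)) (readings k Sg) @
     map (keep (query_state M) (yes_state M)) (readings k Sg) @
     concat (map (%q. map (keep q q) (readings k Sg)) [0..<Qs]) @ il"

definition fits :: "machine => nat => nat => instr list => bool" where
  "fits M Sg Qs il \<longleftrightarrow> set il = {ins \<in> instructions M. fst (fst ins) ~= query_state M} \<and> fit_instrs (tapes M) Sg Qs il \<and>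
     start_state M < Qs \<and> query_state M < Qs \<and> yes_state M < Qs \<and> no_state M < Qs \<and> 0 < Sg"

text \<open>The instruction list works for all sufficiently large bounds, so that two machines can
  share an alphabet and a set of states.\<close>

lemma fits_exists:
  assumes "wf_machine M" shows "\<exists>Sg0 Qs0 il. \<forall>Sg\<ge>Sg0. \<forall>Qs\<ge>Qs0. fits M Sg Qs il" proof -
  have fin: "finite (instructions M)" using assms by (simp add: wf_machine_def)
  then obtain il where il: "set il = {ins \<in> instructions M. fst (fst ins) ~= query_state M}"
    using finite_list[of "{ins \<in> instructions M. fst (fst ins) ~= query_state M}"] by auto
  have "finite (\<Union>ins\<in>set il. fst ` set (snd (snd ins)))" by simp
  then obtain Sg0 where S: "\<forall>a\<in>(\<Union>ins\<in>set il. fst ` set (snd (snd ins))). a < Sg0" using finite_nat_set_iff_bounded by blast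
  have "finite ((%ins. fst (fst ins)) ` set il \<union> (%ins. fst (snd ins)) ` set il \<union>
      {start_state M, query_state M, yes_state M, no_state M})" by simp
  then obtain Qs0 where Q: "\<forall>q\<in>(%ins. fst (fst ins)) ` set il \<union> (%ins. fst (snd ins)) ` set il \<union>
      {start_state M, query_state M, yes_state M, no_state M}. q < Qs0" using finite_nat_set_iff_bounded by blast
  have "fits M Sg Qs il" if "Sg \<ge> Suc Sg0" "Qs \<ge> Qs0" for Sg Qs proof -
    have "case ins of ((q, rs), q', as) => q < Qs \<and> q' < Qs \<and> length rs = tapes M \<and> length as = tapes M \<and> (\<forall>a\<in>set as. fst a < Sg)"
      if ins: "ins \<in> set il" for ins proof -
      obtain q rs q' as where e: "ins = ((q, rs), (q', as))" by (metis surj_pair)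
      have "q < Qs0" "q' < Qs0" using Q ins e by force+
      moreover have "\<forall>a\<in>set as. fst a < Sg0" using S ins e by force
      moreover have "length rs = tapes M \<and> length as = tapes M" using assms ins il e unfolding wf_machine_def by auto
      ultimately show ?thesis using \<open>Sg \<ge> Suc Sg0\<close> \<open>Qs \<ge> Qs0\<close> e by auto
    qed
    moreover have "start_state M < Qs" "query_state M < Qs" "yes_state M < Qs" "no_state M < Qs" "0 < Sg" using Q that by auto
    ultimately show ?thesis using il unfolding fits_def fit_instrs_def by blast
  qed
  then show ?thesis by blast
qed

lemma length_readings: "length (readings k Sg) = Sg ^ k" by (simp add: readings_def length_n_lists)

lemma set_readings: "set (readings k Sg) = {rs. length rs = k \<and> (\<forall>a\<in>set rs. a < Sg)}" by (auto simp: readings_def set_n_lists)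

lemma fit_extended: "fits M Sg Qs il ==> fit_instrs (tapes M) Sg Qs (extended (tapes M) Sg Qs M il)" proof -
  assume f: "fits M Sg Qs il"
  have "fit_instrs (tapes M) Sg Qs (map (keep q q') (readings (tapes M) Sg))" if "q < Qs" "q' < Qs" for q q'
    using that by (auto simp: fit_instrs_def keep_def set_readings)
  moreover have "fit_instrs (tapes M) Sg Qs il" using f by (simp add: fits_def)
  moreover have "query_state M < Qs" "yes_state M < Qs" "no_state M < Qs" using f by (simp_all add: fits_def)
  ultimately show ?thesis unfolding extended_def by (simp add: fit_instrs_def ball_Un)
qed

lemma keep_tapes: "map2 act (map (%r. (r, No_Move)) (map scan ts)) ts = ts" by (induction ts) auto

definition answered :: "nat => nat list set => nat => config => bool" where
  "answered Q A \<iota> c \<longleftrightarrow> (\<iota> < Q --> tape_word (last (snd c)) \<notin> A) \<and> (Q <= \<iota> \<and> \<iota> < 2 * Q --> tape_word (last (snd c)) \<in> A)"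

context
  fixes A :: "nat list set" and M Sg Qs il k Q IL
  assumes fits: "fits M Sg Qs il"
  defines "k \<equiv> tapes M" and "Q \<equiv> length (readings (tapes M) Sg)" and "IL \<equiv> extended (tapes M) Sg Qs M il"
begin

lemma moves_step:
  assumes "moves IL c \<iota> c'" "answered Q A \<iota> c" shows "step A M c c' \<or> c' = c" proof -
  obtain q ts where c: "c = (q, ts)" by (cases c)
  obtain q' as where ins: "\<iota> < length IL" "IL ! \<iota> = ((q, map scan ts), (q', as))" "c' = (q', map2 act as ts)"
    using assms(1) unfolding moves_def c by auto
  have kp: "c' = (p', ts) \<and> q = p" if k: "IL ! \<iota> = keep p p' rs" for p p' rs using k ins keep_tapes unfolding keep_def by auto
  consider "\<iota> < Q" | "Q <= \<iota>" "\<iota> < 2 * Q" | "2 * Q <= \<iota>" by linarith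
  then show ?thesis proof cases
    case 1
    then have "IL ! \<iota> = keep (query_state M) (no_state M) (readings (tapes M) Sg ! \<iota>)" by (simp add: IL_def Q_def extended_def nth_append)
    from kp[OF this] have "c' = (no_state M, ts)" "q = query_state M" by auto
    moreover have "tape_word (last ts) \<notin> A" using assms(2) 1 by (simp add: answered_def c)
    ultimately show ?thesis using step.query[of A M ts] by (simp add: c)
  next
    case 2
    then have "\<iota> - Q < length (readings (tapes M) Sg)" unfolding Q_def by linarith
    then have "IL ! \<iota> = keep (query_state M) (yes_state M) (readings (tapes M) Sg ! (\<iota> - Q))"
      using 2 by (simp add: IL_def Q_def extended_def nth_append)
    from kp[OF this] have "c' = (yes_state M, ts)" "q = query_state M" by auto
    moreover have "tape_word (last ts) \<in> A" using assms(2) 2 by (simp add: answered_def c)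
    ultimately show ?thesis using step.query[of A M ts] by (simp add: c)
  next
    case 3
    let ?r = "concat (map (%q. map (keep q q) (readings (tapes M) Sg)) [0..<Qs]) @ il"
    let ?p = "map (keep (query_state M) (no_state M)) (readings (tapes M) Sg) @ map (keep (query_state M) (yes_state M)) (readings (tapes M) Sg)"
    have I: "IL = ?p @ ?r" "length ?p = 2 * Q" by (simp_all add: IL_def Q_def extended_def)
    have r: "IL ! \<iota> = ?r ! (\<iota> - 2 * Q)" "\<iota> - 2 * Q < length ?r" proof -
      have "length IL = 2 * Q + length ?r" unfolding I(1) using I(2) by simp
      then show "\<iota> - 2 * Q < length ?r" using ins(1) 3 by linarith
      have "\<not> \<iota> < length ?p" unfolding I(2) using 3 by linarith
      then have "(?p @ ?r) ! \<iota> = ?r ! (\<iota> - length ?p)" unfolding nth_append by (rule if_not_P)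
      then show "IL ! \<iota> = ?r ! (\<iota> - 2 * Q)" unfolding I(2) I(1)[symmetric] .
    qed
    then have "IL ! \<iota> \<in> set ?r" unfolding r(1) by (intro nth_mem)
    then consider p rs where "IL ! \<iota> = keep p p rs" | "IL ! \<iota> \<in> set il" by auto
    then show ?thesis proof cases
      case 1
      from kp[OF this] show ?thesis by (simp add: c)
    next
      case 2
      then have "((q, map scan ts), (q', as)) \<in> instructions M" "q ~= query_state M" using fits ins(2) unfolding fits_def by auto
      then show ?thesis using step.instruction ins(3) c by blast
    qed
  qed
qed

lemma fit_scan: "fit_config k Sg Qs n m c ==> map scan (snd c) \<in> set (readings (tapes M) Sg)"
  by (auto simp: set_readings fit_config_def k_def scan_def)

lemma step_moves:
  assumes "step A M c c'" "fit_config k Sg Qs n m c" shows "\<exists>\<iota>. moves IL c \<iota> c' \<and> answered Q A \<iota> c" using assms(1)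
proof cases
  case (instruction q ts q' as)
  then have "((q, map scan ts), (q', as)) \<in> set il" using fits by (auto simp: fits_def)
  then obtain j where j: "j < length il" "il ! j = ((q, map scan ts), (q', as))" by (auto simp: in_set_conv_nth)
  let ?p = "map (keep (query_state M) (no_state M)) (readings (tapes M) Sg) @ map (keep (query_state M) (yes_state M)) (readings (tapes M) Sg) @
      concat (map (%q. map (keep q q) (readings (tapes M) Sg)) [0..<Qs])"
  have I: "IL = ?p @ il" by (simp add: IL_def extended_def)
  have "moves IL c (length ?p + j) c'" unfolding moves_def I nth_append_length_plus using j instruction by simp
  moreover have "2 * Q <= length ?p + j" by (simp add: Q_def)
  then have "answered Q A (length ?p + j) c" unfolding answered_def by linarith
  ultimately show ?thesis by blast
next
  case (query ts)
  obtain j where j: "j < Q" "readings (tapes M) Sg ! j = map scan ts" using fit_scan[OF assms(2)] query(1) by (auto simp: in_set_conv_nth Q_def)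
  have L: "2 * Q <= length IL" by (simp add: IL_def Q_def extended_def)
  show ?thesis proof (cases "tape_word (last ts) \<in> A")
    case True
    have "IL ! (Q + j) = keep (query_state M) (yes_state M) (map scan ts)" using j by (simp add: IL_def Q_def extended_def nth_append)
    then have "moves IL c (Q + j) c'" using j L query True keep_tapes[of ts] by (simp add: moves_def keep_def)
    then show ?thesis using True query(1) unfolding answered_def by (intro exI[of _ "Q + j"]) simp
  next
    case False
    have "IL ! j = keep (query_state M) (no_state M) (map scan ts)" using j by (simp add: IL_def Q_def extended_def nth_append)
    then have "moves IL c j c'" using j L query False keep_tapes[of ts] by (simp add: moves_def keep_def)
    then show ?thesis using False query(1) j unfolding answered_def by (intro exI[of _ j]) simp
  qed
qed

lemma idle_moves:
  assumes "fit_config k Sg Qs n m c" shows "\<exists>\<iota>. moves IL c \<iota> c \<and> answered Q A \<iota> c" proof -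
  let ?p = "map (keep (query_state M) (no_state M)) (readings (tapes M) Sg) @ map (keep (query_state M) (yes_state M)) (readings (tapes M) Sg)"
  let ?m = "concat (map (%q. map (keep q q) (readings (tapes M) Sg)) [0..<Qs])"
  have "keep (fst c) (fst c) (map scan (snd c)) \<in> set ?m" using fit_scan[OF assms] assms by (auto simp: fit_config_def)
  then obtain j where j: "j < length ?m" "?m ! j = keep (fst c) (fst c) (map scan (snd c))" unfolding in_set_conv_nth by blast
  have I: "IL = ?p @ ?m @ il" by (simp add: IL_def extended_def)
  have n: "IL ! (length ?p + j) = ?m ! j" "length ?p + j < length IL" unfolding I nth_append_length_plus using j(1) by (simp_all add: nth_append)
  have "moves IL c (length ?p + j) c" unfolding moves_def using n j(2) keep_tapes[of "snd c"] by (simp add: keep_def)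
  moreover have "2 * Q <= length ?p + j" by (simp add: Q_def)
  then have "answered Q A (length ?p + j) c" unfolding answered_def by linarith
  ultimately show ?thesis by blast
qed

lemma fit_moves:
  assumes "moves IL c \<iota> c'" "fit_config k Sg Qs n m c" shows "fit_config k Sg Qs n (Suc m) c'" proof -
  obtain q ts where c: "c = (q, ts)" by (cases c)
  obtain q' as where ins: "\<iota> < length IL" "IL ! \<iota> = ((q, map scan ts), (q', as))" "c' = (q', map2 act as ts)"
    using assms(1) unfolding moves_def c by auto
  have "((q, map scan ts), (q', as)) \<in> set IL" using ins nth_mem by metis
  then have wf: "q' < Qs" "length as = k" "!!a. a \<in> set as ==> fst a < Sg"
    using fit_extended[OF fits] unfolding fit_instrs_def IL_def k_def by auto
  have "\<bar>snd t\<bar> <= int (Suc m) \<and> (\<forall>i. fst t i < Sg \<and> (fst t i ~= 0 --> i < int n + int (Suc m)))" if t: "t \<in> set (map2 act as ts)" for t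
  proof -
    obtain a u where au: "t = act a u" "a \<in> set as" "u \<in> set ts" using t by (auto elim: in_set_zipE)
    have u: "\<bar>snd u\<bar> <= int m" "!!i. fst u i < Sg" "!!i. fst u i ~= 0 ==> i < int n + int m"
      using assms(2) au(3) unfolding fit_config_def c by auto
    have "\<bar>snd t\<bar> <= int (Suc m)" using u(1) unfolding au(1) by (cases "snd a") (simp_all add: act_def)
    moreover have "fst t i < Sg" for i using u(2) wf(3)[OF au(2)] unfolding au(1) by (simp add: act_def)
    moreover have "i < int n + int (Suc m)" if "fst t i ~= 0" for i proof (cases "i = snd u")
      case True
      then show ?thesis using u(1) by linarith
    next
      case False
      then have "fst u i ~= 0" using that unfolding au(1) by (simp add: act_def)
      from u(3)[OF this] show ?thesis by simp
    qed
    ultimately show ?thesis by blast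
  qed
  then show ?thesis using wf assms(2) unfolding fit_config_def ins(3) c by simp
qed

lemma fit_steps:
  assumes "(step A M ^^ m) (initial M x) c" "x \<in> words g" "g < Sg" "0 < tapes M" shows "fit_config k Sg Qs (length x) m c" using assms(1)
proof (induction m arbitrary: c)
  case 0
  have "x ! i < Sg" if "i < length x" for i using nth_mem[OF that] assms(2,3) unfolding words_def by (auto simp: in_lists_conv_set)
  moreover have "0 < Sg" using assms(3) by simp
  ultimately have "fst t i < Sg \<and> (fst t i ~= 0 --> i < int (length x))" if "t = input_tape x \<or> t = blank_tape" for t i
    using that by (auto simp: input_tape_def blank_tape_def split: if_splits)
  moreover have "snd t = 0" if "t = input_tape x \<or> t = blank_tape" for t using that by (auto simp: input_tape_def blank_tape_def)
  moreover have "t = input_tape x \<or> t = blank_tape" if "t \<in> set (snd c)" for t using that 0 by (auto simp: initial_def)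
  moreover have "fst c < Qs" "length (snd c) = k" using 0 fits assms(4) by (auto simp: initial_def fits_def k_def)
  ultimately show ?case unfolding fit_config_def by (metis abs_zero add.right_neutral of_nat_0 order_refl)
next
  case (Suc m)
  then obtain c0 where "(step A M ^^ m) (initial M x) c0" "step A M c0 c" by auto
  from step_moves[OF this(2) Suc.IH[OF this(1)]] show ?case using fit_moves Suc.IH[OF \<open>(step A M ^^ m) (initial M x) c0\<close>] by blast
qed

text \<open>Time in the tableau and steps of the machine differ because of idle steps. The geometric
  bounds depend on the number m of real steps, which is at most B < K, so the window is never left
  during the K steps of the tableau.\<close>

lemma tableau_sound:
  assumes x: "x \<in> words g" "g < Sg" "0 < tapes M"
    and bound: "!!m c. (step A M ^^ m) (initial M x) c ==> m <= B" and K: "B < K" "2 * K <= N"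
    and tab: "!!tm i d. tm <= N ==> i <= N ==> d <= N ==> tableau k Sg Qs IL U tm i d"
    and init: "described k K N U 0 (initial M x)"
    and queries: "!!tm \<iota> m c. tm <= N ==> (step A M ^^ m) (initial M x) c ==> described k K N U tm c ==> \<iota> < length IL ==>
        U 3 tm \<iota> 0 0 ==> answered Q A \<iota> c"
    and acc: "!!p. p < Qs ==> p ~= accept_state M ==> \<not> U 0 K p 0 0" shows "accepts A M x" proof -
  have "\<exists>m c. (step A M ^^ m) (initial M x) c \<and> described k K N U tm c" if "tm <= K" for tm using that proof (induction tm)
    case 0
    have "(step A M ^^ 0) (initial M x) (initial M x)" by simp
    then show ?case using init by blast
  next
    case (Suc tm)
    then obtain m c where mc: "(step A M ^^ m) (initial M x) c" "described k K N U tm c" by auto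
    have fit: "fit_config k Sg Qs (length x) m c" by (rule fit_steps[OF mc(1) x])
    have m: "m < K" using bound[OF mc(1)] K by simp
    have "tm <= N" using Suc.prems K by linarith
    from tableau_step[OF tab[OF this] mc(2) fit fit_extended[OF fits, folded k_def IL_def] m K(2)]
    obtain \<iota> c' where io: "U 3 tm \<iota> 0 0" "moves IL c \<iota> c'" "described k K N U (tm + 1) c'" by auto
    have "answered Q A \<iota> c" by (rule queries[OF \<open>tm <= N\<close> mc _ io(1)]) (use io(2) in \<open>simp add: moves_def\<close>)
    from moves_step[OF io(2) this] show ?case
    proof
      assume "step A M c c'"
      then have "(step A M ^^ Suc m) (initial M x) c'" using mc(1) by auto
      then show ?thesis using io(3) by (metis Suc_eq_plus1)
    next
      assume "c' = c"
      then show ?thesis using mc(1) io(3) by (metis Suc_eq_plus1)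
    qed
  qed
  then obtain m c where mc: "(step A M ^^ m) (initial M x) c" "described k K N U K c" by blast
  have "fst c < Qs" using fit_steps[OF mc(1) x] by (simp add: fit_config_def)
  then have "fst c = accept_state M" using acc mc(2) unfolding described_def by blast
  then have "(step A M)\<^sup>*\<^sup>* (initial M x) (accept_state M, snd c)" using mc(1) by (metis prod.collapse relpowp_imp_rtranclp)
  then show ?thesis unfolding accepts_def by blast
qed

text \<open>An accepting path has length at most B; it is prolonged by idle steps, so that
  acceptance can be tested at one fixed later time.\<close>

lemma accepting_run:
  assumes x: "x \<in> words g" "g < Sg" "0 < tapes M" and "accepts A M x"
    and bound: "!!m c. (step A M ^^ m) (initial M x) c ==> m <= B"
  shows "\<exists>cf io. cf 0 = initial M x \<and> (\<forall>tm. moves IL (cf tm) (io tm) (cf (tm + 1)) \<and> answered Q A (io tm) (cf tm)) \<and>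
     (\<forall>tm. \<exists>m\<le>B. (step A M ^^ m) (initial M x) (cf tm)) \<and> (\<forall>tm\<ge>B. fst (cf tm) = accept_state M)" proof -
  obtain m ts where m: "(step A M ^^ m) (initial M x) (accept_state M, ts)" using assms(4) unfolding accepts_def by (metis rtranclp_imp_relpowp)
  then obtain f where f: "f 0 = initial M x" "f m = (accept_state M, ts)" "!!i. i < m ==> step A M (f i) (f (Suc i))"
    unfolding relpowp_fun_conv by blast
  define cf where "cf tm = f (min tm m)" for tm
  have pw: "(step A M ^^ i) (initial M x) (f i)" if "i <= m" for i unfolding relpowp_fun_conv using f(1,3) that by (intro exI[of _ f]) auto
  have fit: "fit_config k Sg Qs (length x) (min tm m) (cf tm)" for tm unfolding cf_def by (rule fit_steps[OF pw x]) simp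
  have "\<exists>\<iota>. moves IL (cf tm) \<iota> (cf (tm + 1)) \<and> answered Q A \<iota> (cf tm)" for tm proof (cases "tm < m")
    case True
    then have "step A M (cf tm) (cf (tm + 1))" using f(3)[of tm] by (simp add: cf_def min_def Suc_eq_plus1)
    from step_moves[OF this fit] show ?thesis .
  next
    case False
    then have "cf (tm + 1) = cf tm" by (simp add: cf_def min_def)
    then show ?thesis using idle_moves[OF fit, of tm] by simp
  qed
  then obtain io where "\<forall>tm. moves IL (cf tm) (io tm) (cf (tm + 1)) \<and> answered Q A (io tm) (cf tm)" by metis
  moreover have "\<exists>l\<le>B. (step A M ^^ l) (initial M x) (cf tm)" for tm
    using pw[of "min tm m"] bound[OF pw[of "min tm m"]] unfolding cf_def by auto
  moreover have "fst (cf tm) = accept_state M" if "tm \<ge> B" for tm using bound[OF m] that f(2) by (simp add: cf_def min_absorb2)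
  moreover have "cf 0 = initial M x" using f(1) by (simp add: cf_def)
  ultimately show ?thesis by blast
qed

end

section \<open>Clauses as templates\<close>

fun big :: "(tmpl => tmpl => tmpl) => tmpl list => tmpl" where
  "big C [] = TLit True []"
| "big C [a] = a"
| "big C (a # b # xs) = C a (big C (b # xs))"

lemma evl_big:
  "xs ~= [] ==> evl w (interp E (big TConj xs) e) \<longleftrightarrow> (\<forall>a\<in>set xs. evl w (interp E a e))"
  "xs ~= [] ==> evl w (interp E (big TDisj xs) e) \<longleftrightarrow> (\<exists>a\<in>set xs. evl w (interp E a e))"
  by (induction xs rule: induct_list012) auto

definition binary :: "(tmpl => tmpl => tmpl) => bool" where
  "binary C \<longleftrightarrow> C = TConj \<or> C = TDisj"

lemma binary [simp]: "binary TConj" "binary TDisj" by (simp_all add: binary_def)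

lemma all_lits_big:
  assumes "binary C" "xs ~= []" "!!a. a \<in> set xs ==> all_lits E P a" shows "all_lits E P (big C xs)" using assms(2,3)
proof (induction xs rule: induct_list012)
  case (3 a b xs)
  have "all_lits E P a" using "3.prems"(2) by simp
  moreover have "all_lits E P (big C (b # xs))" by (rule "3.IH"(2)) (simp, rule "3.prems"(2), simp)
  ultimately show ?case using assms(1) unfolding binary_def by (elim disjE) simp_all
qed auto

lemma separated_big:
  assumes "binary C" "ps ~= []" "distinct ps" "!!p. p \<in> set ps ==> separated E (f p)"
    "!!p. p \<in> set ps ==> all_lits E (%e s l. g l = p) (f p)" shows "separated E (big C (map f ps))" using assms(2-)
proof (induction ps rule: induct_list012)
  case (3 p p' ps)
  have "separated E (big C (map f (p' # ps)))" using 3 by simp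
  moreover have "all_lits E (%e s l. g l \<in> set (p' # ps)) (big C (map f (p' # ps)))" proof (rule all_lits_big[OF assms(1)])
    fix a assume "a \<in> set (map f (p' # ps))"
    then obtain r where r: "r \<in> set (p' # ps)" "a = f r" by (metis image_iff list.set_map)
    have "all_lits E (%e s l. g l = r) (f r)" by (rule 3(6)) (use r in auto)
    then show "all_lits E (%e s l. g l \<in> set (p' # ps)) a" unfolding r(2) by (rule all_lits_mono) (use r in simp)
  qed simp
  moreover have "separated E (f p)" "all_lits E (%e s l. g l = p) (f p)" using 3 by simp_all
  ultimately have "separated E (TConj (f p) (big C (map f (p' # ps))))" "separated E (TDisj (f p) (big C (map f (p' # ps))))"
    using separated_binary[of E "f p" "big C (map f (p' # ps))" "%e s l. g l = p" "%e s l. g l \<in> set (p' # ps)"] 3(4) by auto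
  then show ?case using assms(1) by (auto simp: binary_def)
qed auto

definition occ :: "nat => nat => nat => literal => tmpl" where
  "occ part p q l = (case l of (sg, kd, cs) => TLit True
     ([[Cst kd], [Cst (if sg then 1 else 0)], [Cst part], [Cst p], [Cst q], [Idx 1], [Idx 2], [Idx 3], [Idx 4]] @ cs))"

definition nf :: "(tmpl => tmpl => tmpl) => (tmpl => tmpl => tmpl) => nat => literal list list => tmpl" where
  "nf C D part cs = big C (map (%p. big D (map (%q. occ part p q (cs ! p ! q)) [0..<length (cs ! p)])) [0..<length cs])"

primrec ok_summand :: "nat => summand => bool" where
  "ok_summand c0 (Cst c) \<longleftrightarrow> c <= c0"
| "ok_summand c0 (Idx v) \<longleftrightarrow> v \<in> {1..5}"
| "ok_summand c0 (Letter v) \<longleftrightarrow> v \<in> {1..4}"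

definition ok_literal :: "nat => literal => bool" where
  "ok_literal c0 = (%(sg, kd, cs). kd < 2 \<and> length cs = 6 \<and> (\<forall>ss\<in>set cs. length ss <= 3 \<and> (\<forall>s\<in>set ss. ok_summand c0 s)))"

definition ok_clauses :: "nat => literal list list => bool" where
  "ok_clauses c0 cs \<longleftrightarrow> cs ~= [] \<and> length cs <= c0 \<and> (\<forall>c\<in>set cs. c ~= [] \<and> length c <= c0 \<and> (\<forall>l\<in>set c. ok_literal c0 l))"

text \<open>All literals of the matrix are positive atoms; negation is a change of the sign recorded
  in the name.\<close>

definition negate :: "literal => literal" where
  "negate = (%(sg, kd, cs). (\<not> sg, kd, cs))"

lemma ok_negate: "ok_clauses c0 cs ==> ok_clauses c0 (map (map negate) cs)"
  by (auto simp: ok_clauses_def ok_literal_def negate_def split: prod.splits)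

lemma evl_occ:
  assumes "ok_literal c0 l"
  shows "evl (holds W) (interp E (occ part p q l) e) \<longleftrightarrow> (case l of (sg, kd, cs) => W kd (names E e cs) = sg)"
  using assms by (auto simp: occ_def holds_def One_nat_def split: prod.splits)

lemma evl_cnf:
  assumes "ok_clauses c0 cs" shows "evl (holds W) (interp E (nf TConj TDisj part cs) e) \<longleftrightarrow> sat E e W cs" proof -
  have ok: "ok_literal c0 (cs ! p ! q)" if "p < length cs" "q < length (cs ! p)" for p q using assms that unfolding ok_clauses_def by (meson nth_mem)
  have ne: "cs ~= []" "!!p. p < length cs ==> cs ! p ~= []" using assms by (auto simp: ok_clauses_def)
  have c: "evl (holds W) (interp E (big TDisj (map (%q. occ part p q (cs ! p ! q)) [0..<length (cs ! p)])) e) \<longleftrightarrow> true_clause E e W (cs ! p)"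
    if p: "p < length cs" for p proof -
    have "(\<exists>a\<in>set (map (%q. occ part p q (cs ! p ! q)) [0..<length (cs ! p)]). evl (holds W) (interp E a e)) \<longleftrightarrow>
        (\<exists>q<length (cs ! p). evl (holds W) (interp E (occ part p q (cs ! p ! q)) e))" by auto
    also have "\<dots> \<longleftrightarrow> (\<exists>q<length (cs ! p). case cs ! p ! q of (sg, kd, co) => W kd (names E e co) = sg)"
      by (simp add: evl_occ[OF ok[OF p]] cong: conj_cong)
    also have "\<dots> \<longleftrightarrow> true_clause E e W (cs ! p)" unfolding true_clause_def by (metis in_set_conv_nth)
    finally show ?thesis using ne(2)[OF p] by (subst evl_big(2)) simp_all
  qed
  have "evl (holds W) (interp E (nf TConj TDisj part cs) e) \<longleftrightarrow> (\<forall>p<length cs. true_clause E e W (cs ! p))"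
    unfolding nf_def using ne c by (subst evl_big(1)) auto
  then show ?thesis by (simp add: sat_def all_set_conv_all_nth)
qed

lemma evl_dnf:
  assumes "ok_clauses c0 cs" shows "evl (holds W) (interp E (nf TDisj TConj part (map (map negate) cs)) e) \<longleftrightarrow> \<not> sat E e W cs"
proof -
  have ok: "ok_literal c0 (cs ! p ! q)" if "p < length cs" "q < length (cs ! p)" for p q using assms that unfolding ok_clauses_def by (meson nth_mem)
  have n: "evl (holds W) (interp E (occ part p q (negate l)) e) \<longleftrightarrow> \<not> evl (holds W) (interp E (occ part p q l) e)"
    if "ok_literal c0 l" for p q l proof -
    have "ok_literal c0 (negate l)" using that by (auto simp: ok_literal_def negate_def split: prod.splits)
    from evl_occ[OF this] evl_occ[OF that] show ?thesis by (auto simp: negate_def split: prod.splits)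
  qed
  have "cs ~= []" "!!p. p < length cs ==> cs ! p ~= []" using assms by (auto simp: ok_clauses_def)
  then have "evl (holds W) (interp E (nf TDisj TConj part (map (map negate) cs)) e) \<longleftrightarrow> \<not> evl (holds W) (interp E (nf TConj TDisj part cs) e)"
    unfolding nf_def by (simp add: evl_big n ok cong: ball_cong_simp bex_cong_simp)
  then show ?thesis using evl_cnf[OF assms] by simp
qed

text \<open>In the reduction tape 1 holds the time of a query. Clauses NC say that it is not
  answered negatively, and the disjunction at the end says that Y violates one of the clauses YC for
  an accepting run of the oracle machine. The violation of a conjunctive form is written directly as
  a disjunctive one.\<close>

definition matrix :: "literal list list => literal list list => literal list list => tmpl" where
  "matrix XC NC YC = TAll 1 (TConj (TAll 2 (TAll 3 (TAll 4 (nf TConj TDisj 0 XC))))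
     (TDisj (nf TConj TDisj 1 NC) (TEx 2 (TEx 3 (TEx 4 (nf TDisj TConj 2 (map (map negate) YC)))))))"

text \<open>The first nine components of an occurrence in the matrix are \<open>[kind, sign, part, clause, literal]\<close> and the values
  of the loops 1 to 4; \<open>k\<close> is the number of loops that are still free.\<close>

definition occ_lit :: "nat => nat => nat set => (nat => nat) => bool => nat list => bool" where
  "occ_lit N k parts e s l \<longleftrightarrow> matrix_lit s l \<and> l ! 2 \<in> parts \<and> (\<forall>v\<in>{1..k}. l ! (4 + v) = e v) \<and>
     ((\<forall>v\<in>{1..5}. e v <= N) --> set (drop 2 l) \<subseteq> {..3 * N})"

lemma occ_lit_mono: "occ_lit N k parts e s l ==> j <= k ==> parts \<subseteq> parts' ==> occ_lit N j parts' e s l" unfolding occ_lit_def by auto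

context
  fixes E :: "nat => nat list" and N c0 :: nat
  assumes loop_length: "!!v. v \<in> {1..4} ==> length (E v) = N"
    and letters: "!!v i. v \<in> {1..4} ==> nth0 (E v) i <= N"
    and c0: "c0 <= N" "2 <= N"
begin

lemma occ_lits:
  assumes "ok_literal c0 l" "part <= N" "p <= N" "q <= N"
  shows "all_lits E (%e s l. occ_lit N 4 {part} e s l \<and> l ! 3 = p \<and> l ! 4 = q) (occ part p q l)" proof -
  obtain sg kd cs where l: "l = (sg, kd, cs)" by (metis surj_pair)
  have cs: "kd < 2" "length cs = 6" "!!ss. ss \<in> set cs ==> length ss <= 3 \<and> (\<forall>s\<in>set ss. ok_summand c0 s)"
    using assms(1) l by (auto simp: ok_literal_def)
  \<comment> \<open>A component is a sum of at most three summands, each of them at most N; this is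
    the origin of the bound \<open>3 * N\<close>.\<close>
  have cv: "cval E e ss <= 3 * N" if "\<forall>v\<in>{1..5}. e v <= N" "ss \<in> set cs" for e ss proof -
    have "sval E e s <= N" if "s \<in> set ss" for s
      using cs(3)[OF \<open>ss \<in> set cs\<close>] that c0 letters \<open>\<forall>v\<in>{1..5}. e v <= N\<close> by (cases s) fastforce+
    then have "cval E e ss <= length ss * N" by (induction ss) (auto intro: add_mono)
    also have "\<dots> <= 3 * N" using cs(3)[OF that(2)] by (intro mult_right_mono) auto
    finally show ?thesis .
  qed
  have v: "v = 1 \<or> v = 2 \<or> v = 3 \<or> v = 4" if "v \<in> {1..4}" for v :: nat using that by auto
  have e14: "(\<forall>v\<in>{1..5}. e v <= N) ==> e 1 <= 3 * N \<and> e 2 <= 3 * N \<and> e 3 <= 3 * N \<and> e 4 <= 3 * N" for e :: "nat => nat"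
  proof -
    assume a: "\<forall>v\<in>{1..5}. e v <= N"
    have "e 1 <= N" "e 2 <= N" "e 3 <= N" "e 4 <= N" using a by simp_all
    then show ?thesis by simp
  qed
  have "occ_lit N 4 {part} e True ([kd, if sg then 1 else 0, part, p, q, e 1, e 2, e 3, e 4] @ names E e cs)" for e unfolding occ_lit_def
  proof (intro conjI impI ballI)
    let ?l = "[kd, if sg then 1 else 0, part, p, q, e 1, e 2, e 3, e 4] @ names E e cs"
    show "matrix_lit True ?l" using cs by (simp add: matrix_lit_def names_def One_nat_def)
    show "?l ! (4 + v) = e v" if "v \<in> {1..4}" for v using v[OF that] by (elim disjE) simp_all
    show "set (drop 2 ?l) \<subseteq> {..3 * N}" if "\<forall>v\<in>{1..5}. e v <= N"
      using cv[OF that] e14[OF that] assms(2-4) by (auto simp: names_def)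
  qed simp
  then show ?thesis unfolding occ_def l by (simp add: One_nat_def)
qed

lemma nf_separated:
  assumes C: "binary C" "binary D" and ok: "ok_clauses c0 cs" and "part <= 2"
  shows "separated E (nf C D part cs)" "all_lits E (occ_lit N 4 {part}) (nf C D part cs)" proof -
  have ne: "cs ~= []" "length cs <= N" "!!p. p < length cs ==> cs ! p ~= [] \<and> length (cs ! p) <= N"
    using ok c0 by (auto simp: ok_clauses_def dest: nth_mem intro: order_trans)
  have o: "all_lits E (%e s l. occ_lit N 4 {part} e s l \<and> l ! 3 = p \<and> l ! 4 = q) (occ part p q (cs ! p ! q))"
    if "p < length cs" "q < length (cs ! p)" for p q proof (rule occ_lits)
    show "ok_literal c0 (cs ! p ! q)" using ok that unfolding ok_clauses_def by (meson nth_mem)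
    show "part <= N" "p <= N" "q <= N" using assms(4) c0 that ne(2) ne(3)[OF that(1)] by auto
  qed
  let ?D = "%p. big D (map (%q. occ part p q (cs ! p ! q)) [0..<length (cs ! p)])"
  have d: "all_lits E (%e s l. occ_lit N 4 {part} e s l \<and> l ! 3 = p) (?D p)" "separated E (?D p)" if p: "p < length cs" for p proof -
    show "all_lits E (%e s l. occ_lit N 4 {part} e s l \<and> l ! 3 = p) (?D p)"
      using ne(3)[OF p] by (intro all_lits_big[OF C(2)]) (auto intro!: all_lits_mono[OF o[OF p]])
    show "separated E (?D p)"
      using ne(3)[OF p] by (intro separated_big[OF C(2), where g = "%l. l ! 4"]) (auto intro!: all_lits_mono[OF o[OF p]] simp: occ_def split: prod.splits)
  qed
  show "separated E (nf C D part cs)"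
    unfolding nf_def using ne(1) d(2) by (intro separated_big[OF C(1), where g = "%l. l ! 3"]) (auto intro!: all_lits_mono[OF d(1)])
  show "all_lits E (occ_lit N 4 {part}) (nf C D part cs)"
    unfolding nf_def using ne(1) by (intro all_lits_big[OF C(1)]) (auto intro!: all_lits_mono[OF d(1)])
qed

text \<open>The loops are closed in the order 4, 3, 2, 1, so a single number tells which of them are
  still free.\<close>

lemma loop_separated:
  assumes "separated E a" "all_lits E (occ_lit N (Suc k) parts) a" "k < 4" shows "separated E (TAll (Suc k) a)" "separated E (TEx (Suc k) a)"
    "all_lits E (occ_lit N k parts) (TAll (Suc k) a)" "all_lits E (occ_lit N k parts) (TEx (Suc k) a)" proof -
  have "all_lits E (%e s l. l ! (4 + Suc k) = e (Suc k)) a" by (rule all_lits_mono[OF assms(2)]) (auto simp: occ_lit_def dest: bspec[where x = "Suc k"])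
  from separated_loop[OF assms(1) this] show "separated E (TAll (Suc k) a)" "separated E (TEx (Suc k) a)" .
  have m: "occ_lit N k parts e s l" if p: "p <= length (E (Suc k))" and o: "occ_lit N (Suc k) parts (e(Suc k := p)) s l" for e p s l proof -
    have "l ! (4 + v) = e v" if "v \<in> {1..k}" for v using o that by (auto simp: occ_lit_def)
    moreover have "set (drop 2 l) \<subseteq> {..3 * N}" if "\<forall>v\<in>{1..5}. e v <= N"
      using o that p loop_length[of "Suc k"] assms(3) by (auto simp: occ_lit_def)
    ultimately show ?thesis using o by (simp add: occ_lit_def)
  qed
  show "all_lits E (occ_lit N k parts) (TAll (Suc k) a)" "all_lits E (occ_lit N k parts) (TEx (Suc k) a)"
    by (rule all_lits_loop[OF assms(2) m], assumption+)+
qed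

lemma matrix_separated:
  assumes "ok_clauses c0 XC" "ok_clauses c0 NC" "ok_clauses c0 YC"
  shows "separated E (matrix XC NC YC)" "all_lits E (occ_lit N 0 {0, 1, 2}) (matrix XC NC YC)" proof -
  have n: "(4 :: nat) = Suc 3" "(3 :: nat) = Suc 2" "(2 :: nat) = Suc 1" "1 = Suc 0" by simp_all
  have X: "separated E (TAll 2 (TAll 3 (TAll 4 (nf TConj TDisj 0 XC)))) \<and>
      all_lits E (occ_lit N 1 {0}) (TAll 2 (TAll 3 (TAll 4 (nf TConj TDisj 0 XC))))" proof -
    note a = nf_separated[OF binary(1) binary(2) assms(1), of 0, unfolded n(1), OF le0]
    note b = loop_separated(1,3)[OF a, unfolded n(1)[symmetric]]
    note c = loop_separated(1,3)[of "TAll 4 (nf TConj TDisj 0 XC)" 2, folded n(2), OF b[simplified]]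
    show ?thesis using loop_separated(1,3)[of "TAll 3 (TAll 4 (nf TConj TDisj 0 XC))" 1, folded n(3), OF c[simplified]] by simp
  qed
  let ?Y = "nf TDisj TConj 2 (map (map negate) YC)"
  have Y: "separated E (TEx 2 (TEx 3 (TEx 4 ?Y))) \<and> all_lits E (occ_lit N 1 {2}) (TEx 2 (TEx 3 (TEx 4 ?Y)))" proof -
    note a = nf_separated[OF binary(2) binary(1) ok_negate[OF assms(3)], of 2, unfolded n(1), OF order_refl]
    note b = loop_separated(2,4)[OF a, unfolded n(1)[symmetric]]
    note c = loop_separated(2,4)[of "TEx 4 ?Y" 2, folded n(2), OF b[simplified]]
    show ?thesis using loop_separated(2,4)[of "TEx 3 (TEx 4 ?Y)" 1, folded n(3), OF c[simplified]] by simp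
  qed
  have N: "separated E (nf TConj TDisj 1 NC)" "all_lits E (occ_lit N 1 {1}) (nf TConj TDisj 1 NC)"
    by (rule nf_separated[OF binary(1) binary(2) assms(2)], simp)
      (rule all_lits_mono[OF nf_separated(2)[OF binary(1) binary(2) assms(2)]], simp, rule occ_lit_mono, assumption, simp_all)
  have NY: "separated E (TDisj (nf TConj TDisj 1 NC) (TEx 2 (TEx 3 (TEx 4 ?Y))))"
      "all_lits E (occ_lit N 1 {1, 2}) (TDisj (nf TConj TDisj 1 NC) (TEx 2 (TEx 3 (TEx 4 ?Y))))" proof -
    show "separated E (TDisj (nf TConj TDisj 1 NC) (TEx 2 (TEx 3 (TEx 4 ?Y))))"
      by (rule separated_binary(2)[OF N(1) conjunct1[OF Y] N(2) conjunct2[OF Y]]) (auto simp: occ_lit_def)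
    show "all_lits E (occ_lit N 1 {1, 2}) (TDisj (nf TConj TDisj 1 NC) (TEx 2 (TEx 3 (TEx 4 ?Y))))"
      unfolding all_lits_simps(3) by (intro conjI all_lits_mono[OF N(2)] all_lits_mono[OF conjunct2[OF Y]]) (auto intro: occ_lit_mono)
  qed
  let ?all = "TConj (TAll 2 (TAll 3 (TAll 4 (nf TConj TDisj 0 XC)))) (TDisj (nf TConj TDisj 1 NC) (TEx 2 (TEx 3 (TEx 4 ?Y))))"
  have s: "separated E ?all" by (rule separated_binary(1)[OF conjunct1[OF X] NY(1) conjunct2[OF X] NY(2)]) (auto simp: occ_lit_def)
  have l: "all_lits E (occ_lit N (Suc 0) {0, 1, 2}) ?all"
    unfolding all_lits_simps(2) by (intro conjI all_lits_mono[OF conjunct2[OF X]] all_lits_mono[OF NY(2)]) (auto intro: occ_lit_mono simp: One_nat_def)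
  show "separated E (matrix XC NC YC)" "all_lits E (occ_lit N 0 {0, 1, 2}) (matrix XC NC YC)"
    unfolding matrix_def using loop_separated(1,3)[OF s l] by (simp_all add: One_nat_def)
qed

lemma evl_matrix:
  assumes "ok_clauses c0 XC" "ok_clauses c0 NC" "ok_clauses c0 YC"
  shows "evl (holds W) (interp E (matrix XC NC YC) e) \<longleftrightarrow> (\<forall>t\<le>N.
    (\<forall>tm\<le>N. \<forall>i\<le>N. \<forall>d\<le>N. sat E (e(1 := t, 2 := tm, 3 := i, 4 := d)) W XC) \<and>
    (sat E (e(1 := t)) W NC \<or> (\<exists>tm\<le>N. \<exists>i\<le>N. \<exists>d\<le>N. \<not> sat E (e(1 := t, 2 := tm, 3 := i, 4 := d)) W YC)))"
proof -
  have [simp]: "length (E 1) = N" "length (E 2) = N" "length (E 3) = N" "length (E 4) = N" by (simp_all add: loop_length)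
  show ?thesis unfolding matrix_def evl_TAll evl_TEx interp.simps(2,3) evl.simps(3,4) evl_cnf[OF assms(1)] evl_cnf[OF assms(2)] evl_dnf[OF assms(3)]
    by simp
qed

theorem provable_matrix:
  assumes "ok_clauses c0 XC" "ok_clauses c0 NC" "ok_clauses c0 YC"
    and "!!v. v \<in> set (occ_tapes @ var_tapes) ==> length (E v) = R" "3 * N <= R" "!!v. e v <= N"
  shows "CL5_provable (interp E (with_gadgets (matrix XC NC YC) 2 2) e) \<longleftrightarrow> (\<exists>X. \<forall>Y. \<forall>t\<le>N.
    (\<forall>tm\<le>N. \<forall>i\<le>N. \<forall>d\<le>N. sat E (e(1 := t, 2 := tm, 3 := i, 4 := d)) (%kd. if kd = 0 then X else Y) XC) \<and>
    (sat E (e(1 := t)) (%kd. if kd = 0 then X else Y) NC \<or>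
     (\<exists>tm\<le>N. \<exists>i\<le>N. \<exists>d\<le>N. \<not> sat E (e(1 := t, 2 := tm, 3 := i, 4 := d)) (%kd. if kd = 0 then X else Y) YC)))"
proof -
  note s = matrix_separated[OF assms(1-3)]
  have "all_lits E (%e. matrix_lit) (matrix XC NC YC)" by (rule all_lits_mono[OF s(2)]) (simp add: occ_lit_def)
  moreover have "set (drop 2 (unatom b)) \<subseteq> {..R}" if "(sg, b) \<in> set (lits (interp E (matrix XC NC YC) e))" for sg b proof -
    have "occ_lit N 0 {0, 1, 2} e sg (unatom b)" using all_litsD[OF s(2) that] by simp
    then have "set (drop 2 (unatom b)) \<subseteq> {..3 * N}" using assms(6) by (simp add: occ_lit_def)
    then show ?thesis using assms(5) by auto
  qed
  ultimately show ?thesis using provable_with_gadgets[OF assms(4) s(1), of e] evl_matrix[OF assms(1-3)] by simp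
qed

end

section \<open>The reduction\<close>

text \<open>Cell 0 of the machine is cell K of the tableau. The number K depends on the input and is
  available as \<open>Idx 5\<close>, the position of a head that does not move.\<close>

definition start_clauses :: "nat => nat => summand list => nat => nat => literal list list" where
  "start_clauses kd b T k q = [[(True, kd, var b T [] q [] [])]] @
     map (%j. [(True, kd, var (b + 1) T [] j [Idx 5] [])]) [0..<k] @
     map (%j. [(True, kd, var (b + 2) T [] j [Idx 3] [])]) [1..<k]"

definition accept_clauses :: "nat => nat => summand list => nat => nat => literal list list" where
  "accept_clauses kd b T Qs q = map (%p. [(False, kd, var b T [Idx 5] p [] [])]) (filter (%p. p ~= q) [0..<Qs])"

text \<open>The loop tapes contain \<open>K\<close> letters \<open>g + 2\<close>, the input, and \<open>K\<close> letters \<open>g + 1\<close>.  The variables of family 8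
  say which letter is at position \<open>i\<close>.\<close>

definition zone :: "bool => summand => literal" where
  "zone sg s = (sg, 0, var 8 [] [] 0 [Idx 3] [s])"

text \<open>An input letter can appear only inside the name of an atom, as \<open>Letter 3\<close>.
  The first clause makes the variable with this name true and the second group makes all others at
  the same position false; afterwards letters can be compared with constants. The padding letters g
  + 1 and g + 2 stand for blanks.\<close>

definition input_clauses :: "nat => literal list list" where
  "input_clauses g = [[zone True (Letter 3)]] @
     concat (map (%a. map (%a'. [zone False (Cst a), zone False (Cst a')]) (filter (%a'. a ~= a') [0..<g + 3])) [0..<g + 3]) @
     map (%a. [zone False (Cst a), (True, 0, var 2 [] [] 0 [Idx 3] [Cst (if a <= g then a else 0)])]) [0..<g + 3]"

text \<open>The tableaus of the oracle machine have the families 4 to 7 and are indexed by the time of the query.  Their input is the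
  word on the tape \<open>l\<close> of the main machine.\<close>

definition query_clauses :: "nat => nat => nat => nat => nat => literal list list" where
  "query_clauses kd l g h Sg =
     [[zone False (Cst (g + 2)), (True, kd, var 6 [Idx 1] [] 0 [Idx 3] [])],
      [zone True (Cst (g + 2)), (False, kd, var 6 [Idx 1] [] 0 [Idx 3] []), (True, kd, var 6 [Idx 1] [] 0 [Idx 3, Cst 1] [])]] @
     map (%a. [(False, 0, var 2 [] [Idx 1] l [Idx 5] [Cst a]), (True, kd, var 6 [Idx 1] [] 0 [Idx 5] [Cst a])]) [0..<Sg] @
     map (%a. [zone True (Cst (g + 2)), (True, kd, var 6 [Idx 1] [] 0 [Idx 3] []),
       (False, 0, var 2 [] [Idx 1] l [Idx 3, Cst 1] [Cst a]), (True, kd, var 6 [Idx 1] [] 0 [Idx 3, Cst 1] [Cst a])]) [0..<Sg] @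
     map (%a. [(False, kd, var 6 [Idx 1] [] 0 [Idx 3] [Cst a])]) [h + 1..<Sg]"

text \<open>The oracle machine has the empty oracle, so instructions for positive answers are
  forbidden. The kind kd selects whether its run is chosen existentially or universally.\<close>

definition oracle_clauses :: "nat => nat => nat => nat => nat => machine => instr list => nat => literal list list" where
  "oracle_clauses g h l Sg Qs M il kd =
     tableau_clauses kd 4 [Idx 1] (tapes M) Sg Qs (extended (tapes M) Sg Qs M il) @
     start_clauses kd 4 [Idx 1] (tapes M) (start_state M) @
     query_clauses kd l g h Sg @
     map (%\<iota>. [(False, kd, var 7 [Idx 1] [Idx 2] \<iota> [] [])]) [Sg ^ tapes M..<2 * Sg ^ tapes M] @
     accept_clauses kd 4 [Idx 1] Qs (accept_state M)"

text \<open>The last group says that a positive answer at the time \<open>Idx 1\<close> implies the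
  clauses cs. The implication is distributed over the clauses by one more literal in each.\<close>

definition main_clauses :: "nat => nat => machine => instr list => literal list list => nat => literal list list" where
  "main_clauses Sg Qs M il cs g =
     tableau_clauses 0 0 [] (tapes M) Sg Qs (extended (tapes M) Sg Qs M il) @
     start_clauses 0 0 [] (tapes M) (start_state M) @
     input_clauses g @
     accept_clauses 0 0 [] Qs (accept_state M) @
     concat (map (%\<iota>. map (%c. (False, 0, var 3 [] [Idx 1] \<iota> [] []) # c) cs) [Sg ^ tapes M..<2 * Sg ^ tapes M])"

definition no_clauses :: "nat => machine => literal list list" where
  "no_clauses Sg M = map (%\<iota>. [(False, 0, var 3 [] [Idx 1] \<iota> [] [])]) [0..<Sg ^ tapes M]"

text \<open>The clauses are fixed by the two machines and do not depend on the input. Hence their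
  constants have a common bound, which the reduction lets K exceed.\<close>

definition shape :: "literal => bool" where
  "shape l \<longleftrightarrow> (\<exists>c0. ok_literal c0 l)"

lemma ok_summand_mono: "ok_summand c s ==> c <= d ==> ok_summand d s" by (cases s) auto

lemma ok_literal_mono: "ok_literal c l ==> c <= d ==> ok_literal d l" unfolding ok_literal_def by (auto intro: ok_summand_mono)

lemma ok_clauses_mono: "ok_clauses c cs ==> c <= d ==> ok_clauses d cs" unfolding ok_clauses_def by (meson le_trans ok_literal_mono)

definition shape_sum :: "summand list => bool" where
  "shape_sum ss \<longleftrightarrow> length ss <= 3 \<and> (\<forall>s\<in>set ss. case s of Cst c => True | Idx v => v \<in> {1..5} | Letter v => v \<in> {1..4})"

lemma shape_var:
  assumes "kd < 2" "shape_sum T" "shape_sum tm" "shape_sum i" "shape_sum a" shows "shape (sg, kd, var f T tm j i a)" proof -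
  have "\<exists>c0. \<forall>s\<in>set ss. ok_summand c0 s" if "shape_sum ss" for ss using that proof (induction ss)
    case (Cons s ss)
    then obtain c0 where c0: "\<forall>s\<in>set ss. ok_summand c0 s" by (auto simp: shape_sum_def)
    obtain c1 where c1: "ok_summand c1 s" using Cons.prems by (cases s) (auto simp: shape_sum_def)
    show ?case using c0 c1 by (intro exI[of _ "max c0 c1"]) (auto intro: ok_summand_mono)
  qed simp
  from this[OF assms(2)] this[OF assms(3)] this[OF assms(4)] this[OF assms(5)] obtain c1 c2 c3 c4 where
    c: "\<forall>s\<in>set T. ok_summand c1 s" "\<forall>s\<in>set tm. ok_summand c2 s" "\<forall>s\<in>set i. ok_summand c3 s" "\<forall>s\<in>set a. ok_summand c4 s"
    by blast
  define c0 where "c0 = f + j + c1 + c2 + c3 + c4"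
  have "ok_literal c0 (sg, kd, var f T tm j i a)" using assms c unfolding ok_literal_def var_def shape_sum_def
    by (auto simp: c0_def intro: ok_summand_mono)
  then show ?thesis unfolding shape_def by blast
qed

lemma ok_clauses_exists:
  assumes "cs ~= []" "\<forall>c\<in>set cs. c ~= [] \<and> (\<forall>l\<in>set c. shape l)" shows "\<exists>c0. ok_clauses c0 cs" proof -
  have "\<exists>c0. \<forall>l\<in>set c. ok_literal c0 l" if "\<forall>l\<in>set c. shape l" for c using that proof (induction c)
    case (Cons l c)
    then obtain c0 where c0: "\<forall>l\<in>set c. ok_literal c0 l" by auto
    obtain c1 where c1: "ok_literal c1 l" using Cons.prems by (auto simp: shape_def)
    show ?case using c0 c1 by (intro exI[of _ "max c0 c1"]) (auto intro: ok_literal_mono)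
  qed simp
  note 1 = this
  have "\<exists>c0. \<forall>c\<in>set cs. length c <= c0 \<and> (\<forall>l\<in>set c. ok_literal c0 l)" using assms(2) proof (induction cs)
    case (Cons c cs)
    then obtain c0 where c0: "\<forall>c\<in>set cs. length c <= c0 \<and> (\<forall>l\<in>set c. ok_literal c0 l)" by auto
    obtain c1 where c1: "\<forall>l\<in>set c. ok_literal c1 l" using 1[of c] Cons.prems by auto
    show ?case using c0 c1 by (intro exI[of _ "c0 + c1 + length c"])
      (auto intro: ok_literal_mono[of c0 _ "c0 + c1 + length c"] ok_literal_mono[of c1 _ "c0 + c1 + length c"] trans_le_add1)
  qed simp
  then obtain c0 where c0: "\<forall>c\<in>set cs. length c <= c0 \<and> (\<forall>l\<in>set c. ok_literal c0 l)" by blast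
  have "ok_clauses (c0 + length cs) cs"
    using assms c0 unfolding ok_clauses_def by (auto intro: ok_literal_mono[of c0 _ "c0 + length cs"] trans_le_add1)
  then show ?thesis by blast
qed

definition shapes :: "literal list list => bool" where
  "shapes cs \<longleftrightarrow> (\<forall>c\<in>set cs. c ~= [] \<and> (\<forall>l\<in>set c. shape l))"

lemma shapes_simps [simp]:
  "shapes []" "shapes (c # cs) \<longleftrightarrow> c ~= [] \<and> (\<forall>l\<in>set c. shape l) \<and> shapes cs"
  "shapes (cs @ ds) \<longleftrightarrow> shapes cs \<and> shapes ds"
  "shapes (map f xs) \<longleftrightarrow> (\<forall>x\<in>set xs. f x ~= [] \<and> (\<forall>l\<in>set (f x). shape l))"
  "shapes (concat (map h xs)) \<longleftrightarrow> (\<forall>x\<in>set xs. shapes (h x))" by (auto simp: shapes_def)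

lemma shape_sum_simps [simp]:
  "shape_sum []" "shape_sum [Cst c]" "shape_sum [Idx 1]" "shape_sum [Idx 2]" "shape_sum [Idx 3]" "shape_sum [Idx 5]"
  "shape_sum [Letter 3]" "shape_sum [Idx 2, Cst c]" "shape_sum [Idx 3, Cst c]" "shape_sum [Idx 3, Idx 4, Cst c]" by (simp_all add: shape_sum_def)

lemma tableau_shapes: "kd < 2 ==> shape_sum T ==> il ~= [] ==> shapes (tableau_clauses kd b T k Sg Qs il)" proof -
  assume a: "kd < 2" "shape_sum T" "il ~= []"
  have "shapes (instr_clauses kd b T k Sg Qs \<iota> ins)" for \<iota> ins using a by (cases ins) (auto simp: instr_clauses_def intro!: shape_var)
  moreover have "shapes (tape_clauses kd b T Sg j)" for j using a by (auto simp: tape_clauses_def intro!: shape_var)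
  ultimately show ?thesis using a by (auto simp: tableau_clauses_def intro!: shape_var)
qed

lemma zone_shape [simp]: "shape (zone sg (Cst c))" "shape (zone sg (Letter 3))" unfolding zone_def by (rule shape_var; simp)+

lemma extended_nonempty [simp]: "0 < Sg ==> extended k Sg Qs M il ~= []" using length_readings[of k Sg] by (auto simp: extended_def)

lemma oracle_shapes: "kd < 2 ==> 0 < Sg ==> shapes (oracle_clauses g h l Sg Qs M il kd)" proof -
  assume a: "kd < 2" "0 < Sg"
  have "shapes (start_clauses kd 4 [Idx 1] (tapes M) (start_state M))" "shapes (accept_clauses kd 4 [Idx 1] Qs (accept_state M))"
    using a by (auto simp: start_clauses_def accept_clauses_def intro!: shape_var)
  moreover have "shapes (query_clauses kd l g h Sg)" using a by (auto simp: query_clauses_def intro!: shape_var)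
  ultimately show ?thesis using a by (auto simp: oracle_clauses_def intro!: shape_var tableau_shapes)
qed

lemma main_shapes: "0 < Sg ==> shapes cs ==> shapes (main_clauses Sg Qs M il cs g)" proof -
  assume a: "0 < Sg" "shapes cs"
  have "shapes (start_clauses 0 0 [] (tapes M) (start_state M))" "shapes (accept_clauses 0 0 [] Qs (accept_state M))"
    by (auto simp: start_clauses_def accept_clauses_def intro!: shape_var)
  moreover have "shapes (input_clauses g)" by (auto simp: input_clauses_def intro!: shape_var)
  moreover have "shape (False, 0, var 3 [] [Idx 1] \<iota> [] [])" for \<iota> by (rule shape_var) simp_all
  ultimately show ?thesis using a unfolding main_clauses_def by (simp add: tableau_shapes shapes_def[of cs])
qed

lemma no_shapes: "shapes (no_clauses Sg M)" by (auto simp: no_clauses_def intro!: shape_var)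

lemma ok_clauses_all:
  assumes "0 < Sg" shows "\<exists>c0. \<forall>c\<ge>c0. ok_clauses c (main_clauses Sg Qs M il (oracle_clauses g h l Sg Qs M' il' 0) g) \<and>
    ok_clauses c (no_clauses Sg M) \<and> ok_clauses c (oracle_clauses g h l Sg Qs M' il' 1)" proof -
  have "tableau_clauses kd b T k Sg Qs il ~= []" for kd b T k il by (simp add: tableau_clauses_def)
  then have "main_clauses Sg Qs M il (oracle_clauses g h l Sg Qs M' il' 0) g ~= []" "oracle_clauses g h l Sg Qs M' il' 1 ~= []"
    by (simp_all add: main_clauses_def oracle_clauses_def)
  moreover have "no_clauses Sg M ~= []" using assms by (simp add: no_clauses_def)
  moreover have "shapes (main_clauses Sg Qs M il (oracle_clauses g h l Sg Qs M' il' 0) g)" "shapes (oracle_clauses g h l Sg Qs M' il' 1)"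
    using assms by (simp_all add: main_shapes oracle_shapes)
  ultimately have "\<exists>c. ok_clauses c (main_clauses Sg Qs M il (oracle_clauses g h l Sg Qs M' il' 0) g)"
    "\<exists>c. ok_clauses c (no_clauses Sg M)" "\<exists>c. ok_clauses c (oracle_clauses g h l Sg Qs M' il' 1)"
    using no_shapes unfolding shapes_def by (simp_all add: ok_clauses_exists)
  then obtain c1 c2 c3 where "ok_clauses c1 (main_clauses Sg Qs M il (oracle_clauses g h l Sg Qs M' il' 0) g)"
    "ok_clauses c2 (no_clauses Sg M)" "ok_clauses c3 (oracle_clauses g h l Sg Qs M' il' 1)" by blast
  then show ?thesis by (intro exI[of _ "c1 + c2 + c3"]) (auto intro: ok_clauses_mono)
qed

lemma sat_prefix: "sat E e W (map (%c. (sg, kd, co) # c) cs) \<longleftrightarrow> W kd (names E e co) = sg \<or> sat E e W cs"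
  by (auto simp: sat_def)

lemma tape_word_cells:
  assumes "fst t (int n) = 0" shows "length (tape_word t) <= n" "fst t (int (length (tape_word t))) = 0"
    "!!i. i < length (tape_word t) ==> tape_word t ! i = fst t (int i) \<and> fst t (int i) ~= 0" proof -
  have l: "length (tape_word t) = (LEAST n. fst t (int n) = 0)" by (simp add: tape_word_def)
  show "length (tape_word t) <= n" unfolding l by (rule Least_le[of "%n. fst t (int n) = 0", OF assms])
  show "fst t (int (length (tape_word t))) = 0" unfolding l by (rule LeastI[of "%n. fst t (int n) = 0", OF assms])
  fix i assume i: "i < length (tape_word t)"
  have "fst t (int i) ~= 0" using i not_less_Least[of i "%n. fst t (int n) = 0"] unfolding l by blast
  then show "tape_word t ! i = fst t (int i) \<and> fst t (int i) ~= 0" using i unfolding l by (simp add: tape_word_def)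
qed

lemma fst_input_tape: "fst (input_tape y) i = (if 0 <= i \<and> i < int (length y) then y ! nat i else 0)" "snd (input_tape y) = 0"
  by (simp_all add: input_tape_def)

lemma tableau_unique:
  "tableau k Sg Qs il U tm i d ==> j < k ==> a < Sg ==> a' < Sg ==> U 2 tm j i a ==> U 2 tm j i a' ==> a = a'" unfolding tableau_def by blast

text \<open>K exceeds the running times of both machines and bounds the length
  \<open>length x + B\<close> of queries; BO bounds the runs of the oracle machine on words of this
  length. With N as length of the loop tapes the tableau covers the cells from -K to
  \<open>K + length x\<close>.\<close>

locale reduction =
  fixes g h :: nat and A M O' Sg Qs ilM ilO x K N B BO
  assumes fitsM: "fits M Sg Qs ilM" and fitsO: "fits O' Sg Qs ilO"
    and tapesM: "0 < tapes M" and tapesO: "0 < tapes O'" and gh: "g < Sg" "h < Sg"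
    and x: "x \<in> words g"
    and boundM: "!!m c. (step A M ^^ m) (initial M x) c ==> m <= B"
    and A: "A \<subseteq> words h"
    and boundO: "!!y m c. y \<in> words h ==> length y <= length x + B ==> (step {} O' ^^ m) (initial O' y) c ==> m <= BO"
    and accO: "!!y. y \<in> words h ==> y \<in> A \<longleftrightarrow> accepts {} O' y"
    and K: "B < K" "BO < K" "length x + B <= K" and N: "N = 2 * K + length x"
begin

abbreviation "kM \<equiv> tapes M"
abbreviation "kO \<equiv> tapes O'"
abbreviation "QM \<equiv> Sg ^ kM"
abbreviation "QO \<equiv> Sg ^ kO"
abbreviation "IM \<equiv> extended kM Sg Qs M ilM"
abbreviation "IO \<equiv> extended kO Sg Qs O' ilO"

text \<open>U is the tableau of the oracle machine, Z singles out the cells to the left of its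
  input, and C is the content of the queried tape of the main machine.\<close>

definition oracle_ok :: "(nat => nat => nat => nat => nat => bool) => (nat => bool) => (nat => nat => bool) => nat => nat => nat => bool" where
  "oracle_ok U Z C tm i d \<longleftrightarrow> tableau kO Sg Qs IO U tm i d \<and> U 0 0 (start_state O') 0 0 \<and> (\<forall>j<kO. U 1 0 j K 0) \<and>
     (\<forall>j<kO. 0 < j --> U 2 0 j i 0) \<and> (Z i --> U 2 0 0 i 0) \<and> (\<not> Z i --> U 2 0 0 i 0 --> U 2 0 0 (i + 1) 0) \<and>
     (\<forall>a<Sg. C K a --> U 2 0 0 K a) \<and> (\<forall>a<Sg. \<not> Z i --> \<not> U 2 0 0 i 0 --> C (i + 1) a --> U 2 0 0 (i + 1) a) \<and>
     (\<forall>a. h < a \<and> a < Sg --> \<not> U 2 0 0 i a) \<and> (\<forall>\<iota>. QO <= \<iota> \<and> \<iota> < 2 * QO --> \<not> U 3 tm \<iota> 0 0) \<and>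
     (\<forall>p<Qs. p ~= accept_state O' --> \<not> U 0 K p 0 0)"

text \<open>The clauses copy the queried word cell by cell: from a nonblank cell the copy goes on to
  the next one, and from the first blank only blanks follow. By induction from cell K to the right
  the oracle machine thus starts on the word itself and not on what may stand behind it.\<close>

lemma oracle_sound:
  assumes ok: "!!tm i d. tm <= N ==> i <= N ==> d <= N ==> oracle_ok U Z C tm i d"
    and Z: "!!i. i <= N ==> Z i \<longleftrightarrow> i < K"
    and C: "!!i. i <= N ==> C i (fst t (int i - int K))"
    and t: "!!i. fst t i < Sg" "fst t (int (length x + B)) = 0" shows "tape_word t \<in> A" proof -
  define y where "y = tape_word t"
  note y = tape_word_cells[OF t(2), folded y_def]
  have KN: "K + length y <= N" "2 * K <= N" using y(1) K(3) N by linarith+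
  have ok0: "oracle_ok U Z C 0 i 0" if "i <= N" for i using ok[of 0 i 0] that by simp
  have cont: "fst t (int i) = fst (input_tape y) (int i)" if "i <= length y" for i using that y(2) y(3)[of i] by (auto simp: fst_input_tape le_less)
  have word: "U 2 0 0 (K + i) (fst (input_tape y) (int i))" if "K + i <= N" for i using that proof (induction i)
    case 0
    have "U 2 0 0 K (fst t 0)" using ok0[of K] C[of K] t(1) KN unfolding oracle_ok_def by auto
    then show ?case using cont[of 0] by simp
  next
    case (Suc i)
    have iN: "K + i <= N" using Suc.prems by simp
    have nZ: "\<not> Z (K + i)" using Z[OF iN] by simp
    have u: "U 2 0 0 (K + i) (fst (input_tape y) (int i))" using Suc by simp
    show ?case proof (cases "i < length y")
      case True
      then have "fst (input_tape y) (int i) ~= 0" "fst (input_tape y) (int i) < Sg" using cont[of i] y(3)[of i] t(1) by (metis less_imp_le)+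
      then have "\<not> U 2 0 0 (K + i) 0" using ok0[OF iN] u tapesO gh tableau_unique[of kO Sg Qs IO U 0 "K + i" 0 0 _ 0] unfolding oracle_ok_def
        by (metis less_nat_zero_code neq0_conv)
      moreover have "C (K + i + 1) (fst t (int (Suc i)))" using C[OF Suc.prems] by (simp add: Suc_eq_plus1 add.assoc)
      ultimately have "U 2 0 0 (K + i + 1) (fst t (int (Suc i)))" using ok0[OF iN] nZ t(1) unfolding oracle_ok_def by blast
      then show ?thesis using cont[of "Suc i"] True by (simp add: Suc_eq_plus1 add.assoc)
    next
      case False
      then have "U 2 0 0 (K + i) 0" using u by (simp add: fst_input_tape)
      then have "U 2 0 0 (K + i + 1) 0" using ok0[OF iN] nZ unfolding oracle_ok_def by blast
      then show ?thesis using False by (simp add: fst_input_tape Suc_eq_plus1 add.assoc)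
    qed
  qed
  have yh: "y \<in> words h" proof -
    have "y ! i \<in> {1..h}" if i: "i < length y" for i proof -
      have iN: "K + i <= N" using i KN by simp
      have "U 2 0 0 (K + i) (y ! i)" using word[OF iN] i by (simp add: fst_input_tape)
      then have "y ! i <= h" using ok0[OF iN] t(1) y(3)[OF i] unfolding oracle_ok_def by (metis not_less)
      then show ?thesis using y(3)[OF i] by (auto simp: Suc_le_eq)
    qed
    then show ?thesis unfolding words_def by (auto simp: in_lists_conv_set in_set_conv_nth)
  qed
  have "accepts {} O' y" proof (rule tableau_sound[OF fitsO yh gh(2) tapesO _ K(2) KN(2)])
    show "m <= BO" if "(step {} O' ^^ m) (initial O' y) c" for m c using boundO[OF yh y(1) that] .
    show "tableau kO Sg Qs IO U tm i d" if "tm <= N" "i <= N" "d <= N" for tm i d using ok[OF that] unfolding oracle_ok_def by blast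
    show "described kO K N U 0 (initial O' y)" unfolding described_def proof (intro conjI allI impI)
      show "U 0 0 (fst (initial O' y)) 0 0" using ok0[of 0] by (simp add: initial_def oracle_ok_def)
    next
      fix j assume j: "j < kO"
      have tj: "snd (initial O' y) ! j = (if j = 0 then input_tape y else blank_tape)" using j by (cases j) (simp_all add: initial_def)
      have s: "snd (snd (initial O' y) ! j) = 0" unfolding tj by (simp add: input_tape_def blank_tape_def)
      show "U 1 0 j (nat (snd (snd (initial O' y) ! j) + int K)) 0" unfolding s using ok0[of 0] j by (simp add: oracle_ok_def)
      fix i assume i: "i <= N"
      show "U 2 0 j i (fst (snd (initial O' y) ! j) (int i - int K))" proof (cases "j = 0")
        case True
        show ?thesis proof (cases "i < K")
          case True
          then show ?thesis using ok0[OF i] Z[OF i] \<open>j = 0\<close> unfolding tj oracle_ok_def by (simp add: fst_input_tape)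
        next
          case False
          then show ?thesis using word[of "i - K"] i \<open>j = 0\<close> unfolding tj by (simp add: of_nat_diff)
        qed
      next
        case False
        then show ?thesis using ok0[OF i] j unfolding tj oracle_ok_def by (simp add: blank_tape_def)
      qed
    qed
    show "answered (length (readings kO Sg)) {} \<iota> c" if "tm <= N" "U 3 tm \<iota> 0 0" for tm \<iota> c
      using ok[OF that(1), of 0 0] that(2) unfolding oracle_ok_def answered_def length_readings by auto
    show "\<not> U 0 K p 0 0" if "p < Qs" "p ~= accept_state O'" for p using ok0[of 0] that unfolding oracle_ok_def by blast
  qed
  then show ?thesis using accO[OF yh] by (simp add: y_def)
qed

text \<open>U is chosen before Z and C. In the existential assignment of an accepting run these two
  are read off from the very assignment of which U is a part, and the order of the quantifiers
  avoids a circle.\<close>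

lemma oracle_complete:
  assumes tA: "tape_word t \<in> A" and t: "fst t (int (length x + B)) = 0"
  shows "\<exists>U. \<forall>Z C. (\<forall>i\<le>N. Z i \<longleftrightarrow> i < K) --> (\<forall>i\<le>N. \<forall>a<Sg. C i a --> a = fst t (int i - int K)) -->
    (\<forall>tm i d. i <= N --> oracle_ok U Z C tm i d)" proof -
  define y where "y = tape_word t"
  note y = tape_word_cells[OF t, folded y_def]
  have yh: "y \<in> words h" using A tA by (auto simp: y_def)
  then have yl: "y ! i \<in> {1..h}" if "i < length y" for i using that nth_mem unfolding words_def by (auto simp: in_lists_conv_set)
  have acc: "accepts {} O' y" using accO[OF yh] tA by (simp add: y_def)
  have cont: "fst t (int i) = fst (input_tape y) (int i)" if "i <= length y" for i using that y(2) y(3)[of i] by (auto simp: fst_input_tape le_less)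
  have bound: "m <= BO" if "(step {} O' ^^ m) (initial O' y) c" for m c by (rule boundO[OF yh y(1) that])
  from accepting_run[OF fitsO yh gh(2) tapesO acc, of BO] bound obtain cf io where
    cf: "cf 0 = initial O' y" "!!tm. moves IO (cf tm) (io tm) (cf (tm + 1))"
      "!!tm. answered QO {} (io tm) (cf tm)" "!!tm. tm \<ge> BO ==> fst (cf tm) = accept_state O'" unfolding length_readings by blast
  let ?U = "canonical K cf io"
  have tj: "snd (cf 0) ! j = (if j = 0 then input_tape y else blank_tape)" if "j < kO" for j using that by (cases j) (simp_all add: initial_def cf(1))
  have u20: "?U 2 0 0 i a \<longleftrightarrow> a = fst (input_tape y) (int i - int K)" for i a using tj[OF tapesO] by simp
  have "oracle_ok ?U Z C tm i d" if Z: "\<forall>i\<le>N. Z i \<longleftrightarrow> i < K"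
    and C: "\<forall>i\<le>N. \<forall>a<Sg. C i a --> a = fst t (int i - int K)" and i: "i <= N" for Z C tm i d unfolding oracle_ok_def
  proof (intro conjI allI impI)
    show "tableau kO Sg Qs IO ?U tm i d" by (rule tableau_canonical) (rule cf(2), rule fit_extended[OF fitsO])
    show "?U 0 0 (start_state O') 0 0" by (simp add: cf(1) initial_def)
    show "?U 1 0 j K 0" if "j < kO" for j using tj[OF that] by (simp add: input_tape_def blank_tape_def)
    show "?U 2 0 j i 0" if "j < kO" "0 < j" for j using tj[OF that(1)] that by (simp add: blank_tape_def)
    show "?U 2 0 0 i 0" if "Z i" unfolding u20 using that Z i by (auto simp: fst_input_tape)
    show "?U 2 0 0 (i + 1) 0" if "\<not> Z i" "?U 2 0 0 i 0" proof -
      have "K <= i" using that Z i by auto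
      have "\<not> i - K < length y"
      proof
        assume a: "i - K < length y"
        then have "fst (input_tape y) (int i - int K) = y ! (i - K)" using \<open>K <= i\<close> by (simp add: fst_input_tape nat_diff_distrib)
        then show False using that(2) yl[OF a] unfolding u20 by simp
      qed
      then show ?thesis unfolding u20 using \<open>K <= i\<close> by (simp add: fst_input_tape)
    qed
    show "?U 2 0 0 K a" if "a < Sg" "C K a" for a proof -
      have "K <= N" using N by simp
      then have "a = fst t 0" using C that by fastforce
      then show ?thesis unfolding u20 using cont[of 0] by simp
    qed
    show "?U 2 0 0 (i + 1) a" if "a < Sg" "\<not> Z i" "\<not> ?U 2 0 0 i 0" "C (i + 1) a" for a proof -
      have Ki: "K <= i" using that Z i by auto
      have "fst (input_tape y) (int i - int K) ~= 0" using that(3) unfolding u20 by simp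
      then have iy: "i - K < length y" using Ki by (auto simp: fst_input_tape split: if_splits)
      then have "i + 1 <= N" using y(1) K(3) N Ki by linarith
      then have "a = fst t (int (i + 1) - int K)" using C that by blast
      moreover have "int (i + 1) - int K = int (i - K + 1)" using Ki by simp
      ultimately show ?thesis unfolding u20 using cont[of "i - K + 1"] iy by simp
    qed
    show "\<not> ?U 2 0 0 i a" if "h < a \<and> a < Sg" for a proof -
      have "fst (input_tape y) z <= h" for z using yl[of "nat z"] by (auto simp: fst_input_tape nat_less_iff)
      then show ?thesis unfolding u20 using that by (metis not_less)
    qed
    show "\<not> ?U 3 tm \<iota> 0 0" if "QO <= \<iota> \<and> \<iota> < 2 * QO" for \<iota> using cf(3)[of tm] that by (auto simp: answered_def)
    show "\<not> ?U 0 K p 0 0" if "p ~= accept_state O'" for p using that cf(4)[of K] K(2) by simp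
  qed
  then show ?thesis by blast
qed

definition letter_tape :: "nat list" where
  "letter_tape = replicate K (g + 2) @ x @ replicate K (g + 1)"

lemma letters:
  assumes "i <= N" shows "nth0 letter_tape i < g + 3" "nth0 letter_tape i = g + 2 \<longleftrightarrow> i < K"
    "(if nth0 letter_tape i <= g then nth0 letter_tape i else 0) = fst (input_tape x) (int i - int K)" proof -
  have xl: "x ! i \<in> {1..g}" if "i < length x" for i using that nth_mem x unfolding words_def by (auto simp: in_lists_conv_set)
  consider "i < K" | "K <= i" "i < K + length x" | "K + length x <= i" "i < N" | "i = N" using assms by linarith
  then have "nth0 letter_tape i < g + 3 \<and> (nth0 letter_tape i = g + 2 \<longleftrightarrow> i < K) \<and>
    (if nth0 letter_tape i <= g then nth0 letter_tape i else 0) = fst (input_tape x) (int i - int K)" proof cases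
    case 1
    then show ?thesis by (simp add: nth0_def letter_tape_def nth_append fst_input_tape)
  next
    case 2
    then have "i - K < length x" by linarith
    then have "nth0 letter_tape i = x ! (i - K)" using 2 by (simp add: nth0_def letter_tape_def nth_append)
    moreover have "fst (input_tape x) (int i - int K) = x ! (i - K)" using 2 by (simp add: fst_input_tape nat_diff_distrib)
    ultimately show ?thesis using xl[OF \<open>i - K < length x\<close>] 2 by auto
  next
    case 3
    then have "\<not> i - K < length x" by linarith
    then have "nth0 letter_tape i = g + 1" using 3 N by (simp add: nth0_def letter_tape_def nth_append)
    then show ?thesis using 3 by (simp add: fst_input_tape)
  next
    case 4
    then have "nth0 letter_tape i = 0" using N by (simp add: nth0_def letter_tape_def)
    then show ?thesis using 4 N K by (simp add: fst_input_tape)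
  qed
  then show "nth0 letter_tape i < g + 3" "nth0 letter_tape i = g + 2 \<longleftrightarrow> i < K"
    "(if nth0 letter_tape i <= g then nth0 letter_tape i else 0) = fst (input_tape x) (int i - int K)" by blast+
qed

definition main_ok :: "(nat list => bool) => nat => nat => nat => bool" where
  "main_ok X tm i d \<longleftrightarrow> (let U = family X 0 0; Z = %i a. X [8, 0, 0, 0, i, a] in
     tableau kM Sg Qs IM U tm i d \<and> U 0 0 (start_state M) 0 0 \<and> (\<forall>j<kM. U 1 0 j K 0) \<and>
     (\<forall>j<kM. 0 < j --> U 2 0 j i 0) \<and> Z i (nth0 letter_tape i) \<and>
     (\<forall>a<g + 3. \<forall>a'<g + 3. a ~= a' --> Z i a --> \<not> Z i a') \<and>
     (\<forall>a<g + 3. Z i a --> U 2 0 0 i (if a <= g then a else 0)) \<and>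
     (\<forall>p<Qs. p ~= accept_state M --> \<not> U 0 K p 0 0))"

abbreviation "OC \<equiv> oracle_clauses g h (kM - 1) Sg Qs O' ilO"
abbreviation "MC \<equiv> main_clauses Sg Qs M ilM (OC 0) g"

context
  fixes E :: "nat => nat list" and e :: "nat => nat"
  assumes E3: "E 3 = letter_tape" and e5: "e 5 = K"
begin

lemma sat_start:
  "sat E e W (start_clauses kd b T k q) \<longleftrightarrow> (let U = family (W kd) b (cval E e T) in
     U 0 0 q 0 0 \<and> (\<forall>j<k. U 1 0 j K 0) \<and> (\<forall>j<k. 0 < j --> U 2 0 j (e 3) 0))"
  by (auto simp: start_clauses_def family_def e5 Let_def)

lemma sat_accept:
  "sat E e W (accept_clauses kd b T Qs q) \<longleftrightarrow> (\<forall>p<Qs. p ~= q --> \<not> family (W kd) b (cval E e T) 0 K p 0 0)"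
  by (auto simp: accept_clauses_def family_def e5)

lemma sat_oracle:
  "sat E e W (OC kd) \<longleftrightarrow> oracle_ok (family (W kd) 4 (e 1)) (%i. W 0 [8, 0, 0, 0, i, g + 2])
     (%i a. family (W 0) 0 0 2 (e 1) (kM - 1) i a) (e 2) (e 3) (e 4)" proof -
  let ?U = "family (W kd) 4 (e 1)" let ?Z = "%i. W 0 [8, 0, 0, 0, i, g + 2]" let ?C = "%i a. family (W 0) 0 0 2 (e 1) (kM - 1) i a"
  have q: "sat E e W [[zone False (Cst (g + 2)), (True, kd, var 6 [Idx 1] [] 0 [Idx 3] [])],
        [zone True (Cst (g + 2)), (False, kd, var 6 [Idx 1] [] 0 [Idx 3] []), (True, kd, var 6 [Idx 1] [] 0 [Idx 3, Cst 1] [])]] \<longleftrightarrow>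
      (?Z (e 3) --> ?U 2 0 0 (e 3) 0) \<and> (\<not> ?Z (e 3) --> ?U 2 0 0 (e 3) 0 --> ?U 2 0 0 (e 3 + 1) 0)"
    "sat E e W (map (%a. [(False, 0, var 2 [] [Idx 1] (kM - 1) [Idx 5] [Cst a]), (True, kd, var 6 [Idx 1] [] 0 [Idx 5] [Cst a])]) [0..<Sg]) \<longleftrightarrow>
      (\<forall>a<Sg. ?C K a --> ?U 2 0 0 K a)"
    "sat E e W (map (%a. [zone True (Cst (g + 2)), (True, kd, var 6 [Idx 1] [] 0 [Idx 3] []),
        (False, 0, var 2 [] [Idx 1] (kM - 1) [Idx 3, Cst 1] [Cst a]), (True, kd, var 6 [Idx 1] [] 0 [Idx 3, Cst 1] [Cst a])]) [0..<Sg]) \<longleftrightarrow>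
      (\<forall>a<Sg. \<not> ?Z (e 3) --> \<not> ?U 2 0 0 (e 3) 0 --> ?C (e 3 + 1) a --> ?U 2 0 0 (e 3 + 1) a)"
    "sat E e W (map (%a. [(False, kd, var 6 [Idx 1] [] 0 [Idx 3] [Cst a])]) [h + 1..<Sg]) \<longleftrightarrow> (\<forall>a. h < a \<and> a < Sg --> \<not> ?U 2 0 0 (e 3) a)"
    by (auto simp: zone_def family_def e5 Suc_le_eq simp del: add_2_eq_Suc add_2_eq_Suc')
  have n: "sat E e W (map (%\<iota>. [(False, kd, var 7 [Idx 1] [Idx 2] \<iota> [] [])]) [QO..<2 * QO]) \<longleftrightarrow>
      (\<forall>\<iota>. QO <= \<iota> \<and> \<iota> < 2 * QO --> \<not> ?U 3 (e 2) \<iota> 0 0)" by (auto simp: family_def)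
  show ?thesis unfolding oracle_clauses_def query_clauses_def sat_simps(3) q n sat_tableau sat_start sat_accept oracle_ok_def Let_def
    by (simp only: conj_assoc cval_simps sval.simps add_0_right)
qed

lemma sat_main:
  "sat E e W MC \<longleftrightarrow> main_ok (W 0) (e 2) (e 3) (e 4) \<and>
     (\<forall>\<iota>. QM <= \<iota> \<and> \<iota> < 2 * QM --> family (W 0) 0 0 3 (e 1) \<iota> 0 0 --> sat E e W (OC 0))" proof -
  have "sat E e W (input_clauses g) \<longleftrightarrow> (let U = family (W 0) 0 0; Z = %i a. W 0 [8, 0, 0, 0, i, a] in
     Z (e 3) (nth0 letter_tape (e 3)) \<and>
     (\<forall>a<g + 3. \<forall>a'<g + 3. a ~= a' --> Z (e 3) a --> \<not> Z (e 3) a') \<and>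
     (\<forall>a<g + 3. Z (e 3) a --> U 2 0 0 (e 3) (if a <= g then a else 0)))" proof -
    have z: "true_clause E e W [zone False (Cst a), zone False (Cst a')] \<longleftrightarrow> (W 0 [8, 0, 0, 0, e 3, a] --> \<not> W 0 [8, 0, 0, 0, e 3, a'])" for a a'
      by (simp add: zone_def)
    have c: "true_clause E e W [zone False (Cst a), (True, 0, var 2 [] [] 0 [Idx 3] [Cst (if a <= g then a else 0)])] \<longleftrightarrow>
        (W 0 [8, 0, 0, 0, e 3, a] --> family (W 0) 0 0 2 0 0 (e 3) (if a <= g then a else 0))" for a
      by (simp add: zone_def family_def del: if_split add_2_eq_Suc add_2_eq_Suc')
    have l: "true_clause E e W [zone True (Letter 3)] \<longleftrightarrow> W 0 [8, 0, 0, 0, e 3, nth0 letter_tape (e 3)]" by (simp add: zone_def E3)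
    show ?thesis unfolding input_clauses_def sat_simps z c l Let_def
      by (simp only: set_filter set_upt Ball_def mem_Collect_eq atLeastLessThan_iff imp_conjL le0 simp_thms sat_simps(1))
  qed
  note i = this
  have q: "sat E e W (concat (map (%\<iota>. map (%c. (False, 0, var 3 [] [Idx 1] \<iota> [] []) # c) (OC 0)) [QM..<2 * QM])) \<longleftrightarrow>
      (\<forall>\<iota>. QM <= \<iota> \<and> \<iota> < 2 * QM --> family (W 0) 0 0 3 (e 1) \<iota> 0 0 --> sat E e W (OC 0))"
    unfolding sat_simps(5) sat_prefix by (auto simp: family_def)
  show ?thesis unfolding main_clauses_def sat_simps(3) i q sat_tableau sat_start sat_accept main_ok_def Let_def
    by (simp only: conj_assoc cval_simps sval.simps add_0_right)
qed

lemma sat_no: "sat E e W (no_clauses Sg M) \<longleftrightarrow> (\<forall>\<iota><QM. \<not> family (W 0) 0 0 3 (e 1) \<iota> 0 0)"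
  by (auto simp: no_clauses_def family_def)

end

lemma read_word:
  assumes "fit_config kM Sg Qs (length x) m c" "m <= B"
  shows "!!i. fst (snd c ! (kM - 1)) i < Sg" "fst (snd c ! (kM - 1)) (int (length x + B)) = 0" "last (snd c) = snd c ! (kM - 1)" proof -
  have t: "snd c ! (kM - 1) \<in> set (snd c)" "length (snd c) = kM" using assms(1) tapesM by (auto simp: fit_config_def)
  then show "fst (snd c ! (kM - 1)) i < Sg" for i using assms(1) by (auto simp: fit_config_def)
  show "fst (snd c ! (kM - 1)) (int (length x + B)) = 0" proof (rule ccontr)
    assume "fst (snd c ! (kM - 1)) (int (length x + B)) ~= 0"
    then have "int (length x + B) < int (length x) + int m" using assms(1) t(1) unfolding fit_config_def by blast
    then show False using assms(2) by simp
  qed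
  show "last (snd c) = snd c ! (kM - 1)" using t(2) tapesM by (metis last_conv_nth length_0_conv not_less_zero)
qed

lemma zone_iff:
  assumes "!!i. i <= N ==> main_ok X 0 i 0" "i <= N" shows "X [8, 0, 0, 0, i, g + 2] \<longleftrightarrow> i < K" proof -
  have z: "X [8, 0, 0, 0, i, nth0 letter_tape i]"
    "!!a a'. a < g + 3 ==> a' < g + 3 ==> a ~= a' ==> X [8, 0, 0, 0, i, a] ==> \<not> X [8, 0, 0, 0, i, a']"
    using assms(1)[OF assms(2)] unfolding main_ok_def Let_def by blast+
  show ?thesis
  proof
    assume a: "X [8, 0, 0, 0, i, g + 2]"
    have "g + 2 = nth0 letter_tape i" proof (rule ccontr)
      assume "g + 2 ~= nth0 letter_tape i"
      then show False using z(2)[OF _ letters(1)[OF assms(2)] _ a] z(1) by simp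
    qed
    then show "i < K" using letters(2)[OF assms(2)] by simp
  next
    assume "i < K"
    then show "X [8, 0, 0, 0, i, g + 2]" using z(1) letters(2)[OF assms(2)] by simp
  qed
qed

lemma content_iff:
  assumes "main_ok X t i 0" "i <= N" "described kM K N (family X 0 0) t c" "!!i. fst (snd c ! (kM - 1)) i < Sg" "a < Sg"
  shows "family X 0 0 2 t (kM - 1) i a \<longleftrightarrow> a = fst (snd c ! (kM - 1)) (int i - int K)" proof -
  have "tableau kM Sg Qs IM (family X 0 0) t i 0" using assms(1) by (simp add: main_ok_def Let_def)
  moreover have "family X 0 0 2 t (kM - 1) i (fst (snd c ! (kM - 1)) (int i - int K))" using assms(2,3) tapesM by (simp add: described_def)
  ultimately show ?thesis using tableau_unique[of kM Sg Qs IM _ t i 0 "kM - 1" a] assms(4,5) tapesM by (metis diff_less zero_less_one)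
qed

definition oracle_var :: "(nat list => bool) => (nat list => bool) => nat => nat => nat => nat => bool" where
  "oracle_var X V t tm i d \<longleftrightarrow> oracle_ok (family V 4 t) (%i. X [8, 0, 0, 0, i, g + 2]) (%i a. family X 0 0 2 t (kM - 1) i a) tm i d"

definition justified :: "(nat list => bool) => (nat list => bool) => nat => bool" where
  "justified X Y t \<longleftrightarrow> (\<forall>tm\<le>N. \<forall>i\<le>N. \<forall>d\<le>N. main_ok X tm i d \<and>
      (\<forall>\<iota>. QM <= \<iota> \<and> \<iota> < 2 * QM --> family X 0 0 3 t \<iota> 0 0 --> oracle_var X X t tm i d)) \<and>
    ((\<forall>\<iota><QM. \<not> family X 0 0 3 t \<iota> 0 0) \<or> (\<exists>tm\<le>N. \<exists>i\<le>N. \<exists>d\<le>N. \<not> oracle_var X Y t tm i d))"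

text \<open>A query with a positive answer is justified by an accepting run of the oracle machine, which is part of
  the existential variables; one with a negative answer by the fact that no assignment of the universal
  variables is an accepting run.\<close>

lemma justified_sound:
  assumes X: "!!Y t. t <= N ==> justified X Y t" shows "accepts A M x" proof -
  have m: "main_ok X tm i d" if "tm <= N" "i <= N" "d <= N" for tm i d using X[OF le0] that unfolding justified_def by blast
  have m0: "main_ok X 0 i 0" if "i <= N" for i using m that by simp
  have Z: "X [8, 0, 0, 0, i, g + 2] \<longleftrightarrow> i < K" if "i <= N" for i by (rule zone_iff[OF m0 that])
  show ?thesis proof (rule tableau_sound[OF fitsM x gh(1) tapesM boundM K(1)])
    show "2 * K <= N" using N by simp
    show "tableau kM Sg Qs IM (family X 0 0) tm i d" if "tm <= N" "i <= N" "d <= N" for tm i d using m[OF that] by (simp add: main_ok_def Let_def)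
    show "\<not> family X 0 0 0 K p 0 0" if "p < Qs" "p ~= accept_state M" for p using m0[of 0] that by (simp add: main_ok_def Let_def)
    show "described kM K N (family X 0 0) 0 (initial M x)" unfolding described_def proof (intro conjI allI impI)
      show "family X 0 0 0 0 (fst (initial M x)) 0 0" using m0[of 0] by (simp add: initial_def main_ok_def Let_def)
    next
      fix j assume j: "j < kM"
      have tj: "snd (initial M x) ! j = (if j = 0 then input_tape x else blank_tape)" using j by (cases j) (simp_all add: initial_def)
      have s: "snd (snd (initial M x) ! j) = 0" unfolding tj by (simp add: input_tape_def blank_tape_def)
      show "family X 0 0 1 0 j (nat (snd (snd (initial M x) ! j) + int K)) 0" unfolding s using m0[of 0] j by (simp add: main_ok_def Let_def)
      fix i assume i: "i <= N"
      show "family X 0 0 2 0 j i (fst (snd (initial M x) ! j) (int i - int K))" proof (cases "j = 0")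
        case True
        have "X [8, 0, 0, 0, i, nth0 letter_tape i]"
          "\<forall>a<g + 3. X [8, 0, 0, 0, i, a] --> family X 0 0 2 0 0 i (if a <= g then a else 0)"
          using m0[OF i] unfolding main_ok_def Let_def by blast+
        then have "family X 0 0 2 0 0 i (if nth0 letter_tape i <= g then nth0 letter_tape i else 0)" using letters(1)[OF i] by blast
        then show ?thesis using True unfolding tj letters(3)[OF i] by simp
      next
        case False
        then show ?thesis using m0[OF i] j unfolding tj by (simp add: main_ok_def Let_def blank_tape_def)
      qed
    qed
    fix tm \<iota> m' c
    assume a: "tm <= N" "(step A M ^^ m') (initial M x) c" "described kM K N (family X 0 0) tm c" "\<iota> < length IM"
      "family X 0 0 3 tm \<iota> 0 0"
    note fit = fit_steps[OF fitsM a(2) x gh(1) tapesM]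
    note rd = read_word[OF fit boundM[OF a(2)]]
    have C: "family X 0 0 2 tm (kM - 1) i b \<longleftrightarrow> b = fst (snd c ! (kM - 1)) (int i - int K)" if "i <= N" "b < Sg" for i b
      by (rule content_iff[OF m[OF a(1) that(1) le0] that(1) a(3) rd(1) that(2)])
    show "answered (length (readings kM Sg)) A \<iota> c" unfolding answered_def length_readings rd(3) proof (intro conjI impI)
      assume io: "QM <= \<iota> \<and> \<iota> < 2 * QM"
      have ok: "oracle_var X X tm tm' i d" if "tm' <= N" "i <= N" "d <= N" for tm' i d using X[OF a(1)] that io a(5) unfolding justified_def by blast
      show "tape_word (snd c ! (kM - 1)) \<in> A" proof (rule oracle_sound[OF ok[unfolded oracle_var_def] Z _ rd(1,2)])
        show "family X 0 0 2 tm (kM - 1) i (fst (snd c ! (kM - 1)) (int i - int K))" if "i <= N" for i using C[OF that rd(1)] by simp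
      qed
    next
      assume io: "\<iota> < QM"
      show "tape_word (snd c ! (kM - 1)) \<notin> A"
      proof
        assume "tape_word (snd c ! (kM - 1)) \<in> A"
        from oracle_complete[OF this rd(2)] obtain U where U: "\<forall>Z C. (\<forall>i\<le>N. Z i \<longleftrightarrow> i < K) -->
            (\<forall>i\<le>N. \<forall>a<Sg. C i a --> a = fst (snd c ! (kM - 1)) (int i - int K)) --> (\<forall>tm i d. i <= N --> oracle_ok U Z C tm i d)" by blast
        \<comment> \<open>If the word were in A, an accepting run of the oracle machine could be
          chosen as Y and would satisfy all oracle clauses, although the answer was
          negative.\<close>
        define Y where "Y l = U (l ! 0 - 4) (l ! 2) (l ! 3) (l ! 4) (l ! 5)" for l :: "nat list"
        have Y: "family Y 4 tm = U" by (intro ext) (simp add: family_def Y_def)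
        have "oracle_var X Y tm tm' i d" if "i <= N" for tm' i d unfolding oracle_var_def Y by (rule U[rule_format]) (use Z C that in simp_all)
        then show False using X[OF a(1), of Y] io a(5) unfolding justified_def by blast
      qed
    qed
  qed
qed

lemma justified_complete:
  assumes "accepts A M x" shows "\<exists>X. \<forall>Y. \<forall>t\<le>N. justified X Y t" proof -
  from accepting_run[OF fitsM x gh(1) tapesM assms, of B] boundM obtain cf io where
    cf: "cf 0 = initial M x" "!!tm. moves IM (cf tm) (io tm) (cf (tm + 1))" "!!tm. answered QM A (io tm) (cf tm)"
      "!!tm. \<exists>m\<le>B. (step A M ^^ m) (initial M x) (cf tm)" "!!tm. tm \<ge> B ==> fst (cf tm) = accept_state M"
    unfolding length_readings by blast
  have fit: "\<exists>m\<le>B. fit_config kM Sg Qs (length x) m (cf tm)" for tm using cf(4)[of tm] fit_steps[OF fitsM _ x gh(1) tapesM] by blast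
  define tp where "tp tm = snd (cf tm) ! (kM - 1)" for tm
  have rd: "!!i. fst (tp tm) i < Sg" "fst (tp tm) (int (length x + B)) = 0" "last (snd (cf tm)) = tp tm" for tm
    using fit[of tm] read_word unfolding tp_def by blast+
  have "\<exists>U. tape_word (tp t) \<in> A --> (\<forall>Z C. (\<forall>i\<le>N. Z i \<longleftrightarrow> i < K) -->
      (\<forall>i\<le>N. \<forall>a<Sg. C i a --> a = fst (tp t) (int i - int K)) --> (\<forall>tm i d. i <= N --> oracle_ok U Z C tm i d))" for t
    using oracle_complete[OF _ rd(2)[of t]] by blast
  then obtain U where U: "!!t Z C tm i d. tape_word (tp t) \<in> A ==> \<forall>i\<le>N. Z i \<longleftrightarrow> i < K ==>
      \<forall>i\<le>N. \<forall>a<Sg. C i a --> a = fst (tp t) (int i - int K) ==> i <= N ==> oracle_ok (U t) Z C tm i d" by metis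
  \<comment> \<open>Families 0 to 3 describe the accepting run, families 4 to 7 for each time t an
    oracle run on the word then on the oracle tape, and family 8 the letters.\<close>
  define X where "X l = (if l ! 0 < 4 then canonical K cf io (l ! 0) (l ! 2) (l ! 3) (l ! 4) (l ! 5)
     else if l ! 0 < 8 then U (l ! 1) (l ! 0 - 4) (l ! 2) (l ! 3) (l ! 4) (l ! 5) else l ! 5 = nth0 letter_tape (l ! 4))" for l :: "nat list"
  have XM: "family X 0 0 f tm j i a = canonical K cf io f tm j i a" if "f < 4" for f tm j i a using that by (simp add: family_def X_def)
  have XO: "family X 4 t f tm j i a = U t f tm j i a" if "f < 4" for t f tm j i a using that by (simp add: family_def X_def)
  have XZ: "X [8, 0, 0, 0, i, a] \<longleftrightarrow> a = nth0 letter_tape i" for i a by (simp add: X_def)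
  have tabX: "tableau k Sg Qs il (family X 0 0) tm i d = tableau k Sg Qs il (canonical K cf io) tm i d" for k il tm i d
    unfolding tableau_def by (simp add: XM)
  have okX: "oracle_ok (family X 4 t) Z C tm i d = oracle_ok (U t) Z C tm i d" for t Z C tm i d unfolding oracle_ok_def tableau_def by (simp add: XO)
  have tj: "snd (cf 0) ! j = (if j = 0 then input_tape x else blank_tape)" if "j < kM" for j using that by (cases j) (simp_all add: initial_def cf(1))
  have Z: "\<forall>i\<le>N. X [8, 0, 0, 0, i, g + 2] \<longleftrightarrow> i < K" using letters(2) unfolding XZ by metis
  have C: "family X 0 0 2 t (kM - 1) i a \<longleftrightarrow> a = fst (tp t) (int i - int K)" for t i a by (simp add: XM tp_def)
  have "justified X Y t" if t: "t <= N" for Y t unfolding justified_def proof (intro conjI allI impI)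
    fix tm i d assume i: "i <= N"
    have "tableau kM Sg Qs IM (family X 0 0) tm i d" unfolding tabX by (rule tableau_canonical) (rule cf(2), rule fit_extended[OF fitsM])
    moreover have "family X 0 0 0 0 (start_state M) 0 0" by (simp add: XM cf(1) initial_def)
    moreover have "\<forall>j<kM. family X 0 0 1 0 j K 0" using tj by (simp add: XM input_tape_def blank_tape_def)
    moreover have "\<forall>j<kM. 0 < j --> family X 0 0 2 0 j i 0" using tj by (simp add: XM blank_tape_def)
    moreover have "family X 0 0 2 0 0 i (if nth0 letter_tape i <= g then nth0 letter_tape i else 0)"
      unfolding letters(3)[OF i] using tj[OF tapesM] by (simp add: XM)
    moreover have "\<forall>p<Qs. p ~= accept_state M --> \<not> family X 0 0 0 K p 0 0" using cf(5)[of K] K(1) by (simp add: XM)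
    ultimately show "main_ok X tm i d" unfolding main_ok_def Let_def XZ by simp
    fix \<iota> assume "QM <= \<iota> \<and> \<iota> < 2 * QM" "family X 0 0 3 t \<iota> 0 0"
    then have "tape_word (tp t) \<in> A" using cf(3)[of t] rd(3)[of t] by (simp add: XM answered_def)
    from U[OF this Z _ i] show "oracle_var X X t tm i d" unfolding oracle_var_def okX using C by simp
  next
    show "(\<forall>\<iota><QM. \<not> family X 0 0 3 t \<iota> 0 0) \<or> (\<exists>tm\<le>N. \<exists>i\<le>N. \<exists>d\<le>N. \<not> oracle_var X Y t tm i d)"
    proof (rule ccontr)
      assume n: "\<not> ?thesis"
      then have "io t < QM" by (auto simp: XM)
      then have "tape_word (tp t) \<notin> A" using cf(3)[of t] rd(3)[of t] by (simp add: answered_def)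
      moreover have "tape_word (tp t) \<in> A" proof (rule oracle_sound[OF _ _ _ rd(1,2)])
        show "oracle_ok (family Y 4 t) (%i. X [8, 0, 0, 0, i, g + 2]) (%i a. family X 0 0 2 t (kM - 1) i a) tm i d"
          if "tm <= N" "i <= N" "d <= N" for tm i d using n that unfolding oracle_var_def by blast
      qed (use Z C in auto)
      ultimately show False by blast
    qed
  qed
  then show ?thesis by blast
qed

theorem provable_iff_accepts:
  assumes "!!v. v \<in> {1..4} ==> E v = letter_tape" "!!v. v \<in> set (occ_tapes @ var_tapes) ==> length (E v) = R" "3 * N <= R"
    and e: "e 5 = K" "!!v. e v <= N"
    and c0: "ok_clauses c0 MC" "ok_clauses c0 (no_clauses Sg M)" "ok_clauses c0 (OC 1)" "c0 <= N" "2 <= N" "g + 2 <= N"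
  shows "CL5_provable (interp E (with_gadgets (matrix MC (no_clauses Sg M) (OC 1)) 2 2) e) \<longleftrightarrow> accepts A M x" proof -
  have "nth0 letter_tape i <= N" for i proof (cases "i <= N")
    case True
    then show ?thesis using letters(1)[OF True] c0(6) by simp
  next
    case False
    then show ?thesis using N by (simp add: nth0_def letter_tape_def)
  qed
  then have *: "length (E v) = N" "nth0 (E v) i <= N" if "v \<in> {1..4}" for v i using assms(1)[OF that] N by (simp_all add: letter_tape_def)
  have E3: "E 3 = letter_tape" using assms(1) by simp
  let ?e = "%t tm i d. e(1 := t, 2 := tm, 3 := i, 4 := d)"
  have e5: "?e t tm i d 5 = K" "(e(1 := t)) 5 = K" for t tm i d using e(1) by simp_all
  have o: "sat E (?e t tm i d) W (OC kd) \<longleftrightarrow> oracle_var (W 0) (W kd) t tm i d" for t tm i d W kd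
    unfolding sat_oracle[where E = E and e = "?e t tm i d", OF E3 e5(1)] oracle_var_def by simp
  have "(\<forall>tm\<le>N. \<forall>i\<le>N. \<forall>d\<le>N. sat E (?e t tm i d) (%kd. if kd = 0 then X else Y) MC) \<and>
      (sat E (e(1 := t)) (%kd. if kd = 0 then X else Y) (no_clauses Sg M) \<or>
       (\<exists>tm\<le>N. \<exists>i\<le>N. \<exists>d\<le>N. \<not> sat E (?e t tm i d) (%kd. if kd = 0 then X else Y) (OC 1))) \<longleftrightarrow> justified X Y t" for X Y t
    unfolding justified_def sat_main[where E = E and e = "?e t _ _ _", OF E3 e5(1)] sat_no[where E = E and e = "e(1 := t)", OF E3 e5(2)] o by simp
  then have "CL5_provable (interp E (with_gadgets (matrix MC (no_clauses Sg M) (OC 1)) 2 2) e) \<longleftrightarrow> (\<exists>X. \<forall>Y. \<forall>t\<le>N. justified X Y t)"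
    using provable_matrix[OF * c0(4,5,1-3) assms(2,3) e(2)] by simp
  then show ?thesis using justified_sound justified_complete by blast
qed

end

section \<open>Printing formulas\<close>

text \<open>The tapes 1 to 19 are the loop tapes of the templates; tape 6 is the auxiliary tape of \<open>Rep\<close>.\<close>

definition emits :: "(nat => nat list) => (nat => nat) => nat => com => nat list => bool" where
  "emits E e out c w \<longleftrightarrow> (\<forall>s w0. (\<forall>v\<in>{1..19}. s v = lst (E v) (int (e v))) --> s out = lst w0 (int (length w0)) -->
     run E c s = {s(out := lst (w0 @ w) (int (length (w0 @ w))))})"

definition emit :: "nat => nat => com" where
  "emit out a = Upd (%r. (stay r)(out := (a, Right_Move)))"

definition seqs :: "com list => com" where
  "seqs cs = foldr Seq cs skip"

lemma seqs_simps [simp]: "seqs [] = skip" "seqs (c # cs) = Seq c (seqs cs)" by (simp_all add: seqs_def)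

lemma emits_skip [simp]: "emits E e out skip []" by (simp add: emits_def fun_upd_idem)

lemma upd_emit: "upd (%r. (stay r)(out := (a, d))) s = s(out := act (a, d) (s out))" by (rule ext) (simp add: upd_def stay_def syms_def)

lemma act_appends: "(act (a, Right_Move) ^^ n) (lst w (int (length w))) = lst (w @ replicate n a) (int (length w + n))" proof (induction n)
  case (Suc n)
  then show ?case using act_append[of a "w @ replicate n a"] by (simp add: replicate_append_same add.commute)
qed simp

context
  fixes E :: "nat => nat list" and out :: nat
  assumes out: "19 < out"
begin

lemma emits_emit: "emits E e out (emit out a) [a]" unfolding emits_def emit_def by (simp add: upd_emit act_append add.commute)

lemma emits_Seq:
  assumes "emits E e out c w" "emits E e out d w'" shows "emits E e out (Seq c d) (w @ w')" unfolding emits_def proof (intro allI impI)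
  fix s w0 assume s: "\<forall>v\<in>{1..19}. s v = lst (E v) (int (e v))" "s out = lst w0 (int (length w0))"
  let ?t = "s(out := lst (w0 @ w) (int (length (w0 @ w))))"
  have c: "run E c s = {?t}" using assms(1) s unfolding emits_def by blast
  have "\<forall>v\<in>{1..19}. ?t v = lst (E v) (int (e v))" "?t out = lst (w0 @ w) (int (length (w0 @ w)))" using s out by auto
  then have "run E d ?t = {?t(out := lst ((w0 @ w) @ w') (int (length ((w0 @ w) @ w'))))}" using assms(2) unfolding emits_def by blast
  then show "run E (Seq c d) s = {s(out := lst (w0 @ w @ w') (int (length (w0 @ w @ w'))))}" using c by simp
qed

lemma emits_seqs_map: "(!!x. x \<in> set xs ==> emits E e out (c x) (w x)) ==> emits E e out (seqs (map c xs)) (concat (map w xs))"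
  by (induction xs) (auto intro: emits_Seq)

lemma emits_Rep:
  assumes "v \<in> {1..19}" shows "emits E e out (Rep v u out a) (replicate (e v) a)" using assms unfolding emits_def by (simp add: act_appends)

lemma emits_Cond:
  assumes "v \<in> {1..19}" "b (nth0 (E v) (e v)) ==> emits E e out c w" "\<not> b (nth0 (E v) (e v)) ==> emits E e out d w"
  shows "emits E e out (Cond (%r. b (r v)) c d) w" using assms unfolding emits_def by (simp add: syms_def scan_nth0)

lemma emits_For:
  assumes v: "v \<in> {1..19}" "e v = 0" and c: "!!i. i < length (E v) ==> emits E (e(v := i)) out c (w i)"
    and d: "emits E (e(v := length (E v))) out d w'" shows "emits E e out (For v c d) (concat (map w [0..<length (E v)]) @ w')" unfolding emits_def
proof (intro allI impI)
  fix s w0 assume s: "\<forall>v\<in>{1..19}. s v = lst (E v) (int (e v))" "s out = lst w0 (int (length w0))"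
  define acc where "acc i = w0 @ concat (map w [0..<i])" for i
  define S where "S i = s(v := lst (E v) (int i), out := lst (acc i) (int (length (acc i))))" for i
  have vo: "v ~= out" using v out by auto
  have S: "\<forall>u\<in>{1..19}. S i u = lst (E u) (int ((e(v := i)) u))" "S i out = lst (acc i) (int (length (acc i)))" for i
    using s(1) out vo by (auto simp: S_def)
  have "run E (For v c d) s = rew v ` run E d (S (length (E v)))" proof (rule run_For_det[where S = S])
    have "s v = lst (E v) 0" using s(1) v by simp
    then show "S 0 = s" using s(2) by (auto simp: S_def acc_def)
    fix i assume "i < length (E v)"
    then have "run E c (S i) = {(S i)(out := lst (acc i @ w i) (int (length (acc i @ w i))))}" using c S unfolding emits_def by blast
    then show "adv v ` run E c (S i) = {S (Suc i)}" using vo by (auto simp: adv_def S_def acc_def fun_eq_iff add.commute)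
  qed simp
  also have "run E d (S (length (E v))) = {(S (length (E v)))(out := lst (acc (length (E v)) @ w') (int (length (acc (length (E v)) @ w'))))}"
    using d S unfolding emits_def by blast
  also have "rew v ` \<dots> = {s(out := lst (acc (length (E v)) @ w') (int (length (acc (length (E v)) @ w'))))}" proof -
    have "s v = lst (E v) 0" using s(1) v by simp
    then show ?thesis using vo by (auto simp: rew_def S_def fun_eq_iff)
  qed
  finally show "run E (For v c d) s = {s(out := lst (w0 @ concat (map w [0..<length (E v)]) @ w')
      (int (length (w0 @ concat (map w [0..<length (E v)]) @ w'))))}" by (simp add: acc_def)
qed

end

text \<open>A letter is turned into unary by comparing it with each number below the alphabet size
  m.\<close>

primrec print_summand :: "nat => nat => summand => com" where
  "print_summand out m (Cst c) = seqs (replicate c (emit out 8))"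
| "print_summand out m (Idx v) = Rep v 6 out 8"
| "print_summand out m (Letter v) = seqs (map (%a. Cond (%r. a < r v) (emit out 8) skip) [0..<m])"

text \<open>A chain is nested to the right, so its closing parentheses all come after the last
  member; a second loop over the same tape prints them.\<close>

primrec print :: "nat => nat => tmpl => com" where
  "print out m (TLit s cs) = Seq (seqs (map (emit out) (if s then [6, 8] else [3, 6, 8])))
     (seqs (map (%ss. Seq (seqs (map (print_summand out m) ss)) (emit out 7)) cs))"
| "print out m (TConj a b) = Seq (emit out 1) (Seq (print out m a) (Seq (emit out 4) (Seq (print out m b) (emit out 2))))"
| "print out m (TDisj a b) = Seq (emit out 1) (Seq (print out m a) (Seq (emit out 5) (Seq (print out m b) (emit out 2))))"
| "print out m (TAll v a) = Seq (For v (Seq (emit out 1) (Seq (print out m a) (emit out 4))) (print out m a)) (For v (emit out 2) skip)"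
| "print out m (TEx v a) = Seq (For v (Seq (emit out 1) (Seq (print out m a) (emit out 5))) (print out m a)) (For v (emit out 2) skip)"

primrec loops :: "tmpl => nat set" where
  "loops (TLit s cs) = {}"
| "loops (TConj a b) = loops a \<union> loops b"
| "loops (TDisj a b) = loops a \<union> loops b"
| "loops (TAll v a) = insert v (loops a)"
| "loops (TEx v a) = insert v (loops a)"

primrec printable_summand :: "summand => bool" where
  "printable_summand (Cst c) = True"
| "printable_summand (Idx v) = (v \<in> {1..19} - {6})"
| "printable_summand (Letter v) = (v \<in> {1..4})"

primrec printable :: "tmpl => bool" where
  "printable (TLit s cs) = (\<forall>ss\<in>set cs. \<forall>x\<in>set ss. printable_summand x)"
| "printable (TConj a b) = (printable a \<and> printable b)"
| "printable (TDisj a b) = (printable a \<and> printable b)"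
| "printable (TAll v a) = (v \<in> {1..19} - {6} \<and> v \<notin> loops a \<and> printable a)"
| "printable (TEx v a) = (v \<in> {1..19} - {6} \<and> v \<notin> loops a \<and> printable a)"

lemma encode_chain:
  "encode (chain Conj f p n) = concat (map (%q. [1] @ encode (f q) @ [4]) [p..<p + n]) @ encode (f (p + n)) @ replicate n 2"
  "encode (chain Disj f p n) = concat (map (%q. [1] @ encode (f q) @ [5]) [p..<p + n]) @ encode (f (p + n)) @ replicate n 2" proof -
  have u: "[p..<Suc (p + n)] = p # [Suc p..<Suc (p + n)]" for p n by (simp add: upt_conv_Cons)
  show "encode (chain Conj f p n) = concat (map (%q. [1] @ encode (f q) @ [4]) [p..<p + n]) @ encode (f (p + n)) @ replicate n 2"
    by (induction n arbitrary: p) (simp_all add: u replicate_append_same del: upt_Suc)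
  show "encode (chain Disj f p n) = concat (map (%q. [1] @ encode (f q) @ [5]) [p..<p + n]) @ encode (f (p + n)) @ replicate n 2"
    by (induction n arbitrary: p) (simp_all add: u replicate_append_same del: upt_Suc)
qed

context
  fixes E :: "nat => nat list" and out m :: nat
  assumes out: "19 < out" and letters: "!!v i. v \<in> {1..4} ==> nth0 (E v) i <= m"
begin

lemma emits_summand:
  assumes "printable_summand x" shows "emits E e out (print_summand out m x) (replicate (sval E e x) 8)" proof (cases x)
  case (Cst c)
  have "emits E e out (seqs (replicate c (emit out 8))) (replicate c 8)" using emits_Seq[OF out emits_emit[OF out]] by (induction c) fastforce+
  then show ?thesis by (simp add: Cst)
next
  case (Idx v)
  then show ?thesis using assms emits_Rep[OF out, of v] by simp
next
  case (Letter v)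
  let ?l = "nth0 (E v) (e v)"
  have v: "v \<in> {1..19}" "?l <= m" using assms letters[of v "e v"] by (simp_all add: Letter)
  have "emits E e out (seqs (map (%a. Cond (%r. a < r v) (emit out 8) skip) [0..<m]))
      (concat (map (%a. if a < ?l then [8] else []) [0..<m]))"
    by (rule emits_seqs_map[OF out], rule emits_Cond[OF out v(1)]) (simp_all add: emits_emit[OF out])
  moreover have "concat (map (%a. if a < l then [8] else []) [0..<n]) = replicate (min l n) (8 :: nat)" for l n proof (induction n)
    case (Suc n)
    then show ?case
      by (cases "n < l") (simp_all add: replicate_append_same min.absorb1 min.absorb2 Suc_leI less_imp_le not_less le_SucI del: replicate_Suc, simp)
  qed simp
  ultimately show ?thesis using v(2) by (simp add: Letter min_def)
qed

lemma emits_print: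
  assumes "printable a" "!!v. v \<in> loops a ==> e v = 0" shows "emits E e out (print out m a) (encode (interp E a e))" using assms
proof (induction a arbitrary: e)
  case (TLit s cs)
  have "emits E e out (seqs (map (emit out) (if s then [6, 8] else [3, 6, 8]))) (concat (map (%a. [a]) (if s then [6, 8] else [3, 6, 8])))"
    by (rule emits_seqs_map[OF out emits_emit[OF out]])
  moreover have "emits E e out (seqs (map (%ss. Seq (seqs (map (print_summand out m) ss)) (emit out 7)) cs))
      (concat (map (%ss. concat (map (%x. replicate (sval E e x) 8) ss) @ [7]) cs))"
    by (rule emits_seqs_map[OF out], rule emits_Seq[OF out emits_seqs_map[OF out emits_summand] emits_emit[OF out]]) (use TLit in simp)
  moreover have "concat (map (%x. replicate (sval E e x) 8) ss) = replicate (cval E e ss) (8 :: nat)" for ss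
    by (induction ss) (simp_all add: replicate_add)
  ultimately have "emits E e out (print out m (TLit s cs))
      (concat (map (%a. [a]) (if s then [6, 8] else [3, 6, 8])) @ concat (map (%ss. replicate (cval E e ss) 8 @ [7]) cs))"
    using emits_Seq[OF out] by simp
  moreover have "encode (interp E (TLit s cs) e) = (if s then [6, 8] else [3, 6, 8]) @ concat (map (%ss. replicate (cval E e ss) 8 @ [7]) cs)"
    by (simp add: encode_atom unary_def names_def o_def)
  ultimately show ?case by (simp split: if_splits)
next
  case (TConj a b)
  have "emits E e out (print out m (TConj a b)) ([1] @ encode (interp E a e) @ [4] @ encode (interp E b e) @ [2])"
    unfolding print.simps by (intro emits_Seq[OF out] emits_emit[OF out] TConj.IH) (use TConj.prems in simp_all)
  then show ?case by simp
next
  case (TDisj a b)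
  have "emits E e out (print out m (TDisj a b)) ([1] @ encode (interp E a e) @ [5] @ encode (interp E b e) @ [2])"
    unfolding print.simps by (intro emits_Seq[OF out] emits_emit[OF out] TDisj.IH) (use TDisj.prems in simp_all)
  then show ?case by simp
next
  case (TAll v a)
  have v: "v \<in> {1..19}" "e v = 0" using TAll.prems by simp_all
  have a: "emits E (e(v := i)) out (print out m a) (encode (interp E a (e(v := i))))" for i by (rule TAll.IH) (use TAll.prems in auto)
  have "emits E e out (print out m (TAll v a)) ((concat (map (%q. [1] @ encode (interp E a (e(v := q))) @ [4]) [0..<length (E v)]) @
      encode (interp E a (e(v := length (E v))))) @ concat (map (%q. [2]) [0..<length (E v)]) @ [])" unfolding print.simps
    by (intro emits_Seq[OF out] emits_For[OF out, where v = v and e = e, OF v] a emits_emit[OF out] emits_skip)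
  then show ?case by (simp add: encode_chain map_replicate_const)
next
  case (TEx v a)
  have v: "v \<in> {1..19}" "e v = 0" using TEx.prems by simp_all
  have a: "emits E (e(v := i)) out (print out m a) (encode (interp E a (e(v := i))))" for i by (rule TEx.IH) (use TEx.prems in auto)
  have "emits E e out (print out m (TEx v a)) ((concat (map (%q. [1] @ encode (interp E a (e(v := q))) @ [5]) [0..<length (E v)]) @
      encode (interp E a (e(v := length (E v))))) @ concat (map (%q. [2]) [0..<length (E v)]) @ [])" unfolding print.simps
    by (intro emits_Seq[OF out] emits_For[OF out, where v = v and e = e, OF v] a emits_emit[OF out] emits_skip)
  then show ?case by (simp add: encode_chain map_replicate_const)
qed

end

lemma wfc_seqs: "wfc k G Z E (seqs cs) \<longleftrightarrow> (\<forall>c\<in>set cs. wfc k G Z E c)" and lps_seqs: "lps (seqs cs) = (\<Union>c\<in>set cs. lps c)"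
  and det_seqs: "det (seqs cs) \<longleftrightarrow> (\<forall>c\<in>set cs. det c)" by (induction cs) (auto simp: skip_def stay_def)

lemma wfc_emit: "out < k ==> out \<notin> Z ==> a <= G ==> wfc k G Z E (emit out a)" and lps_emit [simp]: "lps (emit out a) = {}"
  and det_emit [simp]: "det (emit out a)" by (auto simp: emit_def stay_def)

lemma det_print: "det (print out m a)" proof -
  have "det (print_summand out m x)" for x by (cases x) (auto simp: det_seqs skip_def)
  then show ?thesis by (induction a) (auto simp: det_seqs skip_def)
qed

lemma print_props:
  assumes "printable a" "!!v. v \<in> {1..19} ==> length (E v) <= length (E 6)" "19 < out" "out < k" "8 <= G"
  shows "wfc k G {1..19} E (print out m a) \<and> lps (print out m a) \<subseteq> insert 6 (loops a)" proof -
  have p: "wfc k G {1..19} E (emit out b)" if "b <= 8" for b using that assms by (intro wfc_emit) auto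
  have x: "wfc k G {1..19} E (print_summand out m x) \<and> lps (print_summand out m x) \<subseteq> {6}" if "printable_summand x" for x
    using that p[of 8] assms by (cases x) (auto simp: wfc_seqs lps_seqs)
  show ?thesis using assms(1) proof (induction a)
    case (TLit sg cs)
    then show ?case using x p by (fastforce simp: wfc_seqs lps_seqs)
  next
    case (TAll v a)
    have "v < k" using TAll.prems assms by simp
    then show ?case using TAll p by auto
  next
    case (TEx v a)
    have "v < k" using TEx.prems assms by simp
    then show ?case using TEx p by auto
  qed (use p in auto)
qed

section \<open>Tapes of polynomial length\<close>

definition on :: "nat set => (tape => tape) => tapes => tapes" where
  "on V F s = (%u. if u \<in> V then F (s u) else s u)"

definition push_all :: "nat => nat set => com" where
  "push_all a V = Upd (%r u. if u \<in> V then (a, Right_Move) else (r u, No_Move))"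

definition left :: "nat set => com" where
  "left V = Upd (%r u. if u \<in> V then (r u, Left_Move) else (r u, No_Move))"

definition nest :: "nat list => com => com" where
  "nest ds c = foldr (%d c. For d c skip) ds c"

definition leftwards :: "tape => tape" where
  "leftwards t = (fst t, snd t - 1)"

lemma run_push_all: "run E (push_all a V) s = {on V (act (a, Right_Move)) s}" by (auto simp: push_all_def on_def upd_def syms_def)

lemma run_left: "run E (left V) s = {on V leftwards s}" by (auto simp: left_def on_def upd_def syms_def act_keep leftwards_def)

lemma on_on: "on V F (on V G s) = on V (F \<circ> G) s" by (auto simp: on_def)

lemma on_cong: "(!!u. u \<in> V ==> F (s u) = G (s u)) ==> on V F s = on V G s" by (auto simp: on_def)

text \<open>Nesting multiplies the numbers of repetitions; this is how lengths that are powers arise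
  from tapes of length n.\<close>

lemma run_nest:
  assumes "!!s. run E c s = {on V F s}" "distinct ds" "set ds \<inter> V = {}"
    "!!d. d \<in> set ds ==> s d = lst (E d) 0 \<and> length (E d) = n" shows "run E (nest ds c) s = {on V (F ^^ (n ^ length ds)) s}" using assms(2-)
proof (induction ds arbitrary: s)
  case Nil
  then show ?case using assms(1) by (simp add: nest_def One_nat_def)
next
  case (Cons d ds)
  let ?F = "F ^^ (n ^ length ds)"
  define S where "S i = (on V (?F ^^ i) s)(d := lst (E d) (int i))" for i
  have d: "s d = lst (E d) 0" "length (E d) = n" "d \<notin> V" "d \<notin> set ds" using Cons.prems by auto
  have "run E (For d (nest ds c) skip) s = rew d ` run E skip (S n)" proof (rule run_For_det[where S = S])
    show "length (E d) = n" by fact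
    show "S 0 = s" using d by (auto simp: S_def on_def)
    fix i assume "i < n"
    have "run E (nest ds c) (S i) = {on V ?F (S i)}" proof (rule Cons.IH)
      show "S i u = lst (E u) 0 \<and> length (E u) = n" if "u \<in> set ds" for u using Cons.prems that d(4) by (auto simp: S_def on_def)
    qed (use Cons.prems in auto)
    then show "adv d ` run E (nest ds c) (S i) = {S (Suc i)}" using d(3) by (auto simp: adv_def S_def on_def fun_eq_iff add.commute)
  qed
  also have "\<dots> = {on V (F ^^ (n ^ length (d # ds))) s}" using d by (auto simp: rew_def S_def on_def fun_eq_iff funpow_mult mult.commute)
  finally show ?case by (simp add: nest_def)
qed

lemma nest_props:
  "distinct ds ==> set ds \<subseteq> Z ==> set ds \<subseteq> {..<k} ==> lps c = {} ==> wfc k G Z E c ==> wfc k G Z E (nest ds c)"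
  "lps (nest ds c) = set ds \<union> lps c" "det (nest ds c) = det c" proof -
  show l: "lps (nest ds c) = set ds \<union> lps c" for ds by (induction ds) (auto simp: nest_def)
  show "det (nest ds c) = det c" by (induction ds) (auto simp: nest_def skip_def)
  show "distinct ds ==> set ds \<subseteq> Z ==> set ds \<subseteq> {..<k} ==> lps c = {} ==> wfc k G Z E c ==> wfc k G Z E (nest ds c)"
  proof (induction ds)
    case (Cons d ds)
    then have "wfc k G Z E (nest ds c)" by simp
    then show ?case using Cons.prems l[of ds] by (simp add: nest_def)
  qed (simp add: nest_def)
qed

lemma move_props [simp]:
  "lps (push_all a V) = {}" "lps (left V) = {}" "det (push_all a V)" "det (left V)"
  "wfc k G Z E (left V) \<longleftrightarrow> V \<subseteq> {..<k} - Z"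
  "V \<subseteq> {..<k} - Z ==> a <= G ==> wfc k G Z E (push_all a V)" by (auto simp: push_all_def left_def split: if_splits)

lemma leftwards_pow: "(leftwards ^^ n) (lst l p) = lst l (p - int n)" by (induction n) (auto simp: leftwards_def algebra_simps)

definition copy_to :: "nat set => com" where
  "copy_to V = For 0 (Upd (%r u. if u \<in> V then (r 0, Right_Move) else (r u, No_Move))) skip"

lemma run_copy_to:
  assumes "E 0 = x" "s 0 = lst x 0" "0 \<notin> V" "!!u. u \<in> V ==> s u = lst l (int (length l))"
  shows "run E (copy_to V) s = {on V (%_. lst (l @ x) (int (length (l @ x)))) s}" proof -
  define S where "S i = (on V (%_. lst (l @ take i x) (int (length (l @ take i x)))) s)(0 := lst x (int i))" for i
  have "run E (copy_to V) s = rew 0 ` run E skip (S (length x))" unfolding copy_to_def proof (rule run_For_det[where S = S])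
    show "S 0 = s" using assms by (auto simp: S_def on_def)
    fix i assume i: "i < length x"
    have n: "syms (S i) 0 = x ! i" using i by (simp add: S_def syms_def scan_nth0 nth0_def)
    have u: "upd (%r u. if u \<in> V then (r 0, Right_Move) else (r u, No_Move)) (S i) =
        on V (act (x ! i, Right_Move)) (S i)" unfolding upd_def n by (auto simp: on_def syms_def)
    have "adv 0 (on V (act (x ! i, Right_Move)) (S i)) = S (Suc i)" using assms(3) i act_append[of "x ! i" "l @ take i x"]
      by (auto simp: adv_def on_def S_def fun_eq_iff take_Suc_conv_app_nth add.commute)
    then show "adv 0 ` run E (Upd (%r u. if u \<in> V then (r 0, Right_Move) else (r u, No_Move))) (S i) = {S (Suc i)}" by (simp add: u)
  qed (use assms in simp)
  then show ?thesis using assms(2,3) by (auto simp: rew_def S_def on_def fun_eq_iff)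
qed

lemma copy_to_props:
  "lps (copy_to V) = {0}" "det (copy_to V)" "0 \<in> Z ==> V \<subseteq> {..<k} - Z ==> 0 < k ==> wfc k G Z E (copy_to V)"
  by (auto simp: copy_to_def skip_def stay_def)

text \<open>Fills the tapes from 20 on with two letters more than the input has. The base
  \<open>n + 2\<close> of all later powers is thus at least 2 even on the empty input.\<close>

definition prepare1 :: "nat => com" where
  "prepare1 b = Seq (nest [0] (push_all 1 {20..<24 + b})) (Seq (push_all 1 {20..<24 + b}) (Seq (push_all 1 {20..<24 + b})
     (Seq (nest [0] (left {20..<24 + b})) (Seq (left {20..<24 + b}) (left {20..<24 + b})))))"

text \<open>With K as the b-th power of the base, the exponent b + 4 makes the tapes from 6 on at
  least 16 K long, which covers components up to \<open>3 * N\<close> for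
  \<open>N = 2 * K + n\<close>. The head of tape 5 is deliberately left behind its word, on cell
  K.\<close>

definition prepare2 :: "nat => nat => com" where
  "prepare2 b g = Seq (nest [20..<20 + b] (push_all (g + 2) {1..4})) (Seq (copy_to {1..4})
     (Seq (nest [20..<20 + b] (push_all (g + 1) {1..4}))
     (Seq (nest [20..<20 + b] (left {1..4})) (Seq (nest [0] (left {1..4})) (Seq (nest [20..<20 + b] (left {1..4}))
     (Seq (nest [20..<20 + b] (push_all 1 {5}))
     (Seq (nest [20..<24 + b] (push_all 1 {6..19})) (nest [20..<24 + b] (left {6..19})))))))))"

context
  fixes x :: "nat list" and b g :: nat
begin

definition zones :: "nat list" where
  "zones = replicate ((length x + 2) ^ b) (g + 2) @ x @ replicate ((length x + 2) ^ b) (g + 1)"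

definition contents :: "nat => nat list" where
  "contents v = (if v = 0 then x else if v <= 4 then zones else if v = 5 then replicate ((length x + 2) ^ b) 1
     else if v <= 19 then replicate ((length x + 2) ^ (b + 4)) 1 else replicate (length x + 2) 1)"

definition parked :: "nat => nat" where
  "parked v = (if v = 5 then (length x + 2) ^ b else 0)"

lemma on_other [simp]: "u \<notin> V ==> on V F s u = s u" by (simp add: on_def)

lemma on_const: "on V F (on V (%_. t) s) = on V (%_. F t) s" by (simp add: on_on o_def)

lemma run_prepare1:
  "run contents (prepare1 b) (input_tapes x) = {on {20..<24 + b} (%_. lst (replicate (length x + 2) 1) 0) (input_tapes x)}" proof -
  let ?V = "{20..<24 + b}" let ?n = "length x"
  have n: "run contents (nest [0] c) s = {on ?V (F ^^ ?n) s}" if "!!s. run contents c s = {on ?V F s}" "s 0 = lst x 0" for c F s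
    using run_nest[OF that(1), of "[0]" s ?n] that(2) by (simp add: contents_def)
  have i0: "input_tapes x 0 = lst x 0" by (simp add: input_tapes_def)
  have "on ?V (act (1, Right_Move) ^^ ?n) (input_tapes x) = on ?V (%_. lst (replicate ?n 1) (int ?n)) (input_tapes x)"
    by (rule on_cong) (use act_appends[where a = 1 and n = ?n and w = "[]"] in "simp add: input_tapes_def blank_tape_lst")
  moreover have "leftwards (leftwards ((leftwards ^^ ?n) (act (1, Right_Move) (act (1, Right_Move) (lst (replicate ?n 1) (int ?n)))))) =
      lst (replicate (?n + 2) 1) 0" proof -
    have a: "act (1, Right_Move) (lst (replicate m 1) (int m)) = lst (replicate (m + 1) 1) (int (m + 1))" for m proof -
      have e: "replicate (m + 1) (1 :: nat) = replicate m 1 @ [1]" by (induction m) (simp_all add: One_nat_def)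
      show ?thesis unfolding e using act_append[of 1 "replicate m 1"] by simp
    qed
    have "act (1, Right_Move) (act (1, Right_Move) (lst (replicate ?n 1) (int ?n))) = lst (replicate (?n + 2) 1) (int (?n + 2))"
      by (simp only: a add.assoc one_add_one)
    then show ?thesis by (simp only: leftwards_pow) (simp add: leftwards_def)
  qed
  ultimately show ?thesis unfolding prepare1_def by (simp add: run_push_all run_left n[OF run_push_all] n[OF run_left] i0 on_const)
qed

lemma run_prepare2:
  defines "s1 \<equiv> on {20..<24 + b} (%_. lst (replicate (length x + 2) 1) 0) (input_tapes x)"
  shows "run contents (prepare2 b g) s1 = {on {6..19} (%_. lst (contents 6) 0)
    (on {5} (%_. lst (contents 5) (int ((length x + 2) ^ b))) (on {1..4} (%_. lst zones 0) s1))}" proof -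
  let ?K = "(length x + 2) ^ b" let ?R = "(length x + 2) ^ (b + 4)" let ?V = "{1..4}" let ?n = "length x"
  define base where "base s \<longleftrightarrow> s 0 = lst x 0 \<and> (\<forall>d\<in>{20..<24 + b}. s d = lst (replicate (?n + 2) 1) 0)" for s
  have base: "base (on V F s)" if "base s" "V \<subseteq> {1..19}" for V F s using that by (auto simp: base_def on_def)
  have s1: "base s1" "!!u. u \<in> {1..19} ==> s1 u = lst [] 0" by (auto simp: base_def s1_def on_def input_tapes_def blank_tape_lst)
  have nA: "run contents (nest [20..<20 + b] c) s = {on V (F ^^ ?K) s}"
    and nR: "run contents (nest [20..<24 + b] c) s = {on V (F ^^ ?R) s}"
    and n0: "run contents (nest [0] c) s = {on V (F ^^ ?n) s}"
    if "!!s. run contents c s = {on V F s}" "V \<subseteq> {1..19}" "base s" for c F V s proof -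
    show "run contents (nest [20..<20 + b] c) s = {on V (F ^^ ?K) s}"
      using run_nest[OF that(1), of "[20..<20 + b]" s "?n + 2"] that(2,3) by (force simp: base_def contents_def)
    show "run contents (nest [20..<24 + b] c) s = {on V (F ^^ ?R) s}"
      using run_nest[OF that(1), of "[20..<24 + b]" s "?n + 2"] that(2,3) by (force simp: base_def contents_def add.commute)
    show "run contents (nest [0] c) s = {on V (F ^^ ?n) s}" using run_nest[OF that(1), of "[0]" s ?n] that(2,3) by (force simp: base_def contents_def)
  qed
  have app: "(act (a, Right_Move) ^^ m) (lst w (int (length w))) = lst (w @ replicate m a) (int (length (w @ replicate m a)))" for a m w
    by (simp add: act_appends)
  have p: "on V (act (a, Right_Move) ^^ m) s = on V (%_. lst (replicate m a) (int m)) s"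
    if "!!u. u \<in> V ==> s u = lst [] 0" for V a m s by (rule on_cong) (use that act_appends[where a = a and n = m and w = "[]"] in simp)
  let ?s = "%w p. on ?V (%_. lst w (int p)) s1" and ?A = "[20..<20 + b]" and ?w = "replicate ?K (g + 2)"
  have 1: "run contents (nest ?A (push_all (g + 2) ?V)) s1 = {?s ?w ?K}"
    unfolding nA[OF run_push_all _ s1(1), of ?V, simplified] by (subst p) (simp_all add: s1)
  have 2: "run contents (copy_to ?V) (?s ?w ?K) = {?s (?w @ x) (length (?w @ x))}"
    by (subst run_copy_to[where x = x and l = ?w]) (use s1 in \<open>simp_all add: contents_def base_def on_const\<close>, simp add: on_def)
  have "(act (g + 1, Right_Move) ^^ ?K) (lst (?w @ x) (int (length (?w @ x)))) = lst zones (int (?K + ?n + ?K))" by (subst app) (simp add: zones_def)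
  then have 3: "run contents (nest ?A (push_all (g + 1) ?V)) (?s (?w @ x) (length (?w @ x))) = {?s zones (?K + ?n + ?K)}"
    by (subst nA[OF run_push_all _ base[OF s1(1)]]) (simp_all only: on_const, auto)
  have l: "(leftwards ^^ m) (lst zones (int (q + m))) = lst zones (int q)" for q m by (simp add: leftwards_pow)
  have 4: "run contents (nest ?A (left ?V)) (?s zones (?K + ?n + ?K)) = {?s zones (?K + ?n)}"
    by (subst nA[OF run_left _ base[OF s1(1)]]) (simp_all only: on_const l, auto)
  have 5: "run contents (nest [0] (left ?V)) (?s zones (?K + ?n)) = {?s zones ?K}"
    by (subst n0[OF run_left _ base[OF s1(1)]]) (simp_all only: on_const l, auto)
  have 6: "run contents (nest ?A (left ?V)) (?s zones (0 + ?K)) = {on ?V (%_. lst zones 0) s1}"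
    by (subst nA[OF run_left _ base[OF s1(1)]]) (simp_all only: on_const l of_nat_0, auto)
  let ?f = "on ?V (%_. lst zones 0) s1"
  let ?h = "on {5} (%_. lst (contents 5) (int ?K)) ?f"
  have f: "base ?f" by (rule base[OF s1(1)]) simp
  have 7: "run contents (nest ?A (push_all 1 {5})) ?f = {?h}"
    unfolding nA[OF run_push_all _ f, of "{5}", simplified] by (subst p) (simp_all add: s1 contents_def)
  have h: "base ?h" by (rule base[OF f]) simp
  let ?r = "on {6..19} (%_. lst (contents 6) (int ?R)) ?h"
  have "on {6..19} (act (1, Right_Move) ^^ ?R) ?h = ?r" by (subst p) (simp_all add: s1 contents_def)
  then have 8: "run contents (nest [20..<24 + b] (push_all 1 {6..19})) ?h = {?r}" by (subst nR[OF run_push_all _ h]) (simp_all only:, auto)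
  have 9: "run contents (nest [20..<24 + b] (left {6..19})) ?r = {on {6..19} (%_. lst (contents 6) 0) ?h}"
    by (subst nR[OF run_left _ base[OF h]]) (simp_all add: on_const leftwards_pow)
  have S: "run E (Seq c d) s = run E d t" if "run E c s = {t}" for E c d s t using that by simp
  show ?thesis unfolding prepare2_def S[OF 1] S[OF 2] S[OF 3] S[OF 4] S[OF 5] S[OF 6[unfolded add_0]] S[OF 7] S[OF 8] by (rule 9)
qed

lemma contents_at:
  assumes "v \<in> {1..19}" shows "(on {6..19} (%_. lst (contents 6) 0) (on {5} (%_. lst (contents 5) (int ((length x + 2) ^ b)))
    (on {1..4} (%_. lst zones 0) s))) v = lst (contents v) (int (parked v))" using assms by (auto simp: on_def contents_def parked_def)

lemma contents_length:
  assumes "1 <= b" "v \<in> {1..19}" shows "length (contents v) <= (length x + 2) ^ (b + 4)" "length (contents v) <= length (contents 6)"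
    "parked v <= length (contents v)" "length zones = 2 * (length x + 2) ^ b + length x" "3 * length zones <= (length x + 2) ^ (b + 4)" proof -
  let ?K = "(length x + 2) ^ b"
  have n: "length x <= ?K" using assms(1) self_le_power[of "length x + 2" b] by linarith
  have "(2 :: nat) ^ 4 <= (length x + 2) ^ 4" by (rule power_mono) simp_all
  then have R: "16 * ?K <= (length x + 2) ^ (b + 4)" by (simp add: power_add)
  show z: "length zones = 2 * ?K + length x" by (simp add: zones_def)
  show "3 * length zones <= (length x + 2) ^ (b + 4)" proof -
    have "3 * (2 * k + m) <= r" if "16 * k <= r" "m <= k" for k m r :: nat using that by presburger
    from this[OF R n] show ?thesis unfolding z .
  qed
  then show "length (contents v) <= (length x + 2) ^ (b + 4)" "length (contents v) <= length (contents 6)"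
    using assms(2) R by (auto simp: contents_def simp del: power_Suc)
  show "parked v <= length (contents v)" by (simp add: parked_def contents_def)
qed

lemma contents_letters:
  assumes "x \<in> words g" shows "set (contents v) \<subseteq> {1..g + 2}"
  using assms by (auto simp: contents_def zones_def words_def in_lists_conv_set)

end

text \<open>Each stage loops over tapes that earlier stages have written. The polynomials of the
  stages are composed with the bounds \<open>n + 2\<close> and \<open>(n + 2) ^ (b + 4)\<close> on
  the lengths of these tapes.\<close>

theorem poly_time_print:
  assumes a: "printable a" "loops a \<subseteq> {1..19} - {5}" and b: "1 <= b"
  shows "poly_time_computable g (%x. encode (interp (contents x b g) a (parked x b)))" proof -
  let ?out = "24 + b" let ?k = "25 + b" let ?G = "g + 8"
  let ?c1 = "prepare1 b" let ?c2 = "prepare2 b g" let ?c3 = "print ?out (g + 2) a"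
  let ?c = "Seq ?c1 (Seq ?c2 ?c3)"
  let ?M = "machine_of ?k ?G ?c (csize ?c) (csize ?c + 3)"
  let ?p = "pcompose (tbound ?c1) [:2, 1:] + (pcompose (tbound ?c2) [:2, 1:] + pcompose (tbound ?c3) ([:2, 1:] ^ (b + 4)))"
  have det: "det ?c" by (simp add: prepare1_def prepare2_def nest_props(3) copy_to_props det_print)
  have main: "\<exists>n q ts. n <= poly ?p (length x) \<and> (step {} ?M ^^ n) (initial ?M x) (q, ts) \<and> (\<nexists>C. step {} ?M (q, ts) C) \<and>
      tape_word (last ts) = encode (interp (contents x b g) a (parked x b))" if x: "x \<in> words g" for x proof -
    let ?E = "contents x b g" and ?e = "parked x b" and ?n = "length x" and ?F = "encode (interp (contents x b g) a (parked x b))"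
    have xg: "0 \<notin> set x" "set x \<subseteq> {..?G}" using x by (auto simp: words_def in_lists_conv_set)
    have E0: "0 \<notin> set (?E v)" for v using contents_letters[OF x, of b v] by auto
    define s1 where "s1 = on {20..<24 + b} (%_. lst (replicate (?n + 2) 1) 0) (input_tapes x)"
    define s2 where "s2 = on {6..19} (%_. lst (?E 6) 0) (on {5} (%_. lst (?E 5) (int ((?n + 2) ^ b))) (on {1..4} (%_. lst (zones x b g) 0) s1))"
    have r: "run ?E ?c1 (input_tapes x) = {s1}" "run ?E ?c2 s1 = {s2}"
      using run_prepare1[of x b g] run_prepare2[of x b g] by (simp_all add: s1_def s2_def)
    have r3: "run ?E ?c3 s2 = {s2(?out := lst ?F (int (length ?F)))}" proof -
      have "emits ?E ?e ?out ?c3 ?F" proof (rule emits_print[OF _ _ a(1)])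
        show "nth0 (?E v) i <= g + 2" for v i proof (cases "i < length (?E v)")
          case True
          from subsetD[OF contents_letters[OF x] nth_mem[OF this]] show ?thesis using True by (simp add: nth0_def)
        qed (simp add: nth0_def)
        show "?e v = 0" if "v \<in> loops a" for v using a(2) that by (auto simp: parked_def)
      qed simp
      moreover have "\<forall>v\<in>{1..19}. s2 v = lst (?E v) (int (?e v))" unfolding s2_def using contents_at by blast
      moreover have "s2 ?out = lst [] (int (length []))" by (simp add: s2_def s1_def on_def input_tapes_def blank_tape_lst)
      ultimately show ?thesis unfolding emits_def by (metis append_Nil)
    qed
    have pre1: "pre ?k ?G (?n + 2) {0} ?E ?c1 (input_tapes x)" unfolding pre_def proof (intro conjI ballI)
      show "wfc ?k ?G {0} ?E ?c1" unfolding prepare1_def wfc.simps by (intro conjI nest_props(1) move_props(5)[THEN iffD2] move_props(6)) auto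
      show "okst ?k ?G (input_tapes x)" by (rule okst_input_tapes[OF xg(2)]) simp
      show "frz {0} ?E (?n + 2) (input_tapes x)" using xg(1) by (auto simp: frz_def input_tapes_def contents_def)
      show "snd (input_tapes x v) = 0" if "v \<in> lps ?c1" for v by (simp add: input_tapes_def blank_tape_def)
    qed
    have ok1: "okst ?k ?G s1" using pre_invariant[OF pre1, of s1] r(1) by simp
    have pre2: "pre ?k ?G (?n + 2) (insert 0 {20..<24 + b}) ?E ?c2 s1" unfolding pre_def proof (intro conjI ballI ok1)
      show "wfc ?k ?G (insert 0 {20..<24 + b}) ?E ?c2" unfolding prepare2_def wfc.simps
        by (intro conjI nest_props(1) copy_to_props(3) move_props(5)[THEN iffD2] move_props(6)) auto
      show "frz (insert 0 {20..<24 + b}) ?E (?n + 2) s1" using xg(1) by (auto simp: frz_def s1_def on_def input_tapes_def contents_def)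
      show "snd (s1 v) = 0" if "v \<in> lps ?c2" for v
        using that by (auto simp: s1_def on_def input_tapes_def blank_tape_def prepare2_def nest_props(2) copy_to_props(1))
    qed
    have ok2: "okst ?k ?G s2" using pre_invariant[OF pre2, of s2] r(2) by simp
    have pre3: "pre ?k ?G ((?n + 2) ^ (b + 4)) {1..19} ?E ?c3 s2" proof -
      have p: "wfc ?k ?G {1..19} ?E ?c3 \<and> lps ?c3 \<subseteq> insert 6 (loops a)"
        using contents_length(2)[OF b] by (intro print_props[OF a(1)]) auto
      moreover have "frz {1..19} ?E ((?n + 2) ^ (b + 4)) s2" unfolding frz_def
      proof
        fix v :: nat assume v: "v \<in> {1..19}"
        show "0 <= snd (s2 v) \<and> snd (s2 v) <= int (length (?E v)) \<and> s2 v = lst (?E v) (snd (s2 v)) \<and>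
            0 \<notin> set (?E v) \<and> length (?E v) <= (?n + 2) ^ (b + 4)"
          using contents_length(1,3)[OF b v, of x g] E0[of v] contents_at[OF v] by (simp add: s2_def)
      qed
      moreover have "snd (s2 v) = 0" if "v \<in> lps ?c3" for v proof -
        have "v \<in> insert 6 (loops a)" using that p by blast
        then have "v \<in> {1..19}" "v ~= 5" using a(2) by auto
        then show ?thesis unfolding s2_def using contents_at[of v] by (simp add: parked_def)
      qed
      ultimately show ?thesis using ok2 by (simp add: pre_def)
    qed
    have code: "code_at ?M ?k ?G (inner ?c) ?c 0 (csize ?c)" by (rule code_at_machine_of) simp
    have "exact (step {} ?M) (inner ?c) (poly (tbound ?c1) (?n + 2) + (poly (tbound ?c2) (?n + 2) + poly (tbound ?c3) ((?n + 2) ^ (b + 4))))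
      (cfg ?k (csize ?c) ` (\<Union>s\<in>run ?E ?c1 (input_tapes x). \<Union>t\<in>run ?E ?c2 s. run ?E ?c3 t)) (cfg ?k 0 (input_tapes x))"
    proof (rule exact_seq[OF compile_exact[OF code_at_Seq(1)[OF code] pre1] _ order_refl])
      fix s assume "s \<in> run ?E ?c1 (input_tapes x)"
      then have s: "s = s1" using r(1) by simp
      show "exact (step {} ?M) (inner ?c) (poly (tbound ?c2) (?n + 2) + poly (tbound ?c3) ((?n + 2) ^ (b + 4)))
         (cfg ?k (csize ?c) ` (\<Union>t\<in>run ?E ?c2 s. run ?E ?c3 t)) (cfg ?k (0 + csize ?c1) s)"
        unfolding s by (rule exact_stages[OF code_at_Seq(2)[OF code] pre2]) (use r(2) pre3 in simp)
    qed
    then have ex: "exact (step {} ?M) (inner ?c) (poly ?p ?n) {cfg ?k (csize ?c) (s2(?out := lst ?F (int (length ?F))))} (initial ?M x)"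
      using initial_machine_of[of ?k ?G ?c] r r3 by (simp add: poly_pcompose add.commute)
    have "tape_word ((s2(?out := lst ?F (int (length ?F)))) (?k - 1)) = ?F" proof -
      have "0 \<notin> set ?F" using set_encode[of "interp ?E a ?e"] by auto
      then show ?thesis by (simp add: tape_word_lst)
    qed
    from function_machine[OF ex _ this] show ?thesis by simp
  qed
  have "wf_machine ?M" by (rule wf_machine_of) simp
  moreover have "deterministic ?M" by (rule deterministic_machine_of[OF det])
  ultimately show ?thesis using main unfolding poly_time_computable_def by blast
qed

section \<open>Unique readability of the encoding\<close>

lemma digits_append:
  assumes "xs @ u = ys @ v" "set xs \<subseteq> {7, 8}" "set ys \<subseteq> {7, 8}" "u = [] \<or> hd u \<notin> {7, 8}" "v = [] \<or> hd v \<notin> {7, 8}"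
  shows "xs = ys \<and> u = (v :: nat list)" proof -
  have "takeWhile (%a. a \<in> {7, 8}) (zs @ w) = zs" if "set zs \<subseteq> {7, 8}" "w = [] \<or> hd w \<notin> {7, 8}" for zs w :: "nat list"
    using that by (subst takeWhile_append2) (auto simp: takeWhile_eq_Nil_iff)
  then have "xs = ys" using assms by metis
  then show ?thesis using assms(1) by simp
qed

text \<open>A numeral has no end mark, hence the condition that the remainders do not begin with a
  digit; inside a formula they begin with a connective or a parenthesis.\<close>

lemma encode_append:
  "encode F @ u = encode G @ v ==> u = [] \<or> hd u \<notin> {7, 8} ==> v = [] \<or> hd v \<notin> {7, 8} ==> F = G \<and> u = v"
proof (induction F arbitrary: G u v)
  case (Pos a)
  then obtain b where b: "G = Pos b" by (cases G) auto
  then have "encode_nat a @ u = encode_nat b @ v" using Pos(1) by simp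
  from digits_append[OF this encode_nat_digits encode_nat_digits Pos(2,3)] have "encode_nat a = encode_nat b" "u = v" by blast+
  then show ?case using encode_nat_inj[of a b] b by simp
next
  case (Neg a)
  then obtain b where b: "G = Neg b" by (cases G) auto
  then have "encode_nat a @ u = encode_nat b @ v" using Neg(1) by simp
  from digits_append[OF this encode_nat_digits encode_nat_digits Neg(2,3)] have "encode_nat a = encode_nat b" "u = v" by blast+
  then show ?case using encode_nat_inj[of a b] b by simp
next
  case (Conj F1 F2)
  obtain G1 G2 and c :: nat where G: "G = Conj G1 G2 \<and> c = 4 \<or> G = Disj G1 G2 \<and> c = 5" using Conj.prems(1) by (cases G) auto
  then have e: "encode F1 @ (4 # encode F2 @ 2 # u) = encode G1 @ (c # encode G2 @ 2 # v)" using Conj.prems(1) by auto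
  from Conj.IH(1)[OF e] G have "F1 = G1" "c = 4" "encode F2 @ 2 # u = encode G2 @ 2 # v" by auto
  then show ?case using Conj.IH(2)[of "2 # u" G2 "2 # v"] G by auto
next
  case (Disj F1 F2)
  obtain G1 G2 and c :: nat where G: "G = Conj G1 G2 \<and> c = 4 \<or> G = Disj G1 G2 \<and> c = 5" using Disj.prems(1) by (cases G) auto
  then have e: "encode F1 @ (5 # encode F2 @ 2 # u) = encode G1 @ (c # encode G2 @ 2 # v)" using Disj.prems(1) by auto
  from Disj.IH(1)[OF e] G have "F1 = G1" "c = 5" "encode F2 @ 2 # u = encode G2 @ 2 # v" by auto
  then show ?case using Disj.IH(2)[of "2 # u" G2 "2 # v"] G by auto
qed

lemma encode_in_CL5_problem: "encode F \<in> CL5_problem \<longleftrightarrow> CL5_provable F"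
  using encode_append[of F "[]" _ "[]"] by (auto simp: CL5_problem_def)

text \<open>The base \<open>n + 2\<close> is at least 2, so constant factors and summands can be
  absorbed by a larger exponent for every n.\<close>

lemma poly_le_power: "\<exists>b\<ge>1. \<forall>n. poly (q :: nat poly) n <= (n + 2) ^ b" proof (induction q)
  case 0
  show ?case by (rule exI[of _ 1]) simp
next
  case (pCons a q)
  then obtain b where b: "1 <= b" "!!n. poly q n <= (n + 2) ^ b" by blast
  have "poly (pCons a q) n <= (n + 2) ^ (a + b + 2)" for n proof -
    have 1: "(n + 2) ^ i <= (n + 2) ^ (a + b + 1)" if "i <= a + b + 1" for i using that by (rule power_increasing) simp
    have "a <= 2 ^ a" using less_exp[of a] by simp
    also have "(2 :: nat) ^ a <= (n + 2) ^ a" by (rule power_mono) simp_all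
    also have "\<dots> <= (n + 2) ^ (a + b + 1)" by (rule 1) simp
    finally have a: "a <= (n + 2) ^ (a + b + 1)" .
    have "n * poly q n <= (n + 2) * (n + 2) ^ b" using b(2) by (intro mult_mono) simp_all
    also have "\<dots> = (n + 2) ^ (b + 1)" by (simp only: Suc_eq_plus1[symmetric] power_Suc)
    also have "\<dots> <= (n + 2) ^ (a + b + 1)" by (rule 1) simp
    finally have "poly (pCons a q) n <= 2 * (n + 2) ^ (a + b + 1)" using a by simp
    also have "\<dots> <= (n + 2) * (n + 2) ^ (a + b + 1)" by (rule mult_right_mono) simp_all
    also have "\<dots> = (n + 2) ^ Suc (a + b + 1)" by (rule power_Suc[symmetric])
    finally show ?thesis by (simp only: add_Suc_right[symmetric] Suc_eq_plus1 add.assoc one_add_one)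
  qed
  then show ?case by (intro exI[of _ "a + b + 2"]) simp
qed

section \<open>The reduction as a computable function\<close>

lemma printable_big: "(!!a. a \<in> set xs ==> printable a \<and> loops a = {}) ==> binary C ==> printable (big C xs) \<and> loops (big C xs) = {}"
  by (induction xs rule: induct_list012) (auto simp: binary_def)

lemma printable_nf:
  assumes "ok_clauses c0 cs" "binary C" "binary D" shows "printable (nf C D part cs)" "loops (nf C D part cs) = {}" proof -
  have "printable (occ part p q l) \<and> loops (occ part p q l) = {}" if "ok_literal c0 l" for p q l proof -
    have "printable_summand s" if "ok_summand c0 s" for s using that by (cases s) auto
    then show ?thesis using that by (auto simp: occ_def ok_literal_def split: prod.splits)
  qed
  moreover have "ok_literal c0 (cs ! p ! q)" if "p < length cs" "q < length (cs ! p)" for p q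
    using assms(1) that unfolding ok_clauses_def by (meson nth_mem)
  ultimately have "printable (occ part p q (cs ! p ! q)) \<and> loops (occ part p q (cs ! p ! q)) = {}"
    if "p < length cs" "q < length (cs ! p)" for p q using that by blast
  then have "printable (nf C D part cs) \<and> loops (nf C D part cs) = {}"
    unfolding nf_def using assms(2,3) by (intro printable_big) (auto intro!: printable_big)
  then show "printable (nf C D part cs)" "loops (nf C D part cs) = {}" by simp_all
qed

lemma printable_matrix:
  assumes "ok_clauses c0 XC" "ok_clauses c0 NC" "ok_clauses c0 YC"
  shows "printable (with_gadgets (matrix XC NC YC) 2 2)" "loops (with_gadgets (matrix XC NC YC) 2 2) \<subseteq> {1..19} - {5}" proof -
  note p = printable_nf[OF assms(1) binary(1) binary(2), of 0] printable_nf[OF assms(2) binary(1) binary(2), of 1]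
    printable_nf[OF ok_negate[OF assms(3)] binary(2) binary(1), of 2]
  have e: "loops (exs vs a) = set vs \<union> loops a \<and> (printable (exs vs a) \<longleftrightarrow> set vs \<subseteq> {1..19} - {6} \<and> distinct vs \<and> set vs \<inter> loops a = {} \<and> printable a)" for vs a
    by (induction vs) auto
  show "printable (with_gadgets (matrix XC NC YC) 2 2)" "loops (with_gadgets (matrix XC NC YC) 2 2) \<subseteq> {1..19} - {5}"
    using p by (simp_all add: with_gadgets_def matrix_def univ_gadget_def exist_gadget_def occ_gadget_def e occ_tapes_def var_tapes_def)
qed

theorem CL5_problem_hard:
  assumes "L \<in> Sigma2p g" shows "poly_many_one_reducible g L 8 CL5_problem" proof -
  obtain h A where hA: "A \<in> NP_oracle {} h" "L \<in> NP_oracle A g" using assms unfolding Sigma2p_def NP_def by blast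
  obtain N pN where N: "A \<subseteq> words h" "wf_machine N" "!!y m c. y \<in> words h ==> (step {} N ^^ m) (initial N y) c ==> m <= poly pN (length y)"
    "!!y. y \<in> words h ==> y \<in> A \<longleftrightarrow> accepts {} N y" using hA(1) unfolding NP_oracle_def by blast
  obtain M pM where M: "L \<subseteq> words g" "wf_machine M" "!!x m c. x \<in> words g ==> (step A M ^^ m) (initial M x) c ==> m <= poly pM (length x)"
    "!!x. x \<in> words g ==> x \<in> L \<longleftrightarrow> accepts A M x" using hA(2) unfolding NP_oracle_def by blast
  obtain S1 Q1 ilM where f1: "!!Sg Qs. S1 <= Sg ==> Q1 <= Qs ==> fits M Sg Qs ilM" using fits_exists[OF M(2)] by blast
  obtain S2 Q2 ilN where f2: "!!Sg Qs. S2 <= Sg ==> Q2 <= Qs ==> fits N Sg Qs ilN" using fits_exists[OF N(2)] by blast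
  define Sg where "Sg = S1 + S2 + g + h + 1"
  define Qs where "Qs = Q1 + Q2"
  have Sg: "fits M Sg Qs ilM" "fits N Sg Qs ilN" "g < Sg" "h < Sg" using f1 f2 by (simp_all add: Sg_def Qs_def)
  let ?OC = "oracle_clauses g h (tapes M - 1) Sg Qs N ilN"
  let ?MC = "main_clauses Sg Qs M ilM (?OC 0) g" and ?NC = "no_clauses Sg M"
  obtain c0 where c0: "ok_clauses c0 ?MC" "ok_clauses c0 ?NC" "ok_clauses c0 (?OC 1)"
    using ok_clauses_all[of Sg Qs M ilM g h "tapes M - 1" N ilN] Sg(3) by (metis less_nat_zero_code neq0_conv order_refl)
  \<comment> \<open>The main machine can lengthen its words by at most one cell per step, which
    bounds the queries on which the oracle machine has to be run.\<close>
  define BN where "BN n = poly pN (n + poly pM n)" for n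
  \<comment> \<open>The sum dominates every requirement on K: both running times (strictly, because
    of the positive constant), the length of queries, the constants of the clauses and the alphabet
    of the loop tapes.\<close>
  define q where "q = pM + pcompose pN (pM + [:0, 1:]) + [:0, 1:] + [:c0 + g + 3:]"
  have q: "poly q n = poly pM n + BN n + n + (c0 + g + 3)" for n by (simp add: q_def BN_def poly_pcompose add.commute)
  obtain b where b: "1 <= b" "!!n. poly q n <= (n + 2) ^ b" using poly_le_power[of q] by blast
  define a where "a = with_gadgets (matrix ?MC ?NC (?OC 1)) 2 2"
  define f where "f x = encode (interp (contents x b g) a (parked x b))" for x
  have "poly_time_computable g f" unfolding f_def by (rule poly_time_print[OF _ _ b(1)]) (use printable_matrix[OF c0] in "simp_all add: a_def")
  moreover have "x \<in> L \<longleftrightarrow> f x \<in> CL5_problem" if x: "x \<in> words g" for x proof -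
    let ?n = "length x" and ?K = "(length x + 2) ^ b"
    have Kb: "poly pM ?n < ?K" "BN ?n < ?K" "?n + poly pM ?n <= ?K" "c0 <= ?K" "g + 2 <= ?K" using b(2)[of ?n] unfolding q by linarith+
    interpret reduction g h A M N Sg Qs ilM ilN x ?K "2 * ?K + ?n" "poly pM ?n" "BN ?n"
    proof
      show "0 < tapes M" "0 < tapes N" using M(2) N(2) by (simp_all add: wf_machine_def)
      show "m <= BN ?n" if "y \<in> words h" "length y <= ?n + poly pM ?n" "(step {} N ^^ m) (initial N y) c" for y m c
        using N(3)[OF that(1,3)] poly_mono_nat[OF that(2), of pN] by (simp add: BN_def)
    qed (use Sg x Kb N(1,4) M(3)[OF x] in auto)
    have z: "zones x b g = letter_tape" unfolding zones_def letter_tape_def ..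
    have "CL5_provable (interp (contents x b g) a (parked x b)) \<longleftrightarrow> accepts A M x" unfolding a_def proof (rule provable_iff_accepts)
      show "contents x b g v = letter_tape" if "v \<in> {1..4}" for v using that by (simp add: contents_def z)
      show "length (contents x b g v) = (?n + 2) ^ (b + 4)" if "v \<in> set (occ_tapes @ var_tapes)" for v
        using that by (auto simp: contents_def occ_tapes_def var_tapes_def)
      show "3 * (2 * ?K + ?n) <= (?n + 2) ^ (b + 4)" using contents_length(4,5)[OF b(1), of 1 x g] by simp
      show "parked x b 5 = ?K" "parked x b v <= 2 * ?K + ?n" for v by (simp_all add: parked_def)
      have "m <= 2 * ?K + ?n" if "m <= ?K" for m using that by simp
      then show "c0 <= 2 * ?K + ?n" "2 <= 2 * ?K + ?n" "g + 2 <= 2 * ?K + ?n" using Kb(4,5) le_trans[of 2 "g + 2" ?K] by simp_all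
    qed (rule c0)+
    then show ?thesis unfolding f_def encode_in_CL5_problem using M(4)[OF x] by simp
  qed
  moreover have "f x \<in> words 8" for x unfolding f_def by (rule encode_words)
  ultimately show ?thesis unfolding poly_many_one_reducible_def by blast
qed

theorem theorem4p2: "Sigma2p_complete 8 CL5_problem" unfolding Sigma2p_complete_def using CL5_problem_Sigma2p CL5_problem_hard by blast

end
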